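(* Let $n$ be a positive integer, let $\mathcal T$ be an algebraic triangulated category with suspension functor $\Sigma$, and let $\mathcal M$ be an $n$-rigid subcategory of $\mathcal T$ closed under direct summands. Then there exists an extriangulated functor $$(\mathbb P,\Omega)\colon \mathrm{pr}_{\mathcal T}^{n+1}(\mathcal M)\longrightarrow K^{[-n,0]}(\mathcal M)$$ whose restriction to $\mathcal M$ is the identity, that is, $\mathbb P|_{\mathcal M}=\mathrm{Id}_{\mathcal M}$ (where $\mathcal M$ is viewed in $K^{[-n,0]}(\mathcal M)$ as the complexes concentrated in degree $0$).
   Context: All categories are additive; all subcategories are full, additive and closed under isomorphisms. A triangulated category is algebraic if it is (triangle equivalent to) the stable category of a Frobenius exact category. $\mathcal M\subseteq\mathcal T$ is $n$-rigid if $\mathrm{Hom}_{\mathcal T}(\mathcal M,\Sigma^i\mathcal M)=0$ for $1\le i\le n$. For subcategories $\mathcal X,\mathcal Y$ of $\mathcal T$, $\mathcal X*\mathcal Y$ consists of the objects $Z$ admitting a triangle $X\to Z\to Y\to\Sigma X$ with $X\in\mathcal X$, $Y\in\mathcal Y$. For $m\ge 0$ put $\mathrm{pr}_{\mathcal T}^{m+1}(\mathcal M)=\mathcal M*\Sigma\mathcal M*\cdots*\Sigma^m\mathcal M$. Extriangulated categories are taken in the sense of Nakaoka–Palu: triples $(\mathcal C,\mathbb E,\mathfrak s)$ with $\mathcal C$ additive, $\mathbb E\colon\mathcal C^{\mathrm{op}}\times\mathcal C\to\mathrm{Ab}$ biadditive, and $\mathfrak s$ an additive realization sending $w\in\mathbb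 E(X,Y)$ to an equivalence class of sequences $Y\xrightarrow{u}Z\xrightarrow{v}X$, satisfying the standard axioms (ET3), (ET3)$^{\mathrm{op}}$, (ET4), (ET4)$^{\mathrm{op}}$; then $Y\xrightarrow{u}Z\xrightarrow{v}X\overset{w}{\dashrightarrow}$ is called an extriangle. Extriangulated structure on $\mathrm{pr}_{\mathcal T}^{n+1}(\mathcal M)$: $\mathbb E_{\mathcal M}(X,Y)=[\Sigma\,\mathrm{pr}_{\mathcal T}^{n}(\mathcal M)](X,\Sigma Y)$, the group of morphisms $X\to\Sigma Y$ in $\mathcal T$ factoring through an object of $\Sigma\,\mathrm{pr}_{\mathcal T}^{n}(\mathcal M)$; the extriangles are the triangles $Y\to Z\to X\xrightarrow{w}\Sigma Y$ of $\mathcal T$ with $X,Y,Z\in\mathrm{pr}_{\mathcal T}^{n+1}(\mathcal M)$ and $w\in\mathbb E_{\mathcal M}(X,Y)$. $K^b(\mathcal M)$ is the bounded homotopy category of complexes over $\mathcal M$, and $K^{[-n,0]}(\mathcal M)$ is its subcategory of objects isomorphic to complexes concentrated in degrees $-n,\dots,0$. It is extriangulated with $\mathbb E(X,Y)=\mathrm{Hom}_{K^b(\mathcal M)}(X,\Sigma Y)$ and extriangles the triangles of $K^b(\mathcal M)$ with first three terms in $K^{[-n,0]}(\mathcal M)$. An extriangulated functor $(\mathcal C,\mathbb E)\to(\mathcal C',\mathbb E')$ is a pair $(\mathbb P,\Omega)$ with $\mathbb P\colon\mathcal C\to\mathcal C'$ an additive functor and $\Omega=\{\Omega^{X,Y}\}\colon\mathbb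 E(-,-)\to\mathbb E'(\mathbb P(-),\mathbb P(-))$ a natural transformation of functors $\mathcal C^{\mathrm{op}}\times\mathcal C\to\mathrm{Ab}$ such that every extriangle $Y\xrightarrow{u}Z\xrightarrow{v}X\overset{w}{\dashrightarrow}$ in $\mathcal C$ yields an extriangle $\mathbb P(Y)\xrightarrow{\mathbb P(u)}\mathbb P(Z)\xrightarrow{\mathbb P(v)}\mathbb P(X)\overset{\Omega^{X,Y}(w)}{\dashrightarrow}$ in $\mathcal C'$. *)

theory Defs
  imports "HOL-Algebra.Group"
begin

section \<open>Additive categories\<close>

text \<open>Morphisms know their source and target, so that \<open>Comp\<close> and \<open>Add\<close> need no object
  arguments; \<open>g \<cdot> f\<close> is ``first \<open>f\<close>, then \<open>g\<close>''. Nothing is assumed about values outside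
  \<open>Obj\<close> and \<open>Arr\<close>.\<close>

record ('o, 'm) addcat =
  Obj :: "'o set"
  Arr :: "'m set"
  Dom :: "'m \<Rightarrow> 'o"
  Cod :: "'m \<Rightarrow> 'o"
  Id :: "'o \<Rightarrow> 'm"
  Comp :: "'m \<Rightarrow> 'm \<Rightarrow> 'm"  (infixl "\<cdot>\<index>" 75)
  Add :: "'m \<Rightarrow> 'm \<Rightarrow> 'm"  (infixl "\<oplus>\<index>" 65)
  Zero :: "'o \<Rightarrow> 'o \<Rightarrow> 'm"

definition Hom :: "('o, 'm, 'z) addcat_scheme \<Rightarrow> 'o \<Rightarrow> 'o \<Rightarrow> 'm set" where
  "Hom C X Y = {f \<in> Arr C. Dom C f = X \<and> Cod C f = Y}"

definition HomGrp :: "('o, 'm, 'z) addcat_scheme \<Rightarrow> 'o \<Rightarrow> 'o \<Rightarrow> 'm monoid" where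
  "HomGrp C X Y = \<lparr>carrier = Hom C X Y, mult = Add C, one = Zero C X Y\<rparr>"

definition Neg :: "('o, 'm, 'z) addcat_scheme \<Rightarrow> 'm \<Rightarrow> 'm" where
  "Neg C f = inv\<^bsub>HomGrp C (Dom C f) (Cod C f)\<^esub> f"

definition is_iso :: "('o, 'm, 'z) addcat_scheme \<Rightarrow> 'm \<Rightarrow> bool" where
  "is_iso C f \<longleftrightarrow> f \<in> Arr C \<and>
     (\<exists>g \<in> Hom C (Cod C f) (Dom C f).
        g \<cdot>\<^bsub>C\<^esub> f = Id C (Dom C f) \<and> f \<cdot>\<^bsub>C\<^esub> g = Id C (Cod C f))"

definition isomorphic :: "('o, 'm, 'z) addcat_scheme \<Rightarrow> 'o \<Rightarrow> 'o \<Rightarrow> bool" where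
  "isomorphic C X Y \<longleftrightarrow> (\<exists>f \<in> Hom C X Y. is_iso C f)"

definition is_zero :: "('o, 'm, 'z) addcat_scheme \<Rightarrow> 'o \<Rightarrow> bool" where
  "is_zero C Z \<longleftrightarrow> Z \<in> Obj C \<and>
     (\<forall>X \<in> Obj C. (\<exists>!f. f \<in> Hom C X Z) \<and> (\<exists>!f. f \<in> Hom C Z X))"

definition is_biproduct ::
  "('o, 'm, 'z) addcat_scheme \<Rightarrow> 'o \<Rightarrow> 'o \<Rightarrow> 'o \<Rightarrow> 'm \<Rightarrow> 'm \<Rightarrow> 'm \<Rightarrow> 'm \<Rightarrow> bool" where
  "is_biproduct C A B S i j p q \<longleftrightarrow>
     i \<in> Hom C A S \<and> j \<in> Hom C B S \<and> p \<in> Hom C S A \<and> q \<in> Hom C S B \<and>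
     p \<cdot>\<^bsub>C\<^esub> i = Id C A \<and> q \<cdot>\<^bsub>C\<^esub> j = Id C B \<and>
     q \<cdot>\<^bsub>C\<^esub> i = Zero C A B \<and> p \<cdot>\<^bsub>C\<^esub> j = Zero C B A \<and>
     i \<cdot>\<^bsub>C\<^esub> p \<oplus>\<^bsub>C\<^esub> j \<cdot>\<^bsub>C\<^esub> q = Id C S"

locale additive_category =
  fixes C :: "('o, 'm, 'z) addcat_scheme" (structure)
  assumes arr_obj: "f \<in> Arr C \<Longrightarrow> Dom C f \<in> Obj C \<and> Cod C f \<in> Obj C"
    and id_hom: "X \<in> Obj C \<Longrightarrow> Id C X \<in> Hom C X X"
    and comp_hom: "\<lbrakk>f \<in> Hom C X Y; g \<in> Hom C Y Z\<rbrakk> \<Longrightarrow> g \<cdot> f \<in> Hom C X Z"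
    and id_left: "f \<in> Hom C X Y \<Longrightarrow> Id C Y \<cdot> f = f"
    and id_right: "f \<in> Hom C X Y \<Longrightarrow> f \<cdot> Id C X = f"
    and comp_assoc:
      "\<lbrakk>f \<in> Hom C W X; g \<in> Hom C X Y; h \<in> Hom C Y Z\<rbrakk> \<Longrightarrow> h \<cdot> (g \<cdot> f) = (h \<cdot> g) \<cdot> f"
    and hom_group: "\<lbrakk>X \<in> Obj C; Y \<in> Obj C\<rbrakk> \<Longrightarrow> comm_group (HomGrp C X Y)"
    and comp_add_left:
      "\<lbrakk>f \<in> Hom C X Y; g \<in> Hom C Y Z; g' \<in> Hom C Y Z\<rbrakk> \<Longrightarrow> (g \<oplus> g') \<cdot> f = g \<cdot> f \<oplus> g' \<cdot> f"
    and comp_add_right: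
      "\<lbrakk>f \<in> Hom C X Y; f' \<in> Hom C X Y; g \<in> Hom C Y Z\<rbrakk> \<Longrightarrow> g \<cdot> (f \<oplus> f') = g \<cdot> f \<oplus> g \<cdot> f'"
    and ex_zero: "\<exists>Z. is_zero C Z"
    and ex_biproduct:
      "\<lbrakk>A \<in> Obj C; B \<in> Obj C\<rbrakk> \<Longrightarrow> \<exists>S i j p q. is_biproduct C A B S i j p q"

text \<open>A full subcategory is given by its set of objects.\<close>

definition full_subcat :: "('o, 'm, 'z) addcat_scheme \<Rightarrow> 'o set \<Rightarrow> ('o, 'm) addcat" where
  "full_subcat C S = \<lparr>Obj = S, Arr = {f \<in> Arr C. Dom C f \<in> S \<and> Cod C f \<in> S},
     Dom = Dom C, Cod = Cod C, Id = Id C, Comp = Comp C, Add = Add C, Zero = Zero C\<rparr>"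

definition additive_subcategory :: "('o, 'm, 'z) addcat_scheme \<Rightarrow> 'o set \<Rightarrow> bool" where
  "additive_subcategory C S \<longleftrightarrow> S \<subseteq> Obj C \<and>
     (\<forall>X \<in> S. \<forall>Y \<in> Obj C. isomorphic C X Y \<longrightarrow> Y \<in> S) \<and>
     (\<exists>Z \<in> S. is_zero C Z) \<and>
     (\<forall>A \<in> S. \<forall>B \<in> S. \<forall>D i j p q. is_biproduct C A B D i j p q \<longrightarrow> D \<in> S)"

definition closed_under_summands :: "('o, 'm, 'z) addcat_scheme \<Rightarrow> 'o set \<Rightarrow> bool" where
  "closed_under_summands C S \<longleftrightarrow>
     (\<forall>A B D i j p q. D \<in> S \<longrightarrow> is_biproduct C A B D i j p q \<longrightarrow> A \<in> S \<and> B \<in> S)"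

text \<open>The quotient of \<open>C\<close> by an ideal \<open>N\<close> of morphisms. The morphisms of the quotient are
  the cosets \<open>qcls C N f\<close>.\<close>

definition qcls :: "('o, 'm, 'z) addcat_scheme \<Rightarrow> 'm set \<Rightarrow> 'm \<Rightarrow> 'm set" where
  "qcls C N f = {f \<oplus>\<^bsub>C\<^esub> h | h. h \<in> N \<and> h \<in> Hom C (Dom C f) (Cod C f)}"

definition rep :: "'m set \<Rightarrow> 'm" where
  "rep F = (SOME f. f \<in> F)"

definition quotient_cat :: "('o, 'm, 'z) addcat_scheme \<Rightarrow> 'm set \<Rightarrow> ('o, 'm set) addcat" where
  "quotient_cat C N = \<lparr>Obj = Obj C, Arr = qcls C N ` Arr C,
     Dom = (\<lambda>F. Dom C (rep F)), Cod = (\<lambda>F. Cod C (rep F)),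
     Id = (\<lambda>X. qcls C N (Id C X)),
     Comp = (\<lambda>G F. qcls C N (rep G \<cdot>\<^bsub>C\<^esub> rep F)),
     Add = (\<lambda>F G. qcls C N (rep F \<oplus>\<^bsub>C\<^esub> rep G)),
     Zero = (\<lambda>X Y. qcls C N (Zero C X Y))\<rparr>"


section \<open>Functors\<close>

record ('o, 'm, 'p, 'q) catfun =
  fobj :: "'o \<Rightarrow> 'p"
  fmor :: "'m \<Rightarrow> 'q"

definition id_fun :: "('o, 'm, 'o, 'm) catfun" where
  "id_fun = \<lparr>fobj = (\<lambda>X. X), fmor = (\<lambda>f. f)\<rparr>"

definition comp_fun ::
  "('p, 'q, 'r, 's) catfun \<Rightarrow> ('o, 'm, 'p, 'q) catfun \<Rightarrow> ('o, 'm, 'r, 's) catfun" where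
  "comp_fun G F = \<lparr>fobj = fobj G \<circ> fobj F, fmor = fmor G \<circ> fmor F\<rparr>"

locale additive_functor =
  source: additive_category C + target: additive_category D
  for C :: "('o, 'm, 'z) addcat_scheme" and D :: "('p, 'q, 'y) addcat_scheme"
    and F :: "('o, 'm, 'p, 'q) catfun" +
  assumes fobj_obj: "X \<in> Obj C \<Longrightarrow> fobj F X \<in> Obj D"
    and fmor_hom: "\<lbrakk>X \<in> Obj C; Y \<in> Obj C\<rbrakk> \<Longrightarrow>
      fmor F \<in> hom (HomGrp C X Y) (HomGrp D (fobj F X) (fobj F Y))"
    and fmor_id: "X \<in> Obj C \<Longrightarrow> fmor F (Id C X) = Id D (fobj F X)"
    and fmor_comp: "\<lbrakk>f \<in> Hom C X Y; g \<in> Hom C Y Z\<rbrakk> \<Longrightarrow>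
      fmor F (g \<cdot>\<^bsub>C\<^esub> f) = fmor F g \<cdot>\<^bsub>D\<^esub> fmor F f"

definition natural_iso ::
  "('o, 'm, 'z) addcat_scheme \<Rightarrow> ('p, 'q, 'y) addcat_scheme \<Rightarrow>
   ('o, 'm, 'p, 'q) catfun \<Rightarrow> ('o, 'm, 'p, 'q) catfun \<Rightarrow> ('o \<Rightarrow> 'q) \<Rightarrow> bool" where
  "natural_iso C D F G \<eta> \<longleftrightarrow>
     (\<forall>X \<in> Obj C. \<eta> X \<in> Hom D (fobj F X) (fobj G X) \<and> is_iso D (\<eta> X)) \<and>
     (\<forall>f \<in> Arr C. fmor G f \<cdot>\<^bsub>D\<^esub> \<eta> (Dom C f) = \<eta> (Cod C f) \<cdot>\<^bsub>D\<^esub> fmor F f)"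

definition equivalence ::
  "('o, 'm, 'z) addcat_scheme \<Rightarrow> ('p, 'q, 'y) addcat_scheme \<Rightarrow>
   ('o, 'm, 'p, 'q) catfun \<Rightarrow> bool" where
  "equivalence C D F \<longleftrightarrow> additive_functor C D F \<and>
     (\<exists>G \<eta> \<epsilon>. additive_functor D C G \<and>
        natural_iso C C id_fun (comp_fun G F) \<eta> \<and>
        natural_iso D D (comp_fun F G) id_fun \<epsilon>)"


section \<open>Triangulated categories\<close>

text \<open>A triangle \<open>X \<rightarrow> Y \<rightarrow> Z \<rightarrow> \<Sigma>X\<close> is the triple \<open>(u, v, w)\<close> of its morphisms.
  The suspension is only required to be an autoequivalence, since the suspension of a stable
  category is in general not invertible on the nose.\<close>

record ('o, 'm) tricat = "('o, 'm) addcat" +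
  Sh :: "('o, 'm, 'o, 'm) catfun"
  Tri :: "('m \<times> 'm \<times> 'm) set"

definition candidate_triangle ::
  "('o, 'm, 'z) addcat_scheme \<Rightarrow> ('o, 'm, 'o, 'm) catfun \<Rightarrow> 'm \<times> 'm \<times> 'm \<Rightarrow> bool" where
  "candidate_triangle C S = (\<lambda>(u, v, w). \<exists>X Y Z.
     u \<in> Hom C X Y \<and> v \<in> Hom C Y Z \<and> w \<in> Hom C Z (fobj S X))"

definition triangle_iso ::
  "('o, 'm, 'z) addcat_scheme \<Rightarrow> ('o, 'm, 'o, 'm) catfun \<Rightarrow>
   'm \<times> 'm \<times> 'm \<Rightarrow> 'm \<times> 'm \<times> 'm \<Rightarrow> bool" where
  "triangle_iso C S = (\<lambda>(u, v, w) (u', v', w').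
     candidate_triangle C S (u, v, w) \<and> candidate_triangle C S (u', v', w') \<and>
     (\<exists>a b c. a \<in> Hom C (Dom C u) (Dom C u') \<and> is_iso C a \<and>
        b \<in> Hom C (Cod C u) (Cod C u') \<and> is_iso C b \<and>
        c \<in> Hom C (Cod C v) (Cod C v') \<and> is_iso C c \<and>
        b \<cdot>\<^bsub>C\<^esub> u = u' \<cdot>\<^bsub>C\<^esub> a \<and> c \<cdot>\<^bsub>C\<^esub> v = v' \<cdot>\<^bsub>C\<^esub> b \<and>
        fmor S a \<cdot>\<^bsub>C\<^esub> w = w' \<cdot>\<^bsub>C\<^esub> c))"

locale triangulated_category = additive_category T
  for T :: "('o, 'm, 'z) tricat_scheme" (structure) +
  assumes shift_equivalence: "equivalence T T (Sh T)"
    and tri_candidate: "t \<in> Tri T \<Longrightarrow> candidate_triangle T (Sh T) t"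
    and TR1_id: "\<lbrakk>X \<in> Obj T; is_zero T Z\<rbrakk> \<Longrightarrow>
      (Id T X, Zero T X Z, Zero T Z (fobj (Sh T) X)) \<in> Tri T"
    and TR1_iso: "\<lbrakk>t \<in> Tri T; triangle_iso T (Sh T) t t'\<rbrakk> \<Longrightarrow> t' \<in> Tri T"
    and TR1_ex: "u \<in> Arr T \<Longrightarrow> \<exists>v w. (u, v, w) \<in> Tri T"
    and TR2: "candidate_triangle T (Sh T) (u, v, w) \<Longrightarrow>
      (u, v, w) \<in> Tri T \<longleftrightarrow> (v, w, Neg T (fmor (Sh T) u)) \<in> Tri T"
    and TR3: "\<lbrakk>(u, v, w) \<in> Tri T; (u', v', w') \<in> Tri T;
        a \<in> Hom T (Dom T u) (Dom T u'); b \<in> Hom T (Cod T u) (Cod T u'); b \<cdot> u = u' \<cdot> a\<rbrakk> \<Longrightarrow>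
      \<exists>c \<in> Hom T (Cod T v) (Cod T v'). c \<cdot> v = v' \<cdot> b \<and> fmor (Sh T) a \<cdot> w = w' \<cdot> c"
    and TR4: "\<lbrakk>(u, i, i') \<in> Tri T; (v, j, j') \<in> Tri T; Cod T u = Dom T v;
        (v \<cdot> u, k, k') \<in> Tri T\<rbrakk> \<Longrightarrow>
      \<exists>f g. f \<in> Hom T (Cod T i) (Cod T k) \<and> g \<in> Hom T (Cod T k) (Cod T j) \<and>
        (f, g, fmor (Sh T) i \<cdot> j') \<in> Tri T \<and>
        f \<cdot> i = k \<cdot> v \<and> k' \<cdot> f = i' \<and> g \<cdot> k = j \<and> j' \<cdot> g = fmor (Sh T) u \<cdot> k'"

definition triangle_equivalence ::
  "('o, 'm, 'z) tricat_scheme \<Rightarrow> ('p, 'q, 'y) tricat_scheme \<Rightarrow>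
   ('o, 'm, 'p, 'q) catfun \<Rightarrow> ('o \<Rightarrow> 'q) \<Rightarrow> bool" where
  "triangle_equivalence T T' F \<phi> \<longleftrightarrow> equivalence T T' F \<and>
     natural_iso T T' (comp_fun F (Sh T)) (comp_fun (Sh T') F) \<phi> \<and>
     (\<forall>(u, v, w) \<in> Tri T.
        (fmor F u, fmor F v, \<phi> (Dom T u) \<cdot>\<^bsub>T'\<^esub> fmor F w) \<in> Tri T')"


section \<open>Frobenius exact categories and their stable categories\<close>

record ('o, 'm) excat = "('o, 'm) addcat" +
  Conf :: "('m \<times> 'm) set"

definition is_kernel :: "('o, 'm, 'z) addcat_scheme \<Rightarrow> 'm \<Rightarrow> 'm \<Rightarrow> bool" where
  "is_kernel C i p \<longleftrightarrow> i \<in> Arr C \<and> p \<in> Arr C \<and> Cod C i = Dom C p \<and>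
     p \<cdot>\<^bsub>C\<^esub> i = Zero C (Dom C i) (Cod C p) \<and>
     (\<forall>f \<in> Arr C. Cod C f = Dom C p \<and> p \<cdot>\<^bsub>C\<^esub> f = Zero C (Dom C f) (Cod C p) \<longrightarrow>
        (\<exists>!h. h \<in> Hom C (Dom C f) (Dom C i) \<and> i \<cdot>\<^bsub>C\<^esub> h = f))"

definition is_cokernel :: "('o, 'm, 'z) addcat_scheme \<Rightarrow> 'm \<Rightarrow> 'm \<Rightarrow> bool" where
  "is_cokernel C p i \<longleftrightarrow> i \<in> Arr C \<and> p \<in> Arr C \<and> Cod C i = Dom C p \<and>
     p \<cdot>\<^bsub>C\<^esub> i = Zero C (Dom C i) (Cod C p) \<and>
     (\<forall>f \<in> Arr C. Dom C f = Cod C i \<and> f \<cdot>\<^bsub>C\<^esub> i = Zero C (Dom C i) (Cod C f) \<longrightarrow>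
        (\<exists>!h. h \<in> Hom C (Cod C p) (Cod C f) \<and> h \<cdot>\<^bsub>C\<^esub> p = f))"

text \<open>\<open>is_pushout C i f f' i'\<close>: the square \<open>f' \<cdot> i = i' \<cdot> f\<close> is a pushout of \<open>i\<close> and \<open>f\<close>.
  \<open>is_pullback C p f f' p'\<close>: the square \<open>p \<cdot> f' = f \<cdot> p'\<close> is a pullback of \<open>p\<close> and \<open>f\<close>.\<close>

definition is_pushout ::
  "('o, 'm, 'z) addcat_scheme \<Rightarrow> 'm \<Rightarrow> 'm \<Rightarrow> 'm \<Rightarrow> 'm \<Rightarrow> bool" where
  "is_pushout C i f f' i' \<longleftrightarrow> i \<in> Arr C \<and> f \<in> Arr C \<and> Dom C i = Dom C f \<and>
     (\<exists>P. f' \<in> Hom C (Cod C i) P \<and> i' \<in> Hom C (Cod C f) P \<and>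
        f' \<cdot>\<^bsub>C\<^esub> i = i' \<cdot>\<^bsub>C\<^esub> f \<and>
        (\<forall>W \<in> Obj C. \<forall>a \<in> Hom C (Cod C i) W. \<forall>b \<in> Hom C (Cod C f) W.
           a \<cdot>\<^bsub>C\<^esub> i = b \<cdot>\<^bsub>C\<^esub> f \<longrightarrow>
           (\<exists>!h. h \<in> Hom C P W \<and> h \<cdot>\<^bsub>C\<^esub> f' = a \<and> h \<cdot>\<^bsub>C\<^esub> i' = b)))"

definition is_pullback ::
  "('o, 'm, 'z) addcat_scheme \<Rightarrow> 'm \<Rightarrow> 'm \<Rightarrow> 'm \<Rightarrow> 'm \<Rightarrow> bool" where
  "is_pullback C p f f' p' \<longleftrightarrow> p \<in> Arr C \<and> f \<in> Arr C \<and> Cod C p = Cod C f \<and>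
     (\<exists>P. f' \<in> Hom C P (Dom C p) \<and> p' \<in> Hom C P (Dom C f) \<and>
        p \<cdot>\<^bsub>C\<^esub> f' = f \<cdot>\<^bsub>C\<^esub> p' \<and>
        (\<forall>W \<in> Obj C. \<forall>a \<in> Hom C W (Dom C p). \<forall>b \<in> Hom C W (Dom C f).
           p \<cdot>\<^bsub>C\<^esub> a = f \<cdot>\<^bsub>C\<^esub> b \<longrightarrow>
           (\<exists>!h. h \<in> Hom C W P \<and> f' \<cdot>\<^bsub>C\<^esub> h = a \<and> p' \<cdot>\<^bsub>C\<^esub> h = b)))"

definition inflation :: "('o, 'm, 'z) excat_scheme \<Rightarrow> 'm \<Rightarrow> bool" where
  "inflation E i \<longleftrightarrow> (\<exists>p. (i, p) \<in> Conf E)"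

definition deflation :: "('o, 'm, 'z) excat_scheme \<Rightarrow> 'm \<Rightarrow> bool" where
  "deflation E p \<longleftrightarrow> (\<exists>i. (i, p) \<in> Conf E)"

locale exact_category = additive_category E
  for E :: "('o, 'm, 'z) excat_scheme" (structure) +
  assumes conf_ker_coker: "(i, p) \<in> Conf E \<Longrightarrow> is_kernel E i p \<and> is_cokernel E p i"
    and conf_iso: "\<lbrakk>(i, p) \<in> Conf E; i' \<in> Arr E; p' \<in> Arr E; Cod E i' = Dom E p';
        a \<in> Hom E (Dom E i) (Dom E i'); is_iso E a;
        b \<in> Hom E (Cod E i) (Cod E i'); is_iso E b;
        c \<in> Hom E (Cod E p) (Cod E p'); is_iso E c;
        b \<cdot> i = i' \<cdot> a; c \<cdot> p = p' \<cdot> b\<rbrakk> \<Longrightarrow> (i', p') \<in> Conf E"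
    and id_inflation: "X \<in> Obj E \<Longrightarrow> inflation E (Id E X)"
    and id_deflation: "X \<in> Obj E \<Longrightarrow> deflation E (Id E X)"
    and inflation_comp: "\<lbrakk>inflation E i; inflation E j; Cod E i = Dom E j\<rbrakk> \<Longrightarrow> inflation E (j \<cdot> i)"
    and deflation_comp: "\<lbrakk>deflation E p; deflation E q; Cod E p = Dom E q\<rbrakk> \<Longrightarrow> deflation E (q \<cdot> p)"
    and inflation_pushout: "\<lbrakk>inflation E i; f \<in> Arr E; Dom E i = Dom E f\<rbrakk> \<Longrightarrow>
      \<exists>f' i'. is_pushout E i f f' i' \<and> inflation E i'"
    and deflation_pullback: "\<lbrakk>deflation E p; f \<in> Arr E; Cod E p = Cod E f\<rbrakk> \<Longrightarrow>
      \<exists>f' p'. is_pullback E p f f' p' \<and> deflation E p'"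

definition projective :: "('o, 'm, 'z) excat_scheme \<Rightarrow> 'o \<Rightarrow> bool" where
  "projective E P \<longleftrightarrow> P \<in> Obj E \<and>
     (\<forall>p. deflation E p \<longrightarrow> (\<forall>f \<in> Hom E P (Cod E p). \<exists>g \<in> Hom E P (Dom E p). p \<cdot>\<^bsub>E\<^esub> g = f))"

definition injective :: "('o, 'm, 'z) excat_scheme \<Rightarrow> 'o \<Rightarrow> bool" where
  "injective E I \<longleftrightarrow> I \<in> Obj E \<and>
     (\<forall>i. inflation E i \<longrightarrow> (\<forall>f \<in> Hom E (Dom E i) I. \<exists>g \<in> Hom E (Cod E i) I. g \<cdot>\<^bsub>E\<^esub> i = f))"

locale frobenius_category = exact_category E
  for E :: "('o, 'm, 'z) excat_scheme" (structure) +
  assumes enough_projectives: "X \<in> Obj E \<Longrightarrow> \<exists>p. deflation E p \<and> Cod E p = X \<and> projective E (Dom E p)"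
    and enough_injectives: "X \<in> Obj E \<Longrightarrow> \<exists>i. inflation E i \<and> Dom E i = X \<and> injective E (Cod E i)"
    and projective_iff_injective: "projective E X \<longleftrightarrow> injective E X"

definition injective_factor :: "('o, 'm, 'z) excat_scheme \<Rightarrow> 'm set" where
  "injective_factor E = {f \<in> Arr E. \<exists>I. injective E I \<and>
     (\<exists>g \<in> Hom E (Dom E f) I. \<exists>h \<in> Hom E I (Cod E f). f = h \<cdot>\<^bsub>E\<^esub> g)}"

text \<open>The triangulated structure of the stable category (Happel) depends, up to triangle
  equivalence, on a choice of a conflation \<open>X \<rightarrow> I X \<rightarrow> \<Sigma>X\<close> with \<open>I X\<close> injective for
  every \<open>X\<close>; here \<open>c X\<close> is the pair of morphisms of this conflation.\<close>

definition injective_choice :: "('o, 'm, 'z) excat_scheme \<Rightarrow> ('o \<Rightarrow> 'm \<times> 'm) \<Rightarrow> bool" where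
  "injective_choice E c \<longleftrightarrow> (\<forall>X \<in> Obj E. c X \<in> Conf E \<and>
     Dom E (fst (c X)) = X \<and> injective E (Cod E (fst (c X))))"

definition stable_shift ::
  "('o, 'm, 'z) excat_scheme \<Rightarrow> ('o \<Rightarrow> 'm \<times> 'm) \<Rightarrow> ('o, 'm set, 'o, 'm set) catfun" where
  "stable_shift E c = \<lparr>fobj = (\<lambda>X. Cod E (snd (c X))),
     fmor = (\<lambda>F. let f = rep F; (i, p) = c (Dom E f); (i', p') = c (Cod E f) in
       qcls E (injective_factor E)
         (SOME h. h \<in> Hom E (Cod E p) (Cod E p') \<and>
            (\<exists>g \<in> Hom E (Cod E i) (Cod E i'). g \<cdot>\<^bsub>E\<^esub> i = i' \<cdot>\<^bsub>E\<^esub> f \<and> h \<cdot>\<^bsub>E\<^esub> p = p' \<cdot>\<^bsub>E\<^esub> g)))\<rparr>"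

text \<open>Standard triangle of \<open>u : X \<rightarrow> Y\<close>: push \<open>X \<rightarrow> I X\<close> out along \<open>u\<close> to get
  \<open>a : I X \<rightarrow> Z\<close> and \<open>v : Y \<rightarrow> Z\<close>; then \<open>w : Z \<rightarrow> \<Sigma>X\<close> is induced by
  \<open>I X \<rightarrow> \<Sigma>X\<close> and \<open>0 : Y \<rightarrow> \<Sigma>X\<close>.\<close>

definition stable_triangles ::
  "('o, 'm, 'z) excat_scheme \<Rightarrow> ('o \<Rightarrow> 'm \<times> 'm) \<Rightarrow> ('m set \<times> 'm set \<times> 'm set) set" where
  "stable_triangles E c = (let N = injective_factor E in
     {t. \<exists>u v w a i p. u \<in> Arr E \<and> c (Dom E u) = (i, p) \<and> is_pushout E i u a v \<and>
        w \<in> Hom E (Cod E v) (Cod E p) \<and> w \<cdot>\<^bsub>E\<^esub> a = p \<and> w \<cdot>\<^bsub>E\<^esub> v = Zero E (Dom E v) (Cod E p) \<and>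
        triangle_iso (quotient_cat E N) (stable_shift E c)
          (qcls E N u, qcls E N v, qcls E N w) t})"

definition stable_category ::
  "('o, 'm, 'z) excat_scheme \<Rightarrow> ('o \<Rightarrow> 'm \<times> 'm) \<Rightarrow> ('o, 'm set) tricat" where
  "stable_category E c = addcat.extend (quotient_cat E (injective_factor E))
     (tricat.fields (stable_shift E c) (stable_triangles E c))"

text \<open>The type arguments are the types of objects and morphisms of the Frobenius model; HOL cannot
  quantify over them inside the definition.\<close>

definition algebraic_triangulated ::
  "'a itself \<Rightarrow> 'b itself \<Rightarrow> ('o, 'm, 'z) tricat_scheme \<Rightarrow> bool" where
  "algebraic_triangulated _ _ T \<longleftrightarrow> triangulated_category T \<and>
     (\<exists>(E :: ('a, 'b) excat) c F \<phi>. frobenius_category E \<and> injective_choice E c \<and>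
        triangle_equivalence (stable_category E c) T F \<phi>)"


section \<open>Rigid subcategories and the categories pr\<close>

definition rigid :: "('o, 'm, 'z) tricat_scheme \<Rightarrow> nat \<Rightarrow> 'o set \<Rightarrow> bool" where
  "rigid T n M \<longleftrightarrow> (\<forall>i. 1 \<le> i \<and> i \<le> n \<longrightarrow> (\<forall>X \<in> M. \<forall>Y \<in> M.
     Hom T X ((fobj (Sh T) ^^ i) Y) = {Zero T X ((fobj (Sh T) ^^ i) Y)}))"

definition shift_subcat :: "('o, 'm, 'z) tricat_scheme \<Rightarrow> nat \<Rightarrow> 'o set \<Rightarrow> 'o set" where
  "shift_subcat T k M = {Y \<in> Obj T. \<exists>X \<in> M. isomorphic T Y ((fobj (Sh T) ^^ k) X)}"

definition star :: "('o, 'm, 'z) tricat_scheme \<Rightarrow> 'o set \<Rightarrow> 'o set \<Rightarrow> 'o set" where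
  "star T A B = {Z \<in> Obj T. \<exists>u v w. (u, v, w) \<in> Tri T \<and> Dom T u \<in> A \<and> Cod T u = Z \<and> Cod T v \<in> B}"

text \<open>\<open>pr T M k\<close> is \<open>M * \<Sigma>M * \<dots> * \<Sigma>\<^sup>k\<^sup>-\<^sup>1M\<close>; the case \<open>k = 0\<close> (the empty product) is not used.\<close>

fun pr :: "('o, 'm, 'z) tricat_scheme \<Rightarrow> 'o set \<Rightarrow> nat \<Rightarrow> 'o set" where
  "pr T M 0 = {Z. is_zero T Z}"
| "pr T M (Suc 0) = M"
| "pr T M (Suc (Suc k)) = star T (pr T M (Suc k)) (shift_subcat T (Suc k) M)"

definition factor_through ::
  "('o, 'm, 'z) addcat_scheme \<Rightarrow> 'o set \<Rightarrow> 'o \<Rightarrow> 'o \<Rightarrow> 'm set" where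
  "factor_through C A X Y =
     {f \<in> Hom C X Y. \<exists>W \<in> A. \<exists>g \<in> Hom C X W. \<exists>h \<in> Hom C W Y. f = h \<cdot>\<^bsub>C\<^esub> g}"


section \<open>Extriangulated categories\<close>

text \<open>\<open>Ext C X Y\<close> is the abelian group \<open>\<bbbE>(X, Y)\<close> (written multiplicatively, as in
  HOL-Algebra), \<open>Act C f g\<close> is the map \<open>\<bbbE>(f, g)\<close>, i.e. \<open>w \<mapsto> f\<^sup>* g\<^sub>* w\<close>, and
  \<open>(u, v, w) \<in> Real C\<close> means that the sequence \<open>Y \<rightarrow> Z \<rightarrow> X\<close> given by \<open>u\<close> and \<open>v\<close> belongs to
  the class \<open>\<ss>(w)\<close> for \<open>w \<in> \<bbbE>(X, Y)\<close>.\<close>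

record ('o, 'm, 'e) extricat = "('o, 'm) addcat" +
  Ext :: "'o \<Rightarrow> 'o \<Rightarrow> 'e monoid"
  Act :: "'m \<Rightarrow> 'm \<Rightarrow> 'e \<Rightarrow> 'e"
  Real :: "('m \<times> 'm \<times> 'e) set"

abbreviation push :: "('o, 'm, 'e, 'z) extricat_scheme \<Rightarrow> 'o \<Rightarrow> 'm \<Rightarrow> 'e \<Rightarrow> 'e" where
  "push C X g w \<equiv> Act C (Id C X) g w"

abbreviation pull :: "('o, 'm, 'e, 'z) extricat_scheme \<Rightarrow> 'o \<Rightarrow> 'm \<Rightarrow> 'e \<Rightarrow> 'e" where
  "pull C Y f w \<equiv> Act C f (Id C Y) w"

definition seq_equiv :: "('o, 'm, 'z) addcat_scheme \<Rightarrow> 'm \<Rightarrow> 'm \<Rightarrow> 'm \<Rightarrow> 'm \<Rightarrow> bool" where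
  "seq_equiv C u v u' v' \<longleftrightarrow> Dom C u = Dom C u' \<and> Cod C v = Cod C v' \<and>
     (\<exists>b \<in> Hom C (Cod C u) (Cod C u'). is_iso C b \<and> b \<cdot>\<^bsub>C\<^esub> u = u' \<and> v' \<cdot>\<^bsub>C\<^esub> b = v)"

text \<open>The axioms of Nakaoka and Palu: \<open>\<bbbE>\<close> is a biadditive bifunctor (ET1), \<open>\<ss>\<close> is an additive
  realization (ET2), and (ET3), (ET4) with their duals.\<close>

locale extriangulated_category = additive_category C
  for C :: "('o, 'm, 'e, 'z) extricat_scheme" (structure) +
  assumes ext_group: "\<lbrakk>X \<in> Obj C; Y \<in> Obj C\<rbrakk> \<Longrightarrow> comm_group (Ext C X Y)"
    and act_hom: "\<lbrakk>f \<in> Hom C X' X; g \<in> Hom C Y Y'\<rbrakk> \<Longrightarrow>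
      Act C f g \<in> hom (Ext C X Y) (Ext C X' Y')"
    and act_id: "\<lbrakk>X \<in> Obj C; Y \<in> Obj C; w \<in> carrier (Ext C X Y)\<rbrakk> \<Longrightarrow>
      Act C (Id C X) (Id C Y) w = w"
    and act_comp: "\<lbrakk>f' \<in> Hom C X'' X'; f \<in> Hom C X' X; g \<in> Hom C Y Y'; g' \<in> Hom C Y' Y'';
        w \<in> carrier (Ext C X Y)\<rbrakk> \<Longrightarrow>
      Act C (f \<cdot> f') (g' \<cdot> g) w = Act C f' g' (Act C f g w)"
    and act_add_left: "\<lbrakk>f \<in> Hom C X' X; f' \<in> Hom C X' X; g \<in> Hom C Y Y';
        w \<in> carrier (Ext C X Y)\<rbrakk> \<Longrightarrow>
      Act C (f \<oplus> f') g w = Act C f g w \<otimes>\<^bsub>Ext C X' Y'\<^esub> Act C f' g w"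
    and act_add_right: "\<lbrakk>f \<in> Hom C X' X; g \<in> Hom C Y Y'; g' \<in> Hom C Y Y';
        w \<in> carrier (Ext C X Y)\<rbrakk> \<Longrightarrow>
      Act C f (g \<oplus> g') w = Act C f g w \<otimes>\<^bsub>Ext C X' Y'\<^esub> Act C f g' w"
    and real_typed: "(u, v, w) \<in> Real C \<Longrightarrow> u \<in> Arr C \<and> v \<in> Arr C \<and> Cod C u = Dom C v \<and>
      w \<in> carrier (Ext C (Cod C v) (Dom C u))"
    and real_ex: "\<lbrakk>X \<in> Obj C; Y \<in> Obj C; w \<in> carrier (Ext C X Y)\<rbrakk> \<Longrightarrow>
      \<exists>u v. (u, v, w) \<in> Real C \<and> Dom C u = Y \<and> Cod C v = X"
    and real_unique: "\<lbrakk>(u, v, w) \<in> Real C; (u', v', w) \<in> Real C;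
        Dom C u = Dom C u'; Cod C v = Cod C v'\<rbrakk> \<Longrightarrow> seq_equiv C u v u' v'"
    and real_closed: "\<lbrakk>(u, v, w) \<in> Real C; u' \<in> Arr C; v' \<in> Arr C; Cod C u' = Dom C v';
        seq_equiv C u v u' v'\<rbrakk> \<Longrightarrow> (u', v', w) \<in> Real C"
    and real_morphism: "\<lbrakk>(u, v, w) \<in> Real C; (u', v', w') \<in> Real C;
        a \<in> Hom C (Dom C u) (Dom C u'); c \<in> Hom C (Cod C v) (Cod C v');
        push C (Cod C v) a w = pull C (Dom C u') c w'\<rbrakk> \<Longrightarrow>
      \<exists>b \<in> Hom C (Cod C u) (Cod C u'). b \<cdot> u = u' \<cdot> a \<and> c \<cdot> v = v' \<cdot> b"
    and real_zero: "is_biproduct C Y X S i j p q \<Longrightarrow> (i, q, \<one>\<^bsub>Ext C X Y\<^esub>) \<in> Real C"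
    and real_sum: "\<lbrakk>(u, v, w) \<in> Real C; (u', v', w') \<in> Real C;
        is_biproduct C (Dom C u) (Dom C u') Y iY jY pY qY;
        is_biproduct C (Cod C u) (Cod C u') Z iZ jZ pZ qZ;
        is_biproduct C (Cod C v) (Cod C v') X iX jX pX qX\<rbrakk> \<Longrightarrow>
      (iZ \<cdot> u \<cdot> pY \<oplus> jZ \<cdot> u' \<cdot> qY, iX \<cdot> v \<cdot> pZ \<oplus> jX \<cdot> v' \<cdot> qZ,
       Act C pX iY w \<otimes>\<^bsub>Ext C X Y\<^esub> Act C qX jY w') \<in> Real C"
    and ET3: "\<lbrakk>(u, v, w) \<in> Real C; (u', v', w') \<in> Real C;
        a \<in> Hom C (Dom C u) (Dom C u'); b \<in> Hom C (Cod C u) (Cod C u'); b \<cdot> u = u' \<cdot> a\<rbrakk> \<Longrightarrow>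
      \<exists>c \<in> Hom C (Cod C v) (Cod C v'). c \<cdot> v = v' \<cdot> b \<and>
        push C (Cod C v) a w = pull C (Dom C u') c w'"
    and ET3_op: "\<lbrakk>(u, v, w) \<in> Real C; (u', v', w') \<in> Real C;
        b \<in> Hom C (Cod C u) (Cod C u'); c \<in> Hom C (Cod C v) (Cod C v'); c \<cdot> v = v' \<cdot> b\<rbrakk> \<Longrightarrow>
      \<exists>a \<in> Hom C (Dom C u) (Dom C u'). b \<cdot> u = u' \<cdot> a \<and>
        push C (Cod C v) a w = pull C (Dom C u') c w'"
    and ET4: "\<lbrakk>(f, f', w) \<in> Real C; (g, g', w') \<in> Real C; Cod C f = Dom C g\<rbrakk> \<Longrightarrow>
      \<exists>h' d e w''. (g \<cdot> f, h', w'') \<in> Real C \<and>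
        d \<in> Hom C (Cod C f') (Cod C h') \<and> e \<in> Hom C (Cod C h') (Cod C g') \<and>
        h' \<cdot> g = d \<cdot> f' \<and> e \<cdot> h' = g' \<and>
        (d, e, push C (Cod C g') f' w') \<in> Real C \<and>
        pull C (Dom C f) d w'' = w \<and>
        push C (Cod C h') f w'' = pull C (Dom C g) e w'"
    and ET4_op: "\<lbrakk>(f', f, w) \<in> Real C; (g', g, w') \<in> Real C; Cod C f = Dom C g\<rbrakk> \<Longrightarrow>
      \<exists>h' d e w''. (h', g \<cdot> f, w'') \<in> Real C \<and>
        d \<in> Hom C (Dom C f') (Dom C h') \<and> e \<in> Hom C (Dom C h') (Dom C g') \<and>
        h' \<cdot> d = f' \<and> f \<cdot> h' = g' \<cdot> e \<and>
        (d, e, pull C (Dom C f') g' w) \<in> Real C \<and>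
        push C (Cod C g) e w'' = w' \<and>
        push C (Cod C f) d w = pull C (Dom C h') g w''"

locale extriangulated_functor =
  source: extriangulated_category C + target: extriangulated_category D + additive_functor C D P
  for C :: "('o, 'm, 'e, 'z) extricat_scheme" and D :: "('p, 'q, 'd, 'y) extricat_scheme"
    and P :: "('o, 'm, 'p, 'q) catfun" and \<Omega> :: "'o \<Rightarrow> 'o \<Rightarrow> 'e \<Rightarrow> 'd" +
  assumes ext_hom: "\<lbrakk>X \<in> Obj C; Y \<in> Obj C\<rbrakk> \<Longrightarrow>
      \<Omega> X Y \<in> hom (Ext C X Y) (Ext D (fobj P X) (fobj P Y))"
    and ext_natural: "\<lbrakk>f \<in> Hom C X' X; g \<in> Hom C Y Y'; w \<in> carrier (Ext C X Y)\<rbrakk> \<Longrightarrow>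
      \<Omega> X' Y' (Act C f g w) = Act D (fmor P f) (fmor P g) (\<Omega> X Y w)"
    and ext_real: "(u, v, w) \<in> Real C \<Longrightarrow>
      (fmor P u, fmor P v, \<Omega> (Cod C v) (Dom C u) w) \<in> Real D"

text \<open>The structure on a full subcategory \<open>S\<close> of a triangulated category with
  \<open>\<bbbE>(X, Y) = G X Y \<subseteq> Hom(X, \<Sigma>Y)\<close> and all triangles \<open>Y \<rightarrow> Z \<rightarrow> X \<rightarrow> \<Sigma>Y\<close> with
  \<open>X, Y, Z\<close> in \<open>S\<close> and third morphism in \<open>\<bbbE>(X, Y)\<close>.\<close>

definition relative_extricat ::
  "('o, 'm, 'z) tricat_scheme \<Rightarrow> 'o set \<Rightarrow> ('o \<Rightarrow> 'o \<Rightarrow> 'm set) \<Rightarrow> ('o, 'm, 'm) extricat" where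
  "relative_extricat T S G = addcat.extend (full_subcat T S) (extricat.fields
     (\<lambda>X Y. \<lparr>carrier = G X Y, mult = Add T, one = Zero T X (fobj (Sh T) Y)\<rparr>)
     (\<lambda>f g w. fmor (Sh T) g \<cdot>\<^bsub>T\<^esub> w \<cdot>\<^bsub>T\<^esub> f)
     {(u, v, w) \<in> Tri T. Dom T u \<in> S \<and> Cod T u \<in> S \<and> Cod T v \<in> S \<and> w \<in> G (Cod T v) (Dom T u)})"

definition pr_extricat ::
  "('o, 'm, 'z) tricat_scheme \<Rightarrow> 'o set \<Rightarrow> nat \<Rightarrow> ('o, 'm, 'm) extricat" where
  "pr_extricat T M n = relative_extricat T (pr T M (n + 1))
     (\<lambda>X Y. factor_through T (shift_subcat T 1 (pr T M n)) X (fobj (Sh T) Y))"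


section \<open>The bounded homotopy category\<close>

record ('o, 'm) cplx =
  cob :: "int \<Rightarrow> 'o"
  cdiff :: "int \<Rightarrow> 'm"

record ('o, 'm) cmap =
  csrc :: "('o, 'm) cplx"
  ctgt :: "('o, 'm) cplx"
  ccomp :: "int \<Rightarrow> 'm"

definition is_complex :: "('o, 'm, 'z) addcat_scheme \<Rightarrow> ('o, 'm) cplx \<Rightarrow> bool" where
  "is_complex C X \<longleftrightarrow> (\<forall>i. cob X i \<in> Obj C \<and> cdiff X i \<in> Hom C (cob X i) (cob X (i + 1)) \<and>
     cdiff X (i + 1) \<cdot>\<^bsub>C\<^esub> cdiff X i = Zero C (cob X i) (cob X (i + 2)))"

definition concentrated ::
  "('o, 'm, 'z) addcat_scheme \<Rightarrow> int set \<Rightarrow> ('o, 'm) cplx \<Rightarrow> bool" where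
  "concentrated C I X \<longleftrightarrow> (\<forall>i. i \<notin> I \<longrightarrow> is_zero C (cob X i))"

definition is_chain_map :: "('o, 'm, 'z) addcat_scheme \<Rightarrow> ('o, 'm) cmap \<Rightarrow> bool" where
  "is_chain_map C f \<longleftrightarrow> (\<forall>i.
     ccomp f i \<in> Hom C (cob (csrc f) i) (cob (ctgt f) i) \<and>
     ccomp f (i + 1) \<cdot>\<^bsub>C\<^esub> cdiff (csrc f) i = cdiff (ctgt f) i \<cdot>\<^bsub>C\<^esub> ccomp f i)"

definition bounded_complexes :: "('o, 'm, 'z) addcat_scheme \<Rightarrow> ('o, 'm) cplx set" where
  "bounded_complexes C = {X. is_complex C X \<and> (\<exists>a b. concentrated C {a..b} X)}"

definition Chb :: "('o, 'm, 'z) addcat_scheme \<Rightarrow> (('o, 'm) cplx, ('o, 'm) cmap) addcat" where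
  "Chb C = \<lparr>Obj = bounded_complexes C,
     Arr = {f. csrc f \<in> bounded_complexes C \<and> ctgt f \<in> bounded_complexes C \<and> is_chain_map C f},
     Dom = csrc, Cod = ctgt,
     Id = (\<lambda>X. \<lparr>csrc = X, ctgt = X, ccomp = (\<lambda>i. Id C (cob X i))\<rparr>),
     Comp = (\<lambda>g f. \<lparr>csrc = csrc f, ctgt = ctgt g, ccomp = (\<lambda>i. ccomp g i \<cdot>\<^bsub>C\<^esub> ccomp f i)\<rparr>),
     Add = (\<lambda>f g. \<lparr>csrc = csrc f, ctgt = ctgt f, ccomp = (\<lambda>i. ccomp f i \<oplus>\<^bsub>C\<^esub> ccomp g i)\<rparr>),
     Zero = (\<lambda>X Y. \<lparr>csrc = X, ctgt = Y, ccomp = (\<lambda>i. Zero C (cob X i) (cob Y i))\<rparr>)\<rparr>"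

definition null_homotopic :: "('o, 'm, 'z) addcat_scheme \<Rightarrow> ('o, 'm) cmap set" where
  "null_homotopic C = {f \<in> Arr (Chb C). \<exists>s. \<forall>i.
     s i \<in> Hom C (cob (csrc f) i) (cob (ctgt f) (i - 1)) \<and>
     ccomp f i = cdiff (ctgt f) (i - 1) \<cdot>\<^bsub>C\<^esub> s i \<oplus>\<^bsub>C\<^esub> s (i + 1) \<cdot>\<^bsub>C\<^esub> cdiff (csrc f) i}"

abbreviation hcls :: "('o, 'm, 'z) addcat_scheme \<Rightarrow> ('o, 'm) cmap \<Rightarrow> ('o, 'm) cmap set" where
  "hcls C \<equiv> qcls (Chb C) (null_homotopic C)"

definition shift_cplx :: "('o, 'm, 'z) addcat_scheme \<Rightarrow> ('o, 'm) cplx \<Rightarrow> ('o, 'm) cplx" where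
  "shift_cplx C X = \<lparr>cob = (\<lambda>i. cob X (i + 1)), cdiff = (\<lambda>i. Neg C (cdiff X (i + 1)))\<rparr>"

definition shift_cmap :: "('o, 'm, 'z) addcat_scheme \<Rightarrow> ('o, 'm) cmap \<Rightarrow> ('o, 'm) cmap" where
  "shift_cmap C f = \<lparr>csrc = shift_cplx C (csrc f), ctgt = shift_cplx C (ctgt f),
     ccomp = (\<lambda>i. ccomp f (i + 1))\<rparr>"

definition Kb_shift :: "('o, 'm, 'z) addcat_scheme \<Rightarrow>
  (('o, 'm) cplx, ('o, 'm) cmap set, ('o, 'm) cplx, ('o, 'm) cmap set) catfun" where
  "Kb_shift C = \<lparr>fobj = shift_cplx C, fmor = (\<lambda>F. hcls C (shift_cmap C (rep F)))\<rparr>"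

text \<open>\<open>is_cone C f Z v w\<close>: \<open>Z\<close> is a mapping cone of \<open>f : X \<rightarrow> Y\<close>, with
  \<open>Z\<^sup>i = X\<^sup>i\<^sup>+\<^sup>1 \<oplus> Y\<^sup>i\<close> and differential \<open>(x, y) \<mapsto> (- d x, f x + d y)\<close>, and \<open>v : Y \<rightarrow> Z\<close> and
  \<open>w : Z \<rightarrow> \<Sigma>X\<close> are the canonical inclusion and projection. Cones are only determined up to the
  choice of the biproducts.\<close>

definition is_cone :: "('o, 'm, 'z) addcat_scheme \<Rightarrow>
  ('o, 'm) cmap \<Rightarrow> ('o, 'm) cplx \<Rightarrow> ('o, 'm) cmap \<Rightarrow> ('o, 'm) cmap \<Rightarrow> bool" where
  "is_cone C f Z v w \<longleftrightarrow> (\<exists>a b p q. let X = csrc f; Y = ctgt f in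
     (\<forall>i. is_biproduct C (cob X (i + 1)) (cob Y i) (cob Z i) (a i) (b i) (p i) (q i) \<and>
        cdiff Z i = a (i + 1) \<cdot>\<^bsub>C\<^esub> Neg C (cdiff X (i + 1)) \<cdot>\<^bsub>C\<^esub> p i
          \<oplus>\<^bsub>C\<^esub> b (i + 1) \<cdot>\<^bsub>C\<^esub> ccomp f (i + 1) \<cdot>\<^bsub>C\<^esub> p i
          \<oplus>\<^bsub>C\<^esub> b (i + 1) \<cdot>\<^bsub>C\<^esub> cdiff Y i \<cdot>\<^bsub>C\<^esub> q i) \<and>
     v = \<lparr>csrc = Y, ctgt = Z, ccomp = b\<rparr> \<and> w = \<lparr>csrc = Z, ctgt = shift_cplx C X, ccomp = p\<rparr>)"

definition Kb :: "('o, 'm, 'z) addcat_scheme \<Rightarrow> (('o, 'm) cplx, ('o, 'm) cmap set) tricat" where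
  "Kb C = (let K = quotient_cat (Chb C) (null_homotopic C) in
     addcat.extend K (tricat.fields (Kb_shift C)
       {t. \<exists>f Z v w. f \<in> Arr (Chb C) \<and> is_cone C f Z v w \<and>
          triangle_iso K (Kb_shift C) (hcls C f, hcls C v, hcls C w) t}))"

definition K_interval :: "('o, 'm, 'z) addcat_scheme \<Rightarrow> nat \<Rightarrow> ('o, 'm) cplx set" where
  "K_interval C n = {X \<in> Obj (Kb C). \<exists>Y \<in> Obj (Kb C).
     concentrated C {- int n..0} Y \<and> isomorphic (Kb C) X Y}"

definition K_extricat :: "('o, 'm, 'z) addcat_scheme \<Rightarrow> nat \<Rightarrow>
  (('o, 'm) cplx, ('o, 'm) cmap set, ('o, 'm) cmap set) extricat" where
  "K_extricat C n = relative_extricat (Kb C) (K_interval C n)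
     (\<lambda>X Y. Hom (Kb C) X (fobj (Sh (Kb C)) Y))"

text \<open>The embedding of \<open>C\<close> as complexes concentrated in degree 0, with one fixed zero object of
  \<open>C\<close> in all other degrees.\<close>

definition zero_obj :: "('o, 'm, 'z) addcat_scheme \<Rightarrow> 'o" where
  "zero_obj C = (SOME Z. is_zero C Z)"

definition stalk :: "('o, 'm, 'z) addcat_scheme \<Rightarrow> 'o \<Rightarrow> ('o, 'm) cplx" where
  "stalk C X = (let x = (\<lambda>i. if i = 0 then X else zero_obj C) in
     \<lparr>cob = x, cdiff = (\<lambda>i. Zero C (x i) (x (i + 1)))\<rparr>)"

definition stalk_map :: "('o, 'm, 'z) addcat_scheme \<Rightarrow> 'm \<Rightarrow> ('o, 'm) cmap" where
  "stalk_map C f = \<lparr>csrc = stalk C (Dom C f), ctgt = stalk C (Cod C f),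
     ccomp = (\<lambda>i. if i = 0 then f else Zero C (zero_obj C) (zero_obj C))\<rparr>"

definition stalk_functor :: "('o, 'm, 'z) addcat_scheme \<Rightarrow>
  ('o, 'm, ('o, 'm) cplx, ('o, 'm) cmap set) catfun" where
  "stalk_functor C = \<lparr>fobj = stalk C, fmor = (\<lambda>f. hcls C (stalk_map C f))\<rparr>"

end

(*
  Let T be the stable category of a Frobenius category E. By rigidity, an object X of pr(n + 1) has
  right M-approximations that come from conflations x(k+1) -> m(k) -> x(k) in E, where x(0) is a
  model of X and x(n+1) is zero in T. They splice to a complex over M in degrees -n, ..., 0, which is
  P X. As injectives are projective, liftings through the approximations can be chosen strictly
  commutative in E; hence a morphism lifts to a chain map, uniquely up to homotopy, and P is a functor.

  An extension w : X -> Sigma Y in E_M(X, Y) vanishes on M, so it is X -> Sigma x(1) -> Sigma Y for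
  some g : x(1) -> y(0), and a lift of g to the truncated resolution represents Omega w. A horseshoe
  construction in E resolves the middle term of the extriangle of w in such a way that its complex is
  a degreewise split extension with connecting map Omega w, so extriangles go to triangles. Objects of
  M get the trivial resolution.
*)
theory Submission
  imports Defs
begin

section \<open>Additive categories\<close>

text \<open>The obstacle is that an inflation is not monic in T. An approximation triangle lifts a
  morphism, but the induced morphism of syzygies is determined only up to morphisms through the
  desuspension of the resolved object. So there is no reason for two lifts to differ by a homotopy,
  and the horseshoe has the same defect. In E inflations are kernels and can be cancelled. The price
  is that squares must commute in E and not only modulo injectives, so the recursions run in E and
  only the terms of the complexes are taken in T. Rigidity enters in one way: morphisms from M to
  \<Sigma> pr(j) vanish for j at most n. This makes m(k) -> x(k) an approximation and identifies
  E_M(X, Y) with the morphisms that vanish on M. An extriangulated functor presupposes the axioms of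
  Nakaoka and Palu on both sides, hence also the octahedral axiom for complexes; both structures are
  treated as instances of one relative structure. Resolutions carry prescribed objects of T besides
  their models in E, so that the functor equals the stalk functor on M and is not just isomorphic to
  it.\<close>

lemma hom_iff [simp]: "f \<in> Hom C X Y \<longleftrightarrow> f \<in> Arr C \<and> Dom C f = X \<and> Cod C f = Y"
  by (auto simp: Hom_def)

section \<open>Arithmetic of morphisms in an additive category\<close>

context additive_category
begin

lemma obj_simps [simp]: "f \<in> Arr C \<Longrightarrow> Dom C f \<in> Obj C" "f \<in> Arr C \<Longrightarrow> Cod C f \<in> Obj C"
  using arr_obj by auto

lemma id_simps [simp]:
  "X \<in> Obj C \<Longrightarrow> Id C X \<in> Arr C" "X \<in> Obj C \<Longrightarrow> Dom C (Id C X) = X"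
  "X \<in> Obj C \<Longrightarrow> Cod C (Id C X) = X"
  using id_hom[of X] by auto

lemma comp_simps [simp]:
  assumes "f \<in> Arr C" "g \<in> Arr C" "Cod C f = Dom C g"
  shows "g \<cdot> f \<in> Arr C" "Dom C (g \<cdot> f) = Dom C f" "Cod C (g \<cdot> f) = Cod C g"
  using comp_hom[of f "Dom C f" "Dom C g" g "Cod C g"] assms by auto

lemma comp_id [simp]:
  "f \<in> Arr C \<Longrightarrow> Cod C f = Y \<Longrightarrow> Id C Y \<cdot> f = f" "f \<in> Arr C \<Longrightarrow> Dom C f = X \<Longrightarrow> f \<cdot> Id C X = f"
  using id_left[of f "Dom C f" "Cod C f"] id_right[of f "Dom C f" "Cod C f"] by auto

lemma comp_assoc_right [simp]:
  "\<lbrakk>f \<in> Arr C; g \<in> Arr C; h \<in> Arr C; Cod C f = Dom C g; Cod C g = Dom C h\<rbrakk> \<Longrightarrow>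
     (h \<cdot> g) \<cdot> f = h \<cdot> (g \<cdot> f)"
  using comp_assoc[of f "Dom C f" "Dom C g" g "Dom C h" h "Cod C h"] by auto

text \<open>Composites are normalized to right-nested form, where an equation for
  \<open>g \<cdot> f\<close> no longer matches inside \<open>g \<cdot> (f \<cdot> h)\<close>. This
  supplies the equation with the tail \<open>h\<close>; most diagram chases below rely on
  it.\<close>

lemma comp_reduce:
  "\<lbrakk>g \<cdot> f = k; f \<in> Arr C; g \<in> Arr C; h \<in> Arr C; Cod C h = Dom C f; Cod C f = Dom C g\<rbrakk> \<Longrightarrow>
     g \<cdot> (f \<cdot> h) = k \<cdot> h"
  using comp_assoc_right[of h f g] by auto

lemma group_homgrp: "X \<in> Obj C \<Longrightarrow> Y \<in> Obj C \<Longrightarrow> group (HomGrp C X Y)"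
  using hom_group comm_group.axioms(2) by blast

lemma monoid_homgrp: "X \<in> Obj C \<Longrightarrow> Y \<in> Obj C \<Longrightarrow> monoid (HomGrp C X Y)"
  using group_homgrp group.is_monoid by blast

lemma comm_monoid_homgrp: "X \<in> Obj C \<Longrightarrow> Y \<in> Obj C \<Longrightarrow> comm_monoid (HomGrp C X Y)"
  using hom_group comm_group.axioms(1) by blast

lemma add_simps [simp]:
  assumes "f \<in> Arr C" "g \<in> Arr C" "Dom C g = Dom C f" "Cod C g = Cod C f"
  shows "f \<oplus> g \<in> Arr C" "Dom C (f \<oplus> g) = Dom C f" "Cod C (f \<oplus> g) = Cod C f"
  using monoid.m_closed[OF monoid_homgrp[of "Dom C f" "Cod C f"], of f g] assms
  by (auto simp: HomGrp_def)

lemma zero_simps [simp]: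
  assumes "X \<in> Obj C" "Y \<in> Obj C"
  shows "Zero C X Y \<in> Arr C" "Dom C (Zero C X Y) = X" "Cod C (Zero C X Y) = Y"
  using monoid.one_closed[OF monoid_homgrp[OF assms]] by (auto simp: HomGrp_def)

lemma neg_simps [simp]:
  assumes "f \<in> Arr C"
  shows "Neg C f \<in> Arr C" "Dom C (Neg C f) = Dom C f" "Cod C (Neg C f) = Cod C f"
  using group.inv_closed[OF group_homgrp[of "Dom C f" "Cod C f"], of f] assms
  by (auto simp: HomGrp_def Neg_def)

lemma add_zero [simp]:
  "f \<in> Arr C \<Longrightarrow> Dom C f = X \<Longrightarrow> Cod C f = Y \<Longrightarrow> Zero C X Y \<oplus> f = f"
  "f \<in> Arr C \<Longrightarrow> Dom C f = X \<Longrightarrow> Cod C f = Y \<Longrightarrow> f \<oplus> Zero C X Y = f"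
  using monoid.l_one[OF monoid_homgrp[of X Y], of f] monoid.r_one[OF monoid_homgrp[of X Y], of f]
  by (auto simp: HomGrp_def)

lemma add_assoc [simp]:
  "\<lbrakk>f \<in> Arr C; g \<in> Arr C; h \<in> Arr C; Dom C g = Dom C f; Cod C g = Cod C f;
    Dom C h = Dom C f; Cod C h = Cod C f\<rbrakk> \<Longrightarrow> (f \<oplus> g) \<oplus> h = f \<oplus> (g \<oplus> h)"
  using monoid.m_assoc[OF monoid_homgrp[of "Dom C f" "Cod C f"], of f g h] by (auto simp: HomGrp_def)

lemma add_commute:
  "\<lbrakk>f \<in> Arr C; g \<in> Arr C; Dom C g = Dom C f; Cod C g = Cod C f\<rbrakk> \<Longrightarrow> f \<oplus> g = g \<oplus> f"
  using comm_monoid.m_comm[OF comm_monoid_homgrp[of "Dom C f" "Cod C f"], of f g]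
  by (auto simp: HomGrp_def)

lemma add_left_commute:
  "\<lbrakk>f \<in> Arr C; g \<in> Arr C; h \<in> Arr C; Dom C g = Dom C f; Cod C g = Cod C f;
    Dom C h = Dom C f; Cod C h = Cod C f\<rbrakk> \<Longrightarrow> f \<oplus> (g \<oplus> h) = g \<oplus> (f \<oplus> h)"
  by (metis add_assoc add_commute)

lemmas add_ac = add_commute add_left_commute

lemma add_neg [simp]:
  "f \<in> Arr C \<Longrightarrow> f \<oplus> Neg C f = Zero C (Dom C f) (Cod C f)"
  "f \<in> Arr C \<Longrightarrow> Neg C f \<oplus> f = Zero C (Dom C f) (Cod C f)"
  using group.r_inv[OF group_homgrp[of "Dom C f" "Cod C f"], of f]
    group.l_inv[OF group_homgrp[of "Dom C f" "Cod C f"], of f]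
  by (auto simp: HomGrp_def Neg_def)

lemma add_neg_cancel [simp]:
  assumes "f \<in> Arr C" "g \<in> Arr C" "Dom C g = Dom C f" "Cod C g = Cod C f"
  shows "f \<oplus> (Neg C f \<oplus> g) = g" "Neg C f \<oplus> (f \<oplus> g) = g"
    "f \<oplus> (g \<oplus> Neg C f) = g" "Neg C f \<oplus> (g \<oplus> f) = g"
proof -
  show 1: "f \<oplus> (Neg C f \<oplus> g) = g" "Neg C f \<oplus> (f \<oplus> g) = g"
    using add_assoc[of f "Neg C f" g] add_assoc[of "Neg C f" f g] assms by auto
  show "f \<oplus> (g \<oplus> Neg C f) = g" "Neg C f \<oplus> (g \<oplus> f) = g"
    using 1 add_commute[of g f] add_commute[of g "Neg C f"] assms by auto
qed

lemma add_neg_cancel2 [simp]: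
  assumes "f \<in> Arr C" "g \<in> Arr C" "Dom C g = Dom C f" "Cod C g = Cod C f"
    "h \<in> Arr C" "Dom C h = Dom C f" "Cod C h = Cod C f"
  shows "f \<oplus> (g \<oplus> (Neg C f \<oplus> h)) = g \<oplus> h" "Neg C f \<oplus> (g \<oplus> (f \<oplus> h)) = g \<oplus> h"
  using add_left_commute[of g "Neg C f" h] add_left_commute[of g f h] assms by auto

lemma add_left_cancel:
  assumes "f \<oplus> g = f \<oplus> h" "f \<in> Arr C" "g \<in> Arr C" "h \<in> Arr C" "Dom C g = Dom C f"
    "Cod C g = Cod C f" "Dom C h = Dom C f" "Cod C h = Cod C f"
  shows "g = h"
  by (metis add_neg_cancel(2) assms)

lemma neg_unique:
  assumes "f \<oplus> g = Zero C (Dom C f) (Cod C f)" "f \<in> Arr C" "g \<in> Arr C"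
    "Dom C g = Dom C f" "Cod C g = Cod C f"
  shows "g = Neg C f"
  using add_left_cancel[of f g "Neg C f"] assms by simp

lemma diff_zero:
  assumes "f \<oplus> Neg C g = Zero C (Dom C f) (Cod C f)" "f \<in> Arr C" "g \<in> Arr C"
    "Dom C g = Dom C f" "Cod C g = Cod C f"
  shows "f = g"
proof -
  have "(f \<oplus> Neg C g) \<oplus> g = f" using assms(2-5) by simp
  hence "f = (f \<oplus> Neg C g) \<oplus> g" by (rule sym)
  also have "\<dots> = g" unfolding assms(1) using assms(2-5) by simp
  finally show ?thesis .
qed

lemma neg_neg [simp]: "f \<in> Arr C \<Longrightarrow> Neg C (Neg C f) = f"
  by (rule neg_unique[symmetric]) auto

lemma neg_inject [simp]: "f \<in> Arr C \<Longrightarrow> g \<in> Arr C \<Longrightarrow> Neg C f = Neg C g \<longleftrightarrow> f = g"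
  by (metis neg_neg)

lemma neg_zero [simp]: "X \<in> Obj C \<Longrightarrow> Y \<in> Obj C \<Longrightarrow> Neg C (Zero C X Y) = Zero C X Y"
  by (rule neg_unique[symmetric]) auto

lemma neg_eq_zero [simp]:
  "\<lbrakk>f \<in> Arr C; X \<in> Obj C; Y \<in> Obj C\<rbrakk> \<Longrightarrow> Neg C f = Zero C X Y \<longleftrightarrow> f = Zero C X Y"
  by (metis neg_neg neg_zero)

lemma neg_add [simp]:
  assumes "f \<in> Arr C" "g \<in> Arr C" "Dom C g = Dom C f" "Cod C g = Cod C f"
  shows "Neg C (f \<oplus> g) = Neg C f \<oplus> Neg C g"
proof -
  have "(f \<oplus> g) \<oplus> (Neg C f \<oplus> Neg C g) = Zero C (Dom C f) (Cod C f)"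
    using assms add_left_commute[of g "Neg C f" "Neg C g"] by simp
  from neg_unique[OF this[folded add_simps(2,3)[OF assms]]] show ?thesis using assms by simp
qed

lemma comp_add [simp]:
  "\<lbrakk>f \<in> Arr C; g \<in> Arr C; g' \<in> Arr C; Cod C f = Dom C g; Dom C g' = Dom C g; Cod C g' = Cod C g\<rbrakk> \<Longrightarrow>
     (g \<oplus> g') \<cdot> f = g \<cdot> f \<oplus> g' \<cdot> f"
  "\<lbrakk>f \<in> Arr C; f' \<in> Arr C; g \<in> Arr C; Cod C f = Dom C g; Dom C f' = Dom C f; Cod C f' = Cod C f\<rbrakk> \<Longrightarrow>
     g \<cdot> (f \<oplus> f') = g \<cdot> f \<oplus> g \<cdot> f'"
  using comp_add_left[of f "Dom C f" "Cod C f" g "Cod C g" g']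
    comp_add_right[of f "Dom C f" "Cod C f" f' g "Cod C g"] by auto

text \<open>By distributivity such a composite is its own double, so it can be cancelled in the
  group of morphisms.\<close>

lemma comp_zero [simp]:
  assumes "f \<in> Arr C"
  shows "Cod C f = Y \<Longrightarrow> Z \<in> Obj C \<Longrightarrow> Zero C Y Z \<cdot> f = Zero C (Dom C f) Z"
    "Dom C f = Y \<Longrightarrow> X \<in> Obj C \<Longrightarrow> f \<cdot> Zero C X Y = Zero C X (Cod C f)"
proof -
  assume *: "Cod C f = Y" "Z \<in> Obj C"
  have "Zero C Y Z \<cdot> f \<oplus> Zero C Y Z \<cdot> f = (Zero C Y Z \<oplus> Zero C Y Z) \<cdot> f"
    using * assms by (intro comp_add(1)[symmetric]) auto
  also have "\<dots> = Zero C Y Z \<cdot> f" using * assms by (auto simp del: comp_add)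
  finally have "Zero C Y Z \<cdot> f \<oplus> Zero C Y Z \<cdot> f = Zero C Y Z \<cdot> f" .
  thus "Zero C Y Z \<cdot> f = Zero C (Dom C f) Z"
    by (rule_tac add_left_cancel[of "Zero C Y Z \<cdot> f"]) (use assms * in auto)
next
  assume *: "Dom C f = Y" "X \<in> Obj C"
  have "f \<cdot> Zero C X Y \<oplus> f \<cdot> Zero C X Y = f \<cdot> (Zero C X Y \<oplus> Zero C X Y)"
    using * assms by (intro comp_add(2)[symmetric]) auto
  also have "\<dots> = f \<cdot> Zero C X Y" using * assms by (auto simp del: comp_add)
  finally have "f \<cdot> Zero C X Y \<oplus> f \<cdot> Zero C X Y = f \<cdot> Zero C X Y" .
  thus "f \<cdot> Zero C X Y = Zero C X (Cod C f)"
    by (rule_tac add_left_cancel[of "f \<cdot> Zero C X Y"]) (use assms * in auto)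
qed

lemma comp_neg [simp]:
  assumes "f \<in> Arr C" "g \<in> Arr C" "Cod C f = Dom C g"
  shows "Neg C g \<cdot> f = Neg C (g \<cdot> f)" "g \<cdot> Neg C f = Neg C (g \<cdot> f)"
  using assms by (auto intro!: neg_unique simp flip: comp_add)

lemma add_eq_zero:
  assumes "f \<oplus> g = Zero C X Y" "f \<in> Arr C" "g \<in> Arr C"
    "Dom C f = X" "Cod C f = Y" "Dom C g = X" "Cod C g = Y"
  shows "f = Neg C g" "g = Neg C f"
  using neg_unique[of f g] assms by auto

subsection \<open>Zero objects, isomorphisms and biproducts\<close>

text \<open>If the identity vanishes, every morphism from or to \<open>Z\<close> is zero. The
  equational form is the one that additive functors visibly preserve.\<close>

lemma is_zero_iff: "is_zero C Z \<longleftrightarrow> Z \<in> Obj C \<and> Id C Z = Zero C Z Z"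
proof
  assume z: "is_zero C Z"
  hence "\<exists>!f. f \<in> Hom C Z Z" and Z: "Z \<in> Obj C" by (auto simp: is_zero_def)
  moreover have "Id C Z \<in> Hom C Z Z" "Zero C Z Z \<in> Hom C Z Z" using Z by auto
  ultimately show "Z \<in> Obj C \<and> Id C Z = Zero C Z Z" by blast
next
  assume z: "Z \<in> Obj C \<and> Id C Z = Zero C Z Z"
  have "f = Zero C X Z" if "f \<in> Hom C X Z" for f X
    using comp_id(1)[of f Z] z that by auto
  moreover have "f = Zero C Z X" if "f \<in> Hom C Z X" for f X
    using comp_id(2)[of f Z] z that by auto
  ultimately show "is_zero C Z" unfolding is_zero_def using z
    by (metis zero_simps(1-3) hom_iff)
qed

lemma to_zero: "is_zero C Z \<Longrightarrow> f \<in> Arr C \<Longrightarrow> Dom C f = X \<Longrightarrow> Cod C f = Z \<Longrightarrow> f = Zero C X Z"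
  using comp_id(1)[of f Z] by (auto simp: is_zero_iff)

lemma from_zero: "is_zero C Z \<Longrightarrow> f \<in> Arr C \<Longrightarrow> Dom C f = Z \<Longrightarrow> Cod C f = X \<Longrightarrow> f = Zero C Z X"
  using comp_id(2)[of f Z] by (auto simp: is_zero_iff)

lemma is_zero_obj [simp]: "is_zero C Z \<Longrightarrow> Z \<in> Obj C"
  by (simp add: is_zero_def)

definition Inv :: "'m \<Rightarrow> 'm" where
  "Inv f = (SOME g. g \<in> Hom C (Cod C f) (Dom C f) \<and> g \<cdot> f = Id C (Dom C f) \<and> f \<cdot> g = Id C (Cod C f))"

lemma iso_arr [simp]: "is_iso C f \<Longrightarrow> f \<in> Arr C"
  by (simp add: is_iso_def)

lemma Inv_simps [simp]:
  assumes "is_iso C f"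
  shows "Inv f \<in> Arr C" "Dom C (Inv f) = Cod C f" "Cod C (Inv f) = Dom C f"
    "Inv f \<cdot> f = Id C (Dom C f)" "f \<cdot> Inv f = Id C (Cod C f)"
proof -
  have "\<exists>g. g \<in> Hom C (Cod C f) (Dom C f) \<and> g \<cdot> f = Id C (Dom C f) \<and> f \<cdot> g = Id C (Cod C f)"
    using assms unfolding is_iso_def by blast
  from someI_ex[OF this, folded Inv_def]
  show "Inv f \<in> Arr C" "Dom C (Inv f) = Cod C f" "Cod C (Inv f) = Dom C f"
    "Inv f \<cdot> f = Id C (Dom C f)" "f \<cdot> Inv f = Id C (Cod C f)" by auto
qed

lemma Inv_cancel [simp]:
  assumes "is_iso C f" "g \<in> Arr C"
  shows "Cod C g = Dom C f \<Longrightarrow> Inv f \<cdot> (f \<cdot> g) = g" "Cod C g = Cod C f \<Longrightarrow> f \<cdot> (Inv f \<cdot> g) = g"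
  using assms by (simp_all add: comp_reduce[OF Inv_simps(4)[OF assms(1)]]
    comp_reduce[OF Inv_simps(5)[OF assms(1)]])

lemma is_isoI:
  assumes "f \<in> Arr C" "g \<in> Arr C" "Dom C g = Cod C f" "Cod C g = Dom C f"
    "g \<cdot> f = Id C (Dom C f)" "f \<cdot> g = Id C (Cod C f)"
  shows "is_iso C f"
  unfolding is_iso_def using assms by auto

lemma iso_left_cancel:
  "\<lbrakk>f \<cdot> g = f \<cdot> h; is_iso C f; g \<in> Arr C; h \<in> Arr C; Cod C g = Dom C f; Cod C h = Dom C f\<rbrakk> \<Longrightarrow> g = h"
  by (metis Inv_cancel(1))

lemma iso_right_cancel:
  "\<lbrakk>g \<cdot> f = h \<cdot> f; is_iso C f; g \<in> Arr C; h \<in> Arr C; Dom C g = Cod C f; Dom C h = Cod C f\<rbrakk> \<Longrightarrow> g = h"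
  by (metis Inv_simps(1,2,3,5) comp_assoc_right comp_id(2) iso_arr)

lemma iso_Inv [simp]: "is_iso C f \<Longrightarrow> is_iso C (Inv f)"
  by (rule is_isoI[of _ f]) auto

lemma iso_Id [simp]: "X \<in> Obj C \<Longrightarrow> is_iso C (Id C X)"
  by (rule is_isoI[of _ "Id C X"]) auto

lemma iso_Neg [simp]: "is_iso C f \<Longrightarrow> is_iso C (Neg C f)"
  by (rule is_isoI[of _ "Neg C (Inv f)"]) auto

lemma iso_comp [simp]: "is_iso C f \<Longrightarrow> is_iso C g \<Longrightarrow> Cod C f = Dom C g \<Longrightarrow> is_iso C (g \<cdot> f)"
  by (rule is_isoI[of _ "Inv f \<cdot> Inv g"]) auto

lemma isomorphicI: "is_iso C f \<Longrightarrow> Dom C f = X \<Longrightarrow> Cod C f = Y \<Longrightarrow> isomorphic C X Y"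
  unfolding isomorphic_def using iso_arr by fastforce

lemma isomorphicE:
  assumes "isomorphic C X Y"
  obtains f where "is_iso C f" "Dom C f = X" "Cod C f = Y"
  using assms unfolding isomorphic_def by auto

lemma isomorphic_obj: "isomorphic C X Y \<Longrightarrow> X \<in> Obj C \<and> Y \<in> Obj C"
  by (elim isomorphicE) auto

lemma isomorphic_refl: "X \<in> Obj C \<Longrightarrow> isomorphic C X X"
  by (rule isomorphicI[of "Id C X"]) auto

lemma isomorphic_sym: "isomorphic C X Y \<Longrightarrow> isomorphic C Y X"
  by (elim isomorphicE, rule_tac f = "Inv f" in isomorphicI) auto

lemma isomorphic_trans: "isomorphic C X Y \<Longrightarrow> isomorphic C Y Z \<Longrightarrow> isomorphic C X Z"
  by (elim isomorphicE, rule_tac f = "fa \<cdot> f" in isomorphicI) auto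

lemma zero_isomorphic: "is_zero C X \<Longrightarrow> is_zero C Y \<Longrightarrow> isomorphic C X Y"
  by (rule isomorphicI[of "Zero C X Y"], rule is_isoI[of _ "Zero C Y X"]) (auto simp: is_zero_iff)

lemma isomorphic_zero: "isomorphic C X Y \<Longrightarrow> is_zero C X \<Longrightarrow> is_zero C Y"
proof -
  assume "isomorphic C X Y" and z: "is_zero C X"
  then obtain f where f: "is_iso C f" "Dom C f = X" "Cod C f = Y" by (elim isomorphicE)
  have "f = Zero C X Y" using f by (intro from_zero[OF z]) auto
  hence "Zero C X Y \<cdot> Inv f = Id C Y" using f Inv_simps(5)[OF f(1)] by simp
  thus "is_zero C Y" using f iso_arr[OF f(1)] by (auto simp: is_zero_iff)
qed

text \<open>The last four facts are the matrix relations with a tail, in the shape that right-nested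
  composites need.\<close>

lemma biproduct_simps:
  assumes "is_biproduct C A B S i j p q"
  shows "i \<in> Arr C" "Dom C i = A" "Cod C i = S" "j \<in> Arr C" "Dom C j = B" "Cod C j = S"
    "p \<in> Arr C" "Dom C p = S" "Cod C p = A" "q \<in> Arr C" "Dom C q = S" "Cod C q = B"
    "p \<cdot> i = Id C A" "q \<cdot> j = Id C B" "q \<cdot> i = Zero C A B" "p \<cdot> j = Zero C B A"
    "A \<in> Obj C" "B \<in> Obj C" "S \<in> Obj C"
    "f \<in> Arr C \<Longrightarrow> Cod C f = A \<Longrightarrow> p \<cdot> (i \<cdot> f) = f"
    "f \<in> Arr C \<Longrightarrow> Cod C f = B \<Longrightarrow> q \<cdot> (j \<cdot> f) = f"
    "f \<in> Arr C \<Longrightarrow> Cod C f = A \<Longrightarrow> q \<cdot> (i \<cdot> f) = Zero C (Dom C f) B"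
    "f \<in> Arr C \<Longrightarrow> Cod C f = B \<Longrightarrow> p \<cdot> (j \<cdot> f) = Zero C (Dom C f) A"
proof -
  note [simp] = assms[unfolded is_biproduct_def hom_iff]
  show i: "i \<in> Arr C" "Dom C i = A" "Cod C i = S" "j \<in> Arr C" "Dom C j = B" "Cod C j = S"
    "p \<in> Arr C" "Dom C p = S" "Cod C p = A" "q \<in> Arr C" "Dom C q = S" "Cod C q = B"
    "p \<cdot> i = Id C A" "q \<cdot> j = Id C B" "q \<cdot> i = Zero C A B" "p \<cdot> j = Zero C B A" by auto
  show o: "A \<in> Obj C" "B \<in> Obj C" "S \<in> Obj C"
    using i obj_simps[of i] obj_simps[of j] by auto
  show "f \<in> Arr C \<Longrightarrow> Cod C f = A \<Longrightarrow> p \<cdot> (i \<cdot> f) = f"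
    "f \<in> Arr C \<Longrightarrow> Cod C f = B \<Longrightarrow> q \<cdot> (j \<cdot> f) = f"
    "f \<in> Arr C \<Longrightarrow> Cod C f = A \<Longrightarrow> q \<cdot> (i \<cdot> f) = Zero C (Dom C f) B"
    "f \<in> Arr C \<Longrightarrow> Cod C f = B \<Longrightarrow> p \<cdot> (j \<cdot> f) = Zero C (Dom C f) A"
    using o by (simp_all add: comp_reduce[OF i(13)] comp_reduce[OF i(14)]
      comp_reduce[OF i(15)] comp_reduce[OF i(16)])
qed

lemma biproduct_sum:
  assumes "is_biproduct C A B S i j p q"
  shows "i \<cdot> p \<oplus> j \<cdot> q = Id C S"
    and "f \<in> Arr C \<Longrightarrow> Cod C f = S \<Longrightarrow> i \<cdot> (p \<cdot> f) \<oplus> j \<cdot> (q \<cdot> f) = f"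
    and "f \<in> Arr C \<Longrightarrow> Dom C f = S \<Longrightarrow> f \<cdot> (i \<cdot> p) \<oplus> f \<cdot> (j \<cdot> q) = f"
proof -
  note [simp] = biproduct_simps[OF assms]
  show s: "i \<cdot> p \<oplus> j \<cdot> q = Id C S" using assms by (simp add: is_biproduct_def)
  show "f \<in> Arr C \<Longrightarrow> Cod C f = S \<Longrightarrow> i \<cdot> (p \<cdot> f) \<oplus> j \<cdot> (q \<cdot> f) = f"
    using arg_cong[OF s, of "\<lambda>x. x \<cdot> f"] by simp
  show "f \<in> Arr C \<Longrightarrow> Dom C f = S \<Longrightarrow> f \<cdot> (i \<cdot> p) \<oplus> f \<cdot> (j \<cdot> q) = f"
    using arg_cong[OF s, of "\<lambda>x. f \<cdot> x"] by simp
qed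

lemma biproduct_eq_in:
  assumes "is_biproduct C A B S i j p q" "f \<in> Arr C" "g \<in> Arr C" "Cod C f = S" "Cod C g = S"
    "p \<cdot> f = p \<cdot> g" "q \<cdot> f = q \<cdot> g"
  shows "f = g"
  using biproduct_sum(2)[OF assms(1), of f] biproduct_sum(2)[OF assms(1), of g] assms(2-) by metis

lemma biproduct_eq_out:
  assumes "is_biproduct C A B S i j p q" "f \<in> Arr C" "g \<in> Arr C" "Dom C f = S" "Dom C g = S"
    "f \<cdot> i = g \<cdot> i" "f \<cdot> j = g \<cdot> j"
  shows "f = g"
proof -
  note [simp] = biproduct_simps[OF assms(1)]
  have "f \<cdot> (i \<cdot> p) = g \<cdot> (i \<cdot> p)" "f \<cdot> (j \<cdot> q) = g \<cdot> (j \<cdot> q)"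
    using arg_cong[OF assms(6), of "\<lambda>x. x \<cdot> p"] arg_cong[OF assms(7), of "\<lambda>x. x \<cdot> q"] assms(2-5)
    by auto
  thus ?thesis
    using biproduct_sum(3)[OF assms(1), of f] biproduct_sum(3)[OF assms(1), of g] assms(2-5) by metis
qed

lemma biproduct_swap:
  assumes "is_biproduct C A B S i j p q"
  shows "is_biproduct C B A S j i q p"
proof -
  note [simp] = biproduct_simps[OF assms]
  show ?thesis using biproduct_sum(1)[OF assms] add_commute[of "i \<cdot> p" "j \<cdot> q"]
    by (simp add: is_biproduct_def)
qed

lemma biproduct_zero_right:
  assumes "X \<in> Obj C" "is_zero C Z"
  shows "is_biproduct C X Z X (Id C X) (Zero C Z X) (Id C X) (Zero C X Z)"
  using assms by (auto simp: is_biproduct_def is_zero_iff)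

lemma biproduct_zero:
  assumes "is_biproduct C A B S i j p q" "is_zero C A" "is_zero C B"
  shows "is_zero C S"
proof -
  note [simp] = biproduct_simps[OF assms(1)]
  have "p = Zero C S A" "q = Zero C S B"
    by (rule to_zero[OF assms(2)], simp_all, rule to_zero[OF assms(3)], simp_all)
  hence "Zero C S S = Id C S" using biproduct_sum(1)[OF assms(1)] by simp
  thus ?thesis by (simp add: is_zero_iff)
qed

lemma additive_subcategory_iso:
  "additive_subcategory C S \<Longrightarrow> X \<in> S \<Longrightarrow> isomorphic C X Y \<Longrightarrow> Y \<in> S"
  using isomorphic_obj unfolding additive_subcategory_def by blast

lemma additive_subcategory_zero: "additive_subcategory C S \<Longrightarrow> is_zero C Z \<Longrightarrow> Z \<in> S"
proof -
  assume S: "additive_subcategory C S" and Z: "is_zero C Z"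
  then obtain Z' where "Z' \<in> S" "is_zero C Z'" unfolding additive_subcategory_def by blast
  thus "Z \<in> S" using additive_subcategory_iso[OF S] zero_isomorphic Z by blast
qed

lemma additive_subcategory_obj: "additive_subcategory C S \<Longrightarrow> X \<in> S \<Longrightarrow> X \<in> Obj C"
  unfolding additive_subcategory_def by blast

end

subsection \<open>Full subcategories\<close>

lemma full_subcat_sel [simp]:
  "Obj (full_subcat C S) = S" "Dom (full_subcat C S) = Dom C" "Cod (full_subcat C S) = Cod C"
  "Id (full_subcat C S) = Id C" "Comp (full_subcat C S) = Comp C" "Add (full_subcat C S) = Add C"
  "Zero (full_subcat C S) = Zero C"
  "f \<in> Arr (full_subcat C S) \<longleftrightarrow> f \<in> Arr C \<and> Dom C f \<in> S \<and> Cod C f \<in> S"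
  by (auto simp: full_subcat_def)

lemma full_subcat_homgrp:
  "X \<in> S \<Longrightarrow> Y \<in> S \<Longrightarrow> HomGrp (full_subcat C S) X Y = HomGrp C X Y"
  by (auto simp: HomGrp_def)

lemma full_subcat_neg [simp]:
  "f \<in> Arr (full_subcat C S) \<Longrightarrow> Neg (full_subcat C S) f = Neg C f"
  by (simp add: Neg_def full_subcat_homgrp)

lemma full_subcat_iso:
  "is_iso (full_subcat C S) f \<longleftrightarrow> is_iso C f \<and> Dom C f \<in> S \<and> Cod C f \<in> S"
  unfolding is_iso_def by auto

lemma full_subcat_biproduct:
  "is_biproduct (full_subcat C S) A B D i j p q \<longleftrightarrow>
     is_biproduct C A B D i j p q \<and> A \<in> S \<and> B \<in> S \<and> D \<in> S"
  unfolding is_biproduct_def by auto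

lemma (in additive_category) full_subcat_zero:
  assumes "S \<subseteq> Obj C" "Z \<in> S" "is_zero C Z" 
  shows "is_zero (full_subcat C S) Z"
proof -
  have "Hom (full_subcat C S) X Y = Hom C X Y" if "X \<in> S" "Y \<in> S" for X Y
    using that by (auto simp: Hom_def)
  moreover have "\<exists>!f. f \<in> Hom C X Z" "\<exists>!f. f \<in> Hom C Z X" if "X \<in> S" for X
    using assms(1,3) that unfolding is_zero_def by blast+
  ultimately show ?thesis using assms(2) unfolding is_zero_def by (simp del: hom_iff)
qed

lemma (in additive_category) full_subcat_additive:
  assumes "additive_subcategory C S"
  shows "additive_category (full_subcat C S)"
proof -
  have S: "S \<subseteq> Obj C" and Z: "\<exists>Z\<in>S. is_zero C Z" and
    B: "\<And>A B D i j p q. A \<in> S \<Longrightarrow> B \<in> S \<Longrightarrow> is_biproduct C A B D i j p q \<Longrightarrow> D \<in> S"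
    using assms unfolding additive_subcategory_def by blast+
  note [simp] = subsetD[OF S]
  show ?thesis
  proof (rule additive_category.intro)
    show "\<exists>Z. is_zero (full_subcat C S) Z" using Z full_subcat_zero[OF S] by blast
    fix A B assume "A \<in> Obj (full_subcat C S)" "B \<in> Obj (full_subcat C S)"
    hence *: "A \<in> S" "B \<in> S" "A \<in> Obj C" "B \<in> Obj C" by auto
    obtain D i j p q where "is_biproduct C A B D i j p q" using ex_biproduct *(3,4) by blast
    thus "\<exists>D i j p q. is_biproduct (full_subcat C S) A B D i j p q"
      unfolding full_subcat_biproduct using B *(1,2) by blast
  qed (auto simp: full_subcat_homgrp hom_group)
qed

subsection \<open>Additive functors\<close>

context additive_functor
begin

lemma F_obj [simp]: "X \<in> Obj C \<Longrightarrow> fobj F X \<in> Obj D"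
  by (rule fobj_obj)

lemma F_simps [simp]:
  assumes "f \<in> Arr C"
  shows "fmor F f \<in> Arr D" "Dom D (fmor F f) = fobj F (Dom C f)" "Cod D (fmor F f) = fobj F (Cod C f)"
  using fmor_hom[of "Dom C f" "Cod C f"] assms by (auto simp: hom_def HomGrp_def Pi_def)

lemma F_comp [simp]:
  "\<lbrakk>f \<in> Arr C; g \<in> Arr C; Cod C f = Dom C g\<rbrakk> \<Longrightarrow> fmor F (g \<cdot>\<^bsub>C\<^esub> f) = fmor F g \<cdot>\<^bsub>D\<^esub> fmor F f"
  using fmor_comp by auto

lemma F_add [simp]:
  "\<lbrakk>f \<in> Arr C; g \<in> Arr C; Dom C g = Dom C f; Cod C g = Cod C f\<rbrakk> \<Longrightarrow>
     fmor F (f \<oplus>\<^bsub>C\<^esub> g) = fmor F f \<oplus>\<^bsub>D\<^esub> fmor F g"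
  using fmor_hom[of "Dom C f" "Cod C f"] by (auto simp: hom_def HomGrp_def)

lemma F_id [simp]: "X \<in> Obj C \<Longrightarrow> fmor F (Id C X) = Id D (fobj F X)"
  by (rule fmor_id)

lemma F_zero [simp]:
  assumes "X \<in> Obj C" "Y \<in> Obj C"
  shows "fmor F (Zero C X Y) = Zero D (fobj F X) (fobj F Y)"
proof -
  have "fmor F (Zero C X Y) \<oplus>\<^bsub>D\<^esub> fmor F (Zero C X Y) = fmor F (Zero C X Y \<oplus>\<^bsub>C\<^esub> Zero C X Y)"
    using assms by (intro F_add[symmetric]) auto
  also have "\<dots> = fmor F (Zero C X Y)" using assms by (simp del: F_add)
  finally have "fmor F (Zero C X Y) \<oplus>\<^bsub>D\<^esub> fmor F (Zero C X Y) = fmor F (Zero C X Y)" .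
  thus ?thesis
    by (rule_tac target.add_left_cancel[of "fmor F (Zero C X Y)"]) (use assms in auto)
qed

lemma F_neg [simp]:
  assumes "f \<in> Arr C"
  shows "fmor F (Neg C f) = Neg D (fmor F f)"
  using assms by (intro target.neg_unique) (auto simp flip: F_add)

lemma F_is_zero [simp]: "is_zero C Z \<Longrightarrow> is_zero D (fobj F Z)"
  by (metis F_id F_obj F_zero source.is_zero_iff target.is_zero_iff)

lemma F_iso [simp]: "is_iso C f \<Longrightarrow> is_iso D (fmor F f)"
proof -
  assume f: "is_iso C f"
  have "fmor F (source.Inv f) \<cdot>\<^bsub>D\<^esub> fmor F f = Id D (fobj F (Dom C f))"
    "fmor F f \<cdot>\<^bsub>D\<^esub> fmor F (source.Inv f) = Id D (fobj F (Cod C f))"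
    using f by (auto simp flip: F_comp)
  thus ?thesis using f by (intro target.is_isoI[of _ "fmor F (source.Inv f)"]) auto
qed

lemma F_Inv [simp]:
  assumes f: "is_iso C f"
  shows "fmor F (source.Inv f) = target.Inv (fmor F f)"
proof -
  have "fmor F (source.Inv f) \<cdot>\<^bsub>D\<^esub> fmor F f = Id D (fobj F (Dom C f))"
    using f by (auto simp flip: F_comp)
  hence "fmor F (source.Inv f) \<cdot>\<^bsub>D\<^esub> fmor F f = target.Inv (fmor F f) \<cdot>\<^bsub>D\<^esub> fmor F f"
    using F_iso[OF f] f by simp
  from target.iso_right_cancel[OF this F_iso[OF f]] show ?thesis using F_iso[OF f] f by simp
qed

lemma F_isomorphic: "isomorphic C X Y \<Longrightarrow> isomorphic D (fobj F X) (fobj F Y)"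
  by (elim source.isomorphicE, rule_tac f = "fmor F f" in target.isomorphicI) auto

lemma F_biproduct:
  assumes "is_biproduct C A B S i j p q"
  shows "is_biproduct D (fobj F A) (fobj F B) (fobj F S) (fmor F i) (fmor F j) (fmor F p) (fmor F q)"
proof -
  note b [simp] = source.biproduct_simps[OF assms]
  have "fmor F p \<cdot>\<^bsub>D\<^esub> fmor F i = Id D (fobj F A)" "fmor F q \<cdot>\<^bsub>D\<^esub> fmor F j = Id D (fobj F B)"
    "fmor F q \<cdot>\<^bsub>D\<^esub> fmor F i = Zero D (fobj F A) (fobj F B)"
    "fmor F p \<cdot>\<^bsub>D\<^esub> fmor F j = Zero D (fobj F B) (fobj F A)" by (auto simp flip: F_comp)
  moreover have "fmor F i \<cdot>\<^bsub>D\<^esub> fmor F p \<oplus>\<^bsub>D\<^esub> fmor F j \<cdot>\<^bsub>D\<^esub> fmor F q = Id D (fobj F S)"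
    using arg_cong[OF source.biproduct_sum(1)[OF assms], of "fmor F"] by simp
  ultimately show ?thesis by (simp add: is_biproduct_def)
qed

end

lemma natural_isoD:
  assumes "natural_iso C D F G \<eta>"
  shows "X \<in> Obj C \<Longrightarrow> is_iso D (\<eta> X)" "X \<in> Obj C \<Longrightarrow> \<eta> X \<in> Arr D"
    "X \<in> Obj C \<Longrightarrow> Dom D (\<eta> X) = fobj F X" "X \<in> Obj C \<Longrightarrow> Cod D (\<eta> X) = fobj G X"
    "f \<in> Arr C \<Longrightarrow> fmor G f \<cdot>\<^bsub>D\<^esub> \<eta> (Dom C f) = \<eta> (Cod C f) \<cdot>\<^bsub>D\<^esub> fmor F f"
  using assms by (auto simp: natural_iso_def)

lemma fun_simps [simp]:
  "fobj id_fun X = X" "fmor id_fun f = f"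
  "fobj (comp_fun G F) X = fobj G (fobj F X)" "fmor (comp_fun G F) f = fmor G (fmor F f)"
  by (auto simp: id_fun_def comp_fun_def)

section \<open>Equivalences of additive categories\<close>

locale category_equivalence = additive_functor C D F
  for C :: "('o, 'm, 'z) addcat_scheme" and D :: "('p, 'q, 'y) addcat_scheme"
    and F :: "('o, 'm, 'p, 'q) catfun" +
  assumes is_equivalence: "equivalence C D F"
begin

lemma ess_surj:
  assumes "Y \<in> Obj D"
  shows "\<exists>X \<in> Obj C. isomorphic D (fobj F X) Y"
proof -
  obtain G \<epsilon> where G: "additive_functor D C G" and e: "natural_iso D D (comp_fun F G) id_fun \<epsilon>"
    using is_equivalence unfolding equivalence_def by blast
  interpret G: additive_functor D C G by (rule G)
  have "isomorphic D (fobj F (fobj G Y)) Y"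
    using natural_isoD[OF e] assms by (intro target.isomorphicI[of "\<epsilon> Y"]) auto
  thus ?thesis using assms by auto
qed

text \<open>Conjugation by \<eta> recovers \<open>f\<close> from \<open>G (F f)\<close>, so
  \<open>F\<close> is faithful; \<epsilon> does the same for \<open>G\<close>. A morphism
  \<open>h\<close> is then the image of the conjugate of \<open>G h\<close>, because the faithful
  functor \<open>G\<close> does not distinguish the two.\<close>

lemma faithful_full:
  shows faithful: "\<lbrakk>f \<in> Arr C; g \<in> Arr C; Dom C f = Dom C g; Cod C f = Cod C g; fmor F f = fmor F g\<rbrakk> \<Longrightarrow>
      f = g"
    and full: "\<lbrakk>X \<in> Obj C; Y \<in> Obj C; h \<in> Arr D; Dom D h = fobj F X; Cod D h = fobj F Y\<rbrakk> \<Longrightarrow>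
      \<exists>f. f \<in> Arr C \<and> Dom C f = X \<and> Cod C f = Y \<and> fmor F f = h"
proof -
  obtain G \<eta> \<epsilon> where G: "additive_functor D C G" and
    n: "natural_iso C C id_fun (comp_fun G F) \<eta>" and e: "natural_iso D D (comp_fun F G) id_fun \<epsilon>"
    using is_equivalence unfolding equivalence_def by blast
  interpret G: additive_functor D C G by (rule G)
  note N = natural_isoD[OF n, simplified] note E = natural_isoD[OF e, simplified]
  note [simp] = N(1-4) E(1-4)
  show fa: "f = g" if "f \<in> Arr C" "g \<in> Arr C" "Dom C f = Dom C g" "Cod C f = Cod C g"
    "fmor F f = fmor F g" for f g
  proof (rule source.iso_left_cancel[of "\<eta> (Cod C f)"])
    show "\<eta> (Cod C f) \<cdot>\<^bsub>C\<^esub> f = \<eta> (Cod C f) \<cdot>\<^bsub>C\<^esub> g"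
      using N(5)[OF that(1)] N(5)[OF that(2)] that(3-5) by metis
  qed (use that in auto)
  have Gfa: "f = g" if "f \<in> Arr D" "g \<in> Arr D" "Dom D f = Dom D g" "Cod D f = Cod D g"
    "fmor G f = fmor G g" for f g
  proof (rule target.iso_right_cancel[of _ "\<epsilon> (Dom D f)"])
    show "f \<cdot>\<^bsub>D\<^esub> \<epsilon> (Dom D f) = g \<cdot>\<^bsub>D\<^esub> \<epsilon> (Dom D f)"
      using E(5)[OF that(1)] E(5)[OF that(2)] that(3-5) by metis
  qed (use that in auto)
  show "\<exists>f. f \<in> Arr C \<and> Dom C f = X \<and> Cod C f = Y \<and> fmor F f = h"
    if *: "X \<in> Obj C" "Y \<in> Obj C" "h \<in> Arr D" "Dom D h = fobj F X" "Cod D h = fobj F Y" for X Y h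
  proof -
    define f where "f = source.Inv (\<eta> Y) \<cdot>\<^bsub>C\<^esub> fmor G h \<cdot>\<^bsub>C\<^esub> \<eta> X"
    have f: "f \<in> Arr C" "Dom C f = X" "Cod C f = Y" using * by (auto simp: f_def)
    have "fmor G (fmor F f) \<cdot>\<^bsub>C\<^esub> \<eta> X = fmor G h \<cdot>\<^bsub>C\<^esub> \<eta> X"
      using N(5)[OF f(1)] f * by (simp add: f_def)
    hence "fmor G (fmor F f) = fmor G h"
      by (rule source.iso_right_cancel[of _ "\<eta> X"]) (use f * in auto)
    hence "fmor F f = h" by (intro Gfa) (use f * in auto)
    thus ?thesis using f by blast
  qed
qed

lemma F_iso_reflect:
  assumes "f \<in> Arr C" "is_iso D (fmor F f)"
  shows "is_iso C f"
proof -
  obtain g where g: "g \<in> Arr C" "Dom C g = Cod C f" "Cod C g = Dom C f" "fmor F g = target.Inv (fmor F f)"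
    using full[of "Cod C f" "Dom C f" "target.Inv (fmor F f)"] assms by auto
  have "g \<cdot>\<^bsub>C\<^esub> f = Id C (Dom C f)" "f \<cdot>\<^bsub>C\<^esub> g = Id C (Cod C f)"
    by (rule faithful; use g assms in simp)+
  thus ?thesis using g assms by (intro source.is_isoI[of f g]) auto
qed

end

lemma equivalenceD: "equivalence C D F \<Longrightarrow> category_equivalence C D F"
  by (simp add: category_equivalence_def category_equivalence_axioms_def equivalence_def)

section \<open>Triangulated categories\<close>

text \<open>The axioms of a triangulated category without the octahedral axiom and with only one
  direction of the rotation axiom; the other direction follows.\<close>

locale pretriangulated_category = additive_category T
  for T :: "('o, 'm, 'z) tricat_scheme" (structure) +
  assumes shift_equivalence: "equivalence T T (Sh T)"
    and tri_candidate: "t \<in> Tri T \<Longrightarrow> candidate_triangle T (Sh T) t"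
    and TR1_id: "\<lbrakk>X \<in> Obj T; is_zero T Z\<rbrakk> \<Longrightarrow>
      (Id T X, Zero T X Z, Zero T Z (fobj (Sh T) X)) \<in> Tri T"
    and TR1_iso: "\<lbrakk>t \<in> Tri T; triangle_iso T (Sh T) t t'\<rbrakk> \<Longrightarrow> t' \<in> Tri T"
    and TR1_ex: "u \<in> Arr T \<Longrightarrow> \<exists>v w. (u, v, w) \<in> Tri T"
    and TR2_rotate: "(u, v, w) \<in> Tri T \<Longrightarrow> (v, w, Neg T (fmor (Sh T) u)) \<in> Tri T"
    and TR3: "\<lbrakk>(u, v, w) \<in> Tri T; (u', v', w') \<in> Tri T;
        a \<in> Hom T (Dom T u) (Dom T u'); b \<in> Hom T (Cod T u) (Cod T u'); b \<cdot> u = u' \<cdot> a\<rbrakk> \<Longrightarrow>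
      \<exists>c \<in> Hom T (Cod T v) (Cod T v'). c \<cdot> v = v' \<cdot> b \<and> fmor (Sh T) a \<cdot> w = w' \<cdot> c"
begin

sublocale S: category_equivalence T T "Sh T"
  by (rule equivalenceD[OF shift_equivalence])

abbreviation "So \<equiv> fobj (Sh T)"
abbreviation "Sm \<equiv> fmor (Sh T)"

section \<open>Exactness, rotation and the five lemma\<close>

lemma tri_simps:
  assumes "(u, v, w) \<in> Tri T"
  shows "u \<in> Arr T" "v \<in> Arr T" "w \<in> Arr T" "Dom T v = Cod T u" "Dom T w = Cod T v"
    "Cod T w = So (Dom T u)"
  using tri_candidate[OF assms] by (auto simp: candidate_triangle_def)

lemma tri_isoI:
  assumes "(u, v, w) \<in> Tri T" "is_iso T a" "is_iso T b" "is_iso T c"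
    "Dom T a = Dom T u" "Cod T a = Dom T u'" "Dom T b = Cod T u" "Cod T b = Cod T u'"
    "Dom T c = Cod T v" "Cod T c = Cod T v'"
    "u' \<in> Arr T" "v' \<in> Arr T" "w' \<in> Arr T" "Dom T v' = Cod T u'" "Dom T w' = Cod T v'"
    "Cod T w' = So (Dom T u')" "b \<cdot> u = u' \<cdot> a" "c \<cdot> v = v' \<cdot> b" "Sm a \<cdot> w = w' \<cdot> c"
  shows "(u', v', w') \<in> Tri T"
proof (rule TR1_iso[OF assms(1)])
  show "triangle_iso T (Sh T) (u, v, w) (u', v', w')"
    unfolding triangle_iso_def split_conv
    using assms tri_candidate[OF assms(1)] iso_arr[of a] iso_arr[of b] iso_arr[of c]
    by (intro conjI exI[of _ a] exI[of _ b] exI[of _ c]) (auto simp: candidate_triangle_def)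
qed

lemma tri_morphism:
  assumes "(u, v, w) \<in> Tri T" "(u', v', w') \<in> Tri T" "a \<in> Arr T" "b \<in> Arr T"
    "Dom T a = Dom T u" "Cod T a = Dom T u'" "Dom T b = Cod T u" "Cod T b = Cod T u'"
    "b \<cdot> u = u' \<cdot> a"
  obtains c where "c \<in> Arr T" "Dom T c = Cod T v" "Cod T c = Cod T v'" "c \<cdot> v = v' \<cdot> b"
    "Sm a \<cdot> w = w' \<cdot> c"
  using TR3[OF assms(1,2), of a b] assms(3-) by auto

text \<open>The pair of the identity and \<open>u\<close> maps the identity triangle X = X -> 0 to
  the given triangle, so \<open>v \<cdot> u\<close> factors through a zero object.\<close>

lemma tri_comp_vu: 
  assumes "(u, v, w) \<in> Tri T"
  shows "v \<cdot> u = Zero T (Dom T u) (Cod T v)"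
proof -
  note [simp] = tri_simps[OF assms]
  obtain Z where Z: "is_zero T Z" using ex_zero by blast
  obtain c where "c \<in> Arr T" "Dom T c = Z" "Cod T c = Cod T v"
    "c \<cdot> Zero T (Dom T u) Z = v \<cdot> u"
    using tri_morphism[OF TR1_id[OF _ Z, of "Dom T u"] assms, of "Id T (Dom T u)" u] Z by auto
  thus ?thesis by (metis Z comp_zero(2) is_zero_obj obj_simps(1) tri_simps(1)[OF assms])
qed

lemma tri_comp:
  assumes "(u, v, w) \<in> Tri T"
  shows "v \<cdot> u = Zero T (Dom T u) (Cod T v)" "w \<cdot> v = Zero T (Cod T u) (So (Dom T u))"
    "Sm u \<cdot> w = Zero T (Cod T v) (So (Cod T u))"
proof -
  note [simp] = tri_simps[OF assms]
  show "v \<cdot> u = Zero T (Dom T u) (Cod T v)" "w \<cdot> v = Zero T (Cod T u) (So (Dom T u))"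
    using tri_comp_vu[OF assms] tri_comp_vu[OF TR2_rotate[OF assms]] by auto
  have "Neg T (Sm u \<cdot> w) = Zero T (Cod T v) (So (Cod T u))"
    using tri_comp_vu[OF TR2_rotate[OF TR2_rotate[OF assms]]] by simp
  thus "Sm u \<cdot> w = Zero T (Cod T v) (So (Cod T u))"
    by simp
qed

text \<open>The identity triangle on the source of \<open>f\<close>, rotated, maps to the rotated
  given triangle by \<open>f\<close> and zero. The component that TR3 adds is a morphism of
  suspensions; since \<Sigma> is fully faithful, it desuspends to \<open>g\<close>.\<close>

lemma tri_exact_Y:
  assumes t: "(u, v, w) \<in> Tri T" and f: "f \<in> Arr T" "Cod T f = Cod T u"
    "v \<cdot> f = Zero T (Dom T f) (Cod T v)"
  obtains g where "g \<in> Arr T" "Dom T g = Dom T f" "Cod T g = Dom T u" "u \<cdot> g = f"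
proof -
  note [simp] = tri_simps[OF t] f
  obtain Z where Z: "is_zero T Z" using ex_zero by blast
  let ?A = "Dom T f"
  obtain c where c: "c \<in> Arr T" "Dom T c = So ?A" "Cod T c = So (Dom T u)"
    "Sm f \<cdot> Neg T (Sm (Id T ?A)) = Neg T (Sm u) \<cdot> c"
    using tri_morphism[OF TR2_rotate[OF TR1_id[OF _ Z, of ?A]] TR2_rotate[OF t],
      of f "Zero T Z (Cod T v)"] Z by auto
  obtain g where g: "g \<in> Arr T" "Dom T g = ?A" "Cod T g = Dom T u" "Sm g = c"
    using S.full[of ?A "Dom T u" c] c by auto
  have "Neg T (Sm f) = Neg T (Sm u \<cdot> c)" using c by simp
  hence "Sm f = Sm u \<cdot> c" using c by simp
  hence "Sm (u \<cdot> g) = Sm f" using g by simp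
  hence "u \<cdot> g = f" using g by (rule_tac S.faithful) auto
  thus thesis using g that by blast
qed

lemma tri_exact_Z:
  assumes t: "(u, v, w) \<in> Tri T" and f: "f \<in> Arr T" "Cod T f = Cod T v"
    "w \<cdot> f = Zero T (Dom T f) (So (Dom T u))"
  obtains g where "g \<in> Arr T" "Dom T g = Dom T f" "Cod T g = Cod T u" "v \<cdot> g = f"
  using tri_exact_Y[OF TR2_rotate[OF t], of f] f tri_simps[OF t] by auto

lemma tri_exact_SX:
  assumes t: "(u, v, w) \<in> Tri T" and f: "f \<in> Arr T" "Cod T f = So (Dom T u)"
    "Sm u \<cdot> f = Zero T (Dom T f) (So (Cod T u))"
  obtains g where "g \<in> Arr T" "Dom T g = Dom T f" "Cod T g = Cod T v" "w \<cdot> g = f"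
  using tri_exact_Y[OF TR2_rotate[OF TR2_rotate[OF t]], of f] f tri_simps[OF t] by auto

text \<open>Exactly the part of the exactness of Hom(A, -) that the five lemma asks of its source.
  Thus sequences that are not yet known to be triangles, such as direct sums, can be compared with
  triangles.\<close>

definition exact_candidate :: "'m \<Rightarrow> 'm \<Rightarrow> 'm \<Rightarrow> bool" where
  "exact_candidate u v w \<longleftrightarrow> u \<in> Arr T \<and> v \<in> Arr T \<and> w \<in> Arr T \<and> Dom T v = Cod T u \<and>
     Dom T w = Cod T v \<and> Cod T w = So (Dom T u) \<and> v \<cdot> u = Zero T (Dom T u) (Cod T v) \<and>
     (\<forall>f. f \<in> Arr T \<longrightarrow> Cod T f = Cod T v \<longrightarrow> w \<cdot> f = Zero T (Dom T f) (So (Dom T u)) \<longrightarrow>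
        (\<exists>g. g \<in> Arr T \<and> Dom T g = Dom T f \<and> Cod T g = Cod T u \<and> v \<cdot> g = f)) \<and>
     (\<forall>f. f \<in> Arr T \<longrightarrow> Cod T f = So (Dom T u) \<longrightarrow> Sm u \<cdot> f = Zero T (Dom T f) (So (Cod T u)) \<longrightarrow>
        (\<exists>g. g \<in> Arr T \<and> Dom T g = Dom T f \<and> Cod T g = Cod T v \<and> w \<cdot> g = f))"

lemma tri_exact_candidate: 
  assumes t: "(u, v, w) \<in> Tri T"
  shows "exact_candidate u v w"
  unfolding exact_candidate_def
  using tri_simps[OF t] tri_comp[OF t]
  by (auto elim: tri_exact_Z[OF t] tri_exact_SX[OF t])

text \<open>A chase with generalized elements: \<open>surj\<close> lifts any morphism along
  \<open>c\<close>, and \<open>inj\<close> shows that \<open>c\<close> can be cancelled. Lifting the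
  identity gives a right inverse \<open>h\<close>, and cancelling \<open>c\<close> in c h c = c
  shows that it is two-sided.\<close>

lemma five_lemma:
  assumes e: "exact_candidate u v w" and t': "(u', v', w') \<in> Tri T"
    and a: "is_iso T a" "Dom T a = Dom T u" "Cod T a = Dom T u'"
    and b: "is_iso T b" "Dom T b = Cod T u" "Cod T b = Cod T u'"
    and c: "c \<in> Arr T" "Dom T c = Cod T v" "Cod T c = Cod T v'"
    and eq: "b \<cdot> u = u' \<cdot> a" "c \<cdot> v = v' \<cdot> b" "Sm a \<cdot> w = w' \<cdot> c"
  shows "is_iso T c"
proof -
  note [simp] = tri_simps[OF t'] a b c 
  have E [simp]: "u \<in> Arr T" "v \<in> Arr T" "w \<in> Arr T" "Dom T v = Cod T u" "Dom T w = Cod T v"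
      "Cod T w = So (Dom T u)" and vu: "v \<cdot> u = Zero T (Dom T u) (Cod T v)" and
    exZ: "\<And>f. \<lbrakk>f \<in> Arr T; Cod T f = Cod T v; w \<cdot> f = Zero T (Dom T f) (So (Dom T u))\<rbrakk> \<Longrightarrow>
        \<exists>g. g \<in> Arr T \<and> Dom T g = Dom T f \<and> Cod T g = Cod T u \<and> v \<cdot> g = f" and
    exS: "\<And>f. \<lbrakk>f \<in> Arr T; Cod T f = So (Dom T u); Sm u \<cdot> f = Zero T (Dom T f) (So (Cod T u))\<rbrakk> \<Longrightarrow>
        \<exists>g. g \<in> Arr T \<and> Dom T g = Dom T f \<and> Cod T g = Cod T v \<and> w \<cdot> g = f"
    using e unfolding exact_candidate_def by blast+
  have surj: "\<exists>h. h \<in> Arr T \<and> Dom T h = Dom T f \<and> Cod T h = Cod T v \<and> c \<cdot> h = f"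
    if f [simp]: "f \<in> Arr T" "Cod T f = Cod T v'" for f
  proof -
    let ?g = "Inv (Sm a) \<cdot> (w' \<cdot> f)"
    have "Sm b \<cdot> (Sm u \<cdot> ?g) = (Sm u' \<cdot> w') \<cdot> f"
      using comp_reduce[OF arg_cong[OF eq(1), of Sm, simplified], of ?g] by simp
    also have "\<dots> = Zero T (Dom T f) (So (Cod T u'))" using tri_comp(3)[OF t'] by simp
    finally have "Sm u \<cdot> ?g = Zero T (Dom T f) (So (Cod T u))"
      by (rule_tac iso_left_cancel[of "Sm b" "Sm u \<cdot> ?g"]) auto
    then obtain h where h [simp]: "h \<in> Arr T" "Dom T h = Dom T f" "Cod T h = Cod T v" and
      wh: "w \<cdot> h = ?g" using exS[of ?g] by auto
    have "w' \<cdot> (c \<cdot> h) = w' \<cdot> f"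
      using comp_reduce[OF eq(3)[symmetric], of h] wh by simp
    hence "w' \<cdot> (f \<oplus> Neg T (c \<cdot> h)) = Zero T (Dom T f) (So (Dom T u'))" by simp
    then obtain y where y [simp]: "y \<in> Arr T" "Dom T y = Dom T f" "Cod T y = Cod T u'" and
      vy: "v' \<cdot> y = f \<oplus> Neg T (c \<cdot> h)"
      using tri_exact_Z[OF t', of "f \<oplus> Neg T (c \<cdot> h)"] by auto
    have "c \<cdot> (v \<cdot> (Inv b \<cdot> y)) = v' \<cdot> y" using comp_reduce[OF eq(2), of "Inv b \<cdot> y"] by simp
    hence "c \<cdot> (v \<cdot> (Inv b \<cdot> y) \<oplus> h) = f" using vy by simp
    thus ?thesis by (intro exI[of _ "v \<cdot> (Inv b \<cdot> y) \<oplus> h"]) simp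
  qed
  have inj: "f = Zero T (Dom T f) (Cod T v)"
    if f [simp]: "f \<in> Arr T" "Cod T f = Cod T v" and cf: "c \<cdot> f = Zero T (Dom T f) (Cod T v')" for f
  proof -
    have "Sm a \<cdot> (w \<cdot> f) = w' \<cdot> (c \<cdot> f)" using comp_reduce[OF eq(3), of f] by simp
    hence "Sm a \<cdot> (w \<cdot> f) = Zero T (Dom T f) (So (Dom T u'))" using cf by simp
    hence "w \<cdot> f = Zero T (Dom T f) (So (Dom T u))"
      by (rule_tac iso_left_cancel[of "Sm a" "w \<cdot> f"]) auto
    then obtain y where y [simp]: "y \<in> Arr T" "Dom T y = Dom T f" "Cod T y = Cod T u" and
      vy: "v \<cdot> y = f" using exZ[of f] by auto
    have "v' \<cdot> (b \<cdot> y) = Zero T (Dom T (b \<cdot> y)) (Cod T v')"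
      using comp_reduce[OF eq(2)[symmetric], of y] vy cf by simp
    then obtain x where x [simp]: "x \<in> Arr T" "Dom T x = Dom T f" "Cod T x = Dom T u'" and
      ux: "u' \<cdot> x = b \<cdot> y" using tri_exact_Y[OF t', of "b \<cdot> y"] by auto
    have "b \<cdot> (u \<cdot> (Inv a \<cdot> x)) = b \<cdot> y" using comp_reduce[OF eq(1), of "Inv a \<cdot> x"] ux by simp
    hence "y = u \<cdot> (Inv a \<cdot> x)" by (rule_tac iso_left_cancel[of b y]) auto
    hence "f = (v \<cdot> u) \<cdot> (Inv a \<cdot> x)" using vy by simp
    thus ?thesis unfolding vu by simp
  qed
  obtain h where h [simp]: "h \<in> Arr T" "Dom T h = Cod T v'" "Cod T h = Cod T v" and
    ch: "c \<cdot> h = Id T (Cod T v')" using surj[of "Id T (Cod T v')"] by auto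
  have "h \<cdot> c \<oplus> Neg T (Id T (Cod T v)) = Zero T (Cod T v) (Cod T v)"
    using inj[of "h \<cdot> c \<oplus> Neg T (Id T (Cod T v))"] comp_reduce[OF ch, of c] by simp
  hence "h \<cdot> c = Id T (Cod T v)" by (rule_tac diff_zero) auto
  thus ?thesis using ch by (intro is_isoI[of c h]) auto
qed

text \<open>The map \<open>c\<close> to a completion of \<open>u\<close> is the identity on the
  first two objects, so the five lemma inverts it. Direct sums and split sequences are recognized as
  triangles in this way.\<close>

lemma exact_candidate_tri:
  assumes e: "exact_candidate u v w" and t: "(u, v', w') \<in> Tri T"
    and c: "c \<in> Arr T" "Dom T c = Cod T v" "Cod T c = Cod T v'" "c \<cdot> v = v'" "w' \<cdot> c = w"
  shows "(u, v, w) \<in> Tri T"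
proof -
  have E [simp]: "u \<in> Arr T" "v \<in> Arr T" "w \<in> Arr T" "Dom T v = Cod T u" "Dom T w = Cod T v"
      "Cod T w = So (Dom T u)" using e unfolding exact_candidate_def by blast+
  note [simp] = tri_simps[OF t] c(1-3)
  have i: "is_iso T c"
    by (rule five_lemma[OF e t, of "Id T (Dom T u)" "Id T (Cod T u)"]) (use c in auto)
  note [simp] = i
  have "Inv c \<cdot> v' = v" unfolding c(4)[symmetric] by simp
  moreover have "w' = w \<cdot> Inv c" unfolding c(5)[symmetric] by simp
  ultimately show ?thesis
    by (intro tri_isoI[OF t, of "Id T (Dom T u)" "Id T (Cod T u)" "Inv c"]) auto
qed

text \<open>Complete \<open>u\<close> to a triangle. Rotated until they begin with -\<Sigma>u, this
  triangle and the given one have the same first morphism, so they are isomorphic by the five lemma.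
  The isomorphism of the third objects is one of suspensions and therefore desuspends.\<close>

lemma TR2_back:
  assumes t: "(v, w, Neg T (Sm u)) \<in> Tri T" and u [simp]: "u \<in> Arr T" "Dom T v = Cod T u"
    "Cod T w = So (Dom T u)"
  shows "(u, v, w) \<in> Tri T"
proof -
  note [simp] = tri_simps[OF t]
  obtain v' w' where t': "(u, v', w') \<in> Tri T" using TR1_ex[of u] by auto
  note [simp] = tri_simps[OF t']
  note r = TR2_rotate[OF TR2_rotate[OF t]] and r' = TR2_rotate[OF TR2_rotate[OF TR2_rotate[OF t']]]
  obtain c where c: "c \<in> Arr T" "Dom T c = So (Cod T v')" "Cod T c = So (Cod T v)"
    "c \<cdot> Neg T (Sm v') = Neg T (Sm v)" "Neg T (Sm w') = Neg T (Sm w) \<cdot> c"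
    using tri_morphism[OF r' r, of "Id T (So (Dom T u))" "Id T (So (Cod T u))"] by auto
  have ci: "is_iso T c"
    by (rule five_lemma[OF tri_exact_candidate[OF r'] r, of "Id T (So (Dom T u))" "Id T (So (Cod T u))"])
      (use c in auto)
  obtain g where g [simp]: "g \<in> Arr T" "Dom T g = Cod T v'" "Cod T g = Cod T v" and Sg: "Sm g = c"
    using S.full[of "Cod T v'" "Cod T v" c] c by auto
  have "Neg T (Sm (g \<cdot> v')) = Neg T (Sm v)" "Neg T (Sm w') = Neg T (Sm (w \<cdot> g))"
    using c Sg by simp_all
  hence "Sm (g \<cdot> v') = Sm v" "Sm w' = Sm (w \<cdot> g)"
    by (simp_all del: S.F_comp)
  hence eq: "g \<cdot> v' = v" "w' = w \<cdot> g" by (rule_tac S.faithful; simp del: S.F_comp)+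
  have "is_iso T g" using S.F_iso_reflect[of g] ci Sg by simp
  thus ?thesis using eq by (intro tri_isoI[OF t', of "Id T (Dom T u)" "Id T (Cod T u)" g]) auto
qed

text \<open>Three rotations negate all three morphisms. The automorphism -1 of the middle object
  absorbs two of the signs, and the third one stays.\<close>

lemma tri_shift:
  assumes t: "(u, v, w) \<in> Tri T"
  shows "(Sm u, Sm v, Neg T (Sm w)) \<in> Tri T"
proof -
  note [simp] = tri_simps[OF t]
  show ?thesis
    by (rule tri_isoI[OF TR2_rotate[OF TR2_rotate[OF TR2_rotate[OF t]]],
      of "Id T (So (Dom T u))" "Neg T (Id T (So (Cod T u)))" "Id T (So (Cod T v))"]) auto
qed

lemma tri_unshift:
  assumes t: "(Sm u, Sm v, Neg T (Sm w)) \<in> Tri T" and [simp]: "u \<in> Arr T" "v \<in> Arr T" "w \<in> Arr T"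
    "Dom T v = Cod T u" "Dom T w = Cod T v" "Cod T w = So (Dom T u)"
  shows "(u, v, w) \<in> Tri T"
proof -
  have "(Neg T (Sm u), Neg T (Sm v), Neg T (Sm w)) \<in> Tri T"
    by (rule tri_isoI[OF t,
      of "Id T (So (Dom T u))" "Neg T (Id T (So (Cod T u)))" "Id T (So (Cod T v))"]) auto
  from TR2_back[OF TR2_back[OF TR2_back[OF this]]] show ?thesis by auto
qed

lemma tri_morphism_fst:
  assumes t: "(u, v, w) \<in> Tri T" and t': "(u', v', w') \<in> Tri T" and [simp]: "b \<in> Arr T" "c \<in> Arr T"
    "Dom T b = Cod T u" "Cod T b = Cod T u'" "Dom T c = Cod T v" "Cod T c = Cod T v'"
    and eq: "c \<cdot> v = v' \<cdot> b"
  obtains a where "a \<in> Arr T" "Dom T a = Dom T u" "Cod T a = Dom T u'" "b \<cdot> u = u' \<cdot> a"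
    "Sm a \<cdot> w = w' \<cdot> c"
proof -
  note [simp] = tri_simps[OF t] tri_simps[OF t']
  obtain d where d: "d \<in> Arr T" "Dom T d = So (Dom T u)" "Cod T d = So (Dom T u')" "d \<cdot> w = w' \<cdot> c"
    "Sm b \<cdot> Neg T (Sm u) = Neg T (Sm u') \<cdot> d"
    using tri_morphism[OF TR2_rotate[OF t] TR2_rotate[OF t'], of b c] eq by auto
  obtain a where a [simp]: "a \<in> Arr T" "Dom T a = Dom T u" "Cod T a = Dom T u'" and Sa: "Sm a = d"
    using S.full[of "Dom T u" "Dom T u'" d] d by auto
  have "Neg T (Sm (b \<cdot> u)) = Neg T (Sm (u' \<cdot> a))" using d Sa by simp
  hence "Sm (b \<cdot> u) = Sm (u' \<cdot> a)"
    by (simp del: S.F_comp)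
  hence "b \<cdot> u = u' \<cdot> a" by (rule_tac S.faithful) (simp_all del: S.F_comp)
  thus thesis using that a Sa d by blast
qed

lemma tri_morphism_snd:
  assumes t: "(u, v, w) \<in> Tri T" and t': "(u', v', w') \<in> Tri T" and [simp]: "a \<in> Arr T" "c \<in> Arr T"
    "Dom T a = Dom T u" "Cod T a = Dom T u'" "Dom T c = Cod T v" "Cod T c = Cod T v'"
    and eq: "Sm a \<cdot> w = w' \<cdot> c"
  obtains b where "b \<in> Arr T" "Dom T b = Cod T u" "Cod T b = Cod T u'" "b \<cdot> u = u' \<cdot> a"
    "c \<cdot> v = v' \<cdot> b"
proof -
  note [simp] = tri_simps[OF t] tri_simps[OF t']
  obtain d where d: "d \<in> Arr T" "Dom T d = Cod T u" "Cod T d = Cod T u'" "c \<cdot> v = v' \<cdot> d"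
    "Sm d \<cdot> Sm u = Sm u' \<cdot> Sm a"
    using tri_morphism_fst[OF TR2_rotate[OF t] TR2_rotate[OF t'], of c "Sm a"] eq by auto
  hence "Sm (d \<cdot> u) = Sm (u' \<cdot> a)" by simp
  hence "d \<cdot> u = u' \<cdot> a" using d by (rule_tac S.faithful) (simp_all del: S.F_comp)
  thus thesis using that d by blast
qed

lemma five_lemma_snd:
  assumes t: "(u, v, w) \<in> Tri T" and t': "(u', v', w') \<in> Tri T"
    and a: "is_iso T a" "Dom T a = Dom T u" "Cod T a = Dom T u'"
    and b: "b \<in> Arr T" "Dom T b = Cod T u" "Cod T b = Cod T u'"
    and c: "is_iso T c" "Dom T c = Cod T v" "Cod T c = Cod T v'"
    and eq: "b \<cdot> u = u' \<cdot> a" "c \<cdot> v = v' \<cdot> b" "Sm a \<cdot> w = w' \<cdot> c"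
  shows "is_iso T b"
proof -
  note [simp] = tri_simps[OF t] tri_simps[OF t'] a b c
  have e: "Sm b \<cdot> Sm u = Sm u' \<cdot> Sm a" "Sm c \<cdot> Sm v = Sm v' \<cdot> Sm b"
    using arg_cong[OF eq(1), of Sm] arg_cong[OF eq(2), of Sm] by simp_all
  have "is_iso T (Sm b)"
    by (rule five_lemma[OF tri_exact_candidate[OF TR2_rotate[OF TR2_rotate[OF t]]]
      TR2_rotate[OF TR2_rotate[OF t']], of c "Sm a"])
      (simp_all add: eq(2,3) e)
  thus ?thesis by (rule_tac S.F_iso_reflect) simp_all
qed

lemma five_lemma_fst:
  assumes t: "(u, v, w) \<in> Tri T" and t': "(u', v', w') \<in> Tri T"
    and a: "a \<in> Arr T" "Dom T a = Dom T u" "Cod T a = Dom T u'"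
    and b: "is_iso T b" "Dom T b = Cod T u" "Cod T b = Cod T u'"
    and c: "is_iso T c" "Dom T c = Cod T v" "Cod T c = Cod T v'"
    and eq: "b \<cdot> u = u' \<cdot> a" "c \<cdot> v = v' \<cdot> b" "Sm a \<cdot> w = w' \<cdot> c"
  shows "is_iso T a"
proof -
  note [simp] = tri_simps[OF t] tri_simps[OF t'] a b c
  have e: "Sm b \<cdot> Sm u = Sm u' \<cdot> Sm a"
    using arg_cong[OF eq(1), of Sm] by simp
  have "is_iso T (Sm a)"
    by (rule five_lemma[OF tri_exact_candidate[OF TR2_rotate[OF t]] TR2_rotate[OF t'], of b c])
      (simp_all add: eq(2,3) e)
  thus ?thesis by (rule_tac S.F_iso_reflect) simp_all
qed

text \<open>The suspension is only essentially surjective, so the source of \<open>u\<close> is some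
  object whose suspension is isomorphic to the cone of \<open>v\<close>, and the isomorphism is
  moved into the cone triangle before rotating back.\<close>

lemma tri_fibre:
  assumes [simp]: "v \<in> Arr T"
  obtains u w where "(u, v, w) \<in> Tri T"
proof -
  obtain k k' where t: "(v, k, k') \<in> Tri T" using TR1_ex[of v] by auto
  note [simp] = tri_simps[OF t]
  obtain E where E [simp]: "E \<in> Obj T" and "isomorphic T (So E) (Cod T k)"
    using S.ess_surj[of "Cod T k"] by auto
  then obtain s where s [simp]: "is_iso T s" "Dom T s = So E" "Cod T s = Cod T k"
    by (elim isomorphicE)
  obtain l where l [simp]: "l \<in> Arr T" "Dom T l = E" "Cod T l = Dom T v" and Sl: "Sm l = k' \<cdot> s"
    using S.full[of E "Dom T v" "k' \<cdot> s"] by auto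
  have "(v, Inv s \<cdot> k, Neg T (Sm (Neg T l))) \<in> Tri T"
    by (rule tri_isoI[OF t, of "Id T (Dom T v)" "Id T (Cod T v)" "Inv s"]) (auto simp: Sl)
  hence "(Neg T l, v, Inv s \<cdot> k) \<in> Tri T" by (rule TR2_back) auto
  thus thesis by (rule that)
qed

text \<open>The target of the comparison is the triangle 0 -> A = A, an identity triangle rotated
  back. The hypothesis on \<open>f\<close> makes zero and \<open>f\<close> a morphism to it, and the
  third component is \<open>g\<close>.\<close>

lemma tri_coexact_Y:
  assumes t: "(u, v, w) \<in> Tri T" and f [simp]: "f \<in> Arr T" "Dom T f = Cod T u"
    and fu: "f \<cdot> u = Zero T (Dom T u) (Cod T f)"
  obtains g where "g \<in> Arr T" "Dom T g = Cod T v" "Cod T g = Cod T f" "g \<cdot> v = f"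
proof -
  note [simp] = tri_simps[OF t]
  obtain Z where Z: "is_zero T Z" using ex_zero by blast
  note [simp] = is_zero_obj[OF Z]
  have SZ: "is_zero T (So Z)" using Z by simp
  let ?A = "Cod T f"
  have "(Zero T Z ?A, Id T ?A, Zero T ?A (So Z)) \<in> Tri T"
  proof (rule TR2_back)
    have eq: "Zero T (So Z) (So ?A) = Neg T (Sm (Zero T Z ?A))" by simp
    show "(Id T ?A, Zero T ?A (So Z), Neg T (Sm (Zero T Z ?A))) \<in> Tri T"
      using TR1_id[OF _ SZ, of ?A] unfolding eq[symmetric] by simp
  qed auto
  from tri_morphism[OF t this, of "Zero T (Dom T u) Z" f] fu that show thesis by auto
qed

lemma tri_coexact_Z:
  assumes t: "(u, v, w) \<in> Tri T" and f [simp]: "f \<in> Arr T" "Dom T f = Cod T v"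
    and fu: "f \<cdot> v = Zero T (Cod T u) (Cod T f)"
  obtains g where "g \<in> Arr T" "Dom T g = So (Dom T u)" "Cod T g = Cod T f" "g \<cdot> w = f"
  using tri_coexact_Y[OF TR2_rotate[OF t], of f] fu tri_simps[OF t] by auto

lemma tri_coexact_SX:
  assumes t: "(u, v, w) \<in> Tri T" and f [simp]: "f \<in> Arr T" "Dom T f = So (Dom T u)"
    and fu: "f \<cdot> w = Zero T (Cod T v) (Cod T f)"
  obtains g where "g \<in> Arr T" "Dom T g = So (Cod T u)" "Cod T g = Cod T f" "g \<cdot> Sm u = f"
proof -
  note [simp] = tri_simps[OF t]
  obtain g where g: "g \<in> Arr T" "Dom T g = So (Cod T u)" "Cod T g = Cod T f" "g \<cdot> Neg T (Sm u) = f"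
    using tri_coexact_Y[OF TR2_rotate[OF TR2_rotate[OF t]], of f] fu by auto
  thus thesis by (intro that[of "Neg T g"]) auto
qed

text \<open>Morphisms out of the zero object vanish, which yields a left inverse of \<open>w\<close>
  by exactness; morphisms into its suspension vanish, which yields a right inverse.\<close>

lemma tri_zero_iso:
  assumes t: "(u, v, w) \<in> Tri T" and z: "is_zero T (Cod T u)"
  shows "is_iso T w"
proof -
  note [simp] = tri_simps[OF t] is_zero_obj[OF z]
  have "Id T (Cod T v) \<cdot> v = Zero T (Cod T u) (Cod T v)" using from_zero[OF z, of v "Cod T v"] by simp
  then obtain g where g [simp]: "g \<in> Arr T" "Dom T g = So (Dom T u)" "Cod T g = Cod T v" and
    gw: "g \<cdot> w = Id T (Cod T v)" using tri_coexact_Z[OF t, of "Id T (Cod T v)"] by auto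
  have "Sm u = Zero T (So (Dom T u)) (So (Cod T u))"
    by (intro to_zero[OF S.F_is_zero[OF z]]) auto
  then obtain h where h [simp]: "h \<in> Arr T" "Dom T h = So (Dom T u)" "Cod T h = Cod T v" and
    wh: "w \<cdot> h = Id T (So (Dom T u))" using tri_exact_SX[OF t, of "Id T (So (Dom T u))"] by auto
  have "g = h" using comp_reduce[OF gw, of h] wh by simp
  thus ?thesis using gw wh by (intro is_isoI[of w g]) auto
qed

text \<open>The sequence is exact by the matrix relations, and \<open>v' \<cdot> j\<close> maps its
  end to a cone of \<open>i\<close>.\<close>

lemma tri_split:
  assumes b: "is_biproduct T Y X D i j p q"
  shows "(i, q, Zero T X (So Y)) \<in> Tri T"
proof -
  note [simp] = biproduct_simps[OF b]
  obtain v' w' where t: "(i, v', w') \<in> Tri T" using TR1_ex[of i] by auto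
  note [simp] = tri_simps[OF t]
  have "exact_candidate i q (Zero T X (So Y))"
    unfolding exact_candidate_def
  proof (intro conjI allI impI)
    fix f assume f: "f \<in> Arr T" "Cod T f = Cod T q"
    thus "\<exists>g. g \<in> Arr T \<and> Dom T g = Dom T f \<and> Cod T g = Cod T i \<and> q \<cdot> g = f"
      by (intro exI[of _ "j \<cdot> f"]) auto
  next
    fix f assume f: "f \<in> Arr T" "Cod T f = So (Dom T i)" "Sm i \<cdot> f = Zero T (Dom T f) (So (Cod T i))"
    hence "f = Zero T (Dom T f) (So Y)"
      using arg_cong[OF f(3), of "\<lambda>x. Sm p \<cdot> x"]
biproduct_simps(20)[OF S.F_biproduct[OF b], of f] by simp
    thus "\<exists>g. g \<in> Arr T \<and> Dom T g = Dom T f \<and> Cod T g = Cod T q \<and> Zero T X (So Y) \<cdot> g = f"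
      using f by (intro exI[of _ "Zero T (Dom T f) X"]) auto
  qed auto
  moreover have "(v' \<cdot> j) \<cdot> q = v'"
    using tri_comp(1)[OF t]
    by (rule_tac biproduct_eq_out[OF b]) auto
  ultimately show ?thesis
    using tri_comp(2)[OF t] comp_reduce[OF tri_comp(2)[OF t], of j]
    by (intro exact_candidate_tri[OF _ t, of _ _ "v' \<cdot> j"]) auto
qed

text \<open>TR3 maps each summand to a completion of the sum of \<open>u\<close> and
  \<open>u'\<close>. Together these maps compare the direct sum, which is exact componentwise, with
  that completion.\<close>

lemma tri_sum:
  assumes t: "(u, v, w) \<in> Tri T" and t': "(u', v', w') \<in> Tri T"
    and bX: "is_biproduct T (Dom T u) (Dom T u') X iX jX pX qX"
    and bY: "is_biproduct T (Cod T u) (Cod T u') Y iY jY pY qY"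
    and bZ: "is_biproduct T (Cod T v) (Cod T v') Z iZ jZ pZ qZ"
  shows "(iY \<cdot> (u \<cdot> pX) \<oplus> jY \<cdot> (u' \<cdot> qX), iZ \<cdot> (v \<cdot> pY) \<oplus> jZ \<cdot> (v' \<cdot> qY),
     Sm iX \<cdot> (w \<cdot> pZ) \<oplus> Sm jX \<cdot> (w' \<cdot> qZ)) \<in> Tri T" (is "(?u, ?v, ?w) \<in> _")
proof -
  note [simp] = tri_simps[OF t] tri_simps[OF t'] biproduct_simps[OF bX] biproduct_simps[OF bY]
    biproduct_simps[OF bZ] biproduct_simps[OF S.F_biproduct[OF bX]]
    biproduct_simps[OF S.F_biproduct[OF bY]]
  obtain vv ww where T: "(?u, vv, ww) \<in> Tri T" using TR1_ex[of ?u] by auto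
  note TT = tri_simps[OF T]
  have [simp]: "vv \<in> Arr T" "ww \<in> Arr T" "Dom T vv = Y" "Dom T ww = Cod T vv" "Cod T ww = So X"
    using TT by simp_all
  obtain c where c [simp]: "c \<in> Arr T" "Dom T c = Cod T v" "Cod T c = Cod T vv" and
    cv: "c \<cdot> v = vv \<cdot> iY" "Sm iX \<cdot> w = ww \<cdot> c"
    using tri_morphism[OF t T, of iX iY] by auto
  obtain c' where c' [simp]: "c' \<in> Arr T" "Dom T c' = Cod T v'" "Cod T c' = Cod T vv" and
    cv': "c' \<cdot> v' = vv \<cdot> jY" "Sm jX \<cdot> w' = ww \<cdot> c'"
    using tri_morphism[OF t' T, of jX jY] by auto
  have "exact_candidate ?u ?v ?w"
    unfolding exact_candidate_def
  proof (intro conjI allI impI)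
    show "?v \<cdot> ?u = Zero T (Dom T ?u) (Cod T ?v)"
      using comp_reduce[OF tri_comp(1)[OF t], of pX] comp_reduce[OF tri_comp(1)[OF t'], of qX]
      by simp
  next
    fix f assume f [simp]: "f \<in> Arr T" "Cod T f = Cod T ?v" and
      wf: "?w \<cdot> f = Zero T (Dom T f) (So (Dom T ?u))"
    have "w \<cdot> (pZ \<cdot> f) = Sm pX \<cdot> (?w \<cdot> f)" "w' \<cdot> (qZ \<cdot> f) = Sm qX \<cdot> (?w \<cdot> f)"
      using f by auto
    hence "w \<cdot> (pZ \<cdot> f) = Zero T (Dom T (pZ \<cdot> f)) (So (Dom T u))"
      "w' \<cdot> (qZ \<cdot> f) = Zero T (Dom T (qZ \<cdot> f)) (So (Dom T u'))" unfolding wf using f by auto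
    moreover have "pZ \<cdot> f \<in> Arr T" "Cod T (pZ \<cdot> f) = Cod T v" "qZ \<cdot> f \<in> Arr T" "Cod T (qZ \<cdot> f) = Cod T v'"
      using f by auto
    ultimately obtain g g' where g: "g \<in> Arr T" "Dom T g = Dom T (pZ \<cdot> f)" "Cod T g = Cod T u"
      "v \<cdot> g = pZ \<cdot> f" "g' \<in> Arr T" "Dom T g' = Dom T (qZ \<cdot> f)" "Cod T g' = Cod T u'" "v' \<cdot> g' = qZ \<cdot> f"
      using tri_exact_Z[OF t, of "pZ \<cdot> f"] tri_exact_Z[OF t', of "qZ \<cdot> f"] by metis
    thus "\<exists>g. g \<in> Arr T \<and> Dom T g = Dom T f \<and> Cod T g = Cod T ?u \<and> ?v \<cdot> g = f"
      using f biproduct_sum(2)[OF bZ, of f]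
      by (intro exI[of _ "iY \<cdot> g \<oplus> jY \<cdot> g'"]) auto
  next
    fix f assume f [simp]: "f \<in> Arr T" "Cod T f = So (Dom T ?u)" and
      wf: "Sm ?u \<cdot> f = Zero T (Dom T f) (So (Cod T ?u))"
    have "Sm u \<cdot> (Sm pX \<cdot> f) = Sm pY \<cdot> (Sm ?u \<cdot> f)" "Sm u' \<cdot> (Sm qX \<cdot> f) = Sm qY \<cdot> (Sm ?u \<cdot> f)"
      using f by auto
    hence "Sm u \<cdot> (Sm pX \<cdot> f) = Zero T (Dom T (Sm pX \<cdot> f)) (So (Cod T u))"
      "Sm u' \<cdot> (Sm qX \<cdot> f) = Zero T (Dom T (Sm qX \<cdot> f)) (So (Cod T u'))" unfolding wf using f by auto
    moreover have "Sm pX \<cdot> f \<in> Arr T" "Cod T (Sm pX \<cdot> f) = So (Dom T u)" "Sm qX \<cdot> f \<in> Arr T"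
      "Cod T (Sm qX \<cdot> f) = So (Dom T u')"
      using f by auto
    ultimately obtain g g' where g: "g \<in> Arr T" "Dom T g = Dom T (Sm pX \<cdot> f)" "Cod T g = Cod T v"
      "w \<cdot> g = Sm pX \<cdot> f" "g' \<in> Arr T" "Dom T g' = Dom T (Sm qX \<cdot> f)" "Cod T g' = Cod T v'"
      "w' \<cdot> g' = Sm qX \<cdot> f"
      using tri_exact_SX[OF t, of "Sm pX \<cdot> f"] tri_exact_SX[OF t', of "Sm qX \<cdot> f"] by metis
    thus "\<exists>g. g \<in> Arr T \<and> Dom T g = Dom T f \<and> Cod T g = Cod T ?v \<and> ?w \<cdot> g = f"
      using f biproduct_sum(2)[OF S.F_biproduct[OF bX], of f]
      by (intro exI[of _ "iZ \<cdot> g \<oplus> jZ \<cdot> g'"]) auto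
  qed auto
  thus ?thesis
  proof (rule exact_candidate_tri[OF _ T, of _ _ "c \<cdot> pZ \<oplus> c' \<cdot> qZ"])
    show "(c \<cdot> pZ \<oplus> c' \<cdot> qZ) \<cdot> ?v = vv"
      using comp_reduce[OF cv(1), of pY] comp_reduce[OF cv'(1), of qY] biproduct_sum(3)[OF bY, of vv]
      by simp
    show "ww \<cdot> (c \<cdot> pZ \<oplus> c' \<cdot> qZ) = ?w"
      using comp_reduce[OF cv(2)[symmetric], of pZ] comp_reduce[OF cv'(2)[symmetric], of qZ] by simp
  qed auto
qed

definition octahedron :: "'m \<Rightarrow> 'm \<Rightarrow> 'm \<Rightarrow> 'm \<Rightarrow> 'm \<Rightarrow> 'm \<Rightarrow> 'm \<Rightarrow> 'm \<Rightarrow> 'm \<Rightarrow> 'm \<Rightarrow> bool" where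
  "octahedron u i i' v j j' k k' f g \<longleftrightarrow>
     f \<in> Hom T (Cod T i) (Cod T k) \<and> g \<in> Hom T (Cod T k) (Cod T j) \<and>
     (f, g, Sm i \<cdot> j') \<in> Tri T \<and> f \<cdot> i = k \<cdot> v \<and> k' \<cdot> f = i' \<and> g \<cdot> k = j \<and> j' \<cdot> g = Sm u \<cdot> k'"

text \<open>It suffices to verify the octahedral axiom for one representative of each isomorphism class
  of composable pairs and one choice of the three triangles.\<close>

lemma octahedron_transport:
  assumes t: "(u, i, i') \<in> Tri T" "(v, j, j') \<in> Tri T" "Cod T u = Dom T v" "(v \<cdot> u, k, k') \<in> Tri T"
    and t0: "(u0, i0, i0') \<in> Tri T" "(v0, j0, j0') \<in> Tri T" "Cod T u0 = Dom T v0"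
      "(v0 \<cdot> u0, k0, k0') \<in> Tri T"
    and o0: "octahedron u0 i0 i0' v0 j0 j0' k0 k0' f0 g0"
    and a: "is_iso T a" "Dom T a = Dom T u" "Cod T a = Dom T u0"
    and c: "is_iso T c" "Dom T c = Dom T v" "Cod T c = Dom T v0"
    and d: "is_iso T d" "Dom T d = Cod T v" "Cod T d = Cod T v0"
    and eq: "c \<cdot> u = u0 \<cdot> a" "d \<cdot> v = v0 \<cdot> c"
  shows "\<exists>f g. octahedron u i i' v j j' k k' f g"
proof -
  note T = tri_simps[OF t(1)] tri_simps[OF t(2)] tri_simps[OF t0(1)] tri_simps[OF t0(2)]
  note [simp] = T t(3) t0(3) a c d
  have K [simp]: "k \<in> Arr T" "k' \<in> Arr T" "Dom T k = Cod T v" "Dom T k' = Cod T k"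
      "Cod T k' = So (Dom T u)" "k0 \<in> Arr T" "k0' \<in> Arr T" "Dom T k0 = Cod T v0"
      "Dom T k0' = Cod T k0" "Cod T k0' = So (Dom T u0)"
    using tri_simps[OF t(4)] tri_simps[OF t0(4)] by auto
  have O [simp]: "f0 \<in> Arr T" "Dom T f0 = Cod T i0" "Cod T f0 = Cod T k0"
      "g0 \<in> Arr T" "Dom T g0 = Cod T k0" "Cod T g0 = Cod T j0" and
    of: "(f0, g0, Sm i0 \<cdot> j0') \<in> Tri T" "f0 \<cdot> i0 = k0 \<cdot> v0" "k0' \<cdot> f0 = i0'" "g0 \<cdot> k0 = j0"
      "j0' \<cdot> g0 = Sm u0 \<cdot> k0'"
    using o0 unfolding octahedron_def by auto
  obtain x where x [simp]: "x \<in> Arr T" "Dom T x = Cod T i" "Cod T x = Cod T i0" and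
    xe: "x \<cdot> i = i0 \<cdot> c" "Sm a \<cdot> i' = i0' \<cdot> x"
    using tri_morphism[OF t(1) t0(1), of a c] eq by auto
  have xi [simp]: "is_iso T x"
    by (rule five_lemma[OF tri_exact_candidate[OF t(1)] t0(1), of a c]) (use eq xe in auto)
  obtain y where y [simp]: "y \<in> Arr T" "Dom T y = Cod T j" "Cod T y = Cod T j0" and
    ye: "y \<cdot> j = j0 \<cdot> d" "Sm c \<cdot> j' = j0' \<cdot> y"
    using tri_morphism[OF t(2) t0(2), of c d] eq by auto
  have yi [simp]: "is_iso T y"
    by (rule five_lemma[OF tri_exact_candidate[OF t(2)] t0(2), of c d]) (use eq ye in auto)
  have e2: "d \<cdot> (v \<cdot> u) = v0 \<cdot> (u0 \<cdot> a)"
    using comp_reduce[OF eq(2), of u] eq(1) by simp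
  obtain z where z [simp]: "z \<in> Arr T" "Dom T z = Cod T k" "Cod T z = Cod T k0" and
    ze: "z \<cdot> k = k0 \<cdot> d" "Sm a \<cdot> k' = k0' \<cdot> z"
    using tri_morphism[OF t(4) t0(4), of a d] e2 by auto
  have zi [simp]: "is_iso T z"
    by (rule five_lemma[OF tri_exact_candidate[OF t(4)] t0(4), of a d]) (use e2 ze in auto)
  let ?f = "Inv z \<cdot> (f0 \<cdot> x)" and ?g = "Inv y \<cdot> (g0 \<cdot> z)"
  have "octahedron u i i' v j j' k k' ?f ?g" unfolding octahedron_def
  proof (intro conjI)
    have e: "Sm i0 \<cdot> (j0' \<cdot> y) = Sm x \<cdot> (Sm i \<cdot> j')"
      using comp_reduce[OF arg_cong[OF xe(1), of Sm, simplified], of j'] ye(2) by simp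
    have "Sm i0 \<cdot> j0' = (Sm i0 \<cdot> (j0' \<cdot> y)) \<cdot> Inv y" by simp
    also have "\<dots> = Sm x \<cdot> (Sm i \<cdot> (j' \<cdot> Inv y))" unfolding e by simp
    finally have "Sm (Inv x) \<cdot> (Sm i0 \<cdot> j0') = Sm (Inv x) \<cdot> (Sm x \<cdot> (Sm i \<cdot> (j' \<cdot> Inv y)))" by simp
    also have "\<dots> = Sm i \<cdot> (j' \<cdot> Inv y)"
      by simp
    finally have ij: "Sm (Inv x) \<cdot> (Sm i0 \<cdot> j0') = Sm i \<cdot> (j' \<cdot> Inv y)" .
    show "(?f, ?g, Sm i \<cdot> j') \<in> Tri T"
      by (intro tri_isoI[OF of(1), of "Inv x" "Inv z" "Inv y"])
        (auto simp: ij[simplified])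
    have "z \<cdot> (?f \<cdot> i) = f0 \<cdot> (i0 \<cdot> c)" using xe by simp
    also have "\<dots> = z \<cdot> (k \<cdot> v)"
      using comp_reduce[OF of(2), of c] eq(2) comp_reduce[OF ze(1), of v] by simp
    finally show "?f \<cdot> i = k \<cdot> v" by (rule_tac iso_left_cancel[of z]) auto
    have "Sm a \<cdot> (k' \<cdot> ?f) = Sm a \<cdot> i'"
      using comp_reduce[OF ze(2), of ?f] comp_reduce[OF of(3), of x] xe(2) by simp
    thus "k' \<cdot> ?f = i'" by (rule_tac iso_left_cancel[of "Sm a"]) auto
    show "?g \<cdot> k = j"
      using ze(1) comp_reduce[OF of(4), of d] 
      by (simp add: ye(1)[symmetric])
    have "Sm c \<cdot> (j' \<cdot> ?g) = Sm c \<cdot> (Sm u \<cdot> k')"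
      using comp_reduce[OF ye(2), of ?g] comp_reduce[OF of(5), of z] ze(2)
        comp_reduce[OF arg_cong[OF eq(1), of Sm, simplified], of k'] by simp
    thus "j' \<cdot> ?g = Sm u \<cdot> k'" by (rule_tac iso_left_cancel[of "Sm c"]) auto
  qed auto
  thus ?thesis by blast
qed

lemma triangulatedI:
  assumes "\<And>u i i' v j j' k k'. \<lbrakk>(u, i, i') \<in> Tri T; (v, j, j') \<in> Tri T; Cod T u = Dom T v;
      (v \<cdot> u, k, k') \<in> Tri T\<rbrakk> \<Longrightarrow> \<exists>f g. octahedron u i i' v j j' k k' f g"
  shows "triangulated_category T"
proof
  fix u v w assume "candidate_triangle T (Sh T) (u, v, w)"
  hence "u \<in> Arr T" "Dom T v = Cod T u" "Cod T w = So (Dom T u)"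
    unfolding candidate_triangle_def by auto
  from TR2_back[OF _ this] show "((u, v, w) \<in> Tri T) = ((v, w, Neg T (Sm u)) \<in> Tri T)"
    using TR2_rotate by blast
next
  fix u i i' v j j' k k'
  assume "(u, i, i') \<in> Tri T" "(v, j, j') \<in> Tri T" "Cod T u = Dom T v" "(v \<cdot> u, k, k') \<in> Tri T"
  from assms[OF this] show "\<exists>f g. f \<in> Hom T (Cod T i) (Cod T k) \<and> g \<in> Hom T (Cod T k) (Cod T j) \<and>
     (f, g, Sm i \<cdot> j') \<in> Tri T \<and> f \<cdot> i = k \<cdot> v \<and> k' \<cdot> f = i' \<and> g \<cdot> k = j \<and> j' \<cdot> g = Sm u \<cdot> k'"
    unfolding octahedron_def .
qed (rule shift_equivalence tri_candidate TR1_id TR1_iso TR1_ex TR3; assumption)+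

end

section \<open>Consequences of the octahedral axiom\<close>

sublocale triangulated_category \<subseteq> pretriangulated_category
proof
  fix u v w assume t: "(u, v, w) \<in> Tri T"
  thus "(v, w, Neg T (fmor (Sh T) u)) \<in> Tri T" using TR2 tri_candidate by blast
qed (rule shift_equivalence tri_candidate TR1_id TR1_iso TR1_ex TR3; assumption)+

context triangulated_category
begin

lemma octahedral:
  assumes "(u, i, i') \<in> Tri T" "(v, j, j') \<in> Tri T" "Cod T u = Dom T v" "(v \<cdot> u, k, k') \<in> Tri T"
  obtains f g where "f \<in> Arr T" "Dom T f = Cod T i" "Cod T f = Cod T k" "g \<in> Arr T"
    "Dom T g = Cod T k" "Cod T g = Cod T j" "(f, g, Sm i \<cdot> j') \<in> Tri T" "f \<cdot> i = k \<cdot> v"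
    "k' \<cdot> f = i'" "g \<cdot> k = j" "j' \<cdot> g = Sm u \<cdot> k'"
  using TR4[OF assms] by auto

text \<open>Rotated once, the two triangles begin with \<open>f\<close> and \<open>g\<close>, so the
  octahedral axiom applies and yields a triangle on suspensions. Its third morphism carries the sign
  of the rotation, which is the sign that desuspending a triangle consumes.\<close>

lemma octahedral_op:
  assumes t: "(f', f, w) \<in> Tri T" and t': "(g', g, w') \<in> Tri T" and fg [simp]: "Cod T f = Dom T g"
  obtains h' d e w'' where "(h', g \<cdot> f, w'') \<in> Tri T" "d \<in> Arr T" "Dom T d = Dom T f'"
    "Cod T d = Dom T h'" "e \<in> Arr T" "Dom T e = Dom T h'" "Cod T e = Dom T g'" "h' \<cdot> d = f'"
    "f \<cdot> h' = g' \<cdot> e" "(d, e, w \<cdot> g') \<in> Tri T" "Sm e \<cdot> w'' = w'" "Sm d \<cdot> w = w'' \<cdot> g"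
proof -
  have [simp]: "f' \<in> Arr T" "f \<in> Arr T" "w \<in> Arr T" "Dom T f = Cod T f'" "Dom T w = Dom T g"
    "Cod T w = So (Dom T f')" "g' \<in> Arr T" "g \<in> Arr T" "w' \<in> Arr T" "Cod T g' = Dom T g"
    "Dom T w' = Cod T g" "Cod T w' = So (Dom T g')"
    using tri_simps[OF t] tri_simps[OF t'] by auto
  obtain h' w'' where h: "(h', g \<cdot> f, w'') \<in> Tri T" using tri_fibre[of "g \<cdot> f"] by auto
  have [simp]: "h' \<in> Arr T" "Cod T h' = Cod T f'" "w'' \<in> Arr T" "Dom T w'' = Cod T g"
    "Cod T w'' = So (Dom T h')" using tri_simps[OF h] by auto
  obtain F G where F: "F \<in> Arr T" "Dom T F = So (Dom T f')" "Cod T F = So (Dom T h')" "G \<in> Arr T"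
    "Dom T G = So (Dom T h')" "Cod T G = So (Dom T g')" and
    FG: "(F, G, Sm w \<cdot> Neg T (Sm g')) \<in> Tri T" "F \<cdot> w = w'' \<cdot> g" "Neg T (Sm h') \<cdot> F = Neg T (Sm f')"
    "G \<cdot> w'' = w'" "Neg T (Sm g') \<cdot> G = Sm f \<cdot> Neg T (Sm h')"
    using octahedral[OF TR2_rotate[OF t] TR2_rotate[OF t'] _ TR2_rotate[OF h]] by auto
  obtain d where d [simp]: "d \<in> Arr T" "Dom T d = Dom T f'" "Cod T d = Dom T h'" and Sd: "Sm d = F"
    using S.full[of "Dom T f'" "Dom T h'" F] F by auto
  obtain e where e [simp]: "e \<in> Arr T" "Dom T e = Dom T h'" "Cod T e = Dom T g'" and Se: "Sm e = G"
    using S.full[of "Dom T h'" "Dom T g'" G] F by auto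
  have "Neg T (Sm (h' \<cdot> d)) = Neg T (Sm f')" "Neg T (Sm (g' \<cdot> e)) = Neg T (Sm (f \<cdot> h'))"
    using FG F Sd Se by auto
  hence "Sm (h' \<cdot> d) = Sm f'" "Sm (f \<cdot> h') = Sm (g' \<cdot> e)"
    by (auto simp del: S.F_comp)
  hence "h' \<cdot> d = f'" "f \<cdot> h' = g' \<cdot> e" by (rule_tac S.faithful; simp del: S.F_comp)+
  moreover have "(d, e, w \<cdot> g') \<in> Tri T"
    by (rule tri_unshift) (use FG(1) Sd Se in auto)
  ultimately show thesis using that[OF h, of d e] FG Sd Se by auto
qed

end

section \<open>Relative extriangulated structures\<close>

lemma addcat_extend_sel [simp]:
  "Obj (addcat.extend R F) = Obj R" "Arr (addcat.extend R F) = Arr R"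
  "Dom (addcat.extend R F) = Dom R" "Cod (addcat.extend R F) = Cod R"
  "Id (addcat.extend R F) = Id R" "Comp (addcat.extend R F) = Comp R"
  "Add (addcat.extend R F) = Add R" "Zero (addcat.extend R F) = Zero R"
  by (simp_all add: addcat.extend_def)

lemma addcat_extend_hom: "Hom (addcat.extend R F) = Hom R"
  by (rule ext, rule ext) (simp add: Hom_def)

lemma addcat_extend_defs [simp]:
  "HomGrp (addcat.extend R F) = HomGrp R" "Neg (addcat.extend R F) = Neg R"
  "is_iso (addcat.extend R F) = is_iso R" "is_zero (addcat.extend R F) = is_zero R"
  "is_biproduct (addcat.extend R F) = is_biproduct R" "isomorphic (addcat.extend R F) = isomorphic R"
proof -
  show H: "HomGrp (addcat.extend R F) = HomGrp R"
    by (rule ext, rule ext) (simp add: HomGrp_def addcat_extend_hom)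
  show I: "is_iso (addcat.extend R F) = is_iso R"
    unfolding is_iso_def addcat_extend_hom by (rule ext) simp
  show "Neg (addcat.extend R F) = Neg R" by (rule ext) (simp add: Neg_def H)
  show "is_zero (addcat.extend R F) = is_zero R"     unfolding is_zero_def addcat_extend_hom by (rule ext) simp
  show "is_biproduct (addcat.extend R F) = is_biproduct R"
    unfolding is_biproduct_def addcat_extend_hom by (intro ext) simp
  show "isomorphic (addcat.extend R F) = isomorphic R"
    unfolding isomorphic_def addcat_extend_hom I by (rule ext) simp
qed

lemma additive_category_extend:
  assumes "additive_category R"
  shows "additive_category (addcat.extend R F)"
proof -
  interpret additive_category R by (rule assms)
  show ?thesis
    by (rule additive_category.intro; (unfold addcat_extend_hom addcat_extend_defs addcat_extend_sel))
      (rule arr_obj id_hom comp_hom id_left id_right comp_assoc hom_group comp_add_left comp_add_right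
        ex_zero ex_biproduct; assumption)+
qed

context triangulated_category
begin

text \<open>Realizes an extension. In a triangle that has \<open>w\<close> in the middle, the last
  morphism starts at \<Sigma>Y; it is desuspended so that the new first morphism starts at the
  prescribed \<open>Y\<close> itself.\<close>

lemma tri_ex_third:
  assumes [simp]: "w \<in> Arr T" "Cod T w = So Y" "Y \<in> Obj T"
  obtains u v where "(u, v, w) \<in> Tri T" "Dom T u = Y"
proof -
  obtain v k where t: "(v, w, k) \<in> Tri T" using tri_fibre[of w] by auto
  note [simp] = tri_simps[OF t] 
  have k: "Dom T k = So Y" using tri_simps(5)[OF t] by simp
  obtain l where l [simp]: "l \<in> Arr T" "Dom T l = Y" "Cod T l = Dom T v" and Sl: "Sm l = k"
    using S.full[of Y "Dom T v" k] k by auto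
  have "(Neg T l, v, w) \<in> Tri T" by (rule TR2_back) (use t Sl in auto)
  thus thesis by (rule that) simp
qed

end

text \<open>The extensions are the morphisms X -> \<Sigma>Y that vanish on all morphisms from
  \<open>N\<close>. Both structures have this form: for pr the test objects \<open>N\<close> are
  those of M, for complexes there are none. Stability under sums and under the bifunctor is then
  immediate, and (ET4) reduces to exactness of triangles. That \<open>S\<close> is closed under such
  extensions has to be shown separately in each case.\<close>

locale relative_structure = triangulated_category T
  for T :: "('o, 'm, 'z) tricat_scheme" (structure) +
  fixes S N :: "'o set" and G :: "'o \<Rightarrow> 'o \<Rightarrow> 'm set"
  assumes S_sub: "additive_subcategory T S"
    and N_sub: "N \<subseteq> Obj T"
    and G_eq: "X \<in> S \<Longrightarrow> Y \<in> S \<Longrightarrow>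
      G X Y = {w \<in> Hom T X (fobj (Sh T) Y). \<forall>A \<in> N. \<forall>a \<in> Hom T A X. w \<cdot> a = Zero T A (fobj (Sh T) Y)}"
    and S_extension: "\<lbrakk>(u, v, w) \<in> Tri T; Dom T u \<in> S; Cod T v \<in> S; w \<in> G (Cod T v) (Dom T u)\<rbrakk> \<Longrightarrow>
      Cod T u \<in> S"
begin

lemma S_obj [simp]: "X \<in> S \<Longrightarrow> X \<in> Obj T"
  by (rule additive_subcategory_obj[OF S_sub])

lemma G_iff: "X \<in> S \<Longrightarrow> Y \<in> S \<Longrightarrow> w \<in> G X Y \<longleftrightarrow> w \<in> Arr T \<and> Dom T w = X \<and> Cod T w = So Y \<and>
    (\<forall>a. a \<in> Arr T \<longrightarrow> Dom T a \<in> N \<longrightarrow> Cod T a = X \<longrightarrow> w \<cdot> a = Zero T (Dom T a) (So Y))"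
  by (auto simp: G_eq)

lemma GD:
  assumes "w \<in> G X Y" "X \<in> S" "Y \<in> S"
  shows "w \<in> Arr T" "Dom T w = X" "Cod T w = So Y"
    "\<And>a. a \<in> Arr T \<Longrightarrow> Dom T a \<in> N \<Longrightarrow> Cod T a = X \<Longrightarrow> w \<cdot> a = Zero T (Dom T a) (So Y)"
  using assms G_iff by auto

lemma G_act:
  assumes "w \<in> G X Y" "X \<in> S" "Y \<in> S" "f \<in> Arr T" "Cod T f = X" "Dom T f \<in> S"
    "g \<in> Arr T" "Dom T g = Y" "Cod T g \<in> S"
  shows "Sm g \<cdot> (w \<cdot> f) \<in> G (Dom T f) (Cod T g)"
  using assms GD[OF assms(1-3)] by (auto simp: G_iff)

lemma G_add:
  assumes "w \<in> G X Y" "w' \<in> G X Y" "X \<in> S" "Y \<in> S"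
  shows "w \<oplus> w' \<in> G X Y"
  using assms(3,4) GD[OF assms(1,3,4)] GD[OF assms(2,3,4)] by (auto simp: G_iff)

abbreviation "R \<equiv> relative_extricat T S G"

lemma R_sel [simp]:
  "Obj R = S" "Dom R = Dom T" "Cod R = Cod T" "Id R = Id T" "Comp R = Comp T" "Add R = Add T"
  "Zero R = Zero T" "f \<in> Arr R \<longleftrightarrow> f \<in> Arr T \<and> Dom T f \<in> S \<and> Cod T f \<in> S"
  "Ext R X Y = \<lparr>carrier = G X Y, mult = Add T, one = Zero T X (So Y)\<rparr>"
  "Act R f g w = Sm g \<cdot> w \<cdot> f"
  by (simp_all add: relative_extricat_def addcat.defs extricat.defs)

lemma R_iso [simp]: "is_iso R f \<longleftrightarrow> is_iso T f \<and> Dom T f \<in> S \<and> Cod T f \<in> S"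
  unfolding relative_extricat_def by (simp add: full_subcat_iso)

lemma R_biproduct [simp]:
  "is_biproduct R A B D i j p q \<longleftrightarrow> is_biproduct T A B D i j p q \<and> A \<in> S \<and> B \<in> S \<and> D \<in> S"
  unfolding relative_extricat_def by (simp add: full_subcat_biproduct)

lemma R_real: "(u, v, w) \<in> Real R \<longleftrightarrow>
    (u, v, w) \<in> Tri T \<and> Dom T u \<in> S \<and> Cod T u \<in> S \<and> Cod T v \<in> S \<and> w \<in> G (Cod T v) (Dom T u)"
  by (simp add: relative_extricat_def addcat.defs extricat.defs)

lemma R_realD:
  assumes "(u, v, w) \<in> Real R"
  shows "(u, v, w) \<in> Tri T" "Dom T u \<in> S" "Cod T u \<in> S" "Cod T v \<in> S" "w \<in> G (Cod T v) (Dom T u)"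
    "u \<in> Arr T" "v \<in> Arr T" "w \<in> Arr T" "Dom T v = Cod T u" "Dom T w = Cod T v" "Cod T w = So (Dom T u)"
proof -
  show *: "(u, v, w) \<in> Tri T" "Dom T u \<in> S" "Cod T u \<in> S" "Cod T v \<in> S" "w \<in> G (Cod T v) (Dom T u)"
    using assms unfolding R_real by auto
  show "u \<in> Arr T" "v \<in> Arr T" "w \<in> Arr T" "Dom T v = Cod T u" "Dom T w = Cod T v" "Cod T w = So (Dom T u)"
    using tri_simps[OF *(1)] by auto
qed

lemma R_additive: "additive_category R"
  unfolding relative_extricat_def
  by (rule additive_category_extend) (rule full_subcat_additive[OF S_sub])

lemma R_group:
  assumes [simp]: "X \<in> S" "Y \<in> S"
  shows "comm_group \<lparr>carrier = G X Y, mult = Add T, one = Zero T X (So Y)\<rparr>"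
proof (rule comm_groupI; simp)
  fix w w' w'' assume w: "w \<in> G X Y" and w': "w' \<in> G X Y"
  note [simp] = GD[OF w assms] GD[OF w' assms]
  show "w \<oplus> w' \<in> G X Y" by (rule G_add[OF w w' assms])
  show "w \<oplus> w' = w' \<oplus> w" by (rule add_commute) auto
  assume w'': "w'' \<in> G X Y"
  note [simp] = GD[OF w'' assms]
  show "w \<oplus> w' \<oplus> w'' = w \<oplus> (w' \<oplus> w'')" by simp
next
  show "Zero T X (So Y) \<in> G X Y" by (simp add: G_iff)
next
  fix w assume w: "w \<in> G X Y"
  note [simp] = GD[OF w assms]
  show "Zero T X (So Y) \<oplus> w = w" by simp
  show "\<exists>y\<in>G X Y. y \<oplus> w = Zero T X (So Y)"
    by (rule bexI[of _ "Neg T w"]) (auto simp: G_iff)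
qed

lemma R_real_unique:
  assumes r: "(u, v, w) \<in> Real R" and r': "(u', v', w) \<in> Real R"
    and eq: "Dom R u = Dom R u'" "Cod R v = Cod R v'"
  shows "seq_equiv R u v u' v'"
proof -
  note D = R_realD[OF r] and D' = R_realD[OF r']
  note [simp] = D(2-4,6-) D'(3,6,7) D'(9)
  have [simp]: "Dom T u' = Dom T u" "Cod T v' = Cod T v" using eq by simp_all
  obtain b where b [simp]: "b \<in> Arr T" "Dom T b = Cod T u" "Cod T b = Cod T u'" and
    be: "b \<cdot> u = u' \<cdot> Id T (Dom T u)" "Id T (Cod T v) \<cdot> v = v' \<cdot> b"
    by (rule tri_morphism_snd[OF D(1) D'(1), of "Id T (Dom T u)" "Id T (Cod T v)"]) (assumption | simp)+
  have be': "b \<cdot> u = u'" "v' \<cdot> b = v" using be by simp_all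
  have "is_iso T b"
    by (rule five_lemma_snd[OF D(1) D'(1), of "Id T (Dom T u)" b "Id T (Cod T v)"]) (simp_all add: be')
  thus ?thesis unfolding seq_equiv_def using be' by (intro conjI bexI[of _ b]) simp_all
qed

lemma R_real_closed:
  assumes r: "(u, v, w) \<in> Real R" and u': "u' \<in> Arr R" "v' \<in> Arr R" "Cod R u' = Dom R v'"
    and eq: "seq_equiv R u v u' v'"
  shows "(u', v', w) \<in> Real R"
proof -
  note D = R_realD[OF r]
  note [simp] = D(2-4,6-)
  obtain b where "Dom T u' = Dom T u" "Cod T v' = Cod T v" "is_iso T b" "Dom T b = Cod T u"
    "Cod T b = Cod T u'" and be: "b \<cdot> u = u'" "v' \<cdot> b = v"
    using eq unfolding seq_equiv_def Bex_def hom_iff R_sel R_iso by metis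
  note [simp] = this(1-5) be
  have [simp]: "u' \<in> Arr T" "v' \<in> Arr T" "Dom T v' = Cod T u'" "Cod T u' \<in> S" using u' by auto
  have "(u', v', w) \<in> Tri T"
    by (rule tri_isoI[OF D(1), of "Id T (Dom T u)" b "Id T (Cod T v)"]) auto
  thus ?thesis using D(5) by (simp add: R_real)
qed

lemma R_real_sum:
  assumes r: "(u, v, w) \<in> Real R" and r': "(u', v', w') \<in> Real R"
    and b: "is_biproduct R (Dom R u) (Dom R u') Y iY jY pY qY"
      "is_biproduct R (Cod R u) (Cod R u') Z iZ jZ pZ qZ"
      "is_biproduct R (Cod R v) (Cod R v') X iX jX pX qX"
  shows "(iZ \<cdot>\<^bsub>R\<^esub> u \<cdot>\<^bsub>R\<^esub> pY \<oplus>\<^bsub>R\<^esub> jZ \<cdot>\<^bsub>R\<^esub> u' \<cdot>\<^bsub>R\<^esub> qY, iX \<cdot>\<^bsub>R\<^esub> v \<cdot>\<^bsub>R\<^esub> pZ \<oplus>\<^bsub>R\<^esub> jX \<cdot>\<^bsub>R\<^esub> v' \<cdot>\<^bsub>R\<^esub> qZ,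
       Act R pX iY w \<otimes>\<^bsub>Ext R X Y\<^esub> Act R qX jY w') \<in> Real R"
proof -
  note D = R_realD[OF r] and D' = R_realD[OF r']
  have bY: "is_biproduct T (Dom T u) (Dom T u') Y iY jY pY qY" and
    bZ: "is_biproduct T (Cod T u) (Cod T u') Z iZ jZ pZ qZ" and
    bX: "is_biproduct T (Cod T v) (Cod T v') X iX jX pX qX" and [simp]: "X \<in> S" "Y \<in> S" "Z \<in> S"
    using b by auto
  note [simp] = D(2-4,6-) D'(2-4,6-) biproduct_simps[OF bX] biproduct_simps[OF bY] biproduct_simps[OF bZ]
  have "Sm iY \<cdot> (w \<cdot> pX) \<oplus> Sm jY \<cdot> (w' \<cdot> qX) \<in> G X Y"
    using G_act[OF D(5), of pX iY] G_act[OF D'(5), of qX jY] by (intro G_add) auto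
  thus ?thesis using tri_sum[OF D(1) D'(1) bY bZ bX] by (simp add: R_real)
qed

lemma R_ET4:
  assumes r: "(f, f', w) \<in> Real R" and r': "(g, g', w') \<in> Real R" and eq: "Cod R f = Dom R g"
  shows "\<exists>h' d e w''. (g \<cdot>\<^bsub>R\<^esub> f, h', w'') \<in> Real R \<and>
        d \<in> Hom R (Cod R f') (Cod R h') \<and> e \<in> Hom R (Cod R h') (Cod R g') \<and>
        h' \<cdot>\<^bsub>R\<^esub> g = d \<cdot>\<^bsub>R\<^esub> f' \<and> e \<cdot>\<^bsub>R\<^esub> h' = g' \<and>
        (d, e, push R (Cod R g') f' w') \<in> Real R \<and>
        pull R (Dom R f) d w'' = w \<and>
        push R (Cod R h') f w'' = pull R (Dom R g) e w'"
proof -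
  note D = R_realD[OF r] and D' = R_realD[OF r']
  have [simp]: "Cod T f = Dom T g" using eq by simp
  note [simp] = D(2-4,6-) D'(2-4,6-)
  obtain h' w'' where t: "(g \<cdot> f, h', w'') \<in> Tri T" using TR1_ex[of "g \<cdot> f"] by auto
  note tt = tri_simps[OF t]
  have [simp]: "h' \<in> Arr T" "w'' \<in> Arr T" "Dom T h' = Cod T g" "Dom T w'' = Cod T h'"
    "Cod T w'' = So (Dom T f)" using tt by simp_all
  obtain d e where de [simp]: "d \<in> Arr T" "Dom T d = Cod T f'" "Cod T d = Cod T h'" "e \<in> Arr T"
    "Dom T e = Cod T h'" "Cod T e = Cod T g'" and
    o: "(d, e, Sm f' \<cdot> w') \<in> Tri T" "d \<cdot> f' = h' \<cdot> g" "w'' \<cdot> d = w" "e \<cdot> h' = g'" "w' \<cdot> e = Sm f \<cdot> w''"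
    using octahedral[OF D(1) D'(1) _ t] by auto
  have g1: "Sm f' \<cdot> w' \<in> G (Cod T g') (Cod T f')"
    using G_act[OF D'(5), of "Id T (Cod T g')" f'] by simp
  have [simp]: "Cod T h' \<in> S" using S_extension[OF o(1)] g1 by simp
  \<comment> \<open>The octahedron gives the diagram; it remains to see that \<open>w''\<close>
    vanishes on \<open>N\<close>. For \<open>a\<close> from \<open>N\<close>, \<Sigma>f kills
    \<open>w'' \<cdot> a\<close>, because this composite is \<open>w' \<cdot> (e \<cdot> a)\<close>.
    Hence \<open>w'' \<cdot> a\<close> is \<open>w \<cdot> b\<close> for some \<open>b\<close> from
    \<open>N\<close>, and \<open>w\<close> kills \<open>b\<close>.\<close>
  have "w'' \<in> G (Cod T h') (Dom T f)"
  proof (simp add: G_iff, intro allI impI)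
    fix a assume a [simp]: "a \<in> Arr T" "Dom T a \<in> N" "Cod T a = Cod T h'"
    have "Sm f \<cdot> (w'' \<cdot> a) = w' \<cdot> (e \<cdot> a)" using comp_reduce[OF o(5), of a] by simp
    also have "\<dots> = Zero T (Dom T a) (So (Dom T g))" using GD(4)[OF D'(5), of "e \<cdot> a"] by simp
    finally obtain b where [simp]: "b \<in> Arr T" "Dom T b = Dom T a" "Cod T b = Cod T f'" and
      b: "w \<cdot> b = w'' \<cdot> a"
      using tri_exact_SX[OF D(1), of "w'' \<cdot> a"] by auto
    show "w'' \<cdot> a = Zero T (Dom T a) (So (Dom T f))"
      using GD(4)[OF D(5), of b] b by simp
  qed
  thus ?thesis using t o g1
    by (intro exI[of _ h'] exI[of _ d] exI[of _ e] exI[of _ w'']) (simp add: R_real)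
qed

lemma R_ET4_op:
  assumes r: "(f', f, w) \<in> Real R" and r': "(g', g, w') \<in> Real R" and eq: "Cod R f = Dom R g"
  shows "\<exists>h' d e w''. (h', g \<cdot>\<^bsub>R\<^esub> f, w'') \<in> Real R \<and>
        d \<in> Hom R (Dom R f') (Dom R h') \<and> e \<in> Hom R (Dom R h') (Dom R g') \<and>
        h' \<cdot>\<^bsub>R\<^esub> d = f' \<and> f \<cdot>\<^bsub>R\<^esub> h' = g' \<cdot>\<^bsub>R\<^esub> e \<and>
        (d, e, pull R (Dom R f') g' w) \<in> Real R \<and>
        push R (Cod R g) e w'' = w' \<and>
        push R (Cod R f) d w = pull R (Dom R h') g w''"
proof -
  note D = R_realD[OF r] and D' = R_realD[OF r']
  have [simp]: "Cod T f = Dom T g" using eq by simp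
  have [simp]: "f' \<in> Arr T" "f \<in> Arr T" "w \<in> Arr T" "Dom T f = Cod T f'" "Dom T w = Dom T g"
    "Cod T w = So (Dom T f')" "g' \<in> Arr T" "g \<in> Arr T" "w' \<in> Arr T" "Cod T g' = Dom T g"
    "Dom T w' = Cod T g" "Cod T w' = So (Dom T g')" "Dom T f' \<in> S" "Cod T f' \<in> S" "Dom T g \<in> S"
    "Dom T g' \<in> S" "Cod T g \<in> S"
    using D D' by auto
  obtain h' d e w'' where t: "(h', g \<cdot> f, w'') \<in> Tri T" and de: "d \<in> Arr T" "Dom T d = Dom T f'"
    "Cod T d = Dom T h'" "e \<in> Arr T" "Dom T e = Dom T h'" "Cod T e = Dom T g'" and
    o: "h' \<cdot> d = f'" "f \<cdot> h' = g' \<cdot> e" "(d, e, w \<cdot> g') \<in> Tri T" "Sm e \<cdot> w'' = w'" "Sm d \<cdot> w = w'' \<cdot> g"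
    by (rule octahedral_op[OF D(1) D'(1) \<open>Cod T f = Dom T g\<close>])
  note tt = tri_simps[OF t] and [simp] = de
  have [simp]: "h' \<in> Arr T" "w'' \<in> Arr T" "Cod T h' = Cod T f'" "Dom T w'' = Cod T g"
    "Cod T w'' = So (Dom T h')" using tt by simp_all
  have g1: "w \<cdot> g' \<in> G (Dom T g') (Dom T f')"
    using G_act[OF D(5), of g' "Id T (Dom T f')"] by simp
  have [simp]: "Dom T h' \<in> S" using S_extension[OF o(3)] g1 by simp
  \<comment> \<open>Dually, \<open>w'\<close> kills \<open>a\<close>, so \<open>a\<close> lifts
    along \<open>g\<close> to some \<open>b\<close>, and \<open>w'' \<cdot> g\<close> is a composite
    with \<open>w\<close>, which kills \<open>b\<close>.\<close>
  have "w'' \<in> G (Cod T g) (Dom T h')"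
  proof (simp add: G_iff, intro allI impI)
    fix a assume a [simp]: "a \<in> Arr T" "Dom T a \<in> N" "Cod T a = Cod T g"
    have "w' \<cdot> a = Zero T (Dom T a) (So (Dom T g'))" using GD(4)[OF D'(5), of a] by simp
    then obtain b where [simp]: "b \<in> Arr T" "Dom T b = Dom T a" "Cod T b = Dom T g" and
      b: "g \<cdot> b = a"
      using tri_exact_Z[OF D'(1), of a] by auto
    have "w'' \<cdot> a = Sm d \<cdot> (w \<cdot> b)" using comp_reduce[OF o(5)[symmetric], of b] b by simp
    thus "w'' \<cdot> a = Zero T (Dom T a) (So (Dom T h'))"
      using GD(4)[OF D(5), of b] by simp
  qed
  thus ?thesis using t o g1
    by (intro exI[of _ h'] exI[of _ d] exI[of _ e] exI[of _ w'']) (simp add: R_real)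
qed

theorem relative_extriangulated: "extriangulated_category R"
proof (intro extriangulated_category.intro extriangulated_category_axioms.intro)
  show "additive_category R" by (rule R_additive)
next
  fix X Y assume "X \<in> Obj R" "Y \<in> Obj R"
  thus "comm_group (Ext R X Y)" using R_group by simp
next
  fix f X' X g Y Y' assume "f \<in> Hom R X' X" "g \<in> Hom R Y Y'"
  hence *: "f \<in> Arr T" "Dom T f = X'" "Cod T f = X" "g \<in> Arr T" "Dom T g = Y" "Cod T g = Y'"
    "X \<in> S" "X' \<in> S" "Y \<in> S" "Y' \<in> S" by auto
  note [simp] = *
  have "Sm g \<cdot> (w \<cdot> f) \<in> G X' Y'" if "w \<in> G X Y" for w
    using G_act[OF that, of f g] by simp
  thus "Act R f g \<in> hom (Ext R X Y) (Ext R X' Y')"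
    unfolding hom_def using GD by auto
next
  fix u v w u' v' w' a c
  assume r: "(u, v, w) \<in> Real R" and r': "(u', v', w') \<in> Real R"
    and a: "a \<in> Hom R (Dom R u) (Dom R u')" "c \<in> Hom R (Cod R v) (Cod R v')"
      "push R (Cod R v) a w = pull R (Dom R u') c w'"
  note D = R_realD[OF r] and D' = R_realD[OF r']
  note [simp] = D(2-4,6-) D'(2-4,6-)
  have [simp]: "a \<in> Arr T" "Dom T a = Dom T u" "Cod T a = Dom T u'" "c \<in> Arr T"
    "Dom T c = Cod T v" "Cod T c = Cod T v'" using a by auto
  obtain b where "b \<in> Arr T" "Dom T b = Cod T u" "Cod T b = Cod T u'" "b \<cdot> u = u' \<cdot> a" "c \<cdot> v = v' \<cdot> b"
    using tri_morphism_snd[OF D(1) D'(1), of a c] a(3) by auto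
  thus "\<exists>b \<in> Hom R (Cod R u) (Cod R u'). b \<cdot>\<^bsub>R\<^esub> u = u' \<cdot>\<^bsub>R\<^esub> a \<and> c \<cdot>\<^bsub>R\<^esub> v = v' \<cdot>\<^bsub>R\<^esub> b"
    by (intro bexI[of _ b]) auto
next
  fix u v w u' v' w' a b
  assume r: "(u, v, w) \<in> Real R" and r': "(u', v', w') \<in> Real R"
    and a: "a \<in> Hom R (Dom R u) (Dom R u')" "b \<in> Hom R (Cod R u) (Cod R u')"
      "b \<cdot>\<^bsub>R\<^esub> u = u' \<cdot>\<^bsub>R\<^esub> a"
  note D = R_realD[OF r] and D' = R_realD[OF r']
  note [simp] = D(2-4,6-) D'(2-4,6-)
  have [simp]: "a \<in> Arr T" "Dom T a = Dom T u" "Cod T a = Dom T u'" "b \<in> Arr T"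
    "Dom T b = Cod T u" "Cod T b = Cod T u'" using a by auto
  obtain c where c: "c \<in> Arr T" "Dom T c = Cod T v" "Cod T c = Cod T v'" "c \<cdot> v = v' \<cdot> b"
    "Sm a \<cdot> w = w' \<cdot> c"
    using tri_morphism[OF D(1) D'(1), of a b] a(3) by auto
  show "\<exists>c \<in> Hom R (Cod R v) (Cod R v'). c \<cdot>\<^bsub>R\<^esub> v = v' \<cdot>\<^bsub>R\<^esub> b \<and>
        push R (Cod R v) a w = pull R (Dom R u') c w'"
    by (rule bexI[of _ c]) (use c in auto)
next
  fix u v w u' v' w' b c
  assume r: "(u, v, w) \<in> Real R" and r': "(u', v', w') \<in> Real R"
    and a: "b \<in> Hom R (Cod R u) (Cod R u')" "c \<in> Hom R (Cod R v) (Cod R v')"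
      "c \<cdot>\<^bsub>R\<^esub> v = v' \<cdot>\<^bsub>R\<^esub> b"
  note D = R_realD[OF r] and D' = R_realD[OF r']
  note [simp] = D(2-4,6-) D'(2-4,6-)
  have [simp]: "c \<in> Arr T" "Dom T c = Cod T v" "Cod T c = Cod T v'" "b \<in> Arr T"
    "Dom T b = Cod T u" "Cod T b = Cod T u'" using a by auto
  obtain x where x: "x \<in> Arr T" "Dom T x = Dom T u" "Cod T x = Dom T u'" "b \<cdot> u = u' \<cdot> x"
    "Sm x \<cdot> w = w' \<cdot> c"
    using tri_morphism_fst[OF D(1) D'(1), of b c] a(3) by auto
  show "\<exists>a \<in> Hom R (Dom R u) (Dom R u'). b \<cdot>\<^bsub>R\<^esub> u = u' \<cdot>\<^bsub>R\<^esub> a \<and>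
        push R (Cod R v) a w = pull R (Dom R u') c w'"
    by (rule bexI[of _ x]) (use x in auto)
next
  fix X Y w assume a: "X \<in> Obj R" "Y \<in> Obj R" "w \<in> carrier (Ext R X Y)"
  hence [simp]: "X \<in> S" "Y \<in> S" and w: "w \<in> G X Y" by auto
  note [simp] = GD(1-3)[OF w]
  obtain u v where t: "(u, v, w) \<in> Tri T" "Dom T u = Y" using tri_ex_third[of w Y] by auto
  have v: "Cod T v = X" using tri_simps(5)[OF t(1)] by simp
  have "Cod T u \<in> S" using S_extension[OF t(1)] t v w by simp
  thus "\<exists>u v. (u, v, w) \<in> Real R \<and> Dom R u = Y \<and> Cod R v = X"
    using t v w by (intro exI[of _ u] exI[of _ v]) (simp add: R_real)
next
  fix Y X D i j p q assume "is_biproduct R Y X D i j p q"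
  hence b: "is_biproduct T Y X D i j p q" and [simp]: "X \<in> S" "Y \<in> S" "D \<in> S" by auto
  show "(i, q, \<one>\<^bsub>Ext R X Y\<^esub>) \<in> Real R"
    using tri_split[OF b] biproduct_simps[OF b] by (simp add: R_real G_iff)
next
  fix u v w assume "(u, v, w) \<in> Real R"
  from R_realD[OF this] show "u \<in> Arr R \<and> v \<in> Arr R \<and> Cod R u = Dom R v \<and>
      w \<in> carrier (Ext R (Cod R v) (Dom R u))" by simp
next
  fix X Y w assume "X \<in> Obj R" "Y \<in> Obj R" "w \<in> carrier (Ext R X Y)"
  thus "Act R (Id R X) (Id R Y) w = w" using GD[of w X Y] by simp
next
  fix f' X'' X' f X g Y Y' g' Y'' w
  assume "f' \<in> Hom R X'' X'" "f \<in> Hom R X' X" "g \<in> Hom R Y Y'" "g' \<in> Hom R Y' Y''"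
    "w \<in> carrier (Ext R X Y)"
  thus "Act R (f \<cdot>\<^bsub>R\<^esub> f') (g' \<cdot>\<^bsub>R\<^esub> g) w = Act R f' g' (Act R f g w)"
    using GD[of w X Y] by auto
next
  fix f X' X f' g Y Y' w
  assume "f \<in> Hom R X' X" "f' \<in> Hom R X' X" "g \<in> Hom R Y Y'" "w \<in> carrier (Ext R X Y)"
  thus "Act R (f \<oplus>\<^bsub>R\<^esub> f') g w = Act R f g w \<otimes>\<^bsub>Ext R X' Y'\<^esub> Act R f' g w"
    using GD[of w X Y] by auto
next
  fix f X' X g Y Y' g' w
  assume "f \<in> Hom R X' X" "g \<in> Hom R Y Y'" "g' \<in> Hom R Y Y'" "w \<in> carrier (Ext R X Y)"
  thus "Act R f (g \<oplus>\<^bsub>R\<^esub> g') w = Act R f g w \<otimes>\<^bsub>Ext R X' Y'\<^esub> Act R f g' w"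
    using GD[of w X Y] by auto
qed (rule R_real_unique R_real_closed R_real_sum R_ET4 R_ET4_op; assumption)+

end

section \<open>Quotients by ideals\<close>

locale ideal_quotient = additive_category C
  for C :: "('o, 'm, 'z) addcat_scheme" (structure) +
  fixes N :: "'m set"
  assumes N_arr: "f \<in> N \<Longrightarrow> f \<in> Arr C"
    and N_zero: "X \<in> Obj C \<Longrightarrow> Y \<in> Obj C \<Longrightarrow> Zero C X Y \<in> N"
    and N_add: "\<lbrakk>f \<in> N; g \<in> N; Dom C g = Dom C f; Cod C g = Cod C f\<rbrakk> \<Longrightarrow> f \<oplus> g \<in> N"
    and N_comp: "\<lbrakk>f \<in> N; g \<in> Arr C; Dom C g = Cod C f\<rbrakk> \<Longrightarrow> g \<cdot> f \<in> N"
    and comp_N: "\<lbrakk>f \<in> N; g \<in> Arr C; Cod C g = Dom C f\<rbrakk> \<Longrightarrow> f \<cdot> g \<in> N"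
begin

abbreviation "Q \<equiv> quotient_cat C N"
abbreviation "cls \<equiv> qcls C N"

lemma N_neg: "f \<in> N \<Longrightarrow> Neg C f \<in> N"
  using N_comp[of f "Neg C (Id C (Cod C f))"] N_arr by simp

lemma in_cls: "f \<in> Arr C \<Longrightarrow>
    g \<in> cls f \<longleftrightarrow> g \<in> Arr C \<and> Dom C g = Dom C f \<and> Cod C g = Cod C f \<and> g \<oplus> Neg C f \<in> N"
proof
  assume f [simp]: "f \<in> Arr C" and "g \<in> cls f"
  then obtain h where h: "g = f \<oplus> h" "h \<in> N" and [simp]: "h \<in> Arr C" "Dom C h = Dom C f" "Cod C h = Cod C f"
    unfolding qcls_def by auto
  thus "g \<in> Arr C \<and> Dom C g = Dom C f \<and> Cod C g = Cod C f \<and> g \<oplus> Neg C f \<in> N" by simp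
next
  assume f [simp]: "f \<in> Arr C" and g: "g \<in> Arr C \<and> Dom C g = Dom C f \<and> Cod C g = Cod C f \<and> g \<oplus> Neg C f \<in> N"
  hence [simp]: "g \<in> Arr C" "Dom C g = Dom C f" "Cod C g = Cod C f" by auto
  have "g = f \<oplus> (g \<oplus> Neg C f)" by simp
  thus "g \<in> cls f" unfolding qcls_def using g
    by (intro CollectI exI[of _ "g \<oplus> Neg C f"]) simp
qed

lemma cls_eq_iff:
  assumes [simp]: "f \<in> Arr C" "g \<in> Arr C" "Dom C g = Dom C f" "Cod C g = Cod C f"
  shows "cls f = cls g \<longleftrightarrow> f \<oplus> Neg C g \<in> N"
proof
  assume "cls f = cls g"
  moreover have "f \<in> cls f" using N_zero by (simp add: in_cls)
  ultimately show "f \<oplus> Neg C g \<in> N" by (simp add: in_cls)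
next
  assume fg: "f \<oplus> Neg C g \<in> N"
  have "h \<oplus> Neg C f \<in> N \<longleftrightarrow> h \<oplus> Neg C g \<in> N"
    if [simp]: "h \<in> Arr C" "Dom C h = Dom C f" "Cod C h = Cod C f" for h
  proof
    have e: "(h \<oplus> Neg C f) \<oplus> (f \<oplus> Neg C g) = h \<oplus> Neg C g" by simp
    assume "h \<oplus> Neg C f \<in> N"
    from N_add[OF this fg] show "h \<oplus> Neg C g \<in> N" unfolding e by simp
  next
    have e: "(h \<oplus> Neg C g) \<oplus> Neg C (f \<oplus> Neg C g) = h \<oplus> Neg C f"
      using add_commute[of "Neg C f" g] by simp
    assume "h \<oplus> Neg C g \<in> N"
    from N_add[OF this N_neg[OF fg]] show "h \<oplus> Neg C f \<in> N" unfolding e by simp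
  qed
  thus "cls f = cls g" by (auto simp: in_cls)
qed

lemma rep_cls:
  assumes [simp]: "f \<in> Arr C"
  shows "rep (cls f) \<in> Arr C" "Dom C (rep (cls f)) = Dom C f" "Cod C (rep (cls f)) = Cod C f"
    "cls (rep (cls f)) = cls f" "rep (cls f) \<oplus> Neg C f \<in> N"
proof -
  have "f \<in> cls f" using N_zero by (simp add: in_cls)
  hence "rep (cls f) \<in> cls f" unfolding rep_def by (rule someI)
  thus *: "rep (cls f) \<in> Arr C" "Dom C (rep (cls f)) = Dom C f" "Cod C (rep (cls f)) = Cod C f"
    "rep (cls f) \<oplus> Neg C f \<in> N" by (simp_all add: in_cls)
  show "cls (rep (cls f)) = cls f" using * by (simp add: cls_eq_iff)
qed

lemma Q_obj [simp]: "Obj Q = Obj C"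
  by (simp add: quotient_cat_def)

lemma Q_arr [simp]: "f \<in> Arr C \<Longrightarrow> cls f \<in> Arr Q"
  by (simp add: quotient_cat_def)

lemma Q_cases:
  assumes "F \<in> Arr Q"
  obtains f where "f \<in> Arr C" "F = cls f"
  using assms by (auto simp: quotient_cat_def)

lemma Q_dom [simp]: "f \<in> Arr C \<Longrightarrow> Dom Q (cls f) = Dom C f" "f \<in> Arr C \<Longrightarrow> Cod Q (cls f) = Cod C f"
  by (simp_all add: quotient_cat_def rep_cls)

lemma Q_id [simp]: "Id Q X = cls (Id C X)"
  by (simp add: quotient_cat_def)

lemma Q_zero [simp]: "Zero Q X Y = cls (Zero C X Y)"
  by (simp add: quotient_cat_def)

lemma Q_comp [simp]:
  assumes [simp]: "f \<in> Arr C" "g \<in> Arr C" "Cod C f = Dom C g"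
  shows "cls g \<cdot>\<^bsub>Q\<^esub> cls f = cls (g \<cdot> f)"
proof -
  note [simp] = rep_cls(1-3)
  \<comment> \<open>With representatives f' and g', the difference of the composites is g' (f' - f)
    + (g' - g) f.\<close>
  have "rep (cls g) \<cdot> (rep (cls f) \<oplus> Neg C f) \<oplus> (rep (cls g) \<oplus> Neg C g) \<cdot> f \<in> N"
    by (rule N_add[OF N_comp[OF rep_cls(5)[of f]] comp_N[OF rep_cls(5)[of g]]]) simp_all
  hence "rep (cls g) \<cdot> rep (cls f) \<oplus> Neg C (g \<cdot> f) \<in> N" by simp
  thus ?thesis by (simp add: quotient_cat_def cls_eq_iff)
qed

lemma Q_add [simp]:
  assumes [simp]: "f \<in> Arr C" "g \<in> Arr C" "Dom C g = Dom C f" "Cod C g = Cod C f"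
  shows "cls f \<oplus>\<^bsub>Q\<^esub> cls g = cls (f \<oplus> g)"
proof -
  note [simp] = rep_cls(1-3)
  have "(rep (cls f) \<oplus> Neg C f) \<oplus> (rep (cls g) \<oplus> Neg C g) \<in> N"
    by (rule N_add[OF rep_cls(5)[of f] rep_cls(5)[of g]]) simp_all
  moreover have "(rep (cls f) \<oplus> Neg C f) \<oplus> (rep (cls g) \<oplus> Neg C g) =
      rep (cls f) \<oplus> rep (cls g) \<oplus> Neg C (f \<oplus> g)"
    using add_left_commute[of "Neg C f" "rep (cls g)" "Neg C g"] by simp
  ultimately show ?thesis by (simp add: quotient_cat_def cls_eq_iff)
qed

lemma Q_hom: "F \<in> Hom Q X Y \<longleftrightarrow> (\<exists>f. f \<in> Arr C \<and> Dom C f = X \<and> Cod C f = Y \<and> F = cls f)"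
proof
  assume F: "F \<in> Hom Q X Y"
  then obtain f where "f \<in> Arr C" "F = cls f" by (auto elim: Q_cases)
  thus "\<exists>f. f \<in> Arr C \<and> Dom C f = X \<and> Cod C f = Y \<and> F = cls f" using F by auto
qed auto

lemma Q_biproduct:
  assumes "is_biproduct C A B S i j p q"
  shows "is_biproduct Q A B S (cls i) (cls j) (cls p) (cls q)"
proof -
  note [simp] = biproduct_simps[OF assms] biproduct_sum(1)[OF assms]
  show ?thesis by (simp add: is_biproduct_def)
qed

theorem Q_additive: "additive_category Q"
proof (rule additive_category.intro)
  fix X Y assume "X \<in> Obj Q" "Y \<in> Obj Q"
  hence [simp]: "X \<in> Obj C" "Y \<in> Obj C" by auto
  show "comm_group (HomGrp Q X Y)"
  proof (rule comm_groupI; simp only: HomGrp_def monoid.simps partial_object.simps Q_hom Q_zero)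
    fix x y z
    assume "\<exists>f. f \<in> Arr C \<and> Dom C f = X \<and> Cod C f = Y \<and> x = cls f"
      "\<exists>f. f \<in> Arr C \<and> Dom C f = X \<and> Cod C f = Y \<and> y = cls f"
      "\<exists>f. f \<in> Arr C \<and> Dom C f = X \<and> Cod C f = Y \<and> z = cls f"
    thus "x \<oplus>\<^bsub>Q\<^esub> y \<oplus>\<^bsub>Q\<^esub> z = x \<oplus>\<^bsub>Q\<^esub> (y \<oplus>\<^bsub>Q\<^esub> z)" by (elim exE conjE) simp
  next
    fix x y
    assume "\<exists>f. f \<in> Arr C \<and> Dom C f = X \<and> Cod C f = Y \<and> x = cls f"
      "\<exists>f. f \<in> Arr C \<and> Dom C f = X \<and> Cod C f = Y \<and> y = cls f"
    then obtain f g where [simp]: "f \<in> Arr C" "Dom C f = X" "Cod C f = Y" "x = cls f"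
      "g \<in> Arr C" "Dom C g = X" "Cod C g = Y" "y = cls g" by blast
    show "x \<oplus>\<^bsub>Q\<^esub> y = y \<oplus>\<^bsub>Q\<^esub> x" using add_commute[of f g] by simp
    show "\<exists>h. h \<in> Arr C \<and> Dom C h = X \<and> Cod C h = Y \<and> x \<oplus>\<^bsub>Q\<^esub> y = cls h"
      by (rule exI[of _ "f \<oplus> g"]) simp
  next
    fix x assume "\<exists>f. f \<in> Arr C \<and> Dom C f = X \<and> Cod C f = Y \<and> x = cls f"
    then obtain f where [simp]: "f \<in> Arr C" "Dom C f = X" "Cod C f = Y" "x = cls f" by blast
    show "cls (Zero C X Y) \<oplus>\<^bsub>Q\<^esub> x = x" by simp
    have "cls (Neg C f) \<oplus>\<^bsub>Q\<^esub> x = cls (Zero C X Y)" "cls (Neg C f) \<in> Hom Q X Y" by simp_all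
    thus "\<exists>y\<in>Hom Q X Y. y \<oplus>\<^bsub>Q\<^esub> x = cls (Zero C X Y)" by blast
  qed (rule exI[of _ "Zero C X Y"], simp)
next
  obtain Z where Z: "is_zero C Z" using ex_zero by blast
  have "is_zero Q Z" unfolding is_zero_def
  proof (intro conjI ballI)
    show "Z \<in> Obj Q" using Z by simp
    fix X assume "X \<in> Obj Q"
    hence X: "X \<in> Obj C" by simp
    have "Zero C X Z \<in> Arr C" "Dom C (Zero C X Z) = X" "Cod C (Zero C X Z) = Z"
      "Zero C Z X \<in> Arr C" "Dom C (Zero C Z X) = Z" "Cod C (Zero C Z X) = X" using Z X by auto
    thus "\<exists>!f. f \<in> Hom Q X Z" "\<exists>!f. f \<in> Hom Q Z X" unfolding Q_hom
      using to_zero[OF Z] from_zero[OF Z] by metis+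
  qed
  thus "\<exists>Z. is_zero Q Z" by blast
next
  fix A B assume "A \<in> Obj Q" "B \<in> Obj Q"
  then obtain S i j p q where "is_biproduct C A B S i j p q" using ex_biproduct by fastforce
  thus "\<exists>S i j p q. is_biproduct Q A B S i j p q" using Q_biproduct by blast
qed (auto elim!: Q_cases)

lemma Q_neg [simp]:
  assumes [simp]: "f \<in> Arr C"
  shows "Neg Q (cls f) = cls (Neg C f)"
proof -
  interpret q: additive_category Q by (rule Q_additive)
  show ?thesis by (rule q.neg_unique[symmetric]) simp_all
qed

lemma Q_isoI:
  assumes "f \<in> Arr C" "g \<in> Arr C" "Dom C g = Cod C f" "Cod C g = Dom C f"
    "cls (g \<cdot> f) = cls (Id C (Dom C f))" "cls (f \<cdot> g) = cls (Id C (Cod C f))"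
  shows "is_iso Q (cls f)"
proof -
  interpret q: additive_category Q by (rule Q_additive)
  show ?thesis using assms by (intro q.is_isoI[of _ "cls g"]) simp_all
qed

end

section \<open>The homotopy category\<close>

lemma cmap_eqI:
  fixes f g :: "('o, 'm) cmap"
  assumes "csrc f = csrc g" "ctgt f = ctgt g" "\<And>i. ccomp f i = ccomp g i"
  shows "f = g"
  using assms by (cases f, cases g) auto

lemma cplx_eqI:
  fixes X Y :: "('o, 'm) cplx"
  assumes "\<And>i. cob X i = cob Y i" "\<And>i. cdiff X i = cdiff Y i"
  shows "X = Y"
  using assms by (cases X, cases Y) auto

lemma Chb_sel [simp]:
  "Obj (Chb C) = bounded_complexes C"
  "f \<in> Arr (Chb C) \<longleftrightarrow> csrc f \<in> bounded_complexes C \<and> ctgt f \<in> bounded_complexes C \<and> is_chain_map C f"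
  "Dom (Chb C) = csrc" "Cod (Chb C) = ctgt"
  "Id (Chb C) X = \<lparr>csrc = X, ctgt = X, ccomp = (\<lambda>i. Id C (cob X i))\<rparr>"
  "Comp (Chb C) g f = \<lparr>csrc = csrc f, ctgt = ctgt g, ccomp = (\<lambda>i. ccomp g i \<cdot>\<^bsub>C\<^esub> ccomp f i)\<rparr>"
  "Add (Chb C) f g = \<lparr>csrc = csrc f, ctgt = ctgt f, ccomp = (\<lambda>i. ccomp f i \<oplus>\<^bsub>C\<^esub> ccomp g i)\<rparr>"
  "Zero (Chb C) X Y = \<lparr>csrc = X, ctgt = Y, ccomp = (\<lambda>i. Zero C (cob X i) (cob Y i))\<rparr>"
  by (simp_all add: Chb_def)

section \<open>Bounded complexes and null homotopic maps\<close>

context additive_category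
begin

lemma cplx_simps [simp]:
  assumes "X \<in> bounded_complexes C"
  shows "cob X i \<in> Obj C" "cdiff X i \<in> Arr C" "Dom C (cdiff X i) = cob X i"
    "Cod C (cdiff X i) = cob X (i + 1)"
    "cdiff X (i + 1) \<cdot> cdiff X i = Zero C (cob X i) (cob X (2 + i))"
    "cdiff X i \<cdot> cdiff X (i - 1) = Zero C (cob X (i - 1)) (cob X (i + 1))"
proof -
  have X: "is_complex C X" using assms by (simp add: bounded_complexes_def)
  show "cob X i \<in> Obj C" "cdiff X i \<in> Arr C" "Dom C (cdiff X i) = cob X i"
    "Cod C (cdiff X i) = cob X (i + 1)"
    "cdiff X (i + 1) \<cdot> cdiff X i = Zero C (cob X i) (cob X (2 + i))" for i
    using X unfolding is_complex_def hom_iff add.commute[of 2] by blast+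
  from this(5)[of "i - 1"]
  show "cdiff X i \<cdot> cdiff X (i - 1) = Zero C (cob X (i - 1)) (cob X (i + 1))" by (simp add: add.commute)
qed

lemma cplx_dd [simp]:
  assumes "X \<in> bounded_complexes C" "f \<in> Arr C"
  shows "Cod C f = cob X i \<Longrightarrow> cdiff X (i + 1) \<cdot> (cdiff X i \<cdot> f) = Zero C (Dom C f) (cob X (2 + i))"
    "Cod C f = cob X (i - 1) \<Longrightarrow> cdiff X i \<cdot> (cdiff X (i - 1) \<cdot> f) = Zero C (Dom C f) (cob X (i + 1))"
  using assms by (simp_all add: comp_reduce[OF cplx_simps(5)] comp_reduce[OF cplx_simps(6)])

lemma cmap_simps [simp]:
  assumes "f \<in> Arr (Chb C)"
  shows "ccomp f i \<in> Arr C" "Dom C (ccomp f i) = cob (csrc f) i" "Cod C (ccomp f i) = cob (ctgt f) i"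
  using assms unfolding Chb_sel is_chain_map_def hom_iff by blast+

lemma cmap_comm:
  assumes "f \<in> Arr (Chb C)"
  shows "ccomp f (i + 1) \<cdot> cdiff (csrc f) i = cdiff (ctgt f) i \<cdot> ccomp f i"
    "ccomp f i \<cdot> cdiff (csrc f) (i - 1) = cdiff (ctgt f) (i - 1) \<cdot> ccomp f (i - 1)"
proof -
  show *: "ccomp f (i + 1) \<cdot> cdiff (csrc f) i = cdiff (ctgt f) i \<cdot> ccomp f i" for i
    using assms unfolding Chb_sel is_chain_map_def by blast
  show "ccomp f i \<cdot> cdiff (csrc f) (i - 1) = cdiff (ctgt f) (i - 1) \<cdot> ccomp f (i - 1)"
    using *[of "i - 1"] by simp
qed

lemma cmap_comm_reduce:
  assumes f: "f \<in> Arr (Chb C)" and h: "h \<in> Arr C"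
  shows "Cod C h = cob (csrc f) i \<Longrightarrow>
      ccomp f (i + 1) \<cdot> (cdiff (csrc f) i \<cdot> h) = cdiff (ctgt f) i \<cdot> (ccomp f i \<cdot> h)"
    "Cod C h = cob (csrc f) (i - 1) \<Longrightarrow>
      ccomp f i \<cdot> (cdiff (csrc f) (i - 1) \<cdot> h) = cdiff (ctgt f) (i - 1) \<cdot> (ccomp f (i - 1) \<cdot> h)"
proof -
  have o: "csrc f \<in> bounded_complexes C" "ctgt f \<in> bounded_complexes C" using f by auto
  show "Cod C h = cob (csrc f) i \<Longrightarrow>
      ccomp f (i + 1) \<cdot> (cdiff (csrc f) i \<cdot> h) = cdiff (ctgt f) i \<cdot> (ccomp f i \<cdot> h)"
    using cmap_simps[OF f] o h by (subst comp_reduce[OF cmap_comm(1)[OF f]]) (simp_all del: Chb_sel)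
  show "Cod C h = cob (csrc f) (i - 1) \<Longrightarrow>
      ccomp f i \<cdot> (cdiff (csrc f) (i - 1) \<cdot> h) = cdiff (ctgt f) (i - 1) \<cdot> (ccomp f (i - 1) \<cdot> h)"
    using cmap_simps[OF f] o h by (subst comp_reduce[OF cmap_comm(2)[OF f]]) (simp_all del: Chb_sel)
qed

lemma cmapD:
  assumes "f \<in> Arr (Chb C)"
  shows "csrc f \<in> bounded_complexes C" "ctgt f \<in> bounded_complexes C"
  using assms by auto

lemma cmapI:
  assumes "csrc f \<in> bounded_complexes C" "ctgt f \<in> bounded_complexes C"
    "\<And>i. ccomp f i \<in> Arr C" "\<And>i. Dom C (ccomp f i) = cob (csrc f) i"
    "\<And>i. Cod C (ccomp f i) = cob (ctgt f) i"
    "\<And>i. ccomp f (i + 1) \<cdot> cdiff (csrc f) i = cdiff (ctgt f) i \<cdot> ccomp f i"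
  shows "f \<in> Arr (Chb C)"
  using assms unfolding Chb_sel is_chain_map_def hom_iff by blast

lemma bounded_complexI:
  assumes "\<And>i. cob X i \<in> Obj C" "\<And>i. cdiff X i \<in> Arr C" "\<And>i. Dom C (cdiff X i) = cob X i"
    "\<And>i. Cod C (cdiff X i) = cob X (i + 1)"
    "\<And>i. cdiff X (i + 1) \<cdot> cdiff X i = Zero C (cob X i) (cob X (2 + i))"
    "concentrated C {a..b} X"
  shows "X \<in> bounded_complexes C"
  using assms unfolding add.commute[of 2]  bounded_complexes_def is_complex_def hom_iff by blast

lemma bounded_complexE:
  assumes "X \<in> bounded_complexes C"
  obtains a b where "concentrated C {a..b} X"
  using assms unfolding bounded_complexes_def by auto

definition cneg :: "('o, 'm) cmap \<Rightarrow> ('o, 'm) cmap" where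
  "cneg f = \<lparr>csrc = csrc f, ctgt = ctgt f, ccomp = (\<lambda>i. Neg C (ccomp f i))\<rparr>"

lemma cneg_sel [simp]:
  "csrc (cneg f) = csrc f" "ctgt (cneg f) = ctgt f" "ccomp (cneg f) i = Neg C (ccomp f i)"
  by (simp_all add: cneg_def)

lemma cneg_arr: "f \<in> Arr (Chb C) \<Longrightarrow> cneg f \<in> Arr (Chb C)"
proof (rule cmapI)
  assume f: "f \<in> Arr (Chb C)"
  note [simp] = cmapD[OF f] cmap_simps[OF f]
  show "ccomp (cneg f) (i + 1) \<cdot> cdiff (csrc (cneg f)) i = cdiff (ctgt (cneg f)) i \<cdot> ccomp (cneg f) i" for i
    using cmap_comm(1)[OF f] by simp
qed (auto simp del: Chb_sel dest: cmapD)

lemma Chb_comp_arr: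
  assumes f: "f \<in> Arr (Chb C)" and g: "g \<in> Arr (Chb C)" and fg: "ctgt f = csrc g"
  shows "g \<cdot>\<^bsub>Chb C\<^esub> f \<in> Arr (Chb C)"
proof -
  note [simp] = cmapD[OF f] cmapD[OF g] cmap_simps[OF f] cmap_simps[OF g] 
    cmap_comm[OF f] cmap_comm_reduce[OF g]
  have [simp]: "csrc g = ctgt f" using fg by simp
  have "ccomp g (i + 1) \<cdot> (cdiff (csrc g) i \<cdot> ccomp f i) = cdiff (ctgt g) i \<cdot> (ccomp g i \<cdot> ccomp f i)" for i
    by (rule cmap_comm_reduce[OF g]) (simp_all del: Chb_sel)
  thus ?thesis by (intro cmapI) (simp_all del: Chb_sel(2))
qed

lemma Chb_add_arr:
  assumes f: "f \<in> Arr (Chb C)" and g: "g \<in> Arr (Chb C)" and fg: "csrc g = csrc f" "ctgt g = ctgt f"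
  shows "f \<oplus>\<^bsub>Chb C\<^esub> g \<in> Arr (Chb C)"
  using cmapD[OF f] cmap_simps[OF f] cmap_simps[OF g] cmap_comm(1)[OF f] cmap_comm(1)[OF g] fg
  by (intro cmapI) (simp_all del: Chb_sel(2))

lemma Chb_zero_obj: "is_zero C Z \<Longrightarrow> \<lparr>cob = (\<lambda>_. Z), cdiff = (\<lambda>_. Zero C Z Z)\<rparr> \<in> bounded_complexes C"
  by (rule bounded_complexI[where a = 0 and b = 0]) (auto simp: concentrated_def)

lemma concentrated_biproduct:
  assumes "concentrated C {a..b} X" "concentrated C {c..d} Y"
    "\<And>i. is_biproduct C (cob X i) (cob Y i) (cob Z i) (x i) (y i) (p i) (q i)"
  shows "concentrated C {min a c..max b d} Z"
  unfolding concentrated_def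
proof (intro allI impI)
  fix i assume "i \<notin> {min a c..max b d}"
  hence "i \<notin> {a..b}" "i \<notin> {c..d}" by auto
  thus "is_zero C (cob Z i)" using assms(1,2) biproduct_zero[OF assms(3)] unfolding concentrated_def by blast
qed

lemma family_biproduct:
  assumes "\<And>i. X i \<in> Obj C" "\<And>i. Y i \<in> Obj C"
  obtains S a b p q where "\<And>i::int. is_biproduct C (X i) (Y i) (S i) (a i) (b i) (p i) (q i)"
proof -
  have "\<forall>i. \<exists>z. case z of (S, a, b, p, q) \<Rightarrow> is_biproduct C (X i) (Y i) S a b p q"
    using ex_biproduct[OF assms] by auto
  from choice[OF this] obtain z where z: "\<And>i. case z i of (S, a, b, p, q) \<Rightarrow> is_biproduct C (X i) (Y i) S a b p q"
    by blast
  show thesis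
    by (rule that[of "\<lambda>i. fst (z i)" "\<lambda>i. fst (snd (z i))" "\<lambda>i. fst (snd (snd (z i)))"
        "\<lambda>i. fst (snd (snd (snd (z i))))" "\<lambda>i. snd (snd (snd (snd (z i))))"])
      (use z in \<open>auto simp: split_beta\<close>)
qed

lemma Chb_biproduct:
  assumes X: "X \<in> bounded_complexes C" and Y: "Y \<in> bounded_complexes C"
  shows "\<exists>S i j p q. is_biproduct (Chb C) X Y S i j p q"
proof -
  note [simp] = X Y
  obtain S a b p q where B: "\<And>i. is_biproduct C (cob X i) (cob Y i) (S i) (a i) (b i) (p i) (q i)"
    using family_biproduct[of "cob X" "cob Y", OF cplx_simps(1)[OF X] cplx_simps(1)[OF Y]] by blast
  note [simp] = biproduct_simps[OF B] biproduct_sum(1)[OF B]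
  let ?S = "\<lparr>cob = S, cdiff = (\<lambda>i. a (i + 1) \<cdot> (cdiff X i \<cdot> p i) \<oplus> b (i + 1) \<cdot> (cdiff Y i \<cdot> q i))\<rparr>"
  obtain l u l' u' where "concentrated C {l..u} X" "concentrated C {l'..u'} Y"
    using bounded_complexE[OF X] bounded_complexE[OF Y] by metis
  from concentrated_biproduct[OF this, of ?S a b p q] B
  have "concentrated C {min l l'..max u u'} ?S" by simp
  hence [simp]: "?S \<in> bounded_complexes C" by (intro bounded_complexI) simp_all
  have "is_biproduct (Chb C) X Y ?S \<lparr>csrc = X, ctgt = ?S, ccomp = a\<rparr> \<lparr>csrc = Y, ctgt = ?S, ccomp = b\<rparr>
    \<lparr>csrc = ?S, ctgt = X, ccomp = p\<rparr> \<lparr>csrc = ?S, ctgt = Y, ccomp = q\<rparr>"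
    unfolding is_biproduct_def hom_iff
    by (intro conjI cmapI) (simp_all del: Chb_sel(2))
  thus ?thesis by blast
qed

theorem Chb_additive: "additive_category (Chb C)"
proof (rule additive_category.intro)
  fix X assume "X \<in> Obj (Chb C)"
  thus "Id (Chb C) X \<in> Hom (Chb C) X X" unfolding hom_iff
    by (intro conjI cmapI) (simp_all del: Chb_sel(2))
next
  fix f X Y g Z assume "f \<in> Hom (Chb C) X Y" "g \<in> Hom (Chb C) Y Z"
  thus "g \<cdot>\<^bsub>Chb C\<^esub> f \<in> Hom (Chb C) X Z" unfolding hom_iff
    using Chb_comp_arr[of f g] by (simp del: Chb_sel(2))
next
  fix X Y assume "X \<in> Obj (Chb C)" "Y \<in> Obj (Chb C)"
  hence X: "X \<in> bounded_complexes C" and Y: "Y \<in> bounded_complexes C" by auto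
  note [simp] = X Y
  show "comm_group (HomGrp (Chb C) X Y)"
  proof (rule comm_groupI; simp only: HomGrp_def monoid.simps partial_object.simps hom_iff)
    fix x y z
    assume a: "x \<in> Arr (Chb C) \<and> Dom (Chb C) x = X \<and> Cod (Chb C) x = Y"
      "y \<in> Arr (Chb C) \<and> Dom (Chb C) y = X \<and> Cod (Chb C) y = Y"
      "z \<in> Arr (Chb C) \<and> Dom (Chb C) z = X \<and> Cod (Chb C) z = Y"
    thus "x \<oplus>\<^bsub>Chb C\<^esub> y \<oplus>\<^bsub>Chb C\<^esub> z = x \<oplus>\<^bsub>Chb C\<^esub> (y \<oplus>\<^bsub>Chb C\<^esub> z)"
      using cmap_simps[of x] cmap_simps[of y] cmap_simps[of z] by (simp del: Chb_sel(2))
  next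
    fix x y
    assume a: "x \<in> Arr (Chb C) \<and> Dom (Chb C) x = X \<and> Cod (Chb C) x = Y"
      "y \<in> Arr (Chb C) \<and> Dom (Chb C) y = X \<and> Cod (Chb C) y = Y"
    thus "x \<oplus>\<^bsub>Chb C\<^esub> y \<in> Arr (Chb C) \<and> Dom (Chb C) (x \<oplus>\<^bsub>Chb C\<^esub> y) = X \<and> Cod (Chb C) (x \<oplus>\<^bsub>Chb C\<^esub> y) = Y"
      using Chb_add_arr[of x y] by (simp del: Chb_sel(2))
    have "ccomp x i \<oplus> ccomp y i = ccomp y i \<oplus> ccomp x i" for i
      using a cmap_simps[of x] cmap_simps[of y] by (intro add_commute) (simp_all del: Chb_sel(2))
    thus "x \<oplus>\<^bsub>Chb C\<^esub> y = y \<oplus>\<^bsub>Chb C\<^esub> x" using a by (simp del: Chb_sel(2))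
  next
    show "Zero (Chb C) X Y \<in> Arr (Chb C) \<and> Dom (Chb C) (Zero (Chb C) X Y) = X \<and> Cod (Chb C) (Zero (Chb C) X Y) = Y"
      by (intro conjI cmapI) (simp_all del: Chb_sel(2))
  next
    fix x assume a: "x \<in> Arr (Chb C) \<and> Dom (Chb C) x = X \<and> Cod (Chb C) x = Y"
    thus "Zero (Chb C) X Y \<oplus>\<^bsub>Chb C\<^esub> x = x"
      using cmap_simps[of x] by (intro cmap_eqI) (simp_all del: Chb_sel(2))
    show "\<exists>y\<in>Hom (Chb C) X Y. y \<oplus>\<^bsub>Chb C\<^esub> x = Zero (Chb C) X Y"
      using a cmap_simps[of x] cneg_arr[of x]
      by (intro bexI[of _ "cneg x"]) (simp_all del: Chb_sel(2))
  qed
next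
  obtain Z where Z: "is_zero C Z" using ex_zero by blast
  let ?Z = "\<lparr>cob = (\<lambda>_. Z), cdiff = (\<lambda>_. Zero C Z Z)\<rparr>"
  have Z' [simp]: "?Z \<in> bounded_complexes C" "Z \<in> Obj C" using Chb_zero_obj[OF Z] Z by auto
  have "is_zero (Chb C) ?Z" unfolding is_zero_def
  proof (intro conjI ballI)
    fix X assume "X \<in> Obj (Chb C)"
    hence [simp]: "X \<in> bounded_complexes C" by simp
    show "\<exists>!f. f \<in> Hom (Chb C) X ?Z" unfolding hom_iff
    proof (rule ex1I[of _ "Zero (Chb C) X ?Z"])
      show "Zero (Chb C) X ?Z \<in> Arr (Chb C) \<and> Dom (Chb C) (Zero (Chb C) X ?Z) = X \<and> Cod (Chb C) (Zero (Chb C) X ?Z) = ?Z"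
        by (intro conjI cmapI) (simp_all del: Chb_sel(2))
      fix f assume "f \<in> Arr (Chb C) \<and> Dom (Chb C) f = X \<and> Cod (Chb C) f = ?Z"
      thus "f = Zero (Chb C) X ?Z"
        using cmap_simps[of f] by (intro cmap_eqI) (auto simp del: Chb_sel(2) intro: to_zero[OF Z])
    qed
    show "\<exists>!f. f \<in> Hom (Chb C) ?Z X" unfolding hom_iff
    proof (rule ex1I[of _ "Zero (Chb C) ?Z X"])
      show "Zero (Chb C) ?Z X \<in> Arr (Chb C) \<and> Dom (Chb C) (Zero (Chb C) ?Z X) = ?Z \<and> Cod (Chb C) (Zero (Chb C) ?Z X) = X"
        by (intro conjI cmapI) (simp_all del: Chb_sel(2))
      fix f assume "f \<in> Arr (Chb C) \<and> Dom (Chb C) f = ?Z \<and> Cod (Chb C) f = X"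
      thus "f = Zero (Chb C) ?Z X"
        using cmap_simps[of f] by (intro cmap_eqI) (auto simp del: Chb_sel(2) intro: from_zero[OF Z])
    qed
  qed simp
  thus "\<exists>Z. is_zero (Chb C) Z" by blast
next
  fix X Y assume "X \<in> Obj (Chb C)" "Y \<in> Obj (Chb C)"
  thus "\<exists>S i j p q. is_biproduct (Chb C) X Y S i j p q" using Chb_biproduct by simp
next
  fix f X Y assume "f \<in> Hom (Chb C) X Y"
  thus "Id (Chb C) Y \<cdot>\<^bsub>Chb C\<^esub> f = f" "f \<cdot>\<^bsub>Chb C\<^esub> Id (Chb C) X = f"
    using cmap_simps[of f] by (auto intro!: cmap_eqI simp del: Chb_sel(2))
next
  fix f W X g Y h Z assume "f \<in> Hom (Chb C) W X" "g \<in> Hom (Chb C) X Y" "h \<in> Hom (Chb C) Y Z"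
  thus "h \<cdot>\<^bsub>Chb C\<^esub> (g \<cdot>\<^bsub>Chb C\<^esub> f) = h \<cdot>\<^bsub>Chb C\<^esub> g \<cdot>\<^bsub>Chb C\<^esub> f"
    using cmap_simps[of f] cmap_simps[of g] cmap_simps[of h] by (auto intro!: cmap_eqI simp del: Chb_sel(2))
next
  fix f X Y g Z g' assume "f \<in> Hom (Chb C) X Y" "g \<in> Hom (Chb C) Y Z" "g' \<in> Hom (Chb C) Y Z"
  thus "(g \<oplus>\<^bsub>Chb C\<^esub> g') \<cdot>\<^bsub>Chb C\<^esub> f = g \<cdot>\<^bsub>Chb C\<^esub> f \<oplus>\<^bsub>Chb C\<^esub> g' \<cdot>\<^bsub>Chb C\<^esub> f"
    using cmap_simps[of f] cmap_simps[of g] cmap_simps[of g'] by (auto intro!: cmap_eqI simp del: Chb_sel(2))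
next
  fix f X Y f' g Z assume "f \<in> Hom (Chb C) X Y" "f' \<in> Hom (Chb C) X Y" "g \<in> Hom (Chb C) Y Z"
  thus "g \<cdot>\<^bsub>Chb C\<^esub> (f \<oplus>\<^bsub>Chb C\<^esub> f') = g \<cdot>\<^bsub>Chb C\<^esub> f \<oplus>\<^bsub>Chb C\<^esub> g \<cdot>\<^bsub>Chb C\<^esub> f'"
    using cmap_simps[of f] cmap_simps[of f'] cmap_simps[of g] by (auto intro!: cmap_eqI simp del: Chb_sel(2))
qed simp

lemma Chb_neg: "f \<in> Arr (Chb C) \<Longrightarrow> Neg (Chb C) f = cneg f"
proof -
  interpret ch: additive_category "Chb C" by (rule Chb_additive)
  assume f: "f \<in> Arr (Chb C)"
  show ?thesis
    by (rule ch.neg_unique[symmetric]) (use f cneg_arr[OF f] cmap_simps[OF f] in \<open>simp_all del: Chb_sel(2)\<close>)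
qed

lemma null_homotopicI:
  assumes f: "f \<in> Arr (Chb C)"
    and s: "\<And>i. s i \<in> Arr C" "\<And>i. Dom C (s i) = cob (csrc f) i" "\<And>i. Cod C (s i) = cob (ctgt f) (i - 1)"
    and eq: "\<And>i. ccomp f i = cdiff (ctgt f) (i - 1) \<cdot> s i \<oplus> s (i + 1) \<cdot> cdiff (csrc f) i"
  shows "f \<in> null_homotopic C"
  unfolding null_homotopic_def hom_iff using f s eq by blast

text \<open>Homotopies add, and composing a homotopy with a chain map on either side is a homotopy
  for the composite.\<close>

lemma null_homotopic_ideal: "ideal_quotient (Chb C) (null_homotopic C)"
proof (rule ideal_quotient.intro[OF Chb_additive], rule ideal_quotient_axioms.intro)
  interpret ch: additive_category "Chb C" by (rule Chb_additive)
  show "f \<in> Arr (Chb C)" if "f \<in> null_homotopic C" for f using that unfolding null_homotopic_def by blast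
  show "Zero (Chb C) X Y \<in> null_homotopic C" if X: "X \<in> Obj (Chb C)" and Y: "Y \<in> Obj (Chb C)" for X Y
    using X Y
    by (intro null_homotopicI[where s = "\<lambda>i. Zero C (cob X i) (cob Y (i - 1))"] ch.zero_simps)
      (simp_all del: Chb_sel(2))
  fix f assume F: "f \<in> null_homotopic C"
  obtain s where f: "f \<in> Arr (Chb C)" and s [simp]: "\<And>i. s i \<in> Arr C" "\<And>i. Dom C (s i) = cob (csrc f) i"
    "\<And>i. Cod C (s i) = cob (ctgt f) (i - 1)" and
    fs: "\<And>i. ccomp f i = cdiff (ctgt f) (i - 1) \<cdot> s i \<oplus> s (i + 1) \<cdot> cdiff (csrc f) i"
    using F unfolding null_homotopic_def hom_iff by blast
  note [simp] = cmapD[OF f] cmap_simps[OF f]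
  {
    fix g assume G: "g \<in> null_homotopic C" and fg: "Dom (Chb C) g = Dom (Chb C) f" "Cod (Chb C) g = Cod (Chb C) f"
    obtain t where g: "g \<in> Arr (Chb C)" and t: "\<And>i. t i \<in> Arr C" "\<And>i. Dom C (t i) = cob (csrc g) i"
      "\<And>i. Cod C (t i) = cob (ctgt g) (i - 1)" and
      gt: "\<And>i. ccomp g i = cdiff (ctgt g) (i - 1) \<cdot> t i \<oplus> t (i + 1) \<cdot> cdiff (csrc g) i"
      using G unfolding null_homotopic_def hom_iff by blast
    have [simp]: "csrc g = csrc f" "ctgt g = ctgt f" using fg by auto
    note [simp] = t
    have gt': "ccomp g i = cdiff (ctgt f) (i - 1) \<cdot> t i \<oplus> t (i + 1) \<cdot> cdiff (csrc f) i" for i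
      using gt[of i] by simp
    show "f \<oplus>\<^bsub>Chb C\<^esub> g \<in> null_homotopic C"
    proof (rule null_homotopicI[where s = "\<lambda>i. s i \<oplus> t i"])
      show "f \<oplus>\<^bsub>Chb C\<^esub> g \<in> Arr (Chb C)" using f g by (intro Chb_add_arr) (simp_all del: Chb_sel(2))
      show "ccomp (f \<oplus>\<^bsub>Chb C\<^esub> g) i = cdiff (ctgt (f \<oplus>\<^bsub>Chb C\<^esub> g)) (i - 1) \<cdot> (s i \<oplus> t i) \<oplus>
          (s (i + 1) \<oplus> t (i + 1)) \<cdot> cdiff (csrc (f \<oplus>\<^bsub>Chb C\<^esub> g)) i" for i
        by (simp add: fs gt', subst add_left_commute) simp_all
    qed simp_all
  next
    fix g assume g: "g \<in> Arr (Chb C)" and fg: "Dom (Chb C) g = Cod (Chb C) f"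
    have [simp]: "csrc g = ctgt f" using fg by auto
    note [simp] = cmapD[OF g] cmap_simps[OF g]
    show "g \<cdot>\<^bsub>Chb C\<^esub> f \<in> null_homotopic C"
    proof (rule null_homotopicI[where s = "\<lambda>i. ccomp g (i - 1) \<cdot> s i"])
      show "g \<cdot>\<^bsub>Chb C\<^esub> f \<in> Arr (Chb C)" using f g by (intro Chb_comp_arr) (simp_all del: Chb_sel(2))
      show "ccomp (g \<cdot>\<^bsub>Chb C\<^esub> f) i = cdiff (ctgt (g \<cdot>\<^bsub>Chb C\<^esub> f)) (i - 1) \<cdot> (ccomp g (i - 1) \<cdot> s i) \<oplus>
          (ccomp g (i + 1 - 1) \<cdot> s (i + 1)) \<cdot> cdiff (csrc (g \<cdot>\<^bsub>Chb C\<^esub> f)) i" for i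
        using cmap_comm_reduce(2)[OF g, of "s i" i] by (simp add: fs)
    qed simp_all
  next
    fix g assume g: "g \<in> Arr (Chb C)" and fg: "Cod (Chb C) g = Dom (Chb C) f"
    have [simp]: "ctgt g = csrc f" using fg by auto
    note [simp] = cmapD[OF g] cmap_simps[OF g]
    show "f \<cdot>\<^bsub>Chb C\<^esub> g \<in> null_homotopic C"
    proof (rule null_homotopicI[where s = "\<lambda>i. s i \<cdot> ccomp g i"])
      show "f \<cdot>\<^bsub>Chb C\<^esub> g \<in> Arr (Chb C)" using f g by (intro Chb_comp_arr) (simp_all del: Chb_sel(2))
      show "ccomp (f \<cdot>\<^bsub>Chb C\<^esub> g) i = cdiff (ctgt (f \<cdot>\<^bsub>Chb C\<^esub> g)) (i - 1) \<cdot> (s i \<cdot> ccomp g i) \<oplus>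
          (s (i + 1) \<cdot> ccomp g (i + 1)) \<cdot> cdiff (csrc (f \<cdot>\<^bsub>Chb C\<^esub> g)) i" for i
        using cmap_comm(1)[OF g, of i] by (simp add: fs)
    qed simp_all
  }
qed

end

declare Chb_sel(2,5-8) [simp del]
lemmas Chb_unfold = Chb_sel(5-8)

lemma Chb_csrc [simp]:
  "csrc (Id (Chb C) X) = X" "ctgt (Id (Chb C) X) = X"
  "csrc (g \<cdot>\<^bsub>Chb C\<^esub> f) = csrc f" "ctgt (g \<cdot>\<^bsub>Chb C\<^esub> f) = ctgt g"
  "csrc (f \<oplus>\<^bsub>Chb C\<^esub> g) = csrc f" "ctgt (f \<oplus>\<^bsub>Chb C\<^esub> g) = ctgt f"
  "csrc (Zero (Chb C) X Y) = X" "ctgt (Zero (Chb C) X Y) = Y"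
  by (simp_all add: Chb_unfold)

lemma (in additive_category) Chb_neg_csrc [simp]:
  "f \<in> Arr (Chb C) \<Longrightarrow> csrc (Neg (Chb C) f) = csrc f" "f \<in> Arr (Chb C) \<Longrightarrow> ctgt (Neg (Chb C) f) = ctgt f"
  by (simp_all add: Chb_neg)

subsection \<open>Isomorphisms of candidate triangles\<close>

lemma triangle_iso_extend [simp]:
  "candidate_triangle (addcat.extend R F) S = candidate_triangle R S"
  "triangle_iso (addcat.extend R F) S = triangle_iso R S"
proof -
  show 1: "candidate_triangle (addcat.extend R F) S = candidate_triangle R S"
    unfolding candidate_triangle_def addcat_extend_hom ..
  show "triangle_iso (addcat.extend R F) S = triangle_iso R S"
    unfolding triangle_iso_def 1 addcat_extend_hom addcat_extend_defs addcat_extend_sel ..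
qed

lemma triangle_isoE:
  assumes "triangle_iso C S (u, v, w) (u', v', w')"
  obtains a b c where "is_iso C a" "is_iso C b" "is_iso C c"
    "Dom C a = Dom C u" "Cod C a = Dom C u'" "Dom C b = Cod C u" "Cod C b = Cod C u'"
    "Dom C c = Cod C v" "Cod C c = Cod C v'" "b \<cdot>\<^bsub>C\<^esub> u = u' \<cdot>\<^bsub>C\<^esub> a" "c \<cdot>\<^bsub>C\<^esub> v = v' \<cdot>\<^bsub>C\<^esub> b"
    "fmor S a \<cdot>\<^bsub>C\<^esub> w = w' \<cdot>\<^bsub>C\<^esub> c"
    "u \<in> Arr C" "v \<in> Arr C" "w \<in> Arr C" "Dom C v = Cod C u" "Dom C w = Cod C v"
    "Cod C w = fobj S (Dom C u)"
    "u' \<in> Arr C" "v' \<in> Arr C" "w' \<in> Arr C" "Dom C v' = Cod C u'" "Dom C w' = Cod C v'"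
    "Cod C w' = fobj S (Dom C u')"
  using assms unfolding triangle_iso_def candidate_triangle_def split_conv Bex_def hom_iff by metis

lemma triangle_isoI:
  assumes "is_iso C a" "is_iso C b" "is_iso C c"
    "Dom C a = Dom C u" "Cod C a = Dom C u'" "Dom C b = Cod C u" "Cod C b = Cod C u'"
    "Dom C c = Cod C v" "Cod C c = Cod C v'" "b \<cdot>\<^bsub>C\<^esub> u = u' \<cdot>\<^bsub>C\<^esub> a" "c \<cdot>\<^bsub>C\<^esub> v = v' \<cdot>\<^bsub>C\<^esub> b"
    "fmor S a \<cdot>\<^bsub>C\<^esub> w = w' \<cdot>\<^bsub>C\<^esub> c"
    "u \<in> Arr C" "v \<in> Arr C" "w \<in> Arr C" "Dom C v = Cod C u" "Dom C w = Cod C v"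
    "Cod C w = fobj S (Dom C u)"
    "u' \<in> Arr C" "v' \<in> Arr C" "w' \<in> Arr C" "Dom C v' = Cod C u'" "Dom C w' = Cod C v'"
    "Cod C w' = fobj S (Dom C u')"
  shows "triangle_iso C S (u, v, w) (u', v', w')"
proof -
  have "a \<in> Arr C" "b \<in> Arr C" "c \<in> Arr C" using assms(1-3) by (auto simp: is_iso_def)
  thus ?thesis unfolding triangle_iso_def candidate_triangle_def split_conv hom_iff using assms by blast
qed

text \<open>Composition and rotation of isomorphisms of candidates need only an additive
  endofunctor. They are wanted before the suspension of complexes is known to belong to a
  triangulated structure.\<close>

locale candidate_category = additive_functor C C S
  for C :: "('o, 'm, 'z) addcat_scheme" (structure) and S :: "('o, 'm, 'o, 'm) catfun"
begin

lemma triangle_iso_refl: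
  "candidate_triangle C S (u, v, w) \<Longrightarrow> triangle_iso C S (u, v, w) (u, v, w)"
  unfolding candidate_triangle_def
  by (auto intro!: triangle_isoI[of _ "Id C (Dom C u)" "Id C (Cod C u)" "Id C (Cod C v)"])

lemma triangle_iso_trans:
  assumes "triangle_iso C S (u, v, w) (u', v', w')" "triangle_iso C S (u', v', w') (u'', v'', w'')"
  shows "triangle_iso C S (u, v, w) (u'', v'', w'')"
proof -
  obtain a b c where 1: "is_iso C a" "is_iso C b" "is_iso C c"
    "Dom C a = Dom C u" "Cod C a = Dom C u'" "Dom C b = Cod C u" "Cod C b = Cod C u'"
    "Dom C c = Cod C v" "Cod C c = Cod C v'" and eq: "b \<cdot> u = u' \<cdot> a" "c \<cdot> v = v' \<cdot> b"
    "fmor S a \<cdot> w = w' \<cdot> c" and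
    2: "u \<in> Arr C" "v \<in> Arr C" "w \<in> Arr C" "Dom C v = Cod C u" "Dom C w = Cod C v"
    "Cod C w = fobj S (Dom C u)" "u' \<in> Arr C" "v' \<in> Arr C" "w' \<in> Arr C" "Dom C v' = Cod C u'"
    "Dom C w' = Cod C v'" "Cod C w' = fobj S (Dom C u')"
    by (rule triangle_isoE[OF assms(1)]) 
  obtain a' b' c' where 3: "is_iso C a'" "is_iso C b'" "is_iso C c'"
    "Dom C a' = Dom C u'" "Cod C a' = Dom C u''" "Dom C b' = Cod C u'" "Cod C b' = Cod C u''"
    "Dom C c' = Cod C v'" "Cod C c' = Cod C v''" and eq': "b' \<cdot> u' = u'' \<cdot> a'" "c' \<cdot> v' = v'' \<cdot> b'"
    "fmor S a' \<cdot> w' = w'' \<cdot> c'" and "u' \<in> Arr C" "v' \<in> Arr C" "w' \<in> Arr C" "Dom C v' = Cod C u'"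
    "Dom C w' = Cod C v'" "Cod C w' = fobj S (Dom C u')" and
    4: "u'' \<in> Arr C" "v'' \<in> Arr C" "w'' \<in> Arr C" "Dom C v'' = Cod C u''"
    "Dom C w'' = Cod C v''" "Cod C w'' = fobj S (Dom C u'')"
    by (rule triangle_isoE[OF assms(2)]) 
  note [simp] = 1 2 3 4
  show ?thesis
    by (rule triangle_isoI[of _ "a' \<cdot> a" "b' \<cdot> b" "c' \<cdot> c"])
      (simp_all add: eq source.comp_reduce[OF eq'(1)] source.comp_reduce[OF eq'(2)]
        source.comp_reduce[OF eq'(3)])
qed

lemma triangle_iso_rotate:
  assumes "triangle_iso C S (u, v, w) (u', v', w')"
  shows "triangle_iso C S (v, w, Neg C (fmor S u)) (v', w', Neg C (fmor S u'))"
proof -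
  obtain a b c where 1: "is_iso C a" "is_iso C b" "is_iso C c"
    "Dom C a = Dom C u" "Cod C a = Dom C u'" "Dom C b = Cod C u" "Cod C b = Cod C u'"
    "Dom C c = Cod C v" "Cod C c = Cod C v'" and eq: "b \<cdot> u = u' \<cdot> a" "c \<cdot> v = v' \<cdot> b"
    "fmor S a \<cdot> w = w' \<cdot> c" and
    2: "u \<in> Arr C" "v \<in> Arr C" "w \<in> Arr C" "Dom C v = Cod C u" "Dom C w = Cod C v"
    "Cod C w = fobj S (Dom C u)" "u' \<in> Arr C" "v' \<in> Arr C" "w' \<in> Arr C" "Dom C v' = Cod C u'"
    "Dom C w' = Cod C v'" "Cod C w' = fobj S (Dom C u')"
    by (rule triangle_isoE[OF assms(1)]) 
  note [simp] = 1 2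
  have "fmor S b \<cdot> fmor S u = fmor S u' \<cdot> fmor S a"
    using arg_cong[OF eq(1), of "fmor S"] by simp
  thus ?thesis
    by (intro triangle_isoI[of _ b c "fmor S a"]) (simp_all add: eq)
qed

end

subsection \<open>Cones and degreewise split extensions\<close>

locale complexes = additive_category C
  for C :: "('o, 'm, 'z) addcat_scheme" (structure)

sublocale complexes \<subseteq> ch: ideal_quotient "Chb C" "null_homotopic C"
  by (rule null_homotopic_ideal)

context complexes
begin

lemma Kb_sel [simp]:
  "Obj (Kb C) = bounded_complexes C" "Arr (Kb C) = Arr ch.Q" "Dom (Kb C) = Dom ch.Q"
  "Cod (Kb C) = Cod ch.Q" "Id (Kb C) = Id ch.Q" "Comp (Kb C) = Comp ch.Q" "Add (Kb C) = Add ch.Q"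
  "Zero (Kb C) = Zero ch.Q" "Sh (Kb C) = Kb_shift C" "Neg (Kb C) = Neg ch.Q"
  "is_iso (Kb C) = is_iso ch.Q" "is_zero (Kb C) = is_zero ch.Q"
  "is_biproduct (Kb C) = is_biproduct ch.Q" "isomorphic (Kb C) = isomorphic ch.Q"
  "triangle_iso (Kb C) = triangle_iso ch.Q" "candidate_triangle (Kb C) = candidate_triangle ch.Q"
  by (auto simp: Kb_def tricat.defs ext Let_def fun_eq_iff) (simp_all add: addcat.defs)

lemma Kb_tri: "t \<in> Tri (Kb C) \<longleftrightarrow> (\<exists>f Z v w. f \<in> Arr (Chb C) \<and> is_cone C f Z v w \<and>
    triangle_iso ch.Q (Kb_shift C) (hcls C f, hcls C v, hcls C w) t)"
  by (simp add: Kb_def tricat.defs Let_def addcat.defs)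

end

sublocale complexes \<subseteq> kq: additive_category "quotient_cat (Chb C) (null_homotopic C)"
  by (rule ch.Q_additive)

context complexes
begin

lemma hcls_eqI:
  assumes f: "f \<in> Arr (Chb C)" and g: "g \<in> Arr (Chb C)" and fg: "csrc g = csrc f" "ctgt g = ctgt f"
    and s: "\<And>i. s i \<in> Arr C" "\<And>i. Dom C (s i) = cob (csrc f) i" "\<And>i. Cod C (s i) = cob (ctgt f) (i - 1)"
    and eq: "\<And>i. ccomp f i = ccomp g i \<oplus> (cdiff (ctgt f) (i - 1) \<cdot> s i \<oplus> s (i + 1) \<cdot> cdiff (csrc f) i)"
  shows "hcls C f = hcls C g"
proof -
  note [simp] = cmapD[OF f] cmap_simps[OF f] cmap_simps[OF g] s fg
  have n: "cneg g \<in> Arr (Chb C)" using cneg_arr[OF g] .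
  have "f \<oplus>\<^bsub>Chb C\<^esub> Neg (Chb C) g \<in> null_homotopic C"
    using f g eq add_commute by (intro null_homotopicI[of _ s] ch.add_simps)
      (simp_all add: Chb_neg[OF g] Chb_unfold cneg_arr)
  thus ?thesis using f g fg by (subst ch.cls_eq_iff) auto
qed

text \<open>Two representatives differ by a null homotopic map, and \<open>Fm\<close> keeps that
  property, so the value on a class does not depend on the representative. Serves both the
  suspension and its inverse.\<close>

lemma Kb_functorI:
  assumes o: "\<And>X. X \<in> bounded_complexes C \<Longrightarrow> Fo X \<in> bounded_complexes C"
    and m: "\<And>f. f \<in> Arr (Chb C) \<Longrightarrow> Fm f \<in> Arr (Chb C)" "\<And>f. csrc (Fm f) = Fo (csrc f)"
      "\<And>f. ctgt (Fm f) = Fo (ctgt f)"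
    and add: "\<And>f g. Fm (f \<oplus>\<^bsub>Chb C\<^esub> g) = Fm f \<oplus>\<^bsub>Chb C\<^esub> Fm g"
    and comp: "\<And>f g. Fm (g \<cdot>\<^bsub>Chb C\<^esub> f) = Fm g \<cdot>\<^bsub>Chb C\<^esub> Fm f"
    and id: "\<And>X. Fm (Id (Chb C) X) = Id (Chb C) (Fo X)"
    and null: "\<And>f. f \<in> null_homotopic C \<Longrightarrow> Fm f \<in> null_homotopic C"
  defines "F \<equiv> \<lparr>fobj = Fo, fmor = (\<lambda>F. hcls C (Fm (rep F)))\<rparr>"
  shows "f \<in> Arr (Chb C) \<Longrightarrow> fmor F (hcls C f) = hcls C (Fm f)"
    and "additive_functor ch.Q ch.Q F"
proof -
  show v: "fmor F (hcls C f) = hcls C (Fm f)" if f [simp]: "f \<in> Arr (Chb C)" for f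
  proof -
    let ?r = "rep (hcls C f)"
    note r = ch.rep_cls[OF f]
    have [simp]: "?r \<in> Arr (Chb C)" "csrc ?r = csrc f" "ctgt ?r = ctgt f" using r(1-3) by simp_all
    note [simp] = m
    have "(?r \<oplus>\<^bsub>Chb C\<^esub> Neg (Chb C) f) \<oplus>\<^bsub>Chb C\<^esub> f = ?r" by simp
    hence e: "?r = (?r \<oplus>\<^bsub>Chb C\<^esub> Neg (Chb C) f) \<oplus>\<^bsub>Chb C\<^esub> f" by (rule sym)
    have "Fm ?r = Fm (?r \<oplus>\<^bsub>Chb C\<^esub> Neg (Chb C) f) \<oplus>\<^bsub>Chb C\<^esub> Fm f"
      by (subst e) (rule add)
    hence "Fm ?r \<oplus>\<^bsub>Chb C\<^esub> Neg (Chb C) (Fm f) = Fm (?r \<oplus>\<^bsub>Chb C\<^esub> Neg (Chb C) f)" 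
      using m(1)[of "?r \<oplus>\<^bsub>Chb C\<^esub> Neg (Chb C) f"] ch.add_simps[of ?r "Neg (Chb C) f"] by simp
    hence "Fm ?r \<oplus>\<^bsub>Chb C\<^esub> Neg (Chb C) (Fm f) \<in> null_homotopic C" using null[OF r(5)] by simp
    thus ?thesis unfolding F_def using ch.cls_eq_iff[of "Fm ?r" "Fm f"] by simp
  qed
  show "additive_functor ch.Q ch.Q F"
  proof (intro additive_functor.intro additive_functor_axioms.intro)
    fix X Y assume "X \<in> Obj ch.Q" "Y \<in> Obj ch.Q"
    show "fmor F \<in> hom (HomGrp ch.Q X Y) (HomGrp ch.Q (fobj F X) (fobj F Y))"
      unfolding hom_def HomGrp_def monoid.simps partial_object.simps
    proof (intro CollectI conjI Pi_I ballI)
      fix x assume "x \<in> Hom ch.Q X Y"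
      then obtain f where f: "f \<in> Arr (Chb C)" "csrc f = X" "ctgt f = Y" "x = hcls C f"
        unfolding ch.Q_hom by auto
      show "fmor F x \<in> Hom ch.Q (fobj F X) (fobj F Y)"
        using m f v[OF f(1)] by (simp add: F_def)
      fix y assume "y \<in> Hom ch.Q X Y"
      then obtain g where g: "g \<in> Arr (Chb C)" "csrc g = X" "ctgt g = Y" "y = hcls C g"
        unfolding ch.Q_hom by auto
      show "fmor F (x \<oplus>\<^bsub>ch.Q\<^esub> y) = fmor F x \<oplus>\<^bsub>ch.Q\<^esub> fmor F y"
        using m f g v[OF f(1)] v[OF g(1)] v[of "f \<oplus>\<^bsub>Chb C\<^esub> g"] by (simp add: add)
    qed
  next
    fix f X Y g Z assume "f \<in> Hom ch.Q X Y" "g \<in> Hom ch.Q Y Z"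
    then obtain f' g' where f: "f' \<in> Arr (Chb C)" "g' \<in> Arr (Chb C)" "csrc g' = ctgt f'"
      "f = hcls C f'" "g = hcls C g'" unfolding ch.Q_hom by auto
    show "fmor F (g \<cdot>\<^bsub>ch.Q\<^esub> f) = fmor F g \<cdot>\<^bsub>ch.Q\<^esub> fmor F f"
      using m f v[OF f(1)] v[OF f(2)] v[of "g' \<cdot>\<^bsub>Chb C\<^esub> f'"] by (simp add: comp)
  next
    fix X assume "X \<in> Obj ch.Q"
    thus "fmor F (Id ch.Q X) = Id ch.Q (fobj F X)" using v[of "Id (Chb C) X"] id[of X] by (simp add: F_def)
  qed (use o in \<open>auto simp: F_def ch.Q_additive\<close>)
qed

section \<open>The suspension of the homotopy category\<close>

lemma shift_sel [simp]:
  "cob (shift_cplx C X) i = cob X (i + 1)" "cdiff (shift_cplx C X) i = Neg C (cdiff X (i + 1))"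
  "csrc (shift_cmap C f) = shift_cplx C (csrc f)" "ctgt (shift_cmap C f) = shift_cplx C (ctgt f)"
  "ccomp (shift_cmap C f) i = ccomp f (i + 1)"
  by (simp_all add: shift_cplx_def shift_cmap_def)

lemma shift_obj [simp]:
  assumes [simp]: "X \<in> bounded_complexes C"
  shows "shift_cplx C X \<in> bounded_complexes C"
proof -
  obtain a b where "concentrated C {a..b} X" using bounded_complexE[OF assms] .
  hence "concentrated C {a - 1..b - 1} (shift_cplx C X)" by (auto simp: concentrated_def)
  moreover have "cdiff X (2 + i) \<cdot> cdiff X (i + 1) = Zero C (cob X (i + 1)) (cob X (3 + i))" for i
    using cplx_simps(5)[OF assms, of "i + 1"] by (simp add: algebra_simps)
  ultimately show ?thesis by (intro bounded_complexI) (auto simp: algebra_simps)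
qed

lemma shift_arr [simp]:
  assumes f: "f \<in> Arr (Chb C)"
  shows "shift_cmap C f \<in> Arr (Chb C)"
proof -
  note [simp] = cmapD[OF f] cmap_simps[OF f] cmap_comm(1)[OF f]
  show ?thesis using cmap_comm(1)[OF f, of "i + 1" for i] by (intro cmapI) auto
qed

text \<open>A strict inverse of the suspension on bounded complexes, including the sign of the
  differential.\<close>

definition unshift_cplx :: "('o, 'm) cplx \<Rightarrow> ('o, 'm) cplx" where
  "unshift_cplx X = \<lparr>cob = (\<lambda>i. cob X (i - 1)), cdiff = (\<lambda>i. Neg C (cdiff X (i - 1)))\<rparr>"

definition unshift_cmap :: "('o, 'm) cmap \<Rightarrow> ('o, 'm) cmap" where
  "unshift_cmap f = \<lparr>csrc = unshift_cplx (csrc f), ctgt = unshift_cplx (ctgt f),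
     ccomp = (\<lambda>i. ccomp f (i - 1))\<rparr>"

lemma unshift_sel [simp]:
  "cob (unshift_cplx X) i = cob X (i - 1)" "cdiff (unshift_cplx X) i = Neg C (cdiff X (i - 1))"
  "csrc (unshift_cmap f) = unshift_cplx (csrc f)" "ctgt (unshift_cmap f) = unshift_cplx (ctgt f)"
  "ccomp (unshift_cmap f) i = ccomp f (i - 1)"
  by (simp_all add: unshift_cplx_def unshift_cmap_def)

lemma unshift_obj [simp]:
  assumes [simp]: "X \<in> bounded_complexes C"
  shows "unshift_cplx X \<in> bounded_complexes C"
proof -
  obtain a b where "concentrated C {a..b} X" using bounded_complexE[OF assms] .
  hence "concentrated C {a + 1..b + 1} (unshift_cplx X)" by (auto simp: concentrated_def)
  thus ?thesis by (intro bounded_complexI) (auto simp: algebra_simps)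
qed

lemma unshift_arr [simp]:
  assumes f: "f \<in> Arr (Chb C)"
  shows "unshift_cmap f \<in> Arr (Chb C)"
proof -
  note [simp] = cmapD[OF f] cmap_simps[OF f] cmap_comm(2)[OF f]
  show ?thesis by (intro cmapI) auto
qed

lemma unshift_shift [simp]:
  assumes "X \<in> bounded_complexes C"
  shows "unshift_cplx (shift_cplx C X) = X" "shift_cplx C (unshift_cplx X) = X"
  using assms by (auto intro!: cplx_eqI)

lemma unshift_shift_cmap [simp]:
  assumes "f \<in> Arr (Chb C)"
  shows "unshift_cmap (shift_cmap C f) = f" "shift_cmap C (unshift_cmap f) = f"
  using cmapD[OF assms] by (auto intro!: cmap_eqI)

text \<open>The suspension negates differentials, so the homotopy has to change its sign as well in
  order to have the same boundary.\<close>

lemma shift_null: "f \<in> null_homotopic C \<Longrightarrow> shift_cmap C f \<in> null_homotopic C"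
proof -
  assume F: "f \<in> null_homotopic C"
  obtain s where f: "f \<in> Arr (Chb C)" and s [simp]: "\<And>i. s i \<in> Arr C" "\<And>i. Dom C (s i) = cob (csrc f) i"
    "\<And>i. Cod C (s i) = cob (ctgt f) (i - 1)" and
    fs: "\<And>i. ccomp f i = cdiff (ctgt f) (i - 1) \<cdot> s i \<oplus> s (i + 1) \<cdot> cdiff (csrc f) i"
    using F unfolding null_homotopic_def hom_iff by blast
  note [simp] = cmapD[OF f]
  show ?thesis
    by (rule null_homotopicI[where s = "\<lambda>i. Neg C (s (i + 1))"]) (simp_all add: f fs)
qed

lemma unshift_null: "f \<in> null_homotopic C \<Longrightarrow> unshift_cmap f \<in> null_homotopic C"
proof -
  assume F: "f \<in> null_homotopic C"
  obtain s where f: "f \<in> Arr (Chb C)" and s [simp]: "\<And>i. s i \<in> Arr C" "\<And>i. Dom C (s i) = cob (csrc f) i"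
    "\<And>i. Cod C (s i) = cob (ctgt f) (i - 1)" and
    fs: "\<And>i. ccomp f i = cdiff (ctgt f) (i - 1) \<cdot> s i \<oplus> s (i + 1) \<cdot> cdiff (csrc f) i"
    using F unfolding null_homotopic_def hom_iff by blast
  note [simp] = cmapD[OF f]
  show ?thesis
    by (rule null_homotopicI[where s = "\<lambda>i. Neg C (s (i - 1))"]) (simp_all add: f fs)
qed

lemma Kb_shift_functor:
  shows Kb_shift_mor [simp]: "f \<in> Arr (Chb C) \<Longrightarrow> fmor (Kb_shift C) (hcls C f) = hcls C (shift_cmap C f)"
    and Kb_shift_additive: "additive_functor ch.Q ch.Q (Kb_shift C)"
  unfolding Kb_shift_def
  by (rule Kb_functorI[where Fo = "shift_cplx C" and Fm = "shift_cmap C"];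
      auto intro!: cmap_eqI simp: Chb_unfold shift_null)+

lemma Kb_shift_obj [simp]: "fobj (Kb_shift C) X = shift_cplx C X"
  by (simp add: Kb_shift_def)

definition Kb_unshift :: "(('o, 'm) cplx, ('o, 'm) cmap set, ('o, 'm) cplx, ('o, 'm) cmap set) catfun" where
  "Kb_unshift = \<lparr>fobj = unshift_cplx, fmor = (\<lambda>F. hcls C (unshift_cmap (rep F)))\<rparr>"

lemma Kb_unshift_functor:
  shows "f \<in> Arr (Chb C) \<Longrightarrow> fmor Kb_unshift (hcls C f) = hcls C (unshift_cmap f)"
    and "additive_functor ch.Q ch.Q Kb_unshift"
  unfolding Kb_unshift_def
  by (rule Kb_functorI[where Fo = unshift_cplx and Fm = unshift_cmap];
      auto intro!: cmap_eqI simp: Chb_unfold unshift_null)+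

lemma Kb_additive: "additive_category (Kb C)"
  unfolding Kb_def Let_def by (rule additive_category_extend) (rule ch.Q_additive)

lemma Kb_functor_extend:
  "additive_functor ch.Q ch.Q F \<Longrightarrow> additive_functor (Kb C) (Kb C) F"
  using Kb_additive unfolding additive_functor_def additive_functor_axioms_def
  by (simp add: Kb_def Let_def addcat_extend_hom)

lemma Kb_shift_equivalence: "equivalence (Kb C) (Kb C) (Sh (Kb C))"
  unfolding equivalence_def
proof (intro conjI exI)
  show "additive_functor (Kb C) (Kb C) (Sh (Kb C))" "additive_functor (Kb C) (Kb C) Kb_unshift"
    using Kb_functor_extend Kb_shift_additive Kb_unshift_functor by auto
  have [simp]: "fobj Kb_unshift X = unshift_cplx X" for X by (simp add: Kb_unshift_def)
  note [simp] = Kb_unshift_functor(1)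
  \<comment> \<open>Since the two functors are strictly inverse to each other on complexes,
    identities serve as unit and counit.\<close>
  show "natural_iso (Kb C) (Kb C) id_fun (comp_fun Kb_unshift (Sh (Kb C))) (Id (Kb C))"
    "natural_iso (Kb C) (Kb C) (comp_fun (Sh (Kb C)) Kb_unshift) id_fun (Id (Kb C))"
    using kq.iso_Id unfolding natural_iso_def
    by (auto simp del: ch.Q_id elim!: ch.Q_cases)
qed

lemma is_cone_ex:
  assumes f: "f \<in> Arr (Chb C)"
  shows "\<exists>Z a b p q.
    (\<forall>i. is_biproduct C (cob (csrc f) (i + 1)) (cob (ctgt f) i) (cob Z i) (a i) (b i) (p i) (q i)) \<and>
    (\<forall>i. cdiff Z i = a (i + 1) \<cdot> Neg C (cdiff (csrc f) (i + 1)) \<cdot> p i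
          \<oplus> b (i + 1) \<cdot> ccomp f (i + 1) \<cdot> p i \<oplus> b (i + 1) \<cdot> cdiff (ctgt f) i \<cdot> q i) \<and>
    is_cone C f Z \<lparr>csrc = ctgt f, ctgt = Z, ccomp = b\<rparr> \<lparr>csrc = Z, ctgt = shift_cplx C (csrc f), ccomp = p\<rparr>"
proof -
  note [simp] = cmapD[OF f] cmap_simps[OF f]
  obtain S a b p q where
    B: "\<And>i. is_biproduct C (cob (csrc f) (i + 1)) (cob (ctgt f) i) (S i) (a i) (b i) (p i) (q i)"
    using family_biproduct[of "\<lambda>i. cob (csrc f) (i + 1)" "cob (ctgt f)"] by (metis cmapD[OF f] cplx_simps(1))
  let ?Z = "\<lparr>cob = S, cdiff = (\<lambda>i. a (i + 1) \<cdot> Neg C (cdiff (csrc f) (i + 1)) \<cdot> p i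
          \<oplus> b (i + 1) \<cdot> ccomp f (i + 1) \<cdot> p i \<oplus> b (i + 1) \<cdot> cdiff (ctgt f) i \<cdot> q i)\<rparr>"
  have "is_cone C f ?Z \<lparr>csrc = ctgt f, ctgt = ?Z, ccomp = b\<rparr> \<lparr>csrc = ?Z, ctgt = shift_cplx C (csrc f), ccomp = p\<rparr>"
    unfolding is_cone_def Let_def
    by (intro exI[of _ a] exI[of _ b] exI[of _ p] exI[of _ q]) (simp add: B del: comp_assoc_right)
  thus ?thesis
    by (intro exI[of _ ?Z] exI[of _ a] exI[of _ b] exI[of _ p] exI[of _ q]) (simp add: B del: comp_assoc_right)
qed

text \<open>\<open>Y\<close> is an extension of \<open>Z\<close> by \<open>X\<close> that splits in every degree, with connecting map
  \<open>h : Z \<rightarrow> \<Sigma>X\<close>: \<open>Y\<^sup>i = X\<^sup>i \<oplus> Z\<^sup>i\<close> with differential \<open>(x, z) \<mapsto> (d x - h z, d z)\<close>. A cone of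
  \<open>f : X \<rightarrow> Y\<close> is such an extension of \<open>\<Sigma>X\<close> by \<open>Y\<close>.\<close>

definition split_ext :: "('o, 'm) cplx \<Rightarrow> ('o, 'm) cplx \<Rightarrow> ('o, 'm) cmap \<Rightarrow> ('o, 'm) cplx \<Rightarrow>
    (int \<Rightarrow> 'm) \<Rightarrow> (int \<Rightarrow> 'm) \<Rightarrow> (int \<Rightarrow> 'm) \<Rightarrow> (int \<Rightarrow> 'm) \<Rightarrow> bool" where
  "split_ext X Z h Y \<alpha> \<sigma> \<rho> \<beta> \<longleftrightarrow> X \<in> bounded_complexes C \<and> Z \<in> bounded_complexes C \<and>
     h \<in> Arr (Chb C) \<and> csrc h = Z \<and> ctgt h = shift_cplx C X \<and>
     (\<forall>i. is_biproduct C (cob X i) (cob Z i) (cob Y i) (\<alpha> i) (\<sigma> i) (\<rho> i) (\<beta> i)) \<and>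
     (\<forall>i. cdiff Y i = \<alpha> (i + 1) \<cdot> (cdiff X i \<cdot> \<rho> i) \<oplus>
        (Neg C (\<alpha> (i + 1) \<cdot> (ccomp h i \<cdot> \<beta> i)) \<oplus> \<sigma> (i + 1) \<cdot> (cdiff Z i \<cdot> \<beta> i)))"

abbreviation "inc X Y \<alpha> \<equiv> \<lparr>csrc = X, ctgt = Y, ccomp = \<alpha>\<rparr>"

lemma split_extD:
  assumes s: "split_ext X Z h Y \<alpha> \<sigma> \<rho> \<beta>"
  shows "X \<in> bounded_complexes C" "Z \<in> bounded_complexes C" "h \<in> Arr (Chb C)" "csrc h = Z"
    "ctgt h = shift_cplx C X" 
    "is_biproduct C (cob X i) (cob Z i) (cob Y i) (\<alpha> i) (\<sigma> i) (\<rho> i) (\<beta> i)"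
    "cdiff Y i = \<alpha> (i + 1) \<cdot> (cdiff X i \<cdot> \<rho> i) \<oplus>
        (Neg C (\<alpha> (i + 1) \<cdot> (ccomp h i \<cdot> \<beta> i)) \<oplus> \<sigma> (i + 1) \<cdot> (cdiff Z i \<cdot> \<beta> i))"
    "ccomp h i \<in> Arr C" "Dom C (ccomp h i) = cob Z i" "Cod C (ccomp h i) = cob X (i + 1)"
    "ccomp h (i + 1) \<cdot> cdiff Z i = Neg C (cdiff X (i + 1) \<cdot> ccomp h i)"
    "f \<in> Arr C \<Longrightarrow> Cod C f = cob Z i \<Longrightarrow> ccomp h (i + 1) \<cdot> (cdiff Z i \<cdot> f) = Neg C (cdiff X (i + 1) \<cdot> (ccomp h i \<cdot> f))"
proof -
  show 1: "X \<in> bounded_complexes C" "Z \<in> bounded_complexes C" "h \<in> Arr (Chb C)" "csrc h = Z"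
    "ctgt h = shift_cplx C X"
    and 2: "is_biproduct C (cob X i) (cob Z i) (cob Y i) (\<alpha> i) (\<sigma> i) (\<rho> i) (\<beta> i)"
      "cdiff Y i = \<alpha> (i + 1) \<cdot> (cdiff X i \<cdot> \<rho> i) \<oplus>
        (Neg C (\<alpha> (i + 1) \<cdot> (ccomp h i \<cdot> \<beta> i)) \<oplus> \<sigma> (i + 1) \<cdot> (cdiff Z i \<cdot> \<beta> i))" for i
    using s unfolding split_ext_def by blast+
  show 3: "ccomp h i \<in> Arr C" "Dom C (ccomp h i) = cob Z i" "Cod C (ccomp h i) = cob X (i + 1)" for i
    using cmap_simps[OF 1(3), of i] 1(4,5) by auto
  show 4: "ccomp h (i + 1) \<cdot> cdiff Z i = Neg C (cdiff X (i + 1) \<cdot> ccomp h i)" for i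
    using cmap_comm(1)[OF 1(3), of i] 1 3 by simp
  show "f \<in> Arr C \<Longrightarrow> Cod C f = cob Z i \<Longrightarrow> ccomp h (i + 1) \<cdot> (cdiff Z i \<cdot> f) = Neg C (cdiff X (i + 1) \<cdot> (ccomp h i \<cdot> f))"
    using 1 3 by (subst comp_reduce[OF 4]) (simp_all add: algebra_simps)
qed

lemma split_ext_arr:
  assumes s: "split_ext X Z h Y \<alpha> \<sigma> \<rho> \<beta>"
  shows "Y \<in> bounded_complexes C" "inc X Y \<alpha> \<in> Arr (Chb C)" "inc Y Z \<beta> \<in> Arr (Chb C)"
proof -
  note D = split_extD[OF s]
  note [simp] = D(1-5,8-12) biproduct_simps[OF D(6)] D(7)
  obtain l u l' u' where "concentrated C {l..u} X" "concentrated C {l'..u'} Z"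
    using bounded_complexE[OF D(1)] bounded_complexE[OF D(2)] by metis
  from concentrated_biproduct[OF this D(6)]
  have "concentrated C {min l l'..max u u'} Y" .
  moreover have "cdiff Y (i + 1) \<cdot> cdiff Y i = Zero C (cob Y i) (cob Y (2 + i))" for i
    by simp
  ultimately show [simp]: "Y \<in> bounded_complexes C"
    by (intro bounded_complexI) (simp_all del: D(7), simp_all)
  show "inc X Y \<alpha> \<in> Arr (Chb C)" "inc Y Z \<beta> \<in> Arr (Chb C)"
    by (rule cmapI; simp)+
qed

lemma split_ext_ex:
  assumes X: "X \<in> bounded_complexes C" and h: "h \<in> Arr (Chb C)" "ctgt h = shift_cplx C X"
  obtains Y \<alpha> \<sigma> \<rho> \<beta> where "split_ext X (csrc h) h Y \<alpha> \<sigma> \<rho> \<beta>"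
proof -
  obtain S a b p q where B: "\<And>i. is_biproduct C (cob X i) (cob (csrc h) i) (S i) (a i) (b i) (p i) (q i)"
    using family_biproduct[of "cob X" "cob (csrc h)"] cplx_simps(1)[OF X] cplx_simps(1)[OF cmapD(1)[OF h(1)]]
    by metis
  show thesis
    by (rule that[of "\<lparr>cob = S, cdiff = (\<lambda>i. a (i + 1) \<cdot> (cdiff X i \<cdot> p i) \<oplus>
        (Neg C (a (i + 1) \<cdot> (ccomp h i \<cdot> q i)) \<oplus> b (i + 1) \<cdot> (cdiff (csrc h) i \<cdot> q i)))\<rparr>" a b p q])
      (use assms cmapD[OF h(1)] in \<open>simp add: split_ext_def B\<close>)
qed

text \<open>The cone W of the inclusion of X is made of \<Sigma>X, X and Z, and the first two form
  the contractible cone of the identity of X. So the projection W -> Z is a homotopy equivalence;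
  its inverse has the components \<open>h\<close> and \<sigma>, since the plain inclusion of Z is
  not a chain map. Composed with this inverse, the projection of W to \<Sigma>X is \<open>h\<close>,
  which is what the sign of \<open>h\<close> in the differential of Y is for.\<close>

lemma split_ext_tri:
  assumes s: "split_ext X Z h Y \<alpha> \<sigma> \<rho> \<beta>"
  shows "(hcls C (inc X Y \<alpha>), hcls C (inc Y Z \<beta>), hcls C h) \<in> Tri (Kb C)"
proof -
  note D = split_extD[OF s] and A = split_ext_arr[OF s]
  note [simp] = D(1-5,8-12) biproduct_simps[OF D(6)] A
  let ?f = "inc X Y \<alpha>"
  obtain W a b p q where
    B0: "\<And>i. is_biproduct C (cob (csrc ?f) (i + 1)) (cob (ctgt ?f) i) (cob W i) (a i) (b i) (p i) (q i)" and
    dW0: "\<And>i. cdiff W i = a (i + 1) \<cdot> Neg C (cdiff (csrc ?f) (i + 1)) \<cdot> p i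
          \<oplus> b (i + 1) \<cdot> ccomp ?f (i + 1) \<cdot> p i \<oplus> b (i + 1) \<cdot> cdiff (ctgt ?f) i \<cdot> q i" and
    W0: "is_cone C ?f W \<lparr>csrc = ctgt ?f, ctgt = W, ccomp = b\<rparr> \<lparr>csrc = W, ctgt = shift_cplx C (csrc ?f), ccomp = p\<rparr>"
    using is_cone_ex[OF A(2)] by blast
  note B = B0[unfolded cmap.select_convs] and dW = dW0[unfolded cmap.select_convs]
    and W = W0[unfolded cmap.select_convs]
  note [simp] = biproduct_simps[OF B]
  have dW': "cdiff W i = b (i + 1) \<cdot> (cdiff Y i \<cdot> q i) \<oplus> (Neg C (b (i + 1) \<cdot> (Neg C (\<alpha> (i + 1)) \<cdot> p i))
      \<oplus> a (i + 1) \<cdot> (Neg C (cdiff X (i + 1)) \<cdot> p i))" for i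
    unfolding dW by (simp add: add_ac)
  \<comment> \<open>Read as a split extension of \<Sigma>X by Y with connecting map
    -\<Sigma>\<alpha>, the cone inherits boundedness and the chain map property of its inclusion and
    projection.\<close>
  have "split_ext Y (shift_cplx C X) (cneg (shift_cmap C (inc X Y \<alpha>))) W b a q p"
    unfolding split_ext_def using B biproduct_swap[OF B] dW' by (simp add: cneg_arr)
  from split_ext_arr[OF this]
  have [simp]: "W \<in> bounded_complexes C" "inc Y W b \<in> Arr (Chb C)" "inc W (shift_cplx C X) p \<in> Arr (Chb C)" .
  let ?\<theta> = "inc Z W (\<lambda>i. b i \<cdot> \<sigma> i \<oplus> a i \<cdot> ccomp h i)" and ?r = "inc W Z (\<lambda>i. \<beta> i \<cdot> q i)"
  have [simp]: "?\<theta> \<in> Arr (Chb C)"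
    by (rule cmapI) (simp_all add: dW D(7) add_ac)
  have [simp]: "?r \<in> Arr (Chb C)"
    by (rule cmapI) (simp_all add: dW D(7))
  have r\<theta>: "hcls C (?r \<cdot>\<^bsub>Chb C\<^esub> ?\<theta>) = hcls C (Id (Chb C) Z)"
    by (simp add: Chb_unfold)
  have \<theta>r: "hcls C (Id (Chb C) W) = hcls C (?\<theta> \<cdot>\<^bsub>Chb C\<^esub> ?r)"
  \<comment> \<open>The homotopy sends the summand X of Y to the same object in the summand
    \<Sigma>X, one degree lower: the standard contraction of the cone of an identity.\<close>
  proof (rule hcls_eqI[where s = "\<lambda>i. a (i - 1) \<cdot> (\<rho> i \<cdot> q i)"])
    fix i
    show "a (i - 1) \<cdot> (\<rho> i \<cdot> q i) \<in> Arr C" "Dom C (a (i - 1) \<cdot> (\<rho> i \<cdot> q i)) = cob (csrc (Id (Chb C) W)) i"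
      "Cod C (a (i - 1) \<cdot> (\<rho> i \<cdot> q i)) = cob (ctgt (Id (Chb C) W)) (i - 1)"
      by (simp_all add: Chb_unfold)
    have e1: "cdiff W (i - 1) \<cdot> (a (i - 1) \<cdot> (\<rho> i \<cdot> q i)) =
        Neg C (a i \<cdot> (cdiff X i \<cdot> (\<rho> i \<cdot> q i))) \<oplus> b i \<cdot> (\<alpha> i \<cdot> (\<rho> i \<cdot> q i))"
      by (simp add: dW)
    have e2: "(a i \<cdot> (\<rho> (i + 1) \<cdot> q (i + 1))) \<cdot> cdiff W i =
        a i \<cdot> p i \<oplus> (a i \<cdot> (cdiff X i \<cdot> (\<rho> i \<cdot> q i)) \<oplus> Neg C (a i \<cdot> (ccomp h i \<cdot> (\<beta> i \<cdot> q i))))"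
      by (simp add: dW D(7))
    show "ccomp (Id (Chb C) W) i = ccomp (?\<theta> \<cdot>\<^bsub>Chb C\<^esub> ?r) i \<oplus>
        (cdiff (ctgt (Id (Chb C) W)) (i - 1) \<cdot> (a (i - 1) \<cdot> (\<rho> i \<cdot> q i)) \<oplus>
         (a (i + 1 - 1) \<cdot> (\<rho> (i + 1) \<cdot> q (i + 1))) \<cdot> cdiff (csrc (Id (Chb C) W)) i)"
      (is "_ = ?R")
    proof -
      have R: "?R = (b i \<cdot> (\<sigma> i \<cdot> (\<beta> i \<cdot> q i)) \<oplus> a i \<cdot> (ccomp h i \<cdot> (\<beta> i \<cdot> q i))) \<oplus>
          ((Neg C (a i \<cdot> (cdiff X i \<cdot> (\<rho> i \<cdot> q i))) \<oplus> b i \<cdot> (\<alpha> i \<cdot> (\<rho> i \<cdot> q i))) \<oplus>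
          (a i \<cdot> p i \<oplus> (a i \<cdot> (cdiff X i \<cdot> (\<rho> i \<cdot> q i)) \<oplus> Neg C (a i \<cdot> (ccomp h i \<cdot> (\<beta> i \<cdot> q i))))))"
        using e1 e2 by (simp add: Chb_unfold)
      have "Id C (cob W i) = ?R" unfolding R
      proof (rule biproduct_eq_out[OF B[of i]])
        have "b i = b i \<cdot> (\<alpha> i \<cdot> \<rho> i) \<oplus> b i \<cdot> (\<sigma> i \<cdot> \<beta> i)"
          using biproduct_sum(3)[OF D(6), of "b i" i] by simp
        also have "\<dots> = b i \<cdot> (\<sigma> i \<cdot> \<beta> i) \<oplus> b i \<cdot> (\<alpha> i \<cdot> \<rho> i)" by (rule add_commute) simp_all
        finally have "b i = b i \<cdot> (\<sigma> i \<cdot> \<beta> i) \<oplus> b i \<cdot> (\<alpha> i \<cdot> \<rho> i)" .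
        thus "Id C (cob W i) \<cdot> b i = ((b i \<cdot> (\<sigma> i \<cdot> (\<beta> i \<cdot> q i)) \<oplus> a i \<cdot> (ccomp h i \<cdot> (\<beta> i \<cdot> q i))) \<oplus>
          ((Neg C (a i \<cdot> (cdiff X i \<cdot> (\<rho> i \<cdot> q i))) \<oplus> b i \<cdot> (\<alpha> i \<cdot> (\<rho> i \<cdot> q i))) \<oplus>
          (a i \<cdot> p i \<oplus> (a i \<cdot> (cdiff X i \<cdot> (\<rho> i \<cdot> q i)) \<oplus> Neg C (a i \<cdot> (ccomp h i \<cdot> (\<beta> i \<cdot> q i))))))) \<cdot> b i"
          by simp
      qed simp_all
      thus ?thesis by (simp add: Chb_unfold)
    qed
  qed (use ch.comp_simps[of ?r ?\<theta>] ch.id_simps(1)[of W] in \<open>simp_all add: Chb_unfold\<close>)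
  have "is_iso ch.Q (hcls C ?r)"
    by (rule ch.Q_isoI[of _ ?\<theta>]) (use r\<theta> \<theta>r in auto)
  moreover have "hcls C ?r \<cdot>\<^bsub>ch.Q\<^esub> hcls C (inc Y W b) = hcls C (inc Y Z \<beta>)"
    by (simp add: Chb_unfold)
  moreover have "hcls C (inc W (shift_cplx C X) p) = hcls C h \<cdot>\<^bsub>ch.Q\<^esub> hcls C ?r"
  proof -
    let ?w = "inc W (shift_cplx C X) p"
    have e: "?w \<cdot>\<^bsub>Chb C\<^esub> ?\<theta> = h"
      by (rule cmap_eqI) (simp_all add: Chb_unfold)
    have "hcls C h \<cdot>\<^bsub>ch.Q\<^esub> hcls C ?r = hcls C ((?w \<cdot>\<^bsub>Chb C\<^esub> ?\<theta>) \<cdot>\<^bsub>Chb C\<^esub> ?r)"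
      unfolding e by (rule ch.Q_comp) simp_all
    also have "\<dots> = hcls C ?w \<cdot>\<^bsub>ch.Q\<^esub> hcls C (?\<theta> \<cdot>\<^bsub>Chb C\<^esub> ?r)"
      by simp
    also have "\<dots> = hcls C ?w \<cdot>\<^bsub>ch.Q\<^esub> hcls C (Id (Chb C) W)" unfolding \<theta>r ..
    also have "\<dots> = hcls C ?w" by simp
    finally show ?thesis by simp
  qed
  ultimately have "triangle_iso ch.Q (Kb_shift C)
     (hcls C (inc X Y \<alpha>), hcls C (inc Y W b), hcls C (inc W (shift_cplx C X) p))
     (hcls C (inc X Y \<alpha>), hcls C (inc Y Z \<beta>), hcls C h)"
    by (intro triangle_isoI[of _ "hcls C (Id (Chb C) X)" "hcls C (Id (Chb C) Y)" "hcls C ?r"])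
      (use kq.iso_Id[of X] kq.iso_Id[of Y] Kb_shift_mor[of "Id (Chb C) X"] in \<open>simp_all\<close>,
        (simp add: shift_cmap_def Chb_unfold)?)
  thus ?thesis unfolding Kb_tri using W A by blast
qed

end

subsection \<open>The triangulated structure\<close>

text \<open>Triangles of complexes are only isomorphic to cones; conjugation with the given
  isomorphisms lets TR3 be checked on the cones.\<close>

lemma (in candidate_category) TR3_transport:
  assumes t: "triangle_iso C S (u0, v0, w0) (u, v, w)" "triangle_iso C S (u0', v0', w0') (u', v', w')"
    and ab: "a \<in> Arr C" "b \<in> Arr C" "Dom C a = Dom C u" "Cod C a = Dom C u'" "Dom C b = Cod C u"
      "Cod C b = Cod C u'" "b \<cdot> u = u' \<cdot> a"
    and TR3: "\<And>a b. \<lbrakk>a \<in> Arr C; b \<in> Arr C; Dom C a = Dom C u0; Cod C a = Dom C u0'; Dom C b = Cod C u0;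
      Cod C b = Cod C u0'; b \<cdot> u0 = u0' \<cdot> a\<rbrakk> \<Longrightarrow> \<exists>c. c \<in> Arr C \<and> Dom C c = Cod C v0 \<and> Cod C c = Cod C v0' \<and>
        c \<cdot> v0 = v0' \<cdot> b \<and> fmor S a \<cdot> w0 = w0' \<cdot> c"
  shows "\<exists>c. c \<in> Arr C \<and> Dom C c = Cod C v \<and> Cod C c = Cod C v' \<and> c \<cdot> v = v' \<cdot> b \<and> fmor S a \<cdot> w = w' \<cdot> c"
proof -
  obtain a1 b1 c1 where 1: "is_iso C a1" "is_iso C b1" "is_iso C c1"
    "Dom C a1 = Dom C u0" "Cod C a1 = Dom C u" "Dom C b1 = Cod C u0" "Cod C b1 = Cod C u"
    "Dom C c1 = Cod C v0" "Cod C c1 = Cod C v" and e1: "b1 \<cdot> u0 = u \<cdot> a1" "c1 \<cdot> v0 = v \<cdot> b1"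
    "fmor S a1 \<cdot> w0 = w \<cdot> c1" and
    2: "u0 \<in> Arr C" "v0 \<in> Arr C" "w0 \<in> Arr C" "Dom C v0 = Cod C u0" "Dom C w0 = Cod C v0"
    "Cod C w0 = fobj S (Dom C u0)" "u \<in> Arr C" "v \<in> Arr C" "w \<in> Arr C" "Dom C v = Cod C u"
    "Dom C w = Cod C v" "Cod C w = fobj S (Dom C u)"
    by (rule triangle_isoE[OF t(1)]) 
  obtain a2 b2 c2 where 3: "is_iso C a2" "is_iso C b2" "is_iso C c2"
    "Dom C a2 = Dom C u0'" "Cod C a2 = Dom C u'" "Dom C b2 = Cod C u0'" "Cod C b2 = Cod C u'"
    "Dom C c2 = Cod C v0'" "Cod C c2 = Cod C v'" and e2: "b2 \<cdot> u0' = u' \<cdot> a2" "c2 \<cdot> v0' = v' \<cdot> b2"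
    "fmor S a2 \<cdot> w0' = w' \<cdot> c2" and
    4: "u0' \<in> Arr C" "v0' \<in> Arr C" "w0' \<in> Arr C" "Dom C v0' = Cod C u0'" "Dom C w0' = Cod C v0'"
    "Cod C w0' = fobj S (Dom C u0')" "u' \<in> Arr C" "v' \<in> Arr C" "w' \<in> Arr C" "Dom C v' = Cod C u'"
    "Dom C w' = Cod C v'" "Cod C w' = fobj S (Dom C u')"
    by (rule triangle_isoE[OF t(2)]) 
  note [simp] = 1 2 3 4 ab(1-6)
  let ?a = "source.Inv a2 \<cdot> (a \<cdot> a1)" and ?b = "source.Inv b2 \<cdot> (b \<cdot> b1)"
  have "b2 \<cdot> (?b \<cdot> u0) = b2 \<cdot> (u0' \<cdot> ?a)"
    using source.comp_reduce[OF e2(1), of ?a] source.comp_reduce[OF ab(7), of a1] by (simp add: e1)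
  hence "?b \<cdot> u0 = u0' \<cdot> ?a" by (rule_tac source.iso_left_cancel[of b2]) auto
  from TR3[OF _ _ _ _ _ _ this] obtain c where c [simp]: "c \<in> Arr C" "Dom C c = Cod C v0" "Cod C c = Cod C v0'"
    and cv: "c \<cdot> v0 = v0' \<cdot> ?b" "fmor S ?a \<cdot> w0 = w0' \<cdot> c" by auto
  let ?c = "c2 \<cdot> (c \<cdot> source.Inv c1)"
  have v: "v = c1 \<cdot> (v0 \<cdot> source.Inv b1)"
    using source.comp_reduce[OF e1(2), of "source.Inv b1"] by simp
  have w: "w = fmor S a1 \<cdot> (w0 \<cdot> source.Inv c1)"
    using source.comp_reduce[OF e1(3), of "source.Inv c1"] by simp
  have "?c \<cdot> v = c2 \<cdot> (c \<cdot> (v0 \<cdot> source.Inv b1))" by (subst v) simp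
  also have "\<dots> = v' \<cdot> b"
    using source.comp_reduce[OF cv(1), of "source.Inv b1"] source.comp_reduce[OF e2(2), of "?b \<cdot> source.Inv b1"]
    by simp
  finally have p1: "?c \<cdot> v = v' \<cdot> b" .
  have "fmor S a \<cdot> w = fmor S a2 \<cdot> ((fmor S ?a \<cdot> w0) \<cdot> source.Inv c1)" by (subst w) simp
  also have "\<dots> = w' \<cdot> ?c"
    unfolding cv(2) using source.comp_reduce[OF e2(3), of "c \<cdot> source.Inv c1"] by simp
  finally have "fmor S a \<cdot> w = w' \<cdot> ?c" .
  thus ?thesis using p1 by (intro exI[of _ ?c]) simp
qed

sublocale complexes \<subseteq> cc: candidate_category "quotient_cat (Chb C) (null_homotopic C)" "Kb_shift C"
  by (rule candidate_category.intro) (rule Kb_shift_additive)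

context complexes
begin

lemma cone_split_ext:
  assumes f: "f \<in> Arr (Chb C)" and Z: "is_cone C f Z v w"
  obtains a b p q where
    "split_ext (ctgt f) (shift_cplx C (csrc f)) (cneg (shift_cmap C f)) Z b a q p"
    "v = inc (ctgt f) Z b" "w = inc Z (shift_cplx C (csrc f)) p"
    "\<forall>i. is_biproduct C (cob (csrc f) (i + 1)) (cob (ctgt f) i) (cob Z i) (a i) (b i) (p i) (q i)"
    "\<forall>i. cdiff Z i = b (i + 1) \<cdot> (cdiff (ctgt f) i \<cdot> q i) \<oplus> (b (i + 1) \<cdot> (ccomp f (i + 1) \<cdot> p i) \<oplus>
      Neg C (a (i + 1) \<cdot> (cdiff (csrc f) (i + 1) \<cdot> p i)))"
proof -
  note [simp] = cmapD[OF f] cmap_simps[OF f]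
  obtain a b p q where
    B: "\<And>i. is_biproduct C (cob (csrc f) (i + 1)) (cob (ctgt f) i) (cob Z i) (a i) (b i) (p i) (q i)" and
    dZ: "\<And>i. cdiff Z i = a (i + 1) \<cdot> Neg C (cdiff (csrc f) (i + 1)) \<cdot> p i
          \<oplus> b (i + 1) \<cdot> ccomp f (i + 1) \<cdot> p i \<oplus> b (i + 1) \<cdot> cdiff (ctgt f) i \<cdot> q i" and
    vw: "v = \<lparr>csrc = ctgt f, ctgt = Z, ccomp = b\<rparr>" "w = \<lparr>csrc = Z, ctgt = shift_cplx C (csrc f), ccomp = p\<rparr>"
    using Z unfolding is_cone_def Let_def by blast
  note [simp] = biproduct_simps[OF B]
  have dZ': "cdiff Z i = b (i + 1) \<cdot> (cdiff (ctgt f) i \<cdot> q i) \<oplus> (b (i + 1) \<cdot> (ccomp f (i + 1) \<cdot> p i) \<oplus>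
      Neg C (a (i + 1) \<cdot> (cdiff (csrc f) (i + 1) \<cdot> p i)))" for i
    unfolding dZ by (simp add: add_ac)
  show thesis
  proof (rule that[of b a q p])
    show "split_ext (ctgt f) (shift_cplx C (csrc f)) (cneg (shift_cmap C f)) Z b a q p"
      unfolding split_ext_def using f biproduct_swap[OF B] by (simp add: cneg_arr dZ')
  qed (use B dZ' vw in blast)+
qed

lemma hcls_eqD:
  assumes f: "f \<in> Arr (Chb C)" and g: "g \<in> Arr (Chb C)" and fg: "csrc g = csrc f" "ctgt g = ctgt f"
    and eq: "hcls C f = hcls C g"
  shows "\<exists>s. \<forall>i. s i \<in> Arr C \<and> Dom C (s i) = cob (csrc f) i \<and> Cod C (s i) = cob (ctgt f) (i - 1) \<and>
    ccomp f i = s (i + 1) \<cdot> cdiff (csrc f) i \<oplus> (ccomp g i \<oplus> cdiff (ctgt f) (i - 1) \<cdot> s i)"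
proof -
  note [simp] = cmapD[OF f] cmap_simps[OF f] cmap_simps[OF g] fg
  have "f \<oplus>\<^bsub>Chb C\<^esub> Neg (Chb C) g \<in> null_homotopic C"
    using ch.cls_eq_iff[of f g] eq f g by simp
  then obtain s where s: "\<And>i. s i \<in> Hom C (cob (csrc f) i) (cob (ctgt f) (i - 1))" and
    e: "\<And>i. ccomp f i \<oplus> Neg C (ccomp g i) = cdiff (ctgt f) (i - 1) \<cdot> s i \<oplus> s (i + 1) \<cdot> cdiff (csrc f) i"
    unfolding null_homotopic_def using g by (auto simp: Chb_neg Chb_unfold)
  note [simp] = s[unfolded hom_iff]
  have "ccomp f i = s (i + 1) \<cdot> cdiff (csrc f) i \<oplus> (ccomp g i \<oplus> cdiff (ctgt f) (i - 1) \<cdot> s i)" for i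
  proof -
    have "ccomp f i = ccomp g i \<oplus> (ccomp f i \<oplus> Neg C (ccomp g i))" by simp
    also have "\<dots> = s (i + 1) \<cdot> cdiff (csrc f) i \<oplus> (ccomp g i \<oplus> cdiff (ctgt f) (i - 1) \<cdot> s i)"
      unfolding e by (simp add: add_ac)
    finally show ?thesis .
  qed
  thus ?thesis using s by (intro exI[of _ s]) simp
qed

lemma TR3_cone:
  assumes f: "f \<in> Arr (Chb C)" and Z: "is_cone C f Z v w"
    and f': "f' \<in> Arr (Chb C)" and Z': "is_cone C f' Z' v' w'"
    and x: "x \<in> Arr (Chb C)" "csrc x = csrc f" "ctgt x = csrc f'"
    and y: "y \<in> Arr (Chb C)" "csrc y = ctgt f" "ctgt y = ctgt f'"
    and eq: "hcls C (y \<cdot>\<^bsub>Chb C\<^esub> f) = hcls C (f' \<cdot>\<^bsub>Chb C\<^esub> x)"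
  obtains c where "c \<in> Arr (Chb C)" "csrc c = Z" "ctgt c = Z'"
    "c \<cdot>\<^bsub>Chb C\<^esub> v = v' \<cdot>\<^bsub>Chb C\<^esub> y" "shift_cmap C x \<cdot>\<^bsub>Chb C\<^esub> w = w' \<cdot>\<^bsub>Chb C\<^esub> c"
proof -
  obtain a b p q where s: "split_ext (ctgt f) (shift_cplx C (csrc f)) (cneg (shift_cmap C f)) Z b a q p"
    and v: "v = inc (ctgt f) Z b" "w = inc Z (shift_cplx C (csrc f)) p"
    and B: "\<forall>i. is_biproduct C (cob (csrc f) (i + 1)) (cob (ctgt f) i) (cob Z i) (a i) (b i) (p i) (q i)"
    and dZ: "\<forall>i. cdiff Z i = b (i + 1) \<cdot> (cdiff (ctgt f) i \<cdot> q i) \<oplus> (b (i + 1) \<cdot> (ccomp f (i + 1) \<cdot> p i) \<oplus>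
      Neg C (a (i + 1) \<cdot> (cdiff (csrc f) (i + 1) \<cdot> p i)))"
    by (rule cone_split_ext[OF f Z])
  obtain a' b' p' q' where s': "split_ext (ctgt f') (shift_cplx C (csrc f')) (cneg (shift_cmap C f')) Z' b' a' q' p'"
    and v': "v' = inc (ctgt f') Z' b'" "w' = inc Z' (shift_cplx C (csrc f')) p'"
    and B': "\<forall>i. is_biproduct C (cob (csrc f') (i + 1)) (cob (ctgt f') i) (cob Z' i) (a' i) (b' i) (p' i) (q' i)"
    and dZ': "\<forall>i. cdiff Z' i = b' (i + 1) \<cdot> (cdiff (ctgt f') i \<cdot> q' i) \<oplus> (b' (i + 1) \<cdot> (ccomp f' (i + 1) \<cdot> p' i) \<oplus>
      Neg C (a' (i + 1) \<cdot> (cdiff (csrc f') (i + 1) \<cdot> p' i)))"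
    by (rule cone_split_ext[OF f' Z'])
  note [simp] = biproduct_simps[OF B[rule_format]] biproduct_simps[OF B'[rule_format]]
    cmapD[OF f] cmapD[OF f'] split_ext_arr(1)[OF s] split_ext_arr(1)[OF s'] x(2,3) y(2,3)
  have T [simp]: "ccomp f i \<in> Arr C" "Dom C (ccomp f i) = cob (csrc f) i" "Cod C (ccomp f i) = cob (ctgt f) i"
    "ccomp f' i \<in> Arr C" "Dom C (ccomp f' i) = cob (csrc f') i" "Cod C (ccomp f' i) = cob (ctgt f') i"
    "ccomp x i \<in> Arr C" "Dom C (ccomp x i) = cob (csrc f) i" "Cod C (ccomp x i) = cob (csrc f') i"
    "ccomp y i \<in> Arr C" "Dom C (ccomp y i) = cob (ctgt f) i" "Cod C (ccomp y i) = cob (ctgt f') i" for i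
    using cmap_simps[OF f] cmap_simps[OF f'] cmap_simps[OF x(1)] cmap_simps[OF y(1)] by auto
  have "y \<cdot>\<^bsub>Chb C\<^esub> f \<in> Arr (Chb C)" "f' \<cdot>\<^bsub>Chb C\<^esub> x \<in> Arr (Chb C)"
    using f f' x y by auto
  from hcls_eqD[OF this _ _ eq] x y obtain h where
    h: "\<And>i. h i \<in> Arr C" "\<And>i. Dom C (h i) = cob (csrc f) i" "\<And>i. Cod C (h i) = cob (ctgt f') (i - 1)" and
    hq: "\<And>i. ccomp y i \<cdot> ccomp f i =
      h (i + 1) \<cdot> cdiff (csrc f) i \<oplus> (ccomp f' i \<cdot> ccomp x i \<oplus> cdiff (ctgt f') (i - 1) \<cdot> h i)"
    unfolding Chb_csrc by (auto simp: Chb_unfold)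
  note [simp] = h
  \<comment> \<open>The square commutes only up to the homotopy \<open>h\<close>, which becomes the
    off-diagonal entry of the map of cones. With this entry the other two squares commute
    strictly.\<close>
  let ?c = "inc Z Z' (\<lambda>i. a' i \<cdot> (ccomp x (i + 1) \<cdot> p i) \<oplus> (b' i \<cdot> (h (i + 1) \<cdot> p i) \<oplus> b' i \<cdot> (ccomp y i \<cdot> q i)))"
  have xc: "ccomp x (2 + i) \<cdot> cdiff (csrc f) (i + 1) = cdiff (csrc f') (i + 1) \<cdot> ccomp x (i + 1)" for i
    using cmap_comm(1)[OF x(1), of "i + 1"] by simp
  have yc: "ccomp y (i + 1) \<cdot> cdiff (ctgt f) i = cdiff (ctgt f') i \<cdot> ccomp y i" for i
    using cmap_comm(1)[OF y(1), of i] by simp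
  have hq1: "ccomp y (i + 1) \<cdot> ccomp f (i + 1) = h (2 + i) \<cdot> cdiff (csrc f) (i + 1) \<oplus>
      (ccomp f' (i + 1) \<cdot> ccomp x (i + 1) \<oplus> cdiff (ctgt f') i \<cdot> h (i + 1))" for i
    using hq[of "i + 1"] by simp
  have "?c \<in> Arr (Chb C)"
  proof (rule cmapI)
    fix i
    let ?g = "\<lambda>i. a' i \<cdot> (ccomp x (i + 1) \<cdot> p i) \<oplus> (b' i \<cdot> (h (i + 1) \<cdot> p i) \<oplus> b' i \<cdot> (ccomp y i \<cdot> q i))"
    have "?g (i + 1) \<cdot> cdiff Z i = cdiff Z' i \<cdot> ?g i"
    proof (rule biproduct_eq_out[OF B[rule_format, of i]])
      show "?g (i + 1) \<cdot> cdiff Z i \<cdot> a i = cdiff Z' i \<cdot> ?g i \<cdot> a i"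
        using hq1[of i] xc[of i]
        by (simp add: dZ[rule_format] dZ'[rule_format] add_ac add.commute[of "1::int"])
      show "?g (i + 1) \<cdot> cdiff Z i \<cdot> b i = cdiff Z' i \<cdot> ?g i \<cdot> b i"
        using yc[of i] by (simp add: dZ[rule_format] dZ'[rule_format] add.commute[of "1::int"])
    qed (simp_all add: dZ[rule_format] dZ'[rule_format] add.commute[of "1::int"])
    thus "ccomp ?c (i + 1) \<cdot> cdiff (csrc ?c) i = cdiff (ctgt ?c) i \<cdot> ccomp ?c i" by simp
  qed simp_all
  moreover have "?c \<cdot>\<^bsub>Chb C\<^esub> v = v' \<cdot>\<^bsub>Chb C\<^esub> y" "shift_cmap C x \<cdot>\<^bsub>Chb C\<^esub> w = w' \<cdot>\<^bsub>Chb C\<^esub> ?c"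
    using v v' by (auto intro!: cmap_eqI simp: Chb_unfold)
  ultimately show thesis using that[of ?c] by simp
qed

lemma zero_complex:
  "\<exists>Z. Z \<in> bounded_complexes C \<and> (\<forall>i. is_zero C (cob Z i))"
proof -
  obtain Z where Z: "is_zero C Z" using ex_zero by blast
  show ?thesis using Chb_zero_obj[OF Z] Z
    by (intro exI[of _ "\<lparr>cob = (\<lambda>_. Z), cdiff = (\<lambda>_. Zero C Z Z)\<rparr>"]) simp
qed

lemma Kb_is_zero:
  assumes Z: "Z \<in> bounded_complexes C" "\<And>i. is_zero C (cob Z i)"
  shows "is_zero ch.Q Z"
proof -
  have "Id (Chb C) Z = Zero (Chb C) Z Z"
    using Z by (intro cmap_eqI) (auto simp: Chb_unfold is_zero_iff)
  thus ?thesis unfolding kq.is_zero_iff using Z(1) by simp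
qed

text \<open>A zero object of the homotopy category is any contractible complex. The triangle is
  first obtained for a complex of zero objects, by which X is a trivial split extension, and is then
  carried over to \<open>Z\<close>.\<close>

lemma Kb_TR1_id:
  assumes X [simp]: "X \<in> bounded_complexes C" and Z: "is_zero ch.Q Z"
  shows "(Id ch.Q X, Zero ch.Q X Z, Zero ch.Q Z (shift_cplx C X)) \<in> Tri (Kb C)"
proof -
  obtain Z0 where Z0: "Z0 \<in> bounded_complexes C" "\<And>i. is_zero C (cob Z0 i)" using zero_complex by blast
  note [simp] = Z0(1)
  have zX: "Zero (Chb C) Z0 (shift_cplx C X) \<in> Arr (Chb C)" by simp
  have "split_ext X Z0 (Zero (Chb C) Z0 (shift_cplx C X)) X (\<lambda>i. Id C (cob X i)) (\<lambda>i. Zero C (cob Z0 i) (cob X i))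
    (\<lambda>i. Id C (cob X i)) (\<lambda>i. Zero C (cob X i) (cob Z0 i))"
    unfolding split_ext_def using biproduct_zero_right Z0 zX by (simp add: Chb_unfold)
  from split_ext_tri[OF this]
  have "(Id ch.Q X, Zero ch.Q X Z0, Zero ch.Q Z0 (shift_cplx C X)) \<in> Tri (Kb C)" by (simp add: Chb_unfold)
  then obtain f W v w where 1: "f \<in> Arr (Chb C)" "is_cone C f W v w" and
    2: "triangle_iso ch.Q (Kb_shift C) (hcls C f, hcls C v, hcls C w)
      (Id ch.Q X, Zero ch.Q X Z0, Zero ch.Q Z0 (shift_cplx C X))"
    unfolding Kb_tri by blast
  note z0 = Kb_is_zero[OF Z0]
  note z [simp] = kq.is_zero_obj[OF Z, simplified]
  have i: "is_iso ch.Q (Zero ch.Q Z0 Z)"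
    by (rule kq.is_isoI[of _ "Zero ch.Q Z Z0"]; insert z0 Z; simp add: kq.is_zero_iff)
  have "triangle_iso ch.Q (Kb_shift C) (Id ch.Q X, Zero ch.Q X Z0, Zero ch.Q Z0 (shift_cplx C X))
      (Id ch.Q X, Zero ch.Q X Z, Zero ch.Q Z (shift_cplx C X))"
    using i kq.iso_Id[of X] cc.F_id[of X]
    by (intro triangle_isoI[of _ "Id ch.Q X" "Id ch.Q X" "Zero ch.Q Z0 Z"]) simp_all
  from cc.triangle_iso_trans[OF 2 this] show ?thesis unfolding Kb_tri using 1 by blast
qed

theorem Kb_pretriangulated: "pretriangulated_category (Kb C)"
proof (intro pretriangulated_category.intro pretriangulated_category_axioms.intro)
  show "additive_category (Kb C)" by (rule Kb_additive)
  show "equivalence (Kb C) (Kb C) (Sh (Kb C))" by (rule Kb_shift_equivalence)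
next
  fix t assume "t \<in> Tri (Kb C)"
  thus "candidate_triangle (Kb C) (Sh (Kb C)) t"
    unfolding Kb_tri Kb_sel triangle_iso_def by (cases t) blast
next
  fix X Z assume "X \<in> Obj (Kb C)" "is_zero (Kb C) Z"
  thus "(Id (Kb C) X, Zero (Kb C) X Z, Zero (Kb C) Z (fobj (Sh (Kb C)) X)) \<in> Tri (Kb C)"
    using Kb_TR1_id[of X Z] by simp
next
  fix t t' assume t: "t \<in> Tri (Kb C)" "triangle_iso (Kb C) (Sh (Kb C)) t t'"
  obtain u v w u' v' w' where [simp]: "t = (u, v, w)" "t' = (u', v', w')" by (cases t, cases t')
  have t': "triangle_iso ch.Q (Kb_shift C) (u, v, w) (u', v', w')" using t(2) by simp
  obtain f Z v0 w0 where f: "f \<in> Arr (Chb C)" "is_cone C f Z v0 w0"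
    "triangle_iso ch.Q (Kb_shift C) (hcls C f, hcls C v0, hcls C w0) (u, v, w)"
    using t(1) unfolding Kb_tri by auto
  from cc.triangle_iso_trans[OF f(3) t'] f show "t' \<in> Tri (Kb C)" unfolding Kb_tri by auto
next
  fix u assume "u \<in> Arr (Kb C)"
  then obtain f where f: "f \<in> Arr (Chb C)" "u = hcls C f" by (auto elim: ch.Q_cases)
  obtain Z v w where Z: "is_cone C f Z v w" using is_cone_ex[OF f(1)] by blast
  obtain a b p q where s: "split_ext (ctgt f) (shift_cplx C (csrc f)) (cneg (shift_cmap C f)) Z b a q p"
    and v: "v = inc (ctgt f) Z b" "w = inc Z (shift_cplx C (csrc f)) p"
    by (rule cone_split_ext[OF f(1) Z])
  have "candidate_triangle ch.Q (Kb_shift C) (hcls C f, hcls C v, hcls C w)"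
    using split_ext_arr[OF s] v f by (simp add: candidate_triangle_def)
  from cc.triangle_iso_refl[OF this] have "(u, hcls C v, hcls C w) \<in> Tri (Kb C)"
    unfolding Kb_tri using f Z by blast
  thus "\<exists>v w. (u, v, w) \<in> Tri (Kb C)" by blast
next
  fix u v w assume "(u, v, w) \<in> Tri (Kb C)"
  then obtain f Z v0 w0 where f: "f \<in> Arr (Chb C)" and Z: "is_cone C f Z v0 w0" and
    i: "triangle_iso ch.Q (Kb_shift C) (hcls C f, hcls C v0, hcls C w0) (u, v, w)" unfolding Kb_tri by blast
  obtain a b p q where s: "split_ext (ctgt f) (shift_cplx C (csrc f)) (cneg (shift_cmap C f)) Z b a q p"
    and v: "v0 = inc (ctgt f) Z b" "w0 = inc Z (shift_cplx C (csrc f)) p"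
    by (rule cone_split_ext[OF f Z])
  \<comment> \<open>The cone is itself a split extension with connecting map -\<Sigma>f, so the
    rotated cone triangle is the triangle of this extension.\<close>
  have "(hcls C v0, hcls C w0, Neg ch.Q (fmor (Kb_shift C) (hcls C f))) \<in> Tri (Kb C)"
    using split_ext_tri[OF s] v f by (simp add: Chb_neg)
  then obtain f' Z' v' w' where "f' \<in> Arr (Chb C)" "is_cone C f' Z' v' w'" "triangle_iso ch.Q (Kb_shift C)
     (hcls C f', hcls C v', hcls C w') (hcls C v0, hcls C w0, Neg ch.Q (fmor (Kb_shift C) (hcls C f)))"
    unfolding Kb_tri by blast
  thus "(v, w, Neg (Kb C) (fmor (Sh (Kb C)) u)) \<in> Tri (Kb C)"
    unfolding Kb_tri Kb_sel using cc.triangle_iso_trans[OF _ cc.triangle_iso_rotate[OF i]] by blast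
next
  fix u v w u' v' w' a b
  assume t: "(u, v, w) \<in> Tri (Kb C)" and t': "(u', v', w') \<in> Tri (Kb C)"
    and ab: "a \<in> Hom (Kb C) (Dom (Kb C) u) (Dom (Kb C) u')" "b \<in> Hom (Kb C) (Cod (Kb C) u) (Cod (Kb C) u')"
      "b \<cdot>\<^bsub>Kb C\<^esub> u = u' \<cdot>\<^bsub>Kb C\<^esub> a"
  obtain f Z v0 w0 where f: "f \<in> Arr (Chb C)" and Z: "is_cone C f Z v0 w0" and
    i: "triangle_iso ch.Q (Kb_shift C) (hcls C f, hcls C v0, hcls C w0) (u, v, w)" using t unfolding Kb_tri by blast
  obtain f' Z' v0' w0' where f': "f' \<in> Arr (Chb C)" and Z': "is_cone C f' Z' v0' w0'" and
    i': "triangle_iso ch.Q (Kb_shift C) (hcls C f', hcls C v0', hcls C w0') (u', v', w')"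
    using t' unfolding Kb_tri by blast
  obtain a1 b1 p1 q1 where s: "split_ext (ctgt f) (shift_cplx C (csrc f)) (cneg (shift_cmap C f)) Z b1 a1 q1 p1"
    and v: "v0 = inc (ctgt f) Z b1" "w0 = inc Z (shift_cplx C (csrc f)) p1"
    by (rule cone_split_ext[OF f Z])
  obtain a2 b2 p2 q2 where s': "split_ext (ctgt f') (shift_cplx C (csrc f')) (cneg (shift_cmap C f')) Z' b2 a2 q2 p2"
    and v': "v0' = inc (ctgt f') Z' b2" "w0' = inc Z' (shift_cplx C (csrc f')) p2"
    by (rule cone_split_ext[OF f' Z'])
  have [simp]: "v0 \<in> Arr (Chb C)" "w0 \<in> Arr (Chb C)" "csrc v0 = ctgt f" "ctgt v0 = Z" "csrc w0 = Z"
    "ctgt w0 = shift_cplx C (csrc f)" "v0' \<in> Arr (Chb C)" "w0' \<in> Arr (Chb C)" "csrc v0' = ctgt f'"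
    "ctgt v0' = Z'" "csrc w0' = Z'" "ctgt w0' = shift_cplx C (csrc f')"
    using split_ext_arr[OF s] split_ext_arr[OF s'] v v' by simp_all
  have TR3: "\<exists>c. c \<in> Arr ch.Q \<and> Dom ch.Q c = Cod ch.Q (hcls C v0) \<and> Cod ch.Q c = Cod ch.Q (hcls C v0') \<and>
      c \<cdot>\<^bsub>ch.Q\<^esub> hcls C v0 = hcls C v0' \<cdot>\<^bsub>ch.Q\<^esub> b \<and>
      fmor (Kb_shift C) a \<cdot>\<^bsub>ch.Q\<^esub> hcls C w0 = hcls C w0' \<cdot>\<^bsub>ch.Q\<^esub> c"
    if *: "a \<in> Arr ch.Q" "b \<in> Arr ch.Q" "Dom ch.Q a = Dom ch.Q (hcls C f)" "Cod ch.Q a = Dom ch.Q (hcls C f')"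
      "Dom ch.Q b = Cod ch.Q (hcls C f)" "Cod ch.Q b = Cod ch.Q (hcls C f')"
      "b \<cdot>\<^bsub>ch.Q\<^esub> hcls C f = hcls C f' \<cdot>\<^bsub>ch.Q\<^esub> a" for a b
  proof -
    obtain x y where xy: "x \<in> Arr (Chb C)" "a = hcls C x" "y \<in> Arr (Chb C)" "b = hcls C y"
      using *(1,2) by (auto elim!: ch.Q_cases)
    have xy': "csrc x = csrc f" "ctgt x = csrc f'" "csrc y = ctgt f" "ctgt y = ctgt f'"
      "hcls C (y \<cdot>\<^bsub>Chb C\<^esub> f) = hcls C (f' \<cdot>\<^bsub>Chb C\<^esub> x)"
      using * xy f f' by simp_all
    obtain c where c: "c \<in> Arr (Chb C)" "csrc c = Z" "ctgt c = Z'"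
      "c \<cdot>\<^bsub>Chb C\<^esub> v0 = v0' \<cdot>\<^bsub>Chb C\<^esub> y" "shift_cmap C x \<cdot>\<^bsub>Chb C\<^esub> w0 = w0' \<cdot>\<^bsub>Chb C\<^esub> c"
      by (rule TR3_cone[OF f Z f' Z' xy(1) xy'(1,2) xy(3) xy'(3,4,5)])
    show ?thesis by (rule exI[of _ "hcls C c"]) (use c xy xy' in simp)
  qed
  have "\<exists>c. c \<in> Arr ch.Q \<and> Dom ch.Q c = Cod ch.Q v \<and> Cod ch.Q c = Cod ch.Q v' \<and>
      c \<cdot>\<^bsub>ch.Q\<^esub> v = v' \<cdot>\<^bsub>ch.Q\<^esub> b \<and> fmor (Kb_shift C) a \<cdot>\<^bsub>ch.Q\<^esub> w = w' \<cdot>\<^bsub>ch.Q\<^esub> c"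
    by (rule cc.TR3_transport[OF i i' _ _ _ _ _ _ _ TR3]) (use ab in simp_all)
  thus "\<exists>c \<in> Hom (Kb C) (Cod (Kb C) v) (Cod (Kb C) v'). c \<cdot>\<^bsub>Kb C\<^esub> v = v' \<cdot>\<^bsub>Kb C\<^esub> b \<and>
      fmor (Sh (Kb C)) a \<cdot>\<^bsub>Kb C\<^esub> w = w' \<cdot>\<^bsub>Kb C\<^esub> c"
    by auto
qed

end

subsection \<open>The octahedral axiom\<close>

sublocale complexes \<subseteq> kb: pretriangulated_category "Kb C"
  by (rule Kb_pretriangulated)

context complexes
begin

lemma Kb_tri_simps:
  assumes "(u, v, w) \<in> Tri (Kb C)"
  shows "u \<in> Arr ch.Q" "v \<in> Arr ch.Q" "w \<in> Arr ch.Q" "Dom ch.Q v = Cod ch.Q u" "Dom ch.Q w = Cod ch.Q v"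
    "Cod ch.Q w = shift_cplx C (Dom ch.Q u)"
  using kb.tri_simps[OF assms] by simp_all

lemma Kb_id [simp]:
  "F \<in> Arr ch.Q \<Longrightarrow> Cod ch.Q F = X \<Longrightarrow> hcls C (Id (Chb C) X) \<cdot>\<^bsub>ch.Q\<^esub> F = F"
  "F \<in> Arr ch.Q \<Longrightarrow> Dom ch.Q F = X \<Longrightarrow> F \<cdot>\<^bsub>ch.Q\<^esub> hcls C (Id (Chb C) X) = F"
  "X \<in> bounded_complexes C \<Longrightarrow> is_iso ch.Q (hcls C (Id (Chb C) X))"
  using kq.comp_id[of F X] kq.iso_Id[of X] by simp_all

lemma hcls_obtain:
  assumes "F \<in> Arr ch.Q"
  obtains f where "f \<in> Arr (Chb C)" "F = hcls C f" "csrc f = Dom ch.Q F" "ctgt f = Cod ch.Q F"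
proof -
  obtain f where "f \<in> Arr (Chb C)" "F = hcls C f" using assms by (auto elim: ch.Q_cases)
  thus thesis using that[of f] by simp
qed

text \<open>A triangle is determined up to isomorphism by its third morphism. Representing
  \<open>w\<close> by a chain map and taking its split extension gives a model with the same outer
  objects, in which the first morphism is an inclusion of complexes.\<close>

lemma split_model:
  assumes t: "(u, v, w) \<in> Tri (Kb C)"
  obtains h Y a s r b c where "h \<in> Arr (Chb C)" "w = hcls C h"
    "split_ext (Dom ch.Q u) (Cod ch.Q v) h Y a s r b"
    "(hcls C (inc (Dom ch.Q u) Y a), hcls C (inc Y (Cod ch.Q v) b), w) \<in> Tri (Kb C)"
    "is_iso ch.Q c" "Dom ch.Q c = Cod ch.Q u" "Cod ch.Q c = Y"
    "c \<cdot>\<^bsub>ch.Q\<^esub> u = hcls C (inc (Dom ch.Q u) Y a)" "hcls C (inc Y (Cod ch.Q v) b) \<cdot>\<^bsub>ch.Q\<^esub> c = v"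
proof -
  note T = Kb_tri_simps[OF t]
  let ?X = "Dom ch.Q u" and ?Z = "Cod ch.Q v"
  have X: "?X \<in> bounded_complexes C" "?Z \<in> bounded_complexes C"
    using kq.obj_simps(1)[OF T(1)] kq.obj_simps(2)[OF T(2)] by simp_all
  obtain h where h: "h \<in> Arr (Chb C)" "w = hcls C h" "csrc h = ?Z" "ctgt h = shift_cplx C ?X"
    using hcls_obtain[OF T(3)] T(5,6) by metis
  obtain Y a s r b where s: "split_ext ?X ?Z h Y a s r b"
    using split_ext_ex[OF X(1) h(1,4)] h(3) by metis
  let ?a = "hcls C (inc ?X Y a)" and ?b = "hcls C (inc Y ?Z b)"
  have t0: "(?a, ?b, w) \<in> Tri (Kb C)" using split_ext_tri[OF s] h(2) by simp
  note A = split_ext_arr[OF s]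
  have TT: "Dom (Kb C) ?a = ?X" "Cod (Kb C) ?b = ?Z" "Cod (Kb C) ?a = Y" using A by simp_all
  have I: "is_iso (Kb C) (Id (Kb C) ?X)" "is_iso (Kb C) (Id (Kb C) ?Z)"
    "Dom (Kb C) (Id (Kb C) ?X) = ?X" "Cod (Kb C) (Id (Kb C) ?X) = ?X"
    "Dom (Kb C) (Id (Kb C) ?Z) = ?Z" "Cod (Kb C) (Id (Kb C) ?Z) = ?Z"
    "Id (Kb C) ?X \<in> Arr (Kb C)" "Id (Kb C) ?Z \<in> Arr (Kb C)"
    using X kq.iso_Id[of ?X] kq.iso_Id[of ?Z] by simp_all
  have wI: "fmor (Sh (Kb C)) (Id (Kb C) ?X) \<cdot>\<^bsub>Kb C\<^esub> w = w \<cdot>\<^bsub>Kb C\<^esub> Id (Kb C) ?Z"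
    using X T h kq.comp_id[of w] cc.F_id[of ?X] by simp
  obtain c where c: "c \<in> Arr (Kb C)" "Dom (Kb C) c = Cod (Kb C) u" "Cod (Kb C) c = Cod (Kb C) ?a"
    "c \<cdot>\<^bsub>Kb C\<^esub> u = ?a \<cdot>\<^bsub>Kb C\<^esub> Id (Kb C) ?X" "Id (Kb C) ?Z \<cdot>\<^bsub>Kb C\<^esub> v = ?b \<cdot>\<^bsub>Kb C\<^esub> c"
    by (rule kb.tri_morphism_snd[OF t t0, of "Id (Kb C) ?X" "Id (Kb C) ?Z"])
      (use I TT wI T in \<open>simp_all del: Kb_sel(5) ch.Q_id\<close>)
  have ci: "is_iso (Kb C) c"
    by (rule kb.five_lemma_snd[OF t t0 I(1) _ _ c(1,2,3) I(2) _ _ c(4,5) wI]) (use I TT in simp_all)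
  have e: "c \<cdot>\<^bsub>ch.Q\<^esub> u = ?a" "?b \<cdot>\<^bsub>ch.Q\<^esub> c = v"
    using c(4,5) T A X kq.comp_id(1)[of v ?Z] by simp_all
  show thesis by (rule that[OF h(1,2) s t0 _ _ _ e]) (use ci c TT in simp_all)
qed

text \<open>For complexes X in Y in Z the octahedron is the third isomorphism theorem. The quotient
  W = Z/X is a split extension of V = Z/Y by U = Y/X, with connecting map the image of
  \<open>k\<close> in \<Sigma>U.\<close>

lemma split_octahedron:
  assumes s1: "split_ext X U h Y \<alpha> \<sigma> \<rho> \<beta>" and s2: "split_ext Y V k Z \<alpha>' \<sigma>' \<rho>' \<beta>'"
  obtains l \<kappa> f g where
    "(hcls C (inc Y Z \<alpha>') \<cdot>\<^bsub>ch.Q\<^esub> hcls C (inc X Y \<alpha>), \<kappa>, l) \<in> Tri (Kb C)"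
    "kb.octahedron (hcls C (inc X Y \<alpha>)) (hcls C (inc Y U \<beta>)) (hcls C h)
      (hcls C (inc Y Z \<alpha>')) (hcls C (inc Z V \<beta>')) (hcls C k) \<kappa> l f g"
proof -
  note D1 = split_extD[OF s1] and D2 = split_extD[OF s2] and A1 = split_ext_arr[OF s1] and A2 = split_ext_arr[OF s2]
  note [simp] = D1(1-5,8-12) D2(2-5,8-10) A1 A2 biproduct_simps[OF D1(6)] biproduct_simps[OF D2(6)]
  have mA: "shift_cmap C (inc Y U \<beta>) \<cdot>\<^bsub>Chb C\<^esub> k \<in> Arr (Chb C)" by simp
  let ?m = "shift_cmap C (inc Y U \<beta>) \<cdot>\<^bsub>Chb C\<^esub> k"
  have mt: "ctgt ?m = shift_cplx C U" "csrc ?m = V" by simp_all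
  obtain W a s r b where s3: "split_ext U V ?m W a s r b"
    using split_ext_ex[OF D1(2) mA mt(1), unfolded mt(2)] by blast
  note D3 = split_extD[OF s3] and A3 = split_ext_arr[OF s3]
  have [simp]: "ccomp ?m i = \<beta> (i + 1) \<cdot> ccomp k i" for i by (simp add: Chb_unfold)
  note [simp] = A3 biproduct_simps[OF D3(6)]
  \<comment> \<open>The connecting map of X in Z: on U it is that of X in Y, and on V it is the
    X-component of \<open>k\<close>.\<close>
  let ?l = "inc W (shift_cplx C X) (\<lambda>i. ccomp h i \<cdot> r i \<oplus> \<rho> (i + 1) \<cdot> (ccomp k i \<cdot> b i))"
  have kd: "ccomp k (i + 1) \<cdot> (cdiff V i \<cdot> f) = Neg C (cdiff Y (i + 1) \<cdot> (ccomp k i \<cdot> f))"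
    if "f \<in> Arr C" "Cod C f = cob V i" for f i using D2(12)[OF that] .
  have l [simp]: "?l \<in> Arr (Chb C)"
  proof (rule cmapI)
    fix i
    have "(ccomp h (i + 1) \<cdot> r (i + 1) \<oplus> \<rho> (2 + i) \<cdot> (ccomp k (i + 1) \<cdot> b (i + 1))) \<cdot> cdiff W i =
      Neg C (cdiff X (i + 1)) \<cdot> (ccomp h i \<cdot> r i \<oplus> \<rho> (i + 1) \<cdot> (ccomp k i \<cdot> b i))"
    proof (rule biproduct_eq_out[OF D3(6)[of i]])
      show "(ccomp h (i + 1) \<cdot> r (i + 1) \<oplus> \<rho> (2 + i) \<cdot> (ccomp k (i + 1) \<cdot> b (i + 1))) \<cdot> cdiff W i \<cdot> a i =
        Neg C (cdiff X (i + 1)) \<cdot> (ccomp h i \<cdot> r i \<oplus> \<rho> (i + 1) \<cdot> (ccomp k i \<cdot> b i)) \<cdot> a i"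
        by (simp add: D3(7) kd)
      show "(ccomp h (i + 1) \<cdot> r (i + 1) \<oplus> \<rho> (2 + i) \<cdot> (ccomp k (i + 1) \<cdot> b (i + 1))) \<cdot> cdiff W i \<cdot> s i =
        Neg C (cdiff X (i + 1)) \<cdot> (ccomp h i \<cdot> r i \<oplus> \<rho> (i + 1) \<cdot> (ccomp k i \<cdot> b i)) \<cdot> s i"
        using D2(11)[of i] D1(7)[of "i + 1"] by (simp add: D3(7))
    qed (simp_all add: D3(7))
    thus "ccomp ?l (i + 1) \<cdot> cdiff (csrc ?l) i = cdiff (ctgt ?l) i \<cdot> ccomp ?l i" by simp
  qed simp_all
  let ?\<kappa> = "\<lambda>i. a i \<cdot> (\<beta> i \<cdot> \<rho>' i) \<oplus> s i \<cdot> \<beta>' i" and ?\<tau> = "\<lambda>i. \<alpha>' i \<cdot> (\<sigma> i \<cdot> r i) \<oplus> \<sigma>' i \<cdot> b i"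
  have s4: "split_ext X W ?l Z (\<lambda>i. \<alpha>' i \<cdot> \<alpha> i) ?\<tau> (\<lambda>i. \<rho> i \<cdot> \<rho>' i) ?\<kappa>"
    unfolding split_ext_def
  proof (intro conjI allI)
    fix i
    have e: "(\<alpha>' i \<cdot> \<alpha> i) \<cdot> (\<rho> i \<cdot> \<rho>' i) \<oplus> ?\<tau> i \<cdot> ?\<kappa> i = Id C (cob Z i)"
    proof (rule biproduct_eq_out[OF D2(6)[of i]])
      show "((\<alpha>' i \<cdot> \<alpha> i) \<cdot> (\<rho> i \<cdot> \<rho>' i) \<oplus> ?\<tau> i \<cdot> ?\<kappa> i) \<cdot> \<alpha>' i = Id C (cob Z i) \<cdot> \<alpha>' i"
        using biproduct_sum(3)[OF D1(6), of "\<alpha>' i" i] by simp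
    qed simp_all
    show "is_biproduct C (cob X i) (cob W i) (cob Z i) (\<alpha>' i \<cdot> \<alpha> i) (?\<tau> i) (\<rho> i \<cdot> \<rho>' i) (?\<kappa> i)"
      using e biproduct_sum(1)[OF D3(6), of i] unfolding is_biproduct_def by simp
    show "cdiff Z i = \<alpha>' (i + 1) \<cdot> \<alpha> (i + 1) \<cdot> (cdiff X i \<cdot> (\<rho> i \<cdot> \<rho>' i)) \<oplus>
        (Neg C (\<alpha>' (i + 1) \<cdot> \<alpha> (i + 1) \<cdot> (ccomp ?l i \<cdot> ?\<kappa> i)) \<oplus> ?\<tau> (i + 1) \<cdot> (cdiff W i \<cdot> ?\<kappa> i))"
      (is "_ = ?R")
    proof (rule biproduct_eq_out[OF D2(6)[of i]])
      show "cdiff Z i \<cdot> \<alpha>' i = ?R \<cdot> \<alpha>' i"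
        by (simp add: D1(7) D2(7) D3(7))
      have "\<alpha>' (i + 1) \<cdot> ccomp k i = (\<alpha>' (i + 1) \<cdot> (\<alpha> (i + 1) \<cdot> \<rho> (i + 1)) \<oplus>
          \<alpha>' (i + 1) \<cdot> (\<sigma> (i + 1) \<cdot> \<beta> (i + 1))) \<cdot> ccomp k i"
        using biproduct_sum(3)[OF D1(6), of "\<alpha>' (i + 1)" "i + 1"] by simp
      thus "cdiff Z i \<cdot> \<sigma>' i = ?R \<cdot> \<sigma>' i"
        by (simp add: D2(7) D3(7))
    qed (simp_all add: D2(7) D3(7))
  qed simp_all
  note D4 = split_extD[OF s4] and A4 = split_ext_arr[OF s4]
  note [simp] = A4
  have c12: "inc Y Z \<alpha>' \<cdot>\<^bsub>Chb C\<^esub> inc X Y \<alpha> = inc X Z (\<lambda>i. \<alpha>' i \<cdot> \<alpha> i)" by (simp add: Chb_unfold)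
  have "hcls C k \<cdot>\<^bsub>ch.Q\<^esub> hcls C (inc W V b) =
    fmor (Kb_shift C) (hcls C (inc X Y \<alpha>)) \<cdot>\<^bsub>ch.Q\<^esub> hcls C ?l"
  proof -
    let ?p = "k \<cdot>\<^bsub>Chb C\<^esub> inc W V b" and ?q = "shift_cmap C (inc X Y \<alpha>) \<cdot>\<^bsub>Chb C\<^esub> ?l"
    have [simp]: "ccomp ?p i = ccomp k i \<cdot> b i" "ccomp ?q i = \<alpha> (i + 1) \<cdot> (ccomp h i \<cdot> r i \<oplus> \<rho> (i + 1) \<cdot> (ccomp k i \<cdot> b i))" for i
      by (simp_all add: Chb_unfold)
    have "hcls C ?p = hcls C ?q"
    \<comment> \<open>This one relation holds only up to homotopy. The difference of the two sides
      is -\<alpha> h on U and \<sigma> \<beta> k on V, which is the boundary of -\<sigma> r.\<close>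
    proof (rule hcls_eqI[where s = "\<lambda>i. Neg C (\<sigma> i \<cdot> r i)"])
      fix i
      have "ccomp k i \<cdot> b i = \<alpha> (i + 1) \<cdot> (\<rho> (i + 1) \<cdot> (ccomp k i \<cdot> b i)) \<oplus>
        \<sigma> (i + 1) \<cdot> (\<beta> (i + 1) \<cdot> (ccomp k i \<cdot> b i))"
        using biproduct_sum(2)[OF D1(6), of "ccomp k i \<cdot> b i" "i + 1"] by simp
      moreover have "cdiff (ctgt ?p) (i - 1) \<cdot> Neg C (\<sigma> i \<cdot> r i) =
        \<sigma> (i + 1) \<cdot> (cdiff U i \<cdot> r i) \<oplus> Neg C (\<alpha> (i + 1) \<cdot> (ccomp h i \<cdot> r i))"
        by (simp add: D1(7) add_ac)
      moreover have "Neg C (\<sigma> (i + 1) \<cdot> r (i + 1)) \<cdot> cdiff (csrc ?p) i =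
        Neg C (\<sigma> (i + 1) \<cdot> (cdiff U i \<cdot> r i)) \<oplus> \<sigma> (i + 1) \<cdot> (\<beta> (i + 1) \<cdot> (ccomp k i \<cdot> b i))"
        by (simp add: D3(7))
      ultimately show "ccomp ?p i = ccomp ?q i \<oplus> (cdiff (ctgt ?p) (i - 1) \<cdot> Neg C (\<sigma> i \<cdot> r i) \<oplus>
          Neg C (\<sigma> (i + 1) \<cdot> r (i + 1)) \<cdot> cdiff (csrc ?p) i)"
        by (simp add: add_ac)
    qed simp_all
    thus ?thesis by simp
  qed
  moreover have "hcls C (inc U W a) \<cdot>\<^bsub>ch.Q\<^esub> hcls C (inc Y U \<beta>) = hcls C (inc Z W ?\<kappa>) \<cdot>\<^bsub>ch.Q\<^esub> hcls C (inc Y Z \<alpha>')"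
    "hcls C ?l \<cdot>\<^bsub>ch.Q\<^esub> hcls C (inc U W a) = hcls C h"
    "hcls C (inc W V b) \<cdot>\<^bsub>ch.Q\<^esub> hcls C (inc Z W ?\<kappa>) = hcls C (inc Z V \<beta>')"
    by (simp, simp add: Chb_unfold)+ (auto simp: Chb_unfold intro!: cmap_eqI arg_cong[where f = "hcls C"])
  moreover have "(hcls C (inc U W a), hcls C (inc W V b), fmor (Kb_shift C) (hcls C (inc Y U \<beta>)) \<cdot>\<^bsub>ch.Q\<^esub> hcls C k) \<in> Tri (Kb C)"
    using split_ext_tri[OF s3] by simp
  ultimately have "kb.octahedron (hcls C (inc X Y \<alpha>)) (hcls C (inc Y U \<beta>)) (hcls C h)
      (hcls C (inc Y Z \<alpha>')) (hcls C (inc Z V \<beta>')) (hcls C k) (hcls C (inc Z W ?\<kappa>)) (hcls C ?l)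
      (hcls C (inc U W a)) (hcls C (inc W V b))"
    unfolding kb.octahedron_def by simp
  thus thesis using that split_ext_tri[OF s4] c12 by simp
qed

theorem Kb_triangulated: "triangulated_category (Kb C)"
proof (rule kb.triangulatedI)
  fix u i i' v j j' k k'
  assume t1: "(u, i, i') \<in> Tri (Kb C)" and t2: "(v, j, j') \<in> Tri (Kb C)"
    and uv: "Cod (Kb C) u = Dom (Kb C) v" and t3: "(v \<cdot>\<^bsub>Kb C\<^esub> u, k, k') \<in> Tri (Kb C)"
  note T1 = Kb_tri_simps[OF t1] and T2 = Kb_tri_simps[OF t2]
  have uv' [simp]: "Cod ch.Q u = Dom ch.Q v" using uv by simp
  let ?X = "Dom ch.Q u" and ?U = "Cod ch.Q i" and ?V = "Cod ch.Q j"
  obtain h Y a s r b c where h: "h \<in> Arr (Chb C)" "i' = hcls C h" and s1: "split_ext ?X ?U h Y a s r b"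
    and t10: "(hcls C (inc ?X Y a), hcls C (inc Y ?U b), i') \<in> Tri (Kb C)"
    and c: "is_iso ch.Q c" "Dom ch.Q c = Cod ch.Q u" "Cod ch.Q c = Y"
    "c \<cdot>\<^bsub>ch.Q\<^esub> u = hcls C (inc ?X Y a)" "hcls C (inc Y ?U b) \<cdot>\<^bsub>ch.Q\<^esub> c = i"
    by (rule split_model[OF t1])
  note [simp] = T1 T2 c(1-3) split_ext_arr[OF s1]
  have X [simp]: "?X \<in> bounded_complexes C" "Dom ch.Q v \<in> bounded_complexes C" "Cod ch.Q v \<in> bounded_complexes C"
    "?V \<in> bounded_complexes C"
    using kq.obj_simps(1)[OF T1(1)] kq.obj_simps[OF T2(1)] kq.obj_simps(2)[OF T2(2)] by simp_all
  \<comment> \<open>Once \<open>u\<close> is an inclusion into a model \<open>Y\<close> of its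
    target, the second triangle is rewritten to start at \<open>Y\<close>. Its own model then makes
    both morphisms composable inclusions.\<close>
  let ?v = "v \<cdot>\<^bsub>ch.Q\<^esub> kq.Inv c" and ?j = "fmor (Kb_shift C) c \<cdot>\<^bsub>ch.Q\<^esub> j'"
  have I: "is_iso ch.Q (Id ch.Q (Cod ch.Q v))" "is_iso ch.Q (Id ch.Q ?V)" "is_iso ch.Q (Id ch.Q ?X)"
    using kq.iso_Id by (simp_all del: ch.Q_id)
  have t2': "(?v, j, ?j) \<in> Tri (Kb C)"
    by (rule kb.tri_isoI[OF t2, of c "Id (Kb C) (Cod ch.Q v)" "Id (Kb C) ?V"])
      (use I kq.comp_id(1)[of v "Cod ch.Q v"] kq.comp_id(1)[of j ?V] kq.comp_id(2)[of j "Cod ch.Q v"]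
        kq.comp_id(2)[of ?j ?V] in simp_all)
  have D: "Dom ch.Q ?v = Y" "Cod ch.Q ?v = Cod ch.Q v" by simp_all
  obtain k0 Z a' s' r' b' d where k0: "k0 \<in> Arr (Chb C)" "?j = hcls C k0" and s2: "split_ext Y ?V k0 Z a' s' r' b'"
    and t20: "(hcls C (inc Y Z a'), hcls C (inc Z ?V b'), ?j) \<in> Tri (Kb C)"
    and d: "is_iso ch.Q d" "Dom ch.Q d = Cod ch.Q v" "Cod ch.Q d = Z"
    "d \<cdot>\<^bsub>ch.Q\<^esub> ?v = hcls C (inc Y Z a')" "hcls C (inc Z ?V b') \<cdot>\<^bsub>ch.Q\<^esub> d = j"
    by (rule split_model[OF t2', unfolded D])
  note [simp] = d(1-3) split_ext_arr[OF s2]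
  have dv: "d \<cdot>\<^bsub>ch.Q\<^esub> v = hcls C (inc Y Z a') \<cdot>\<^bsub>ch.Q\<^esub> c" unfolding d(4)[symmetric] by simp
  obtain l \<kappa> f g where t30: "(hcls C (inc Y Z a') \<cdot>\<^bsub>ch.Q\<^esub> hcls C (inc ?X Y a), \<kappa>, l) \<in> Tri (Kb C)"
    and oc: "kb.octahedron (hcls C (inc ?X Y a)) (hcls C (inc Y ?U b)) (hcls C h)
      (hcls C (inc Y Z a')) (hcls C (inc Z ?V b')) (hcls C k0) \<kappa> l f g"
    by (rule split_octahedron[OF s1 s2])
  show "\<exists>f g. kb.octahedron u i i' v j j' k k' f g"
    by (rule kb.octahedron_transport[OF t1 t2 uv t3 t10[unfolded h(2)] t20[unfolded k0(2)] _ _ oc,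
        of "Id (Kb C) ?X" c d])
      (use I t30 c(4) dv in simp_all)
qed

end

sublocale complexes \<subseteq> kt: triangulated_category "Kb C"
  by (rule Kb_triangulated)

subsection \<open>Complexes concentrated in an interval\<close>

context complexes
begin

lemma K_interval_iff: "X \<in> K_interval C n \<longleftrightarrow>
    (\<exists>Y \<in> bounded_complexes C. concentrated C {- int n..0} Y \<and> isomorphic ch.Q X Y)"
  using kq.isomorphic_obj unfolding K_interval_def by auto

lemma K_intervalI:
  "X \<in> bounded_complexes C \<Longrightarrow> concentrated C {- int n..0} X \<Longrightarrow> X \<in> K_interval C n"
  unfolding K_interval_iff using kq.isomorphic_refl[of X] by auto

lemma K_interval_isomorphic: "X \<in> K_interval C n \<Longrightarrow> isomorphic ch.Q X Y \<Longrightarrow> Y \<in> K_interval C n"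
  unfolding K_interval_iff using kq.isomorphic_sym kq.isomorphic_trans by blast

text \<open>Up to isomorphism the outer complexes are concentrated in the interval, and the middle
  one is in each degree a biproduct of their terms.\<close>

lemma K_interval_extension:
  assumes t: "(u, v, w) \<in> Tri (Kb C)" and X: "Dom ch.Q u \<in> K_interval C n" and Z: "Cod ch.Q v \<in> K_interval C n"
  shows "Cod ch.Q u \<in> K_interval C n"
proof -
  note [simp] = Kb_tri_simps[OF t]
  obtain X' where X': "X' \<in> bounded_complexes C" "concentrated C {- int n..0} X'" "isomorphic ch.Q (Dom ch.Q u) X'"
    using X unfolding K_interval_iff by auto
  obtain Z' where Z': "Z' \<in> bounded_complexes C" "concentrated C {- int n..0} Z'" "isomorphic ch.Q (Cod ch.Q v) Z'"
    using Z unfolding K_interval_iff by auto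
  obtain a where a [simp]: "is_iso ch.Q a" "Dom ch.Q a = Dom ch.Q u" "Cod ch.Q a = X'"
    using kq.isomorphicE[OF X'(3)] .
  obtain c where c [simp]: "is_iso ch.Q c" "Dom ch.Q c = Cod ch.Q v" "Cod ch.Q c = Z'"
    using kq.isomorphicE[OF Z'(3)] .
  have B: "Cod ch.Q u \<in> bounded_complexes C" using kq.obj_simps(2)[of u] by simp
  have I: "is_iso ch.Q (Id ch.Q (Cod ch.Q u))" using kq.iso_Id[of "Cod ch.Q u"] B by (simp del: ch.Q_id)
  let ?u = "u \<cdot>\<^bsub>ch.Q\<^esub> kq.Inv a" and ?v = "c \<cdot>\<^bsub>ch.Q\<^esub> v"
    and ?w = "fmor (Kb_shift C) a \<cdot>\<^bsub>ch.Q\<^esub> (w \<cdot>\<^bsub>ch.Q\<^esub> kq.Inv c)"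
  have t': "(?u, ?v, ?w) \<in> Tri (Kb C)"
    by (rule kb.tri_isoI[OF t, of a "Id (Kb C) (Cod ch.Q u)" c])
      (use I B kq.comp_id(1)[of u "Cod ch.Q u"] kq.comp_id(2)[of ?v "Cod ch.Q u"] in simp_all)
  have D: "Dom ch.Q ?u = X'" "Cod ch.Q ?v = Z'" "Cod ch.Q ?u = Cod ch.Q u" by simp_all
  obtain h Y al s r be d where s: "split_ext X' Z' h Y al s r be" and
    d: "is_iso ch.Q d" "Dom ch.Q d = Cod ch.Q u" "Cod ch.Q d = Y"
    using split_model[OF t', unfolded D] by metis
  have "Y \<in> K_interval C n"
    using split_ext_arr(1)[OF s] concentrated_biproduct[OF X'(2) Z'(2) split_extD(6)[OF s]]
    by (intro K_intervalI) simp_all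
  thus ?thesis using d kq.isomorphic_sym[OF kq.isomorphicI[OF d]] K_interval_isomorphic by blast
qed

lemma K_interval_additive: "additive_subcategory (Kb C) (K_interval C n)"
  unfolding additive_subcategory_def
proof (intro conjI ballI allI impI)
  show "K_interval C n \<subseteq> Obj (Kb C)" unfolding K_interval_def by blast
  show "Y \<in> K_interval C n" if "X \<in> K_interval C n" "isomorphic (Kb C) X Y" for X Y
    using that K_interval_isomorphic by simp
  obtain Z where Z: "Z \<in> bounded_complexes C" "\<And>i. is_zero C (cob Z i)" using zero_complex by blast
  hence "Z \<in> K_interval C n" by (intro K_intervalI) (auto simp: concentrated_def)
  thus "\<exists>Z\<in>K_interval C n. is_zero (Kb C) Z" using Kb_is_zero[OF Z] by auto
  fix A B D i j p q
  assume A: "A \<in> K_interval C n" "B \<in> K_interval C n" and b: "is_biproduct (Kb C) A B D i j p q"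
  note s = kq.biproduct_simps[OF b[simplified]]
  show "D \<in> K_interval C n" using K_interval_extension[OF kb.tri_split[OF b], of n] A s by simp
qed

text \<open>Without test objects the vanishing condition is empty, so every morphism to a suspension
  is an extension.\<close>

theorem K_extricat_relative:
  "relative_structure (Kb C) (K_interval C n) {} (\<lambda>X Y. Hom (Kb C) X (fobj (Sh (Kb C)) Y))"
proof (intro relative_structure.intro relative_structure_axioms.intro)
  show "triangulated_category (Kb C)" by (rule Kb_triangulated)
  show "additive_subcategory (Kb C) (K_interval C n)" by (rule K_interval_additive)
  show "Cod (Kb C) u \<in> K_interval C n"
    if "(u, v, w) \<in> Tri (Kb C)" "Dom (Kb C) u \<in> K_interval C n" "Cod (Kb C) v \<in> K_interval C n" for u v w
    using K_interval_extension[of u v w n] that by simp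
qed auto

end

section \<open>Exact categories\<close>

context exact_category
begin

lemma conf_simps:
  assumes "(i, p) \<in> Conf E"
  shows "i \<in> Arr E" "p \<in> Arr E" "Dom E p = Cod E i" "p \<cdot> i = Zero E (Dom E i) (Cod E p)"
  using conf_ker_coker[OF assms] unfolding is_kernel_def by auto

lemma conf_lift:
  assumes "(i, p) \<in> Conf E" "f \<in> Arr E" "Cod E f = Cod E i" "p \<cdot> f = Zero E (Dom E f) (Cod E p)"
  obtains h where "h \<in> Arr E" "Dom E h = Dom E f" "Cod E h = Dom E i" "i \<cdot> h = f"
  using conf_ker_coker[OF assms(1)] assms(2-) unfolding is_kernel_def hom_iff by metis

lemma conf_mono:
  assumes c: "(i, p) \<in> Conf E" and f: "f \<in> Arr E" "Cod E f = Dom E i" and g: "g \<in> Arr E" "Cod E g = Dom E i"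
    and eq: "i \<cdot> f = i \<cdot> g"
  shows "f = g"
proof -
  note [simp] = conf_simps[OF c] f g
  have d: "Dom E g = Dom E f" using arg_cong[OF eq, of "Dom E"] by simp
  have z: "p \<cdot> (i \<cdot> f) = Zero E (Dom E (i \<cdot> f)) (Cod E p)"
    using comp_reduce[OF conf_simps(4)[OF c], of f] by simp
  have U: "\<And>f. \<lbrakk>f \<in> Arr E; Cod E f = Dom E p; p \<cdot> f = Zero E (Dom E f) (Cod E p)\<rbrakk> \<Longrightarrow>
      \<exists>!h. h \<in> Hom E (Dom E f) (Dom E i) \<and> i \<cdot> h = f"
    using conf_ker_coker[OF c] unfolding is_kernel_def by blast
  have "\<exists>!h. h \<in> Hom E (Dom E (i \<cdot> f)) (Dom E i) \<and> i \<cdot> h = i \<cdot> f"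
    by (rule U[OF _ _ z]) simp_all
  moreover have "f \<in> Hom E (Dom E (i \<cdot> f)) (Dom E i)" "g \<in> Hom E (Dom E (i \<cdot> f)) (Dom E i)" using d by simp_all
  ultimately show ?thesis using eq by metis
qed

lemma conf_colift:
  assumes "(i, p) \<in> Conf E" "f \<in> Arr E" "Dom E f = Cod E i" "f \<cdot> i = Zero E (Dom E i) (Cod E f)"
  obtains h where "h \<in> Arr E" "Dom E h = Cod E p" "Cod E h = Cod E f" "h \<cdot> p = f"
  using conf_ker_coker[OF assms(1)] assms(2-) unfolding is_cokernel_def hom_iff by metis

lemma conf_epi:
  assumes c: "(i, p) \<in> Conf E" and f: "f \<in> Arr E" "Dom E f = Cod E p" and g: "g \<in> Arr E" "Dom E g = Cod E p"
    and eq: "f \<cdot> p = g \<cdot> p"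
  shows "f = g"
proof -
  note [simp] = conf_simps[OF c] f g
  have d: "Cod E g = Cod E f" using arg_cong[OF eq, of "Cod E"] by simp
  have z: "f \<cdot> p \<cdot> i = Zero E (Dom E i) (Cod E (f \<cdot> p))" by simp
  have U: "\<And>f. \<lbrakk>f \<in> Arr E; Dom E f = Cod E i; f \<cdot> i = Zero E (Dom E i) (Cod E f)\<rbrakk> \<Longrightarrow>
      \<exists>!h. h \<in> Hom E (Cod E p) (Cod E f) \<and> h \<cdot> p = f"
    using conf_ker_coker[OF c] unfolding is_cokernel_def by blast
  have "\<exists>!h. h \<in> Hom E (Cod E p) (Cod E (f \<cdot> p)) \<and> h \<cdot> p = f \<cdot> p"
    by (rule U[OF _ _ z]) simp_all
  moreover have "f \<in> Hom E (Cod E p) (Cod E (f \<cdot> p))" "g \<in> Hom E (Cod E p) (Cod E (f \<cdot> p))" using d by simp_all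
  ultimately show ?thesis using eq by metis
qed

text \<open>A factorization of \<open>i\<close> through \<open>i'\<close> and cancellability of
  \<open>i'\<close> already make the two isomorphic, and conflations are closed under isomorphism.
  Explicitly constructed kernels are recognized as inflations by this criterion.\<close>

lemma conf_of_kernel:
  assumes c: "(i, p) \<in> Conf E" and i': "i' \<in> Arr E" "Cod E i' = Cod E i" "p \<cdot> i' = Zero E (Dom E i') (Cod E p)"
    and lift: "\<exists>h. h \<in> Arr E \<and> Dom E h = Dom E i \<and> Cod E h = Dom E i' \<and> i' \<cdot> h = i"
    and mono: "\<And>f g. \<lbrakk>f \<in> Arr E; g \<in> Arr E; Dom E f = Dom E g; Cod E f = Dom E i'; Cod E g = Dom E i'; i' \<cdot> f = i' \<cdot> g\<rbrakk> \<Longrightarrow> f = g"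
  shows "(i', p) \<in> Conf E"
proof -
  note [simp] = conf_simps[OF c] i'
  obtain h where h [simp]: "h \<in> Arr E" "Dom E h = Dom E i" "Cod E h = Dom E i'" and ih: "i' \<cdot> h = i" using lift by blast
  obtain k where k [simp]: "k \<in> Arr E" "Dom E k = Dom E i'" "Cod E k = Dom E i" and ik: "i \<cdot> k = i'"
    using conf_lift[OF c, of i'] by auto
  have "i \<cdot> (k \<cdot> h) = i" using comp_reduce[OF ik, of h] ih by simp
  hence kh: "k \<cdot> h = Id E (Dom E i)" by (rule_tac conf_mono[OF c]) simp_all
  have "i' \<cdot> (h \<cdot> k) = i'" using comp_reduce[OF ih, of k] ik by simp
  hence hk: "h \<cdot> k = Id E (Dom E i')" by (rule_tac mono) simp_all
  have "is_iso E h" using kh hk by (intro is_isoI[of h k]) simp_all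
  thus ?thesis
    using ih by (intro conf_iso[OF c, of i' p h "Id E (Cod E i)" "Id E (Cod E p)"]) simp_all
qed

lemma conf_neg:
  assumes c: "(i, p) \<in> Conf E"
  shows "(Neg E i, p) \<in> Conf E"
  using conf_simps[OF c]
  by (intro conf_iso[OF c, of "Neg E i" p "Neg E (Id E (Dom E i))" "Id E (Cod E i)" "Id E (Cod E p)"]) simp_all

text \<open>The axiom provides some inflation with the identity as cokernel. It is zero, so the
  given zero object can replace its source.\<close>

lemma conf_id:
  assumes X [simp]: "X \<in> Obj E" and Z: "is_zero E Z"
  shows "(Zero E Z X, Id E X) \<in> Conf E"
proof -
  obtain i where c: "(i, Id E X) \<in> Conf E" using id_deflation[OF X] unfolding deflation_def by blast
  note s = conf_simps[OF c]
  have [simp]: "i \<in> Arr E" "Cod E i = X" "Z \<in> Obj E" using s X Z by simp_all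
  have i0: "i = Zero E (Dom E i) X" using s(4) by simp
  show ?thesis
  proof (rule conf_of_kernel[OF c])
    show "\<exists>h. h \<in> Arr E \<and> Dom E h = Dom E i \<and> Cod E h = Dom E (Zero E Z X) \<and> Zero E Z X \<cdot> h = i"
      using i0 by (intro exI[of _ "Zero E (Dom E i) Z"]) simp
    fix f g assume "f \<in> Arr E" "g \<in> Arr E" "Dom E f = Dom E g" "Cod E f = Dom E (Zero E Z X)" "Cod E g = Dom E (Zero E Z X)"
    thus "f = g" using to_zero[OF Z, of f "Dom E g"] to_zero[OF Z, of g "Dom E g"] by simp
  qed simp_all
qed

text \<open>The universal property split into existence and joint cancellability, since the chases
  below use the two separately.\<close>

definition pullback_square :: "'m \<Rightarrow> 'm \<Rightarrow> 'm \<Rightarrow> 'm \<Rightarrow> bool" where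
  "pullback_square p f f' p' \<longleftrightarrow> p \<in> Arr E \<and> f \<in> Arr E \<and> f' \<in> Arr E \<and> p' \<in> Arr E \<and> Cod E p = Cod E f \<and>
     Dom E f' = Dom E p' \<and> Cod E f' = Dom E p \<and> Cod E p' = Dom E f \<and> p \<cdot> f' = f \<cdot> p' \<and>
     (\<forall>a b. a \<in> Arr E \<longrightarrow> b \<in> Arr E \<longrightarrow> Dom E a = Dom E b \<longrightarrow> Cod E a = Dom E p \<longrightarrow> Cod E b = Dom E f \<longrightarrow>
        p \<cdot> a = f \<cdot> b \<longrightarrow> (\<exists>h. h \<in> Arr E \<and> Dom E h = Dom E a \<and> Cod E h = Dom E f' \<and> f' \<cdot> h = a \<and> p' \<cdot> h = b)) \<and>
     (\<forall>h k. h \<in> Arr E \<longrightarrow> k \<in> Arr E \<longrightarrow> Dom E h = Dom E k \<longrightarrow> Cod E h = Dom E f' \<longrightarrow> Cod E k = Dom E f' \<longrightarrow>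
        f' \<cdot> h = f' \<cdot> k \<longrightarrow> p' \<cdot> h = p' \<cdot> k \<longrightarrow> h = k)"

lemma pullback_squareD:
  assumes "pullback_square p f f' p'"
  shows "p \<in> Arr E" "f \<in> Arr E" "f' \<in> Arr E" "p' \<in> Arr E" "Cod E p = Cod E f" "Dom E f' = Dom E p'"
    "Cod E f' = Dom E p" "Cod E p' = Dom E f" "p \<cdot> f' = f \<cdot> p'"
  using assms unfolding pullback_square_def by blast+

lemma pullback_lift:
  assumes "pullback_square p f f' p'" "a \<in> Arr E" "b \<in> Arr E" "Dom E a = Dom E b" "Cod E a = Dom E p"
    "Cod E b = Dom E f" "p \<cdot> a = f \<cdot> b"
  obtains h where "h \<in> Arr E" "Dom E h = Dom E a" "Cod E h = Dom E p'" "f' \<cdot> h = a" "p' \<cdot> h = b"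
  using assms unfolding pullback_square_def by metis

lemma pullback_mono:
  assumes "pullback_square p f f' p'" "h \<in> Arr E" "k \<in> Arr E" "Dom E h = Dom E k" "Cod E h = Dom E p'"
    "Cod E k = Dom E p'" "f' \<cdot> h = f' \<cdot> k" "p' \<cdot> h = p' \<cdot> k"
  shows "h = k"
  using assms unfolding pullback_square_def by metis

text \<open>Pulling back a deflation does not change its kernel: \<open>i\<close> and zero induce
  the new inflation, which is then compared with the inflation that the axioms supply.\<close>

lemma pullback_kernel:
  assumes c: "(i, p) \<in> Conf E" and sq: "pullback_square p f f' p'" and c': "(k, p') \<in> Conf E"
  obtains i' where "(i', p') \<in> Conf E" "Dom E i' = Dom E i" "Cod E i' = Dom E p'" "f' \<cdot> i' = i"
proof -
  note D = pullback_squareD[OF sq]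
  note [simp] = conf_simps[OF c] conf_simps[OF c'] D(2,3) D(7)
  have [simp]: "Dom E f' = Cod E k" "Cod E p = Cod E f" "Cod E p' = Dom E f" using D by simp_all
  obtain i' where i' [simp]: "i' \<in> Arr E" "Dom E i' = Dom E i" "Cod E i' = Cod E k" and
    e: "f' \<cdot> i' = i" "p' \<cdot> i' = Zero E (Dom E i) (Dom E f)"
    using pullback_lift[OF sq, of i "Zero E (Dom E i) (Dom E f)"] by auto
  have "(i', p') \<in> Conf E"
  proof (rule conf_of_kernel[OF c'])
    have "p \<cdot> (f' \<cdot> k) = f \<cdot> (p' \<cdot> k)" using comp_reduce[OF D(9), of k] by simp
    hence "p \<cdot> (f' \<cdot> k) = Zero E (Dom E (f' \<cdot> k)) (Cod E p)" by simp
    then obtain t where t [simp]: "t \<in> Arr E" "Dom E t = Dom E k" "Cod E t = Dom E i" and it: "i \<cdot> t = f' \<cdot> k"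
      using conf_lift[OF c, of "f' \<cdot> k"] by auto
    have "i' \<cdot> t = k"
      using comp_reduce[OF e(1), of t] comp_reduce[OF e(2), of t] it
      by (rule_tac pullback_mono[OF sq]) simp_all
    thus "\<exists>h. h \<in> Arr E \<and> Dom E h = Dom E k \<and> Cod E h = Dom E i' \<and> i' \<cdot> h = k"
      by (intro exI[of _ t]) simp
  next
    fix g h assume gh [simp]: "g \<in> Arr E" "h \<in> Arr E" "Dom E g = Dom E h" "Cod E g = Dom E i'" "Cod E h = Dom E i'"
      and "i' \<cdot> g = i' \<cdot> h"
    hence "f' \<cdot> (i' \<cdot> g) = f' \<cdot> (i' \<cdot> h)" by simp
    hence "i \<cdot> g = i \<cdot> h" using comp_reduce[OF e(1), of g] comp_reduce[OF e(1), of h] by simp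
    thus "g = h" by (rule_tac conf_mono[OF c]) simp_all
  qed (simp_all add: e)
  thus thesis using that e by simp
qed

lemma pullback_ex:
  assumes c: "(i, p) \<in> Conf E" and f [simp]: "f \<in> Arr E" and pf: "Cod E f = Cod E p"
  obtains i' p' f' where "(i', p') \<in> Conf E" "pullback_square p f f' p'" "Dom E i' = Dom E i"
    "Cod E i' = Dom E p'" "f' \<cdot> i' = i"
proof -
  note [simp] = conf_simps[OF c]
  have "deflation E p" using c unfolding deflation_def by blast
  then obtain f' p' k where sq: "is_pullback E p f f' p'" and k: "(k, p') \<in> Conf E"
    using deflation_pullback[of p f] pf unfolding deflation_def by auto
  note [simp] = conf_simps[OF k]
  obtain P where P: "f' \<in> Hom E P (Dom E p)" "p' \<in> Hom E P (Dom E f)" "p \<cdot> f' = f \<cdot> p'" and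
    U: "\<And>W a b. \<lbrakk>W \<in> Obj E; a \<in> Hom E W (Dom E p); b \<in> Hom E W (Dom E f); p \<cdot> a = f \<cdot> b\<rbrakk> \<Longrightarrow>
      \<exists>!h. h \<in> Hom E W P \<and> f' \<cdot> h = a \<and> p' \<cdot> h = b"
    using sq unfolding is_pullback_def by blast
  have P' [simp]: "f' \<in> Arr E" "Dom E f' = Cod E k" "Cod E f' = Cod E i" "Cod E p' = Dom E f" and PP: "P = Cod E k"
    using P by simp_all
  have "pullback_square p f f' p'" unfolding pullback_square_def
  proof (intro conjI allI impI)
    fix a b assume "a \<in> Arr E" "b \<in> Arr E" "Dom E a = Dom E b" "Cod E a = Dom E p" "Cod E b = Dom E f" "p \<cdot> a = f \<cdot> b"
    thus "\<exists>h. h \<in> Arr E \<and> Dom E h = Dom E a \<and> Cod E h = Dom E f' \<and> f' \<cdot> h = a \<and> p' \<cdot> h = b"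
      using U[of "Dom E a" a b] PP by auto
  next
    fix h l assume hl [simp]: "h \<in> Arr E" "l \<in> Arr E" "Dom E h = Dom E l" "Cod E h = Dom E f'" "Cod E l = Dom E f'"
      and e: "f' \<cdot> h = f' \<cdot> l" "p' \<cdot> h = p' \<cdot> l"
    have "p \<cdot> (f' \<cdot> h) = f \<cdot> (p' \<cdot> h)" using comp_reduce[OF P(3), of h] by simp
    hence "\<exists>!x. x \<in> Hom E (Dom E l) P \<and> f' \<cdot> x = f' \<cdot> h \<and> p' \<cdot> x = p' \<cdot> h"
      by (intro U) simp_all
    moreover have "h \<in> Hom E (Dom E l) P" "l \<in> Hom E (Dom E l) P" using PP by simp_all
    ultimately show "h = l" using e by metis
  qed (use P(3) pf in simp_all)
  from pullback_kernel[OF c this k] that[OF _ this] show thesis by metis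
qed

text \<open>The axiom yields only some pullback along a deflation; every other one is isomorphic to
  it.\<close>

lemma deflation_of_pullback:
  assumes c: "(i, p) \<in> Conf E" and sq: "pullback_square p f f' p'"
  shows "deflation E p'"
proof -
  note [simp] = conf_simps[OF c] pullback_squareD[OF sq]
  obtain i1 p1 f1 where c1: "(i1, p1) \<in> Conf E" and sq1: "pullback_square p f f1 p1"
    by (rule pullback_ex[OF c, of f]) simp_all
  note D1 = pullback_squareD[OF sq1] and D = pullback_squareD[OF sq]
  have [simp]: "f1 \<in> Arr E" "p1 \<in> Arr E" "i1 \<in> Arr E" "Dom E f1 = Cod E i1" "Dom E p1 = Cod E i1" "Cod E f1 = Cod E i"
    "Cod E p1 = Dom E f" using D1 conf_simps[OF c1] by simp_all
  obtain h where h [simp]: "h \<in> Arr E" "Dom E h = Cod E i1" "Cod E h = Dom E p'" and e: "f' \<cdot> h = f1" "p' \<cdot> h = p1"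
    using pullback_lift[OF sq, of f1 p1] D1(9) by auto
  obtain l where l [simp]: "l \<in> Arr E" "Dom E l = Dom E p'" "Cod E l = Cod E i1" and e': "f1 \<cdot> l = f'" "p1 \<cdot> l = p'"
    using pullback_lift[OF sq1, of f' p'] D(9) by auto
  have "h \<cdot> l = Id E (Dom E p')"
    using comp_reduce[OF e(1), of l] comp_reduce[OF e(2), of l] e'
    by (rule_tac pullback_mono[OF sq]) simp_all
  moreover have "l \<cdot> h = Id E (Cod E i1)"
    using comp_reduce[OF e'(1), of h] comp_reduce[OF e'(2), of h] e
    by (rule_tac pullback_mono[OF sq1]) simp_all
  ultimately have "is_iso E h" by (intro is_isoI[of h l]) simp_all
  hence "(h \<cdot> i1, p') \<in> Conf E"
    by (intro conf_iso[OF c1, of "h \<cdot> i1" p' "Id E (Dom E i1)" h "Id E (Dom E f)"]) (simp_all add: e)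
  thus ?thesis unfolding deflation_def by blast
qed

lemma pushout_ex:
  assumes i: "inflation E i" and f: "f \<in> Arr E" "Dom E f = Dom E i" and ia: "i \<in> Arr E"
  obtains i' f' where "is_pushout E i f f' i'" "inflation E i'" "f' \<in> Arr E" "i' \<in> Arr E" "Dom E f' = Cod E i"
    "Dom E i' = Cod E f" "Cod E f' = Cod E i'" "f' \<cdot> i = i' \<cdot> f"
    "\<And>a b. \<lbrakk>a \<in> Arr E; b \<in> Arr E; Dom E a = Cod E i; Dom E b = Cod E f; Cod E a = Cod E b; a \<cdot> i = b \<cdot> f\<rbrakk> \<Longrightarrow>
      \<exists>h. h \<in> Arr E \<and> Dom E h = Cod E i' \<and> Cod E h = Cod E b \<and> h \<cdot> f' = a \<and> h \<cdot> i' = b"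
    "\<And>h k. \<lbrakk>h \<in> Arr E; k \<in> Arr E; Dom E h = Cod E i'; Dom E k = Cod E i'; Cod E h = Cod E k; h \<cdot> f' = k \<cdot> f'; h \<cdot> i' = k \<cdot> i'\<rbrakk> \<Longrightarrow> h = k"
proof -
  obtain f' i' where sq: "is_pushout E i f f' i'" and i': "inflation E i'"
    using inflation_pushout[OF i f(1) f(2)[symmetric]] by blast
  then obtain P where P: "f' \<in> Hom E (Cod E i) P" "i' \<in> Hom E (Cod E f) P" "f' \<cdot> i = i' \<cdot> f" and
    U: "\<And>W a b. \<lbrakk>W \<in> Obj E; a \<in> Hom E (Cod E i) W; b \<in> Hom E (Cod E f) W; a \<cdot> i = b \<cdot> f\<rbrakk> \<Longrightarrow>
      \<exists>!h. h \<in> Hom E P W \<and> h \<cdot> f' = a \<and> h \<cdot> i' = b"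
    unfolding is_pushout_def by blast
  have P' [simp]: "f' \<in> Arr E" "i' \<in> Arr E" "Dom E f' = Cod E i" "Dom E i' = Cod E f" "Cod E f' = Cod E i'" and
    PP: "P = Cod E i'" using P by simp_all
  note [simp] = f ia
  show thesis
  proof (rule that[OF sq i' P'(1-5) P(3)])
    fix a b assume "a \<in> Arr E" "b \<in> Arr E" "Dom E a = Cod E i" "Dom E b = Cod E f" "Cod E a = Cod E b" "a \<cdot> i = b \<cdot> f"
    thus "\<exists>h. h \<in> Arr E \<and> Dom E h = Cod E i' \<and> Cod E h = Cod E b \<and> h \<cdot> f' = a \<and> h \<cdot> i' = b"
      using U[of "Cod E b" a b] PP by auto
  next
    fix h k assume hk [simp]: "h \<in> Arr E" "k \<in> Arr E" "Dom E h = Cod E i'" "Dom E k = Cod E i'" "Cod E h = Cod E k"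
      and e: "h \<cdot> f' = k \<cdot> f'" "h \<cdot> i' = k \<cdot> i'"
    have "(h \<cdot> f') \<cdot> i = (h \<cdot> i') \<cdot> f" using P(3) by simp
    hence "\<exists>!x. x \<in> Hom E P (Cod E k) \<and> x \<cdot> f' = h \<cdot> f' \<and> x \<cdot> i' = h \<cdot> i'"
      by (intro U) simp_all
    moreover have "h \<in> Hom E P (Cod E k)" "k \<in> Hom E P (Cod E k)" using PP by simp_all
    ultimately show "h = k" using e by metis
  qed
qed

lemma injective_extend:
  assumes "injective E I" "(i, p) \<in> Conf E" "f \<in> Arr E" "Dom E f = Dom E i" "Cod E f = I"
  obtains g where "g \<in> Arr E" "Dom E g = Cod E i" "Cod E g = I" "g \<cdot> i = f"
proof -
  have "inflation E i" "f \<in> Hom E (Dom E i) I" using assms unfolding inflation_def by auto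
  then obtain g where "g \<in> Hom E (Cod E i) I" "g \<cdot> i = f" using assms(1) unfolding injective_def by blast
  thus thesis using that[of g] by simp
qed

end

section \<open>Injective objects and stably trivial morphisms\<close>

lemma injective_factorE:
  assumes "f \<in> injective_factor E"
  obtains I g h where "injective E I" "g \<in> Arr E" "h \<in> Arr E" "Dom E g = Dom E f" "Cod E g = I" "Dom E h = I"
    "Cod E h = Cod E f" "f = h \<cdot>\<^bsub>E\<^esub> g"
  using assms unfolding injective_factor_def by auto

context frobenius_category
begin

text \<open>Here the Frobenius condition enters: the injective object is projective, so it also
  lifts along deflations.\<close>

lemma injective_lift:
  assumes I: "injective E I" and c: "(i, p) \<in> Conf E" and f: "f \<in> Arr E" "Dom E f = I" "Cod E f = Cod E p"
  obtains g where "g \<in> Arr E" "Dom E g = I" "Cod E g = Cod E i" "p \<cdot> g = f"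
proof -
  have "projective E I" using I projective_iff_injective by simp
  moreover have "deflation E p" using c unfolding deflation_def by blast
  moreover have "f \<in> Hom E I (Cod E p)" using f by simp
  ultimately obtain g where "g \<in> Hom E I (Dom E p)" "p \<cdot> g = f"
    unfolding projective_def by blast
  thus thesis using that[of g] conf_simps(3)[OF c] by simp
qed

lemma injective_conf:
  assumes "X \<in> Obj E"
  obtains i p where "(i, p) \<in> Conf E" "Dom E i = X" "injective E (Cod E i)"
  using enough_injectives[OF assms] unfolding inflation_def by blast

lemma injective_factorI:
  "\<lbrakk>injective E I; g \<in> Arr E; h \<in> Arr E; Cod E g = I; Dom E h = I\<rbrakk> \<Longrightarrow> h \<cdot> g \<in> injective_factor E"
  unfolding injective_factor_def
  by (intro CollectI conjI exI[of _ I] bexI[of _ g] bexI[of _ h]) simp_all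

lemma injective_factor_ideal: "ideal_quotient E (injective_factor E)"
proof (intro ideal_quotient.intro ideal_quotient_axioms.intro)
  show "additive_category E" ..
  show "f \<in> Arr E" if "f \<in> injective_factor E" for f using that unfolding injective_factor_def by simp
next
  fix X Y assume [simp]: "X \<in> Obj E" "Y \<in> Obj E"
  obtain i p where c: "(i, p) \<in> Conf E" "Dom E i = X" and I: "injective E (Cod E i)" by (rule injective_conf[of X]) simp_all
  note [simp] = conf_simps[OF c(1)] c(2)
  show "Zero E X Y \<in> injective_factor E"
    using injective_factorI[OF I, of i "Zero E (Cod E i) Y"] by simp
next
  fix f g assume f: "f \<in> injective_factor E" and g: "g \<in> injective_factor E" and fg: "Dom E g = Dom E f" "Cod E g = Cod E f"
  obtain I a b where I: "injective E I" and [simp]: "a \<in> Arr E" "b \<in> Arr E" "Dom E a = Dom E f" "Cod E a = I" "Dom E b = I"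
    "Cod E b = Cod E f" and fe: "f = b \<cdot> a" by (rule injective_factorE[OF f])
  obtain J c d where J: "injective E J" and [simp]: "c \<in> Arr E" "d \<in> Arr E" "Dom E c = Dom E g" "Cod E c = J" "Dom E d = J"
    "Cod E d = Cod E g" and ge: "g = d \<cdot> c" by (rule injective_factorE[OF g])
  have [simp]: "I \<in> Obj E" "J \<in> Obj E" using I J unfolding injective_def by auto
  have [simp]: "f \<in> Arr E" "g \<in> Arr E" using f g unfolding injective_factor_def by auto
  obtain S i j p q where B: "is_biproduct E I J S i j p q" using ex_biproduct[of I J] by auto
  note [simp] = biproduct_simps[OF B] fg
  \<comment> \<open>Factorizations through I and J combine to one through their biproduct, which is
    injective because extensions can be found componentwise.\<close>
  have "injective E S" unfolding injective_def
  proof (intro conjI allI impI ballI)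
    fix k f assume k: "inflation E k" and f: "f \<in> Hom E (Dom E k) S"
    have ka [simp]: "k \<in> Arr E" using k conf_simps unfolding inflation_def by blast
    have pf: "p \<cdot> f \<in> Hom E (Dom E k) I" "q \<cdot> f \<in> Hom E (Dom E k) J" using f by auto
    obtain x where x: "x \<in> Hom E (Cod E k) I" "x \<cdot> k = p \<cdot> f" 
      using I k f pf unfolding injective_def by blast
    obtain y where y: "y \<in> Hom E (Cod E k) J" "y \<cdot> k = q \<cdot> f" 
      using J k f pf unfolding injective_def by blast
    show "\<exists>g\<in>Hom E (Cod E k) S. g \<cdot> k = f"
      using x y f biproduct_sum(2)[OF B, of f] by (intro bexI[of _ "i \<cdot> x \<oplus> j \<cdot> y"]) auto
  qed simp
  from injective_factorI[OF this, of "i \<cdot> a \<oplus> j \<cdot> c" "b \<cdot> p \<oplus> d \<cdot> q"]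
  show "f \<oplus> g \<in> injective_factor E" unfolding fe ge by simp
next
  fix f g assume f: "f \<in> injective_factor E" and g [simp]: "g \<in> Arr E"
  obtain I a b where I: "injective E I" and [simp]: "a \<in> Arr E" "b \<in> Arr E" "Dom E a = Dom E f" "Cod E a = I" "Dom E b = I"
    "Cod E b = Cod E f" and fe: "f = b \<cdot> a" by (rule injective_factorE[OF f])
  show "g \<cdot> f \<in> injective_factor E" if "Dom E g = Cod E f"
    using injective_factorI[OF I, of a "g \<cdot> b"] that unfolding fe by simp
  show "f \<cdot> g \<in> injective_factor E" if "Cod E g = Dom E f"
    using injective_factorI[OF I, of "a \<cdot> g" b] that unfolding fe by simp
qed

end

section \<open>Triangulated categories with a Frobenius model\<close>

text \<open>What is used of an equivalence of \<open>T\<close> with the stable category of \<open>E\<close>: the induced functor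
  from \<open>E\<close> to \<open>T\<close> and the connecting morphisms of the triangles given by conflations.\<close>

locale frobenius_model = E: frobenius_category E + T: triangulated_category T + Phi: additive_functor E T \<Phi>
  for E :: "('a, 'b, 'y) excat_scheme" and T :: "('o, 'm, 'z) tricat_scheme" and \<Phi> :: "('a, 'b, 'o, 'm) catfun" +
  fixes \<delta> :: "'b \<Rightarrow> 'b \<Rightarrow> 'm"
  assumes Phi_full: "\<lbrakk>X \<in> Obj E; Y \<in> Obj E; h \<in> Arr T; Dom T h = fobj \<Phi> X; Cod T h = fobj \<Phi> Y\<rbrakk> \<Longrightarrow>
      \<exists>f. f \<in> Arr E \<and> Dom E f = X \<and> Cod E f = Y \<and> fmor \<Phi> f = h"
    and Phi_zero_iff: "f \<in> Arr E \<Longrightarrow>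
      fmor \<Phi> f = Zero T (fobj \<Phi> (Dom E f)) (fobj \<Phi> (Cod E f)) \<longleftrightarrow> f \<in> injective_factor E"
    and Phi_ess_surj: "Z \<in> Obj T \<Longrightarrow> \<exists>X \<in> Obj E. isomorphic T (fobj \<Phi> X) Z"
    and delta_tri: "(i, p) \<in> Conf E \<Longrightarrow> (fmor \<Phi> i, fmor \<Phi> p, \<delta> i p) \<in> Tri T"
    and delta_natural: "\<lbrakk>(i, p) \<in> Conf E; (i', p') \<in> Conf E; a \<in> Hom E (Dom E i) (Dom E i');
      b \<in> Hom E (Cod E i) (Cod E i'); c \<in> Hom E (Cod E p) (Cod E p'); b \<cdot>\<^bsub>E\<^esub> i = i' \<cdot>\<^bsub>E\<^esub> a; c \<cdot>\<^bsub>E\<^esub> p = p' \<cdot>\<^bsub>E\<^esub> b\<rbrakk> \<Longrightarrow>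
      fmor (Sh T) (fmor \<Phi> a) \<cdot>\<^bsub>T\<^esub> \<delta> i p = \<delta> i' p' \<cdot>\<^bsub>T\<^esub> fmor \<Phi> c"

section \<open>The stable category and its connecting morphisms\<close>

locale stable_model = frobenius_category E
  for E :: "('o, 'm, 'z) excat_scheme" (structure) +
  fixes c :: "'o \<Rightarrow> 'm \<times> 'm"
  assumes choice: "injective_choice E c"

sublocale stable_model \<subseteq> st: ideal_quotient E "injective_factor E"
  by (rule injective_factor_ideal)

context stable_model
begin

abbreviation "J X \<equiv> fst (c X)"
abbreviation "\<pi> X \<equiv> snd (c X)"

lemma choice_simps [simp]:
  assumes "X \<in> Obj E"
  shows "(J X, \<pi> X) \<in> Conf E" "c X \<in> Conf E" "Dom E (J X) = X" "injective E (Cod E (J X))"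
    "J X \<in> Arr E" "\<pi> X \<in> Arr E" "Dom E (\<pi> X) = Cod E (J X)" "\<pi> X \<cdot> J X = Zero E X (Cod E (\<pi> X))"
proof -
  show *: "(J X, \<pi> X) \<in> Conf E" "c X \<in> Conf E" "Dom E (J X) = X" "injective E (Cod E (J X))"
    using choice assms unfolding injective_choice_def by auto
  show "J X \<in> Arr E" "\<pi> X \<in> Arr E" "Dom E (\<pi> X) = Cod E (J X)" "\<pi> X \<cdot> J X = Zero E X (Cod E (\<pi> X))"
    using conf_simps[OF *(1)] *(3) by simp_all
qed

lemma stable_sel [simp]:
  "Obj (stable_category E c) = Obj E" "Arr (stable_category E c) = Arr st.Q"
  "Dom (stable_category E c) = Dom st.Q" "Cod (stable_category E c) = Cod st.Q"
  "Id (stable_category E c) = Id st.Q" "Comp (stable_category E c) = Comp st.Q"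
  "Add (stable_category E c) = Add st.Q" "Zero (stable_category E c) = Zero st.Q"
  "Sh (stable_category E c) = stable_shift E c" "Tri (stable_category E c) = stable_triangles E c"
  "Neg (stable_category E c) = Neg st.Q"
  by (auto simp: stable_category_def tricat.defs fun_eq_iff) (simp_all add: addcat.defs)

text \<open>Unpacks the two choices hidden in \<open>stable_shift\<close>: a representative
  \<open>r\<close> of the class, which agrees with \<open>f\<close> only modulo injectives, and an
  induced map \<open>h\<close> on the cokernels.\<close>

lemma stable_shift_mor:
  assumes f [simp]: "f \<in> Arr E"
  obtains r g h where "r \<in> Arr E" "Dom E r = Dom E f" "Cod E r = Cod E f" "r \<oplus> Neg E f \<in> injective_factor E"
    "g \<in> Arr E" "Dom E g = Cod E (J (Dom E f))" "Cod E g = Cod E (J (Cod E f))" "g \<cdot> J (Dom E f) = J (Cod E f) \<cdot> r"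
    "h \<in> Arr E" "Dom E h = Cod E (\<pi> (Dom E f))" "Cod E h = Cod E (\<pi> (Cod E f))" "h \<cdot> \<pi> (Dom E f) = \<pi> (Cod E f) \<cdot> g"
    "fmor (stable_shift E c) (st.cls f) = st.cls h"
proof -
  let ?r = "rep (st.cls f)" and ?X = "Dom E f" and ?Y = "Cod E f"
  note r = st.rep_cls[OF f]
  note [simp] = r(1-3)
  obtain g0 where g0: "g0 \<in> Arr E" "Dom E g0 = Cod E (J ?X)" "Cod E g0 = Cod E (J ?Y)" "g0 \<cdot> J ?X = J ?Y \<cdot> ?r"
    using injective_extend[of "Cod E (J ?Y)" "J ?X" "\<pi> ?X" "J ?Y \<cdot> ?r"] by auto
  have "(\<pi> ?Y \<cdot> g0) \<cdot> J ?X = Zero E (Dom E (J ?X)) (Cod E (\<pi> ?Y \<cdot> g0))"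
    using g0 comp_reduce[OF choice_simps(8)[of ?Y], of ?r] by simp
  then obtain h0 where h0: "h0 \<in> Arr E" "Dom E h0 = Cod E (\<pi> ?X)" "Cod E h0 = Cod E (\<pi> ?Y)" "h0 \<cdot> \<pi> ?X = \<pi> ?Y \<cdot> g0"
    using conf_colift[of "J ?X" "\<pi> ?X" "\<pi> ?Y \<cdot> g0"] g0 by auto
  define P where "P = (\<lambda>h. h \<in> Hom E (Cod E (\<pi> ?X)) (Cod E (\<pi> ?Y)) \<and>
            (\<exists>g \<in> Hom E (Cod E (J ?X)) (Cod E (J ?Y)). g \<cdot> J ?X = J ?Y \<cdot> ?r \<and> h \<cdot> \<pi> ?X = \<pi> ?Y \<cdot> g))"
  define k where "k = (SOME h. P h)"
  have "P h0" unfolding P_def using h0 g0 by auto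
  hence Pk: "P k" unfolding k_def by (rule someI[of P])
  obtain g where g: "k \<in> Arr E" "Dom E k = Cod E (\<pi> ?X)" "Cod E k = Cod E (\<pi> ?Y)"
    "g \<in> Arr E" "Dom E g = Cod E (J ?X)" "Cod E g = Cod E (J ?Y)" "g \<cdot> J ?X = J ?Y \<cdot> ?r"
    "k \<cdot> \<pi> ?X = \<pi> ?Y \<cdot> g" using Pk[unfolded P_def hom_iff Bex_def] by (elim conjE exE) 
  have v: "fmor (stable_shift E c) (st.cls f) = st.cls k"
    unfolding stable_shift_def k_def P_def by (simp add: Let_def split_beta)
  show thesis by (rule that[of ?r g k]) (use g r v in simp_all)
qed

text \<open>The maps \<open>g\<close> and \<open>w\<close> compare a conflation with the chosen
  injective conflation on the same first object; \<open>w\<close> is the negative of the third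
  morphism of the triangle.\<close>

definition connecting :: "'m \<Rightarrow> 'm \<Rightarrow> 'm \<Rightarrow> 'm \<Rightarrow> bool" where
  "connecting i p g w \<longleftrightarrow> g \<in> Arr E \<and> Dom E g = Cod E i \<and> Cod E g = Cod E (J (Dom E i)) \<and> g \<cdot> i = J (Dom E i) \<and>
     w \<in> Arr E \<and> Dom E w = Cod E p \<and> Cod E w = Cod E (\<pi> (Dom E i)) \<and> w \<cdot> p = \<pi> (Dom E i) \<cdot> g"

lemma connecting_ex:
  assumes cf: "(i, p) \<in> Conf E"
  shows "\<exists>w g. connecting i p g w"
proof -
  note [simp] = conf_simps[OF cf]
  obtain g where g [simp]: "g \<in> Arr E" "Dom E g = Cod E i" "Cod E g = Cod E (J (Dom E i))" "g \<cdot> i = J (Dom E i)"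
    using injective_extend[OF _ cf, of "Cod E (J (Dom E i))" "J (Dom E i)"] by auto
  obtain w where "w \<in> Arr E" "Dom E w = Cod E p" "Cod E w = Cod E (\<pi> (Dom E i))" "w \<cdot> p = \<pi> (Dom E i) \<cdot> g"
    using conf_colift[OF cf, of "\<pi> (Dom E i) \<cdot> g"] by auto
  thus ?thesis unfolding connecting_def by (intro exI[of _ w] exI[of _ g]) simp
qed

lemma connecting_natural:
  assumes c1: "(i, p) \<in> Conf E" and c2: "(i', p') \<in> Conf E" and k1: "connecting i p g w" and k2: "connecting i' p' g' w'"
    and a [simp]: "a \<in> Arr E" "Dom E a = Dom E i" "Cod E a = Dom E i'" and b [simp]: "b \<in> Arr E" "Dom E b = Cod E i" "Cod E b = Cod E i'"
    and d [simp]: "d \<in> Arr E" "Dom E d = Cod E p" "Cod E d = Cod E p'" and e: "b \<cdot> i = i' \<cdot> a" "d \<cdot> p = p' \<cdot> b"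
  shows "fmor (stable_shift E c) (st.cls a) \<cdot>\<^bsub>st.Q\<^esub> st.cls w = st.cls w' \<cdot>\<^bsub>st.Q\<^esub> st.cls d"
proof -
  note [simp] = conf_simps[OF c1] conf_simps[OF c2]
  have k1' [simp]: "g \<in> Arr E" "Dom E g = Cod E i" "Cod E g = Cod E (J (Dom E i))" "g \<cdot> i = J (Dom E i)"
     "w \<in> Arr E" "Dom E w = Cod E p" "Cod E w = Cod E (\<pi> (Dom E i))" and wp: "w \<cdot> p = \<pi> (Dom E i) \<cdot> g"
    using k1 unfolding connecting_def by auto
  have k2' [simp]: "g' \<in> Arr E" "Dom E g' = Cod E i'" "Cod E g' = Cod E (J (Dom E i'))" "g' \<cdot> i' = J (Dom E i')"
     "w' \<in> Arr E" "Dom E w' = Cod E p'" "Cod E w' = Cod E (\<pi> (Dom E i'))" and wp': "w' \<cdot> p' = \<pi> (Dom E i') \<cdot> g'"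
    using k2 unfolding connecting_def by auto
  obtain r y h where r: "r \<in> Arr E" "Dom E r = Dom E a" "Cod E r = Cod E a" "r \<oplus> Neg E a \<in> injective_factor E"
    and y: "y \<in> Arr E" "Dom E y = Cod E (J (Dom E a))" "Cod E y = Cod E (J (Cod E a))" "y \<cdot> J (Dom E a) = J (Cod E a) \<cdot> r"
    and h: "h \<in> Arr E" "Dom E h = Cod E (\<pi> (Dom E a))" "Cod E h = Cod E (\<pi> (Cod E a))" "h \<cdot> \<pi> (Dom E a) = \<pi> (Cod E a) \<cdot> y"
    and v: "fmor (stable_shift E c) (st.cls a) = st.cls h"
    by (rule stable_shift_mor[OF a(1)])
  note [simp] = r(1-3) y(1-3) h(1-3)
  have y4: "y \<cdot> J (Dom E i) = J (Dom E i') \<cdot> r" and h4: "h \<cdot> \<pi> (Dom E i) = \<pi> (Dom E i') \<cdot> y"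
    using y(4) h(4) by simp_all
  obtain I x z where I: "injective E I" and xz: "x \<in> Arr E" "z \<in> Arr E" "Dom E x = Dom E (r \<oplus> Neg E a)"
    "Cod E x = I" "Dom E z = I" "Cod E z = Cod E (r \<oplus> Neg E a)" and rz: "r \<oplus> Neg E a = z \<cdot> x"
    by (rule injective_factorE[OF r(4)])
  have [simp]: "x \<in> Arr E" "z \<in> Arr E" "Dom E x = Dom E i" "Cod E x = I" "Dom E z = I" "Cod E z = Dom E i'"
    using xz by simp_all
  obtain x' where x' [simp]: "x' \<in> Arr E" "Dom E x' = Cod E i" "Cod E x' = I" and xe: "x' \<cdot> i = x"
    using injective_extend[OF I c1, of x] by auto
  \<comment> \<open>The last term corrects for the difference of \<open>r\<close> and
    \<open>a\<close>, so that the sum vanishes on \<open>i\<close> and factors through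
    \<open>p\<close> by some \<open>s\<close>. The correction dies under \<pi>, so the two sides of
    the claim differ by \<pi> s, which passes through an injective object.\<close>
  let ?t = "y \<cdot> g \<oplus> Neg E (g' \<cdot> b) \<oplus> Neg E (J (Dom E i') \<cdot> (z \<cdot> x'))"
  have "?t \<cdot> i = J (Dom E i') \<cdot> ((r \<oplus> Neg E a) \<oplus> Neg E (z \<cdot> x))"
    using comp_reduce[OF k2'(4), of a] by (simp add: e y4 xe)
  also have "\<dots> = Zero E (Dom E i) (Cod E (J (Dom E i')))" unfolding rz by simp
  finally obtain s where s [simp]: "s \<in> Arr E" "Dom E s = Cod E p" "Cod E s = Cod E (J (Dom E i'))" and st: "s \<cdot> p = ?t"
    using conf_colift[OF c1, of ?t] by auto
  have "(h \<cdot> w \<oplus> Neg E (w' \<cdot> d)) \<cdot> p = \<pi> (Dom E i') \<cdot> (y \<cdot> g \<oplus> Neg E (g' \<cdot> b))"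
    using comp_reduce[OF h4, of g] comp_reduce[OF wp', of b] by (simp add: wp e)
  also have "\<dots> = \<pi> (Dom E i') \<cdot> ?t"
    using comp_reduce[OF choice_simps(8)[of "Dom E i'"], of "z \<cdot> x'"] by simp
  also have "\<dots> = (\<pi> (Dom E i') \<cdot> s) \<cdot> p" using st by simp
  finally have "h \<cdot> w \<oplus> Neg E (w' \<cdot> d) = \<pi> (Dom E i') \<cdot> s" by (rule_tac conf_epi[OF c1]) simp_all
  also have "\<dots> \<in> injective_factor E"
    by (rule injective_factorI[of "Cod E (J (Dom E i'))"]) simp_all
  finally have "st.cls (h \<cdot> w) = st.cls (w' \<cdot> d)" by (subst st.cls_eq_iff) simp_all
  thus ?thesis using v by simp
qed

text \<open>A standard triangle has the pushout of \<open>i\<close> and the injective hull as its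
  third object. Stably this pushout is the cokernel of \<open>i\<close>, and under the
  identification the standard third morphism becomes the negative of the connecting one.\<close>

lemma connecting_tri:
  assumes cf: "(i, p) \<in> Conf E" and k: "connecting i p g wb"
  shows "(st.cls i, st.cls p, Neg st.Q (st.cls wb)) \<in> stable_triangles E c"
proof -
  note [simp] = conf_simps[OF cf]
  let ?X = "Dom E i"
  have k' [simp]: "g \<in> Arr E" "Dom E g = Cod E i" "Cod E g = Cod E (J ?X)" "g \<cdot> i = J ?X"
     "wb \<in> Arr E" "Dom E wb = Cod E p" "Cod E wb = Cod E (\<pi> ?X)" and wp: "wb \<cdot> p = \<pi> ?X \<cdot> g"
    using k unfolding connecting_def by auto
  have "inflation E (J ?X)" unfolding inflation_def by (rule exI[of _ "\<pi> ?X"]) (rule choice_simps(1), simp)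
  note po = pushout_ex[OF this conf_simps(1)[OF cf] choice_simps(3)[symmetric] choice_simps(5)]
  have X: "?X \<in> Obj E" by simp
  obtain v a where sq: "is_pushout E (J ?X) i a v" and "inflation E v" and
    av: "a \<in> Arr E" "v \<in> Arr E" "Dom E a = Cod E (J ?X)" "Dom E v = Cod E i" "Cod E a = Cod E v" and
    ai: "a \<cdot> J ?X = v \<cdot> i" and
    U: "\<And>x y. \<lbrakk>x \<in> Arr E; y \<in> Arr E; Dom E x = Cod E (J ?X); Dom E y = Cod E i; Cod E x = Cod E y; x \<cdot> J ?X = y \<cdot> i\<rbrakk> \<Longrightarrow>
      \<exists>h. h \<in> Arr E \<and> Dom E h = Cod E v \<and> Cod E h = Cod E y \<and> h \<cdot> a = x \<and> h \<cdot> v = y" and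
    M: "\<And>h k. \<lbrakk>h \<in> Arr E; k \<in> Arr E; Dom E h = Cod E v; Dom E k = Cod E v; Cod E h = Cod E k; h \<cdot> a = k \<cdot> a; h \<cdot> v = k \<cdot> v\<rbrakk> \<Longrightarrow> h = k"
    by (rule po[OF X X]) (rule that, assumption+)
  note [simp] = av
  obtain w where w [simp]: "w \<in> Arr E" "Dom E w = Cod E v" "Cod E w = Cod E (\<pi> ?X)" and
    we: "w \<cdot> a = \<pi> ?X" "w \<cdot> v = Zero E (Cod E i) (Cod E (\<pi> ?X))"
    using U[of "\<pi> ?X" "Zero E (Cod E i) (Cod E (\<pi> ?X))"] by auto
  obtain r where r [simp]: "r \<in> Arr E" "Dom E r = Cod E v" "Cod E r = Cod E p" and
    re: "r \<cdot> a = Zero E (Cod E (J ?X)) (Cod E p)" "r \<cdot> v = p"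
    using U[of "Zero E (Cod E (J ?X)) (Cod E p)" p] by auto
  obtain t where t [simp]: "t \<in> Arr E" "Dom E t = Cod E v" "Cod E t = Cod E (J ?X)" and
    te: "t \<cdot> a = Id E (Cod E (J ?X))" "t \<cdot> v = g"
    using U[of "Id E (Cod E (J ?X))" g] by auto
  have I: "injective E (Cod E (J ?X))" by simp
  \<comment> \<open>Origin of the sign: the sum of the two candidates for the third morphism factors
    through the injective object, as one sees on both legs of the pushout.\<close>
  have "w \<oplus> wb \<cdot> r = \<pi> ?X \<cdot> t"
    by (rule M) (simp_all add: we re te wp)
  moreover have "\<pi> ?X \<cdot> t \<in> injective_factor E" by (rule injective_factorI[OF I]) simp_all
  ultimately have w': "st.cls w = st.cls (Neg E (wb \<cdot> r))" by (subst st.cls_eq_iff) simp_all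
  \<comment> \<open>The section \<open>s\<close> of \<open>r\<close> is induced by v - a g. The
    defect 1 - s r is a t, which passes through the injective object, so \<open>r\<close> is stably
    invertible.\<close>
  have "(v \<oplus> Neg E (a \<cdot> g)) \<cdot> i = Zero E ?X (Cod E v)" using ai by simp
  then obtain s where s [simp]: "s \<in> Arr E" "Dom E s = Cod E p" "Cod E s = Cod E v" and sp: "s \<cdot> p = v \<oplus> Neg E (a \<cdot> g)"
    using conf_colift[OF cf, of "v \<oplus> Neg E (a \<cdot> g)"] by auto
  have "(r \<cdot> s) \<cdot> p = Id E (Cod E p) \<cdot> p"
    using comp_reduce[OF re(1), of g] by (simp add: sp re)
  hence rs: "r \<cdot> s = Id E (Cod E p)" by (rule_tac conf_epi[OF cf]) simp_all
  have "Id E (Cod E v) \<oplus> Neg E (s \<cdot> r) = a \<cdot> t"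
    by (rule M) (simp_all add: re te sp)
  moreover have "a \<cdot> t \<in> injective_factor E" by (rule injective_factorI[OF I]) simp_all
  ultimately have "st.cls (Id E (Cod E v)) = st.cls (s \<cdot> r)" by (subst st.cls_eq_iff) simp_all
  hence ri: "is_iso st.Q (st.cls r)" using rs by (intro st.Q_isoI[of r s]) simp_all
  interpret q: additive_category st.Q by (rule st.Q_additive)
  have ids: "is_iso st.Q (st.cls (Id E ?X))" "is_iso st.Q (st.cls (Id E (Cod E i)))"
    using q.iso_Id[of ?X] q.iso_Id[of "Cod E i"] by simp_all
  \<comment> \<open>Functoriality of the suspension is not at hand here. Naturality of the
    connecting morphism shows that the suspended identity fixes \<open>wb\<close>, hence also
    \<open>w\<close>, which is stably -wb r.\<close>
  have sid: "fmor (stable_shift E c) (st.cls (Id E ?X)) \<cdot>\<^bsub>st.Q\<^esub> st.cls w = st.cls w"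
  proof -
    have cw: "connecting i p g wb" by (rule k)
    have "fmor (stable_shift E c) (st.cls (Id E ?X)) \<cdot>\<^bsub>st.Q\<^esub> st.cls wb = st.cls wb \<cdot>\<^bsub>st.Q\<^esub> st.cls (Id E (Cod E p))"
      by (rule connecting_natural[OF cf cf k k, where b = "Id E (Cod E i)"]) simp_all
    hence 1: "fmor (stable_shift E c) (st.cls (Id E ?X)) \<cdot>\<^bsub>st.Q\<^esub> st.cls wb = st.cls wb" by simp
    obtain h where h [simp]: "h \<in> Arr E" "Dom E h = Cod E (\<pi> ?X)" "Cod E h = Cod E (\<pi> ?X)" and
      hv: "fmor (stable_shift E c) (st.cls (Id E ?X)) = st.cls h"
      by (rule stable_shift_mor[of "Id E ?X"]) simp_all
    have "st.cls h \<cdot>\<^bsub>st.Q\<^esub> st.cls w = st.cls (Neg E (h \<cdot> wb \<cdot> r))" unfolding w' by simp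
    also have "\<dots> = Neg st.Q ((st.cls h \<cdot>\<^bsub>st.Q\<^esub> st.cls wb) \<cdot>\<^bsub>st.Q\<^esub> st.cls r)" by simp
    also have "\<dots> = st.cls w" using 1 unfolding hv w' by simp
    finally show ?thesis unfolding hv .
  qed
  have so: "fobj (stable_shift E c) X = Cod E (\<pi> X)" for X by (simp add: stable_shift_def)
  have "triangle_iso st.Q (stable_shift E c) (st.cls i, st.cls v, st.cls w)
    (st.cls i, st.cls p, Neg st.Q (st.cls wb))"
    by (rule triangle_isoI[OF ids ri]) (use sid in \<open>simp_all add: so re w'\<close>)
  thus ?thesis unfolding stable_triangles_def Let_def
    using sq we w by (intro CollectI exI[of _ i] exI[of _ v] exI[of _ w] exI[of _ a] exI[of _ "J ?X"] exI[of _ "\<pi> ?X"]) simp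
qed

end

theorem algebraic_frobenius_model:
  assumes "algebraic_triangulated TYPE('a) TYPE('b) T"
  obtains E :: "('a, 'b) excat" and \<Phi> \<delta> where "frobenius_model E T \<Phi> \<delta>"
proof -
  obtain E :: "('a, 'b) excat" and c F \<phi> where T: "triangulated_category T" and E: "frobenius_category E" and
    c: "injective_choice E c" and F: "triangle_equivalence (stable_category E c) T F \<phi>"
    using assms unfolding algebraic_triangulated_def by blast
  interpret T: triangulated_category T by (rule T)
  interpret stable_model E c using E c by (simp add: stable_model_def stable_model_axioms_def)
  interpret F: category_equivalence "stable_category E c" T F
    using F equivalenceD unfolding triangle_equivalence_def by blast
  have n: "natural_iso (stable_category E c) T (comp_fun F (stable_shift E c)) (comp_fun (Sh T) F) \<phi>" and
    tri: "\<And>u v w. (u, v, w) \<in> stable_triangles E c \<Longrightarrow> (fmor F u, fmor F v, \<phi> (Dom st.Q u) \<cdot>\<^bsub>T\<^esub> fmor F w) \<in> Tri T"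
    using F unfolding triangle_equivalence_def by auto
  note N = natural_isoD[OF n, simplified]
  have so: "fobj (stable_shift E c) X = Cod E (\<pi> X)" for X by (simp add: stable_shift_def)
  let ?\<Phi> = "\<lparr>fobj = fobj F, fmor = (\<lambda>f. fmor F (st.cls f))\<rparr>"
  define w where "w i p = (SOME w. \<exists>g. connecting i p g w)" for i p
  have w: "\<exists>g. connecting i p g (w i p)" if "(i, p) \<in> Conf E" for i p
    unfolding w_def using connecting_ex[OF that] by (rule someI_ex)
  \<comment> \<open>The sign is that of the standard triangles, and \<phi> moves the suspension past
    the equivalence.\<close>
  let ?\<delta> = "\<lambda>i p. \<phi> (Dom E i) \<cdot>\<^bsub>T\<^esub> fmor F (Neg st.Q (st.cls (w i p)))"
  have Phi: "additive_functor E T ?\<Phi>"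
  proof (intro additive_functor.intro additive_functor_axioms.intro)
    show "additive_category E" "additive_category T" by unfold_locales
    show "fobj ?\<Phi> X \<in> Obj T" if "X \<in> Obj E" for X using F.F_obj[of X] that by simp
    show "fmor ?\<Phi> \<in> hom (HomGrp E X Y) (HomGrp T (fobj ?\<Phi> X) (fobj ?\<Phi> Y))" for X Y
      unfolding hom_def HomGrp_def using F.F_simps F.F_add by (auto simp flip: st.Q_add)
    show "fmor ?\<Phi> (Id E X) = Id T (fobj ?\<Phi> X)" if "X \<in> Obj E" for X using F.F_id[of X] that by simp
    show "fmor ?\<Phi> (g \<cdot>\<^bsub>E\<^esub> f) = fmor ?\<Phi> g \<cdot>\<^bsub>T\<^esub> fmor ?\<Phi> f" if "f \<in> Hom E X Y" "g \<in> Hom E Y Z" for f g X Y Z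
      using F.F_comp[of "st.cls f" "st.cls g"] that by simp
  qed
  have "frobenius_model E T ?\<Phi> ?\<delta>"
  proof (intro frobenius_model.intro frobenius_model_axioms.intro E T Phi)
    fix X Y h assume "X \<in> Obj E" "Y \<in> Obj E" "h \<in> Arr T" "Dom T h = fobj ?\<Phi> X" "Cod T h = fobj ?\<Phi> Y"
    then obtain f where f: "f \<in> Arr st.Q" "Dom st.Q f = X" "Cod st.Q f = Y" "fmor F f = h"
      using F.full[of X Y h] by auto
    then obtain f' where "f' \<in> Arr E" "f = st.cls f'" by (elim st.Q_cases)
    thus "\<exists>f. f \<in> Arr E \<and> Dom E f = X \<and> Cod E f = Y \<and> fmor ?\<Phi> f = h" using f by auto
  next
    fix f assume f [simp]: "f \<in> Arr E"
    have z: "fmor F (st.cls (Zero E (Dom E f) (Cod E f))) = Zero T (fobj F (Dom E f)) (fobj F (Cod E f))"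
      using F.F_zero[of "Dom E f" "Cod E f"] by simp
    have "fmor ?\<Phi> f = Zero T (fobj ?\<Phi> (Dom E f)) (fobj ?\<Phi> (Cod E f)) \<longleftrightarrow> st.cls f = st.cls (Zero E (Dom E f) (Cod E f))"
      using F.faithful[of "st.cls f" "st.cls (Zero E (Dom E f) (Cod E f))"] z by auto
    also have "\<dots> \<longleftrightarrow> f \<in> injective_factor E" by (subst st.cls_eq_iff) simp_all
    finally show "fmor ?\<Phi> f = Zero T (fobj ?\<Phi> (Dom E f)) (fobj ?\<Phi> (Cod E f)) \<longleftrightarrow> f \<in> injective_factor E" .
  next
    fix Y assume "Y \<in> Obj T"
    thus "\<exists>X\<in>Obj E. isomorphic T (fobj ?\<Phi> X) Y" using F.ess_surj[of Y] by simp
  next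
    fix i p assume c: "(i, p) \<in> Conf E"
    then obtain g where g: "connecting i p g (w i p)" using w by blast
    from tri[OF connecting_tri[OF c g]] show "(fmor ?\<Phi> i, fmor ?\<Phi> p, ?\<delta> i p) \<in> Tri T"
      using conf_simps[OF c] by simp
  next
    fix i p i' p' a b d assume c1: "(i, p) \<in> Conf E" and c2: "(i', p') \<in> Conf E" and
      h: "a \<in> Hom E (Dom E i) (Dom E i')" "b \<in> Hom E (Cod E i) (Cod E i')" "d \<in> Hom E (Cod E p) (Cod E p')" and
      e: "b \<cdot>\<^bsub>E\<^esub> i = i' \<cdot>\<^bsub>E\<^esub> a" "d \<cdot>\<^bsub>E\<^esub> p = p' \<cdot>\<^bsub>E\<^esub> b"
    note [simp] = h[unfolded hom_iff, THEN conjunct1] h[unfolded hom_iff, THEN conjunct2, THEN conjunct1]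
      h[unfolded hom_iff, THEN conjunct2, THEN conjunct2] conf_simps[OF c1] conf_simps[OF c2]
    obtain g where g: "connecting i p g (w i p)" using w[OF c1] by blast
    obtain g' where g': "connecting i' p' g' (w i' p')" using w[OF c2] by blast
    have [simp]: "w i p \<in> Arr E" "Dom E (w i p) = Cod E p" "Cod E (w i p) = Cod E (\<pi> (Dom E i))"
      "w i' p' \<in> Arr E" "Dom E (w i' p') = Cod E p'" "Cod E (w i' p') = Cod E (\<pi> (Dom E i'))"
      using g g' unfolding connecting_def by auto
    obtain s where s [simp]: "s \<in> Arr E" "Dom E s = Cod E (\<pi> (Dom E a))" "Cod E s = Cod E (\<pi> (Cod E a))" and
      sv: "fmor (stable_shift E c) (st.cls a) = st.cls s"
      by (rule stable_shift_mor[of a]) simp_all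
    have "st.cls s \<cdot>\<^bsub>st.Q\<^esub> st.cls (w i p) = st.cls (w i' p') \<cdot>\<^bsub>st.Q\<^esub> st.cls d"
      using connecting_natural[OF c1 c2 g g', of a b d] e sv by simp
    hence sw: "st.cls (s \<cdot>\<^bsub>E\<^esub> w i p) = st.cls (w i' p' \<cdot>\<^bsub>E\<^esub> d)" by simp
    hence sw': "Neg st.Q (st.cls (s \<cdot>\<^bsub>E\<^esub> w i p)) = Neg st.Q (st.cls (w i' p' \<cdot>\<^bsub>E\<^esub> d))" by (rule arg_cong)
    note [simp] = N(2)[of "Dom E i", simplified so] N(2)[of "Dom E i'", simplified so]
      N(3)[of "Dom E i", simplified so] N(3)[of "Dom E i'", simplified so]
      N(4)[of "Dom E i", simplified so] N(4)[of "Dom E i'", simplified so]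
    have Fa [simp]: "fmor F (st.cls f) \<in> Arr T" "Dom T (fmor F (st.cls f)) = fobj F (Dom E f)" "Cod T (fmor F (st.cls f)) = fobj F (Cod E f)"
      if "f \<in> Arr E" for f using F.F_simps[of "st.cls f"] that by simp_all
    have Fc: "fmor F (st.cls (g \<cdot>\<^bsub>E\<^esub> f)) = fmor F (st.cls g) \<cdot>\<^bsub>T\<^esub> fmor F (st.cls f)"
      if "f \<in> Arr E" "g \<in> Arr E" "Cod E f = Dom E g" for f g using F.F_comp[of "st.cls f" "st.cls g"] that by simp
    have Fo [simp]: "fobj F X \<in> Obj T" if "X \<in> Obj E" for X using F.F_obj[of X] that by simp
    have "fmor (Sh T) (fmor F (st.cls a)) \<cdot>\<^bsub>T\<^esub> \<phi> (Dom E i) = \<phi> (Dom E i') \<cdot>\<^bsub>T\<^esub> fmor F (st.cls s)"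
      using N(5)[of "st.cls a"] sv by simp
    from T.comp_reduce[OF this, of "fmor F (st.cls (Neg E (w i p)))"]
    have "fmor (Sh T) (fmor F (st.cls a)) \<cdot>\<^bsub>T\<^esub> (\<phi> (Dom E i) \<cdot>\<^bsub>T\<^esub> fmor F (st.cls (Neg E (w i p)))) =
      \<phi> (Dom E i') \<cdot>\<^bsub>T\<^esub> (fmor F (st.cls s) \<cdot>\<^bsub>T\<^esub> fmor F (st.cls (Neg E (w i p))))" by simp
    also have "fmor F (st.cls s) \<cdot>\<^bsub>T\<^esub> fmor F (st.cls (Neg E (w i p))) = fmor F (st.cls (s \<cdot>\<^bsub>E\<^esub> Neg E (w i p)))"
      by (rule Fc[symmetric]) simp_all
    also have "\<dots> = fmor F (st.cls (Neg E (w i' p') \<cdot>\<^bsub>E\<^esub> d))" using sw' by simp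
    also have "\<dots> = fmor F (st.cls (Neg E (w i' p'))) \<cdot>\<^bsub>T\<^esub> fmor F (st.cls d)"
      by (rule Fc) simp_all
    finally show "fmor (Sh T) (fmor ?\<Phi> a) \<cdot>\<^bsub>T\<^esub> ?\<delta> i p = ?\<delta> i' p' \<cdot>\<^bsub>T\<^esub> fmor ?\<Phi> d" by simp
  qed
  thus thesis by (rule that)
qed

section \<open>Complexes in nonpositive degrees\<close>

context complexes
begin

lemma zero_obj_zero: "is_zero C (zero_obj C)"
  unfolding zero_obj_def using ex_zero by (rule someI_ex)

lemma zero_obj_simps [simp]: "zero_obj C \<in> Obj C" "Id C (zero_obj C) = Zero C (zero_obj C) (zero_obj C)"
  using zero_obj_zero by (auto simp: is_zero_iff)

text \<open>The complex with the object \<open>ob k\<close> in degree \<open>-k\<close> and the differentials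
  \<open>d k : ob (k + 1) \<rightarrow> ob k\<close>; \<open>nmap\<close> are chain maps between such complexes, and \<open>omap\<close> are
  chain maps to the suspension of such a complex.\<close>

definition ncx :: "(nat \<Rightarrow> 'o) \<Rightarrow> (nat \<Rightarrow> 'm) \<Rightarrow> ('o, 'm) cplx" where
  "ncx ob d = \<lparr>cob = (\<lambda>i. if i \<le> 0 then ob (nat (- i)) else zero_obj C),
     cdiff = (\<lambda>i. if i < 0 then d (nat (- i - 1))
       else Zero C (if i \<le> 0 then ob (nat (- i)) else zero_obj C) (zero_obj C))\<rparr>"

definition nmap :: "('o, 'm) cplx \<Rightarrow> ('o, 'm) cplx \<Rightarrow> (nat \<Rightarrow> 'm) \<Rightarrow> ('o, 'm) cmap" where
  "nmap X Y b = \<lparr>csrc = X, ctgt = Y,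
     ccomp = (\<lambda>i. if i \<le> 0 then b (nat (- i)) else Zero C (zero_obj C) (zero_obj C))\<rparr>"

definition omap :: "('o, 'm) cplx \<Rightarrow> ('o, 'm) cplx \<Rightarrow> (nat \<Rightarrow> 'm) \<Rightarrow> ('o, 'm) cmap" where
  "omap X Y c = \<lparr>csrc = X, ctgt = shift_cplx C Y,
     ccomp = (\<lambda>i. if i < 0 then c (nat (- i - 1)) else Zero C (cob X i) (zero_obj C))\<rparr>"

definition nat_complex :: "(nat \<Rightarrow> 'o) \<Rightarrow> (nat \<Rightarrow> 'm) \<Rightarrow> bool" where
  "nat_complex ob d \<longleftrightarrow> (\<forall>k. ob k \<in> Obj C \<and> d k \<in> Arr C \<and> Dom C (d k) = ob (Suc k) \<and> Cod C (d k) = ob k \<and>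
     d k \<cdot> d (Suc k) = Zero C (ob (Suc (Suc k))) (ob k)) \<and> (\<exists>n. \<forall>k>n. is_zero C (ob k))"

lemma nat_complexD:
  assumes "nat_complex ob d"
  shows "ob k \<in> Obj C" "d k \<in> Arr C" "Dom C (d k) = ob (Suc k)" "Cod C (d k) = ob k"
    "d k \<cdot> d (Suc k) = Zero C (ob (Suc (Suc k))) (ob k)"
  using assms unfolding nat_complex_def by blast+

lemma nat_int_simps: "nat (1 + int k) = Suc k" "nat (int k + 1) = Suc k" "nat (2 + int k) = Suc (Suc k)" "nat (int k + 2) = Suc (Suc k)"
  by auto

text \<open>Negative degrees are written as -1 - k so that the selector rules for sequences indexed
  by natural numbers apply, with the truncation at degree 0 as a case of its own.\<close>

lemma int_trichotomy:
  obtains k where "i = - 1 - int k" | "i = 0" | "i > 0"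
proof (cases "i < 0")
  case True
  hence "i = - 1 - int (nat (- i - 1))" by simp
  thus thesis using that(1) by blast
qed (use that in fastforce)

lemma ncx_sel [simp]:
  "cob (ncx ob d) (- 1 - int k) = ob (Suc k)" "cob (ncx ob d) (- int k) = ob k" "cob (ncx ob d) 0 = ob 0"
  "i > 0 \<Longrightarrow> cob (ncx ob d) i = zero_obj C" "cdiff (ncx ob d) (- 1 - int k) = d k"
  "cdiff (ncx ob d) 0 = Zero C (ob 0) (zero_obj C)" "i > 0 \<Longrightarrow> cdiff (ncx ob d) i = Zero C (zero_obj C) (zero_obj C)"
  "csrc (nmap X Y b) = X" "ctgt (nmap X Y b) = Y"
  "ccomp (nmap X Y b) (- 1 - int k) = b (Suc k)" "ccomp (nmap X Y b) (- int k) = b k" "ccomp (nmap X Y b) 0 = b 0"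
  "i > 0 \<Longrightarrow> ccomp (nmap X Y b) i = Zero C (zero_obj C) (zero_obj C)"
  "csrc (omap X Y c) = X" "ctgt (omap X Y c) = shift_cplx C Y"
  "ccomp (omap X Y c) (- 1 - int k) = c k"
  "i \<ge> 0 \<Longrightarrow> ccomp (omap X Y c) i = Zero C (cob X i) (zero_obj C)"
  by (auto simp: ncx_def nmap_def omap_def nat_int_simps)

lemma ncx_sel_low [simp]:
  "cob (ncx ob d) (- 1) = ob (Suc 0)" "cdiff (ncx ob d) (- 1) = d 0" "ccomp (nmap X Y b) (- 1) = b (Suc 0)"
  "ccomp (omap X Y c) (- 1) = c 0" "cob (ncx ob d) (- 2 - int k) = ob (Suc (Suc k))"
  "cdiff (ncx ob d) (- 2 - int k) = d (Suc k)" "ccomp (omap X Y c) (- 2 - int k) = c (Suc k)"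
  by (auto simp: ncx_def nmap_def omap_def nat_int_simps)

lemma ncx_concentrated:
  assumes "\<And>k. k > n \<Longrightarrow> is_zero C (ob k)"
  shows "concentrated C {- int n..0} (ncx ob d)"
  unfolding concentrated_def
proof (intro allI impI)
  fix i assume "i \<notin> {- int n..0}"
  hence "i > 0 \<or> (i \<le> 0 \<and> n < nat (- i))" by auto
  thus "is_zero C (cob (ncx ob d) i)" using assms zero_obj_zero by (auto simp: ncx_def)
qed

lemma ncx_bounded [simp]:
  assumes X: "nat_complex ob d"
  shows "ncx ob d \<in> bounded_complexes C"
proof -
  note [simp] = nat_complexD[OF X]
  obtain n where "\<And>k. k > n \<Longrightarrow> is_zero C (ob k)" using X unfolding nat_complex_def by blast
  hence c: "concentrated C {- int n..0} (ncx ob d)" by (rule ncx_concentrated)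
  have "cdiff (ncx ob d) (i + 1) \<cdot> cdiff (ncx ob d) i = Zero C (cob (ncx ob d) i) (cob (ncx ob d) (2 + i))" for i
  proof (cases i rule: int_trichotomy)
    case (1 k)
    show ?thesis
    proof (cases k)
      case (Suc l)
      have "- 1 - int (Suc l) + 1 = - 1 - int l" "2 + (- 1 - int (Suc l)) = - int l" by simp_all
      thus ?thesis unfolding 1 Suc by (simp only: ncx_sel nat_complexD[OF X])
    qed (simp add: 1)
  qed simp_all
  moreover have "cob (ncx ob d) i \<in> Obj C \<and> cdiff (ncx ob d) i \<in> Arr C \<and> Dom C (cdiff (ncx ob d) i) = cob (ncx ob d) i \<and>
      Cod C (cdiff (ncx ob d) i) = cob (ncx ob d) (i + 1)" for i
    by (cases i rule: int_trichotomy) simp_all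
  ultimately show ?thesis using c by (intro bounded_complexI[where a = "- int n" and b = 0]) blast+
qed

lemma nmap_arr:
  assumes X: "nat_complex ob d" and Y: "nat_complex ob' d'"
    and b: "\<And>k. b k \<in> Arr C" "\<And>k. Dom C (b k) = ob k" "\<And>k. Cod C (b k) = ob' k"
    and comm: "\<And>k. b k \<cdot> d k = d' k \<cdot> b (Suc k)"
  shows "nmap (ncx ob d) (ncx ob' d') b \<in> Arr (Chb C)"
proof -
  note [simp] = nat_complexD[OF X] nat_complexD[OF Y] b
  let ?f = "nmap (ncx ob d) (ncx ob' d') b"
  have "ccomp ?f i \<in> Arr C \<and> Dom C (ccomp ?f i) = cob (ncx ob d) i \<and> Cod C (ccomp ?f i) = cob (ncx ob' d') i \<and>
    ccomp ?f (i + 1) \<cdot> cdiff (ncx ob d) i = cdiff (ncx ob' d') i \<cdot> ccomp ?f i" for i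
    by (cases i rule: int_trichotomy) (simp_all add: comm)
  thus ?thesis by (intro cmapI) (use X Y in simp_all)
qed

lemma omap_arr:
  assumes X: "nat_complex ob d" and Y: "nat_complex ob' d'"
    and c: "\<And>k. c k \<in> Arr C" "\<And>k. Dom C (c k) = ob (Suc k)" "\<And>k. Cod C (c k) = ob' k"
    and comm: "\<And>k. c k \<cdot> d (Suc k) = Neg C (d' k) \<cdot> c (Suc k)"
  shows "omap (ncx ob d) (ncx ob' d') c \<in> Arr (Chb C)"
proof -
  note [simp] = nat_complexD[OF X] nat_complexD[OF Y] c
  let ?f = "omap (ncx ob d) (ncx ob' d') c"
  have "ccomp ?f (i + 1) \<cdot> cdiff (ncx ob d) i = Neg C (cdiff (ncx ob' d') (i + 1)) \<cdot> ccomp ?f i" for i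
  proof (cases i rule: int_trichotomy)
    case (1 k)
    show ?thesis
    proof (cases k)
      case (Suc l)
      have "- 1 - int (Suc l) + 1 = - 1 - int l" by simp
      thus ?thesis unfolding 1 Suc by (simp only: ncx_sel comm)
    qed (simp add: 1)
  qed simp_all
  moreover have "ccomp ?f i \<in> Arr C \<and> Dom C (ccomp ?f i) = cob (ncx ob d) i \<and> Cod C (ccomp ?f i) = cob (ncx ob' d') (i + 1)" for i
    by (cases i rule: int_trichotomy) simp_all
  ultimately show ?thesis by (intro cmapI) (use X Y in simp_all)
qed

lemma nmap_null:
  assumes X: "nat_complex ob d" and Y: "nat_complex ob' d'"
    and f: "nmap (ncx ob d) (ncx ob' d') b \<in> Arr (Chb C)"
    and s: "\<And>k. s k \<in> Arr C" "\<And>k. Dom C (s k) = ob k" "\<And>k. Cod C (s k) = ob' (Suc k)"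
    and eq: "b 0 = d' 0 \<cdot> s 0" "\<And>k. b (Suc k) = d' (Suc k) \<cdot> s (Suc k) \<oplus> s k \<cdot> d k"
  shows "nmap (ncx ob d) (ncx ob' d') b \<in> null_homotopic C"
proof -
  note [simp] = nat_complexD[OF X] nat_complexD[OF Y] s
  let ?f = "nmap (ncx ob d) (ncx ob' d') b"
  let ?s = "\<lambda>i. if i \<le> 0 then s (nat (- i)) else Zero C (zero_obj C) (cob (ncx ob' d') (i - 1))"
  have [simp]: "cob (ncx ob' d') i \<in> Obj C" for i using Y by simp
  have c: "cob (ncx ob' d') (- 1 - int k - 1) = ob' (Suc (Suc k))" "cdiff (ncx ob' d') (- 1 - int k - 1) = d' (Suc k)" for k
    using ncx_sel(1,5)[of ob' d' "Suc k"] by (simp_all add: algebra_simps)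
  have c0: "cob (ncx ob' d') (- 1) = ob' (Suc 0)" "cdiff (ncx ob' d') (- 1) = d' 0"
    using ncx_sel(1,5)[of ob' d' 0] by simp_all
  have "?s i \<in> Arr C \<and> Dom C (?s i) = cob (ncx ob d) i \<and> Cod C (?s i) = cob (ncx ob' d') (i - 1) \<and>
    ccomp ?f i = cdiff (ncx ob' d') (i - 1) \<cdot> ?s i \<oplus> ?s (i + 1) \<cdot> cdiff (ncx ob d) i" for i
  proof (cases i rule: int_trichotomy)
    case (1 k)
    have e: "nat (- (- 1 - int k)) = Suc k" "- 1 - int k \<le> 0" "nat (- (- 1 - int k + 1)) = k" "- 1 - int k + 1 \<le> 0" by auto
    show ?thesis unfolding 1 e(1,3) c using e(2,4) by (simp add: eq)
  next
    case 2
    show ?thesis unfolding 2 by (simp add: eq c0)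
  next
    case 3
    have "cdiff (ncx ob' d') (i - 1) \<in> Arr C" "Dom C (cdiff (ncx ob' d') (i - 1)) = cob (ncx ob' d') (i - 1)"
      "Cod C (cdiff (ncx ob' d') (i - 1)) = cob (ncx ob' d') i"
      using cplx_simps[OF ncx_bounded[OF Y], of "i - 1"] by simp_all
    thus ?thesis using 3 by simp
  qed
  thus ?thesis by (intro null_homotopicI[OF f, where s = ?s]) simp_all
qed

text \<open>The homotopy has a single non-zero component, in degree 0. The other half of its
  boundary lands in a zero object, so only the component \<open>c 0\<close> of the map can
  survive.\<close>

lemma omap_null:
  assumes X: "nat_complex ob d" and Y: "nat_complex ob' d'"
    and f: "omap (ncx ob d) (ncx ob' d') c \<in> Arr (Chb C)"
    and s: "s \<in> Arr C" "Dom C s = ob 0" "Cod C s = ob' 0"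
    and eq: "c 0 = s \<cdot> d 0" "\<And>k. c (Suc k) = Zero C (ob (Suc (Suc k))) (ob' (Suc k))"
  shows "omap (ncx ob d) (ncx ob' d') c \<in> null_homotopic C"
proof -
  note [simp] = nat_complexD[OF X] nat_complexD[OF Y] s
  let ?f = "omap (ncx ob d) (ncx ob' d') c"
  let ?s = "\<lambda>i. if i = 0 then s else Zero C (cob (ncx ob d) i) (cob (ncx ob' d') i)"
  have [simp]: "cob (ncx ob d) i \<in> Obj C" "cob (ncx ob' d') i \<in> Obj C" for i using X Y by simp_all
  have [simp]: "cdiff (ncx ob d) i \<in> Arr C" "Dom C (cdiff (ncx ob d) i) = cob (ncx ob d) i" "Cod C (cdiff (ncx ob d) i) = cob (ncx ob d) (i + 1)"
    "cdiff (ncx ob' d') i \<in> Arr C" "Dom C (cdiff (ncx ob' d') i) = cob (ncx ob' d') i" "Cod C (cdiff (ncx ob' d') i) = cob (ncx ob' d') (i + 1)" for i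
    using cplx_simps[OF ncx_bounded[OF X]] cplx_simps[OF ncx_bounded[OF Y]] by simp_all
  have "ccomp ?f i = Neg C (cdiff (ncx ob' d') i) \<cdot> ?s i \<oplus> ?s (i + 1) \<cdot> cdiff (ncx ob d) i" for i
  proof (cases i rule: int_trichotomy)
    case (1 k)
    show ?thesis by (cases k) (simp_all add: 1 eq)
  qed simp_all
  moreover have "?s i \<in> Arr C \<and> Dom C (?s i) = cob (ncx ob d) i \<and> Cod C (?s i) = cob (ncx ob' d') i" for i by simp
  ultimately show ?thesis by (intro null_homotopicI[OF f, where s = ?s]) simp_all
qed

lemma nmap_comp:
  assumes "\<And>k. b' k \<in> Arr C" "\<And>k. b k \<in> Arr C"
  shows "nmap Y Z b' \<cdot>\<^bsub>Chb C\<^esub> nmap X Y b = nmap X Z (\<lambda>k. b' k \<cdot> b k)"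
  by (rule cmap_eqI) (simp_all add: Chb_unfold nmap_def)

lemma nmap_add: "nmap X Y b \<oplus>\<^bsub>Chb C\<^esub> nmap X Y b' = nmap X Y (\<lambda>k. b k \<oplus> b' k)"
  by (rule cmap_eqI) (simp_all add: Chb_unfold nmap_def)

lemma nmap_id: "Id (Chb C) (ncx ob d) = nmap (ncx ob d) (ncx ob d) (\<lambda>k. Id C (ob k))"
  by (rule cmap_eqI) (simp_all add: Chb_unfold nmap_def ncx_def)

lemma shift_nmap_omap:
  assumes "nat_complex ob d"
  shows "shift_cmap C (nmap Y Z b) \<cdot>\<^bsub>Chb C\<^esub> omap (ncx ob d) Y c = omap (ncx ob d) Z (\<lambda>k. b k \<cdot> c k)"
proof (rule cmap_eqI)
  note [simp] = nat_complexD[OF assms]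
  show "ccomp (shift_cmap C (nmap Y Z b) \<cdot>\<^bsub>Chb C\<^esub> omap (ncx ob d) Y c) i = ccomp (omap (ncx ob d) Z (\<lambda>k. b k \<cdot> c k)) i" for i
    using cplx_simps(1)[OF ncx_bounded[OF assms]]
    by (cases i rule: int_trichotomy) (simp_all add: Chb_unfold)
qed (simp_all add: Chb_unfold)

lemma omap_nmap:
  assumes "nat_complex ob d" "nat_complex ob' d'" "\<And>k. b k \<in> Arr C" "\<And>k. Dom C (b k) = ob k" "\<And>k. Cod C (b k) = ob' k"
  shows "omap (ncx ob' d') Z c \<cdot>\<^bsub>Chb C\<^esub> nmap (ncx ob d) (ncx ob' d') b = omap (ncx ob d) Z (\<lambda>k. c k \<cdot> b (Suc k))"
proof (rule cmap_eqI)
  note [simp] = nat_complexD[OF assms(1)] nat_complexD[OF assms(2)] assms(3-)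
  show "ccomp (omap (ncx ob' d') Z c \<cdot>\<^bsub>Chb C\<^esub> nmap (ncx ob d) (ncx ob' d') b) i =
    ccomp (omap (ncx ob d) Z (\<lambda>k. c k \<cdot> b (Suc k))) i" for i
    by (cases i rule: int_trichotomy) (simp_all add: Chb_unfold)
qed (simp_all add: Chb_unfold)

lemma ncx_split_ext:
  assumes X: "nat_complex x dx" and Z: "nat_complex z dz" 
    and h: "omap (ncx z dz) (ncx x dx) c \<in> Arr (Chb C)"
    and c: "\<And>k. c k \<in> Arr C" "\<And>k. Dom C (c k) = z (Suc k)" "\<And>k. Cod C (c k) = x k"
    and B: "\<And>k. is_biproduct C (x k) (z k) (y k) (a k) (s k) (r k) (b k)"
    and dy: "\<And>k. dy k = a k \<cdot> (dx k \<cdot> r (Suc k)) \<oplus> (Neg C (a k \<cdot> (c k \<cdot> b (Suc k))) \<oplus> s k \<cdot> (dz k \<cdot> b (Suc k)))"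
  shows "(hcls C (nmap (ncx x dx) (ncx y dy) a), hcls C (nmap (ncx y dy) (ncx z dz) b),
     hcls C (omap (ncx z dz) (ncx x dx) c)) \<in> Tri (Kb C)"
proof -
  note [simp] = nat_complexD[OF X] nat_complexD[OF Z] biproduct_simps[OF B] c
  let ?e = "\<lambda>b i. if i \<le> 0 then b (nat (- i)) else Zero C (zero_obj C) (zero_obj C)"
  have "split_ext (ncx x dx) (ncx z dz) (omap (ncx z dz) (ncx x dx) c) (ncx y dy) (?e a) (?e s) (?e r) (?e b)"
    unfolding split_ext_def
  proof (intro conjI allI)
    fix i
    show "is_biproduct C (cob (ncx x dx) i) (cob (ncx z dz) i) (cob (ncx y dy) i) (?e a i) (?e s i) (?e r i) (?e b i)"
      using B by (cases i rule: int_trichotomy) (simp_all add: nat_int_simps, simp add: is_biproduct_def)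
    show "cdiff (ncx y dy) i = ?e a (i + 1) \<cdot> (cdiff (ncx x dx) i \<cdot> ?e r i) \<oplus>
        (Neg C (?e a (i + 1) \<cdot> (ccomp (omap (ncx z dz) (ncx x dx) c) i \<cdot> ?e b i)) \<oplus> ?e s (i + 1) \<cdot> (cdiff (ncx z dz) i \<cdot> ?e b i))"
    proof (cases i rule: int_trichotomy)
      case (1 k)
      have e: "nat (- (- 1 - int k)) = Suc k" "- 1 - int k \<le> 0" "nat (- (- 1 - int k + 1)) = k" "- 1 - int k + 1 \<le> 0" by auto
      show ?thesis unfolding 1 e(1,3) using e(2,4) by (simp add: dy)
    qed simp_all
  qed (use X Z h in simp_all)
  from split_ext_tri[OF this] show ?thesis by (simp add: nmap_def)
qed

end

section \<open>Resolutions\<close>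

lemma (in pretriangulated_category) tri_zero_middle:
  assumes t: "(u, v, w) \<in> Tri T" and z: "is_zero T (Dom T u)" "is_zero T (Cod T v)"
  shows "is_zero T (Cod T u)"
proof -
  note [simp] = tri_simps[OF t]
  have "v \<cdot> Id T (Cod T u) = Zero T (Dom T (Id T (Cod T u))) (Cod T v)"
    using to_zero[OF z(2), of v "Cod T u"] by simp
  then obtain g where g: "g \<in> Arr T" "Dom T g = Cod T u" "Cod T g = Dom T u" "u \<cdot> g = Id T (Cod T u)"
    using tri_exact_Y[OF t, of "Id T (Cod T u)"] by auto
  have "g = Zero T (Cod T u) (Dom T u)" using to_zero[OF z(1), of g "Cod T u"] g by simp
  hence "Id T (Cod T u) = Zero T (Cod T u) (Cod T u)" using g(4) by simp
  thus ?thesis by (simp add: is_zero_iff)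
qed

lemma (in ideal_quotient) cls_add_null:
  assumes "f \<in> N" "g \<in> Arr C" "Dom C g = Dom C f" "Cod C g = Cod C f"
  shows "cls (f \<oplus> g) = cls g"
  using assms N_arr by (subst cls_eq_iff) simp_all

context frobenius_model
begin

abbreviation compE (infixl "\<star>" 75) where "g \<star> f \<equiv> Comp E g f"
abbreviation compT (infixl "\<bullet>" 75) where "g \<bullet> f \<equiv> Comp T g f"
abbreviation "Fo \<equiv> fobj \<Phi>"
abbreviation "Fm \<equiv> fmor \<Phi>"
abbreviation "So \<equiv> fobj (Sh T)"
abbreviation "Sm \<equiv> fmor (Sh T)"

lemma Phi_injective: "injective E I \<Longrightarrow> is_zero T (Fo I)"
proof -
  assume I: "injective E I"
  hence [simp]: "I \<in> Obj E" unfolding injective_def by auto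
  have "Id E I \<in> injective_factor E"
    using E.injective_factorI[OF I, of "Id E I" "Id E I"] by simp
  thus ?thesis using Phi_zero_iff[of "Id E I"] by (simp add: T.is_zero_iff)
qed

lemma Phi_eq_iff:
  assumes [simp]: "f \<in> Arr E" "g \<in> Arr E" "Dom E g = Dom E f" "Cod E g = Cod E f"
  shows "Fm f = Fm g \<longleftrightarrow> f \<oplus>\<^bsub>E\<^esub> Neg E g \<in> injective_factor E"
proof -
  have "Fm f = Fm g \<longleftrightarrow> Fm (f \<oplus>\<^bsub>E\<^esub> Neg E g) = Zero T (Fo (Dom E f)) (Fo (Cod E f))"
    using T.diff_zero[of "Fm f" "Fm g"] by auto
  thus ?thesis using Phi_zero_iff[of "f \<oplus>\<^bsub>E\<^esub> Neg E g"] by simp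
qed

text \<open>Injective objects are projective, so lifts along deflations in \<open>T\<close> can be made strict.\<close>

lemma strict_lift:
  assumes c: "(i, p) \<in> Conf E" and f: "f \<in> Arr E" "Cod E f = Cod E p"
    and t: "t \<in> Arr T" "Dom T t = Fo (Dom E f)" "Cod T t = Fo (Cod E i)" "Fm p \<bullet> t = Fm f"
  obtains g where "g \<in> Arr E" "Dom E g = Dom E f" "Cod E g = Cod E i" "p \<star> g = f" "Fm g = t"
proof -
  note [simp] = E.conf_simps[OF c] f t(1-3)
  obtain t' where t' [simp]: "t' \<in> Arr E" "Dom E t' = Dom E f" "Cod E t' = Cod E i" and Ft: "Fm t' = t"
    using Phi_full[of "Dom E f" "Cod E i" t] by auto
  have "Fm f = Fm (p \<star> t')" using t(4) Ft by simp
  hence n: "f \<oplus>\<^bsub>E\<^esub> Neg E (p \<star> t') \<in> injective_factor E" by (subst (asm) Phi_eq_iff) simp_all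
  obtain I x y where I: "injective E I" and xy: "x \<in> Arr E" "y \<in> Arr E" "Dom E x = Dom E (f \<oplus>\<^bsub>E\<^esub> Neg E (p \<star> t'))"
    "Cod E x = I" "Dom E y = I" "Cod E y = Cod E (f \<oplus>\<^bsub>E\<^esub> Neg E (p \<star> t'))" and e: "f \<oplus>\<^bsub>E\<^esub> Neg E (p \<star> t') = y \<star> x"
    by (rule injective_factorE[OF n])
  have xy' [simp]: "x \<in> Arr E" "y \<in> Arr E" "Dom E x = Dom E f" "Cod E x = I" "Dom E y = I" "Cod E y = Cod E p"
    using xy by simp_all
  obtain y' where y' [simp]: "y' \<in> Arr E" "Dom E y' = I" "Cod E y' = Cod E i" and py: "p \<star> y' = y"
    using E.injective_lift[OF I c, of y] by auto
  have "y' \<star> x \<in> injective_factor E" by (rule E.injective_factorI[OF I]) simp_all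
  hence "Fm (t' \<oplus>\<^bsub>E\<^esub> y' \<star> x) = t" using Phi_zero_iff[of "y' \<star> x"] Ft by simp
  moreover have "p \<star> (t' \<oplus>\<^bsub>E\<^esub> y' \<star> x) = f"
  proof -
    have "f = (f \<oplus>\<^bsub>E\<^esub> Neg E (p \<star> t')) \<oplus>\<^bsub>E\<^esub> p \<star> t'" by simp
    also have "\<dots> = p \<star> t' \<oplus>\<^bsub>E\<^esub> y \<star> x" unfolding e by (rule E.add_commute) simp_all
    finally have f': "f = p \<star> t' \<oplus>\<^bsub>E\<^esub> y \<star> x" .
    have "p \<star> (t' \<oplus>\<^bsub>E\<^esub> y' \<star> x) = p \<star> t' \<oplus>\<^bsub>E\<^esub> y \<star> x"
      using E.comp_reduce[OF py, of x] by simp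
    thus ?thesis by (rule trans[OF _ f'[symmetric]])
  qed
  ultimately show thesis using that[of "t' \<oplus>\<^bsub>E\<^esub> y' \<star> x"] by simp
qed

lemma delta_simps:
  assumes c: "(i, p) \<in> Conf E"
  shows "\<delta> i p \<in> Arr T" "Dom T (\<delta> i p) = Fo (Cod E p)" "Cod T (\<delta> i p) = So (Fo (Dom E i))"
  using T.tri_simps[OF delta_tri[OF c]] E.conf_simps[OF c] by simp_all

text \<open>Every morphism \<open>\<Phi> c \<rightarrow> \<Sigma>\<Phi> a\<close> is the connecting morphism of a conflation: pull back a
  conflation \<open>a \<rightarrow> I \<rightarrow> a'\<close> with \<open>I\<close> injective, for which \<open>\<delta>\<close> is invertible.\<close>

lemma realize:
  assumes a: "a \<in> Obj E" and x: "x \<in> Obj E" and w: "w \<in> Arr T" "Dom T w = Fo x" "Cod T w = So (Fo a)"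
  obtains i p where "(i, p) \<in> Conf E" "Dom E i = a" "Cod E p = x" "\<delta> i p = w"
proof -
  obtain j q where c: "(j, q) \<in> Conf E" "Dom E j = a" and I: "injective E (Cod E j)"
    by (rule E.injective_conf[OF a])
  note [simp] = E.conf_simps[OF c(1)] delta_simps[OF c(1)] c(2) a x w
  have d: "is_iso T (\<delta> j q)"
    using T.tri_zero_iso[OF delta_tri[OF c(1)]] Phi_injective[OF I] by simp
  note [simp] = d
  obtain f where f [simp]: "f \<in> Arr E" "Dom E f = x" "Cod E f = Cod E q" and Ff: "Fm f = T.Inv (\<delta> j q) \<bullet> w"
    using Phi_full[of x "Cod E q" "T.Inv (\<delta> j q) \<bullet> w"] by auto
  obtain i p f' where c': "(i, p) \<in> Conf E" and sq: "E.pullback_square q f f' p" and i: "Dom E i = Dom E j"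
    and "Cod E i = Dom E p" and fi: "f' \<star> i = j"
    by (rule E.pullback_ex[OF c(1) f(1) f(3)])
  note [simp] = i E.conf_simps[OF c'] delta_simps[OF c']
  note D = E.pullback_squareD[OF sq]
  have p: "Cod E p = x" using D(8) by simp
  have "Sm (Fm (Id E a)) \<bullet> \<delta> i p = \<delta> j q \<bullet> Fm f"
    by (rule delta_natural[OF c' c(1), of _ f']) (use D fi p in simp_all)
  hence "\<delta> i p = w" using Ff p by simp
  thus thesis using that[OF c'] p by simp
qed

end

record ('a, 'b, 'o, 'm) resolution =
  rx :: "nat \<Rightarrow> 'a"
  ri :: "nat \<Rightarrow> 'b"
  rp :: "nat \<Rightarrow> 'b"
  ro :: "nat \<Rightarrow> 'o"
  rt :: "nat \<Rightarrow> 'm"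

locale model_subcategory = frobenius_model E T \<Phi> \<delta>
  for E :: "('a, 'b, 'y) excat_scheme" and T :: "('o, 'm, 'z) tricat_scheme" and \<Phi> :: "('a, 'b, 'o, 'm) catfun"
    and \<delta> :: "'b \<Rightarrow> 'b \<Rightarrow> 'm" +
  fixes M :: "'o set"
  assumes M_sub: "additive_subcategory T M"

sublocale model_subcategory \<subseteq> km: complexes "full_subcat T M"
  by (rule complexes.intro) (rule T.full_subcat_additive[OF M_sub])

context model_subcategory
begin

abbreviation "CC \<equiv> full_subcat T M"
abbreviation "H \<equiv> hcls (full_subcat T M)"
abbreviation compK (infixl "\<odot>" 75) where "G \<odot> F \<equiv> Comp km.ch.Q G F"

lemma M_obj [simp]: "A \<in> M \<Longrightarrow> A \<in> Obj T"
  by (rule T.additive_subcategory_obj[OF M_sub])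

lemma M_iso: "is_iso T f \<Longrightarrow> Dom T f \<in> M \<Longrightarrow> Cod T f \<in> M"
  using T.additive_subcategory_iso[OF M_sub] T.isomorphicI by blast

definition "rm r k = Cod E (ri r k)"

text \<open>A resolution of \<open>rx r 0\<close> consists of conflations \<open>rx (k + 1) \<rightarrow> rm k \<rightarrow> rx k\<close> in \<open>E\<close> that
  become right \<open>M\<close>-approximations in \<open>T\<close>; the isomorphisms \<open>rt k : ro k \<rightarrow> \<Phi> (rm k)\<close> allow
  one to prescribe the objects of the resulting complex.\<close>

definition is_res :: "nat \<Rightarrow> ('a, 'b, 'o, 'm) resolution \<Rightarrow> bool" where
  "is_res n r \<longleftrightarrow> (\<forall>k. (ri r k, rp r k) \<in> Conf E \<and> Cod E (rp r k) = rx r k \<and> Dom E (ri r k) = rx r (Suc k) \<and>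
     ro r k \<in> M \<and> is_iso T (rt r k) \<and> Dom T (rt r k) = ro r k \<and> Cod T (rt r k) = Fo (rm r k) \<and>
     (\<forall>f. f \<in> Arr T \<longrightarrow> Dom T f \<in> M \<longrightarrow> Cod T f = Fo (rx r k) \<longrightarrow>
        (\<exists>g. g \<in> Arr T \<and> Dom T g = Dom T f \<and> Cod T g = Fo (rm r k) \<and> Fm (rp r k) \<bullet> g = f)) \<and>
     (n < k \<longrightarrow> is_zero T (Fo (rx r k))))"

lemma is_resD:
  assumes r: "is_res n r"
  shows "(ri r k, rp r k) \<in> Conf E" "Cod E (rp r k) = rx r k" "Dom E (ri r k) = rx r (Suc k)" "Cod E (ri r k) = rm r k"
    "ri r k \<in> Arr E" "rp r k \<in> Arr E" "Dom E (rp r k) = rm r k" "rx r k \<in> Obj E" "rm r k \<in> Obj E"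
    "rp r k \<star> ri r k = Zero E (rx r (Suc k)) (rx r k)"
    "f \<in> Arr E \<Longrightarrow> Cod E f = rx r (Suc k) \<Longrightarrow> rp r k \<star> (ri r k \<star> f) = Zero E (Dom E f) (rx r k)"
    "ro r k \<in> M" "is_iso T (rt r k)" "rt r k \<in> Arr T" "Dom T (rt r k) = ro r k" "Cod T (rt r k) = Fo (rm r k)"
    "Fo (rm r k) \<in> M"
proof -
  show 1: "(ri r k, rp r k) \<in> Conf E" "Cod E (rp r k) = rx r k" "Dom E (ri r k) = rx r (Suc k)" "Cod E (ri r k) = rm r k"
    and 3: "ro r k \<in> M" "is_iso T (rt r k)" "Dom T (rt r k) = ro r k" "Cod T (rt r k) = Fo (rm r k)"
    using r unfolding is_res_def rm_def by blast+
  note [simp] = 1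
  show 2: "ri r k \<in> Arr E" "rp r k \<in> Arr E" "Dom E (rp r k) = rm r k"
    using E.conf_simps[OF 1(1)] by simp_all
  show o: "rx r k \<in> Obj E" "rm r k \<in> Obj E" using E.obj_simps[OF 2(2)] 2(3) by simp_all
  show 4: "rp r k \<star> ri r k = Zero E (rx r (Suc k)) (rx r k)" using E.conf_simps[OF 1(1)] by simp
  have "rx r (Suc k) \<in> Obj E" using E.obj_simps(1)[OF 2(1)] by simp
  thus "f \<in> Arr E \<Longrightarrow> Cod E f = rx r (Suc k) \<Longrightarrow> rp r k \<star> (ri r k \<star> f) = Zero E (Dom E f) (rx r k)"
    using 2 o by (subst E.comp_reduce[OF 4]) simp_all
  show "rt r k \<in> Arr T" using 3 by simp
  show "Fo (rm r k) \<in> M" using M_iso[OF 3(2)] 3 by simp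
qed

lemma is_res_approx:
  assumes "is_res n r" "f \<in> Arr T" "Dom T f \<in> M" "Cod T f = Fo (rx r k)"
  obtains g where "g \<in> Arr T" "Dom T g = Dom T f" "Cod T g = Fo (rm r k)" "Fm (rp r k) \<bullet> g = f"
  using assms unfolding is_res_def by blast

lemma is_res_zero: "is_res n r \<Longrightarrow> n < k \<Longrightarrow> is_zero T (Fo (rx r k))"
  unfolding is_res_def by blast

lemma is_res_zero_ro:
  assumes r: "is_res n r" and k: "n < k"
  shows "is_zero T (ro r k)"
proof -
  note [simp] = is_resD[OF r]
  have "is_zero T (Cod T (Fm (ri r k)))"
    by (rule T.tri_zero_middle[OF delta_tri[OF is_resD(1)[OF r, of k]]])
      (use is_res_zero[OF r k] is_res_zero[OF r, of "Suc k"] k in simp_all)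
  hence "is_zero T (Fo (rm r k))" by simp
  moreover have "isomorphic T (Fo (rm r k)) (ro r k)"
    using T.isomorphic_sym[OF T.isomorphicI[of "rt r k"]] by simp
  ultimately show ?thesis using T.isomorphic_zero by blast
qed

section \<open>Lifting morphisms to resolutions\<close>

lemma res_lift:
  assumes s: "is_res n s" and f: "f \<in> Arr E" "Cod E f = rx s k" "Fo (Dom E f) \<in> M"
  obtains g where "g \<in> Arr E" "Dom E g = Dom E f" "Cod E g = rm s k" "rp s k \<star> g = f"
proof -
  note [simp] = is_resD[OF s] f(1,2)
  obtain t where t: "t \<in> Arr T" "Dom T t = Dom T (Fm f)" "Cod T t = Fo (rm s k)" "Fm (rp s k) \<bullet> t = Fm f"
    by (rule is_res_approx[OF s, of "Fm f" k]) (use f in simp_all)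
  obtain g where "g \<in> Arr E" "Dom E g = Dom E f" "Cod E g = Cod E (ri s k)" "rp s k \<star> g = f"
    by (rule strict_lift[OF is_resD(1)[OF s], of f k t]) (use t in simp_all)
  thus thesis using that by simp
qed

definition rd :: "('a, 'b, 'o, 'm) resolution \<Rightarrow> nat \<Rightarrow> 'm" where
  "rd r k = T.Inv (rt r k) \<bullet> (Fm (ri r k \<star> rp r (Suc k)) \<bullet> rt r (Suc k))"

definition "Cx r = km.ncx (ro r) (rd r)"

lemma res_complex:
  assumes r: "is_res n r"
  shows "km.nat_complex (ro r) (rd r)"
  unfolding km.nat_complex_def
proof (intro conjI allI)
  note [simp] = is_resD[OF r]
  fix k
  show "rd r k \<in> Arr CC" "Dom CC (rd r k) = ro r (Suc k)" "Cod CC (rd r k) = ro r k" "ro r k \<in> Obj CC"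
    unfolding rd_def by simp_all
  have rr: "Fm (rp r (Suc k)) \<bullet> Fm (ri r (Suc k)) = Zero T (Fo (rx r (Suc (Suc k)))) (Fo (rx r (Suc k)))"
    by (subst Phi.F_comp[symmetric]) simp_all
  have "Fm (rp r (Suc k)) \<bullet> (Fm (ri r (Suc k)) \<bullet> f) = Zero T (Dom T f) (Fo (rx r (Suc k)))"
    if "f \<in> Arr T" "Cod T f = Fo (rx r (Suc (Suc k)))" for f
    using T.comp_reduce[OF rr, of f] that by simp
  thus "rd r k \<cdot>\<^bsub>CC\<^esub> rd r (Suc k) = Zero CC (ro r (Suc (Suc k))) (ro r k)"
    unfolding rd_def by simp
next
  have "is_zero CC (ro r k)" if "n < k" for k
    by (rule T.full_subcat_zero[OF subsetI[OF M_obj]]) (use is_res_zero_ro[OF r that] is_resD(12)[OF r] in simp_all)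
  thus "\<exists>n. \<forall>k>n. is_zero CC (ro r k)" by blast
qed

lemma Cx_bounded [simp]: "is_res n r \<Longrightarrow> Cx r \<in> bounded_complexes CC"
  unfolding Cx_def by (rule km.ncx_bounded[OF res_complex])

lemma Cx_interval: "is_res n r \<Longrightarrow> Cx r \<in> K_interval CC n"
proof (rule km.K_intervalI)
  assume r: "is_res n r"
  show "Cx r \<in> bounded_complexes CC" using r by simp
  show "concentrated CC {- int n..0} (Cx r)" unfolding Cx_def
    by (rule km.ncx_concentrated, rule T.full_subcat_zero)
      (use is_res_zero_ro[OF r] is_resD(12)[OF r] in auto)
qed

text \<open>Commutativity is required in E and not just after applying \<Phi>; only then can
  inflations be cancelled when two lifts are compared.\<close>

definition is_lift :: "('a, 'b, 'o, 'm) resolution \<Rightarrow> ('a, 'b, 'o, 'm) resolution \<Rightarrow> (nat \<Rightarrow> 'b) \<Rightarrow> (nat \<Rightarrow> 'b) \<Rightarrow> bool" where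
  "is_lift r s a b \<longleftrightarrow> (\<forall>k. a k \<in> Arr E \<and> Dom E (a k) = rx r k \<and> Cod E (a k) = rx s k \<and>
     b k \<in> Arr E \<and> Dom E (b k) = rm r k \<and> Cod E (b k) = rm s k \<and>
     rp s k \<star> b k = a k \<star> rp r k \<and> b k \<star> ri r k = ri s k \<star> a (Suc k))"

lemma is_liftD:
  assumes "is_lift r s a b"
  shows "a k \<in> Arr E" "Dom E (a k) = rx r k" "Cod E (a k) = rx s k"
     "b k \<in> Arr E" "Dom E (b k) = rm r k" "Cod E (b k) = rm s k"
     "rp s k \<star> b k = a k \<star> rp r k" "b k \<star> ri r k = ri s k \<star> a (Suc k)"
  using assms unfolding is_lift_def by blast+

text \<open>A strict lift to the middle terms restricts to the kernels, and this restriction is the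
  next morphism to be lifted. \<open>P\<close> carries the initial value \<open>x\<close> through
  the dependent choice.\<close>

lemma lift_ex:
  assumes r: "is_res n r" and s: "is_res m s" and x: "x \<in> Arr E" "Dom E x = rx r 0" "Cod E x = rx s 0"
  obtains a b where "is_lift r s a b" "a 0 = x"
proof -
  note R = is_resD[OF r] and S = is_resD[OF s]
  define P where "P k y \<longleftrightarrow> y \<in> Arr E \<and> Dom E y = rx r k \<and> Cod E y = rx s k \<and> (k = 0 \<longrightarrow> y = x)" for k y
  define Q where "Q k y y' \<longleftrightarrow> (\<exists>b. b \<in> Arr E \<and> Dom E b = rm r k \<and> Cod E b = rm s k \<and>
     rp s k \<star> b = y \<star> rp r k \<and> b \<star> ri r k = ri s k \<star> y')" for k y y'
  have "\<exists>y'. P (Suc k) y' \<and> Q k y y'" if "P k y" for k y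
  proof -
    note [simp] = R S
    have y [simp]: "y \<in> Arr E" "Dom E y = rx r k" "Cod E y = rx s k" using that unfolding P_def by auto
    obtain b where b [simp]: "b \<in> Arr E" "Dom E b = rm r k" "Cod E b = rm s k" and pb: "rp s k \<star> b = y \<star> rp r k"
      by (rule res_lift[OF s, of "y \<star> rp r k" k]) simp_all
    have "rp s k \<star> (b \<star> ri r k) = Zero E (Dom E (b \<star> ri r k)) (Cod E (rp s k))"
      using E.comp_reduce[OF pb, of "ri r k"] by simp
    then obtain y' where "y' \<in> Arr E" "Dom E y' = rx r (Suc k)" "Cod E y' = rx s (Suc k)" "ri s k \<star> y' = b \<star> ri r k"
      using E.conf_lift[OF S(1)[of k], of "b \<star> ri r k"] by auto
    thus ?thesis unfolding P_def Q_def using b pb by (intro exI[of _ y'] conjI exI[of _ b]) simp_all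
  qed
  moreover have "P 0 x" unfolding P_def using x by simp
  ultimately obtain a where a: "\<And>k. P k (a k)" "\<And>k. Q k (a k) (a (Suc k))"
    using dependent_nat_choice[of P Q] by blast
  have "\<forall>k. \<exists>b. b \<in> Arr E \<and> Dom E b = rm r k \<and> Cod E b = rm s k \<and>
     rp s k \<star> b = a k \<star> rp r k \<and> b \<star> ri r k = ri s k \<star> a (Suc k)" using a(2) unfolding Q_def by blast
  then obtain b where b: "\<And>k. b k \<in> Arr E \<and> Dom E (b k) = rm r k \<and> Cod E (b k) = rm s k \<and>
     rp s k \<star> b k = a k \<star> rp r k \<and> b k \<star> ri r k = ri s k \<star> a (Suc k)" by metis
  have "is_lift r s a b" using a(1) b unfolding is_lift_def P_def by blast
  thus thesis using that a(1)[of 0] unfolding P_def by blast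
qed

definition cmp :: "('a, 'b, 'o, 'm) resolution \<Rightarrow> ('a, 'b, 'o, 'm) resolution \<Rightarrow> (nat \<Rightarrow> 'b) \<Rightarrow> nat \<Rightarrow> 'm" where
  "cmp r s b k = T.Inv (rt s k) \<bullet> (Fm (b k) \<bullet> rt r k)"

definition "Nm r s b = km.nmap (Cx r) (Cx s) (cmp r s b)"

lemma cmp_simps:
  assumes r: "is_res n r" and s: "is_res m s" and l: "is_lift r s a b"
  shows "cmp r s b k \<in> Arr T" "Dom T (cmp r s b k) = ro r k" "Cod T (cmp r s b k) = ro s k"
  using is_resD[OF r] is_resD[OF s] is_liftD[OF l] unfolding cmp_def by simp_all

lemma Nm_arr:
  assumes r: "is_res n r" and s: "is_res m s" and l: "is_lift r s a b"
  shows "Nm r s b \<in> Arr (Chb CC)"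
  unfolding Nm_def Cx_def
proof (rule km.nmap_arr[OF res_complex[OF r] res_complex[OF s]])
  note [simp] = is_resD[OF r] is_resD[OF s] is_liftD[OF l] cmp_simps[OF r s l]
  fix k
  show "cmp r s b k \<in> Arr CC" "Dom CC (cmp r s b k) = ro r k" "Cod CC (cmp r s b k) = ro s k" by simp_all
  have "b k \<star> (ri r k \<star> rp r (Suc k)) = ri s k \<star> (rp s (Suc k) \<star> b (Suc k))"
    using E.comp_reduce[OF is_liftD(8)[OF l, of k], of "rp r (Suc k)"] by simp
  from arg_cong[OF this, of Fm]
  have "Fm (b k) \<bullet> (Fm (ri r k) \<bullet> Fm (rp r (Suc k))) = Fm (ri s k) \<bullet> (Fm (rp s (Suc k)) \<bullet> Fm (b (Suc k)))"
    by (simp del: is_liftD[OF l] add: is_liftD(1-6)[OF l])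
  from arg_cong[OF this, of "\<lambda>x. T.Inv (rt s k) \<bullet> (x \<bullet> rt r (Suc k))"]
  show "cmp r s b k \<cdot>\<^bsub>CC\<^esub> rd r k = rd s k \<cdot>\<^bsub>CC\<^esub> cmp r s b (Suc k)"
    unfolding cmp_def rd_def by (simp del: is_liftD[OF l] add: is_liftD(1-6)[OF l])
qed

lemma Nm_sel [simp]: "csrc (Nm r s b) = Cx r" "ctgt (Nm r s b) = Cx s"
  by (simp_all add: Nm_def)

text \<open>The homotopy is built together with morphisms \<open>y k\<close> from the syzygies of
  \<open>r\<close> to the middle terms of \<open>s\<close> that lift \<open>a k\<close> in T.
  Initially \<open>y 0\<close> is zero, and then \<open>y (Suc k)\<close> is the restriction of the
  homotopy \<open>t k\<close> to the kernel.\<close>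

lemma lift_null_sequence:
  assumes r: "is_res n r" and s: "is_res m s" and l: "is_lift r s a b"
    and z: "Fm (a 0) = Zero T (Fo (rx r 0)) (Fo (rx s 0))"
  obtains t where "\<And>k. t k \<in> Arr E" "\<And>k. Dom E (t k) = rm r k" "\<And>k. Cod E (t k) = rm s (Suc k)"
    "Fm (b 0) = Fm (ri s 0 \<star> (rp s (Suc 0) \<star> t 0))"
    "\<And>k. Fm (b (Suc k)) = Fm (ri s (Suc k) \<star> (rp s (Suc (Suc k)) \<star> t (Suc k))) \<oplus>\<^bsub>T\<^esub> Fm (t k \<star> (ri r k \<star> rp r (Suc k)))"
proof -
  note [simp] = is_resD[OF r] is_resD[OF s] is_liftD(1-6)[OF l]
  define P where "P k y \<longleftrightarrow> y \<in> Arr E \<and> Dom E y = rx r k \<and> Cod E y = rm s k \<and> Fm (a k) = Fm (rp s k \<star> y) \<and>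
     (k = 0 \<longrightarrow> y = Zero E (rx r 0) (rm s 0))" for k y
  define Q where "Q k y y' \<longleftrightarrow> (\<exists>t. t \<in> Arr E \<and> Dom E t = rm r k \<and> Cod E t = rm s (Suc k) \<and>
     Fm (b k) = Fm (ri s k \<star> (rp s (Suc k) \<star> t)) \<oplus>\<^bsub>T\<^esub> Fm (y \<star> rp r k) \<and> y' = t \<star> ri r k)" for k y y'
  have "\<exists>y'. P (Suc k) y' \<and> Q k y y'" if "P k y" for k y
  proof -
    have y [simp]: "y \<in> Arr E" "Dom E y = rx r k" "Cod E y = rm s k" and Fa: "Fm (a k) = Fm (rp s k \<star> y)"
      using that unfolding P_def by auto
    have "Fm (rp s k) \<bullet> Fm y = Fm (a k)" using Fa by simp
    \<comment> \<open>Replaces \<open>y\<close> by a lift that is strict in E and has the same image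
      in T. Then \<open>b k\<close> minus the composite with \<open>rp r k\<close> maps into the
      kernel of \<open>rp s k\<close>.\<close>
    then obtain y2 where y2: "y2 \<in> Arr E" "Dom E y2 = Dom E (a k)" "Cod E y2 = Cod E (ri s k)" "rp s k \<star> y2 = a k" "Fm y2 = Fm y"
      using strict_lift[OF is_resD(1)[OF s], of "a k" k "Fm y"] by auto
    note [simp] = y2(1) and [simp] = y2(2,3)[simplified]
    have "rp s k \<star> (b k \<oplus>\<^bsub>E\<^esub> Neg E (y2 \<star> rp r k)) = Zero E (Dom E (b k \<oplus>\<^bsub>E\<^esub> Neg E (y2 \<star> rp r k))) (Cod E (rp s k))"
      using is_liftD(7)[OF l, of k] E.comp_reduce[OF y2(4), of "rp r k"] by simp
    then obtain u where u: "u \<in> Arr E" "Dom E u = rm r k" "Cod E u = rx s (Suc k)" "ri s k \<star> u = b k \<oplus>\<^bsub>E\<^esub> Neg E (y2 \<star> rp r k)"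
      using E.conf_lift[OF is_resD(1)[OF s, of k], of "b k \<oplus>\<^bsub>E\<^esub> Neg E (y2 \<star> rp r k)"] by auto
    note [simp] = u(1-3)
    obtain t where t: "t \<in> Arr E" "Dom E t = Dom E u" "Cod E t = rm s (Suc k)" "rp s (Suc k) \<star> t = u"
      by (rule res_lift[OF s, of u "Suc k"]) simp_all
    note [simp] = t(1) t(3) t(2)[simplified]
    have b: "b k = ri s k \<star> (rp s (Suc k) \<star> t) \<oplus>\<^bsub>E\<^esub> y2 \<star> rp r k" using t(4) u(4) by simp
    hence Fb: "Fm (b k) = Fm (ri s k \<star> (rp s (Suc k) \<star> t)) \<oplus>\<^bsub>T\<^esub> Fm (y \<star> rp r k)" using y2(5) by simp
    have "ri s k \<star> a (Suc k) = ri s k \<star> (rp s (Suc k) \<star> (t \<star> ri r k))"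
      unfolding is_liftD(8)[OF l, symmetric] b by simp
    \<comment> \<open>The inflation is cancelled in E. In T this conclusion would fail by morphisms
      through the connecting morphism.\<close>
    hence "a (Suc k) = rp s (Suc k) \<star> (t \<star> ri r k)" by (rule_tac E.conf_mono[OF is_resD(1)[OF s, of k]]) simp_all
    hence "P (Suc k) (t \<star> ri r k)" unfolding P_def by simp
    moreover have "Q k y (t \<star> ri r k)" unfolding Q_def using Fb by (intro exI[of _ t]) simp
    ultimately show ?thesis by blast
  qed
  moreover have "P 0 (Zero E (rx r 0) (rm s 0))" unfolding P_def using z by simp
  ultimately obtain y where y: "\<And>k. P k (y k)" "\<And>k. Q k (y k) (y (Suc k))"
    using dependent_nat_choice[of P Q] by blast
  obtain t where t: "\<And>k. t k \<in> Arr E \<and> Dom E (t k) = rm r k \<and> Cod E (t k) = rm s (Suc k) \<and>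
     Fm (b k) = Fm (ri s k \<star> (rp s (Suc k) \<star> t k)) \<oplus>\<^bsub>T\<^esub> Fm (y k \<star> rp r k) \<and> y (Suc k) = t k \<star> ri r k"
    using y(2) unfolding Q_def by metis
  have y0: "y 0 = Zero E (rx r 0) (rm s 0)" using y(1)[of 0] unfolding P_def by simp
  have t' [simp]: "t k \<in> Arr E" "Dom E (t k) = rm r k" "Cod E (t k) = rm s (Suc k)" for k using t by blast+
  show thesis
  proof (rule that[of t])
    show "Fm (b 0) = Fm (ri s 0 \<star> (rp s (Suc 0) \<star> t 0))" using t[of 0] y0 by simp
    show "Fm (b (Suc k)) = Fm (ri s (Suc k) \<star> (rp s (Suc (Suc k)) \<star> t (Suc k))) \<oplus>\<^bsub>T\<^esub> Fm (t k \<star> (ri r k \<star> rp r (Suc k)))" for k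
      using t[of "Suc k"] t[of k] by simp
  qed simp_all
qed

lemma Nm_null:
  assumes r: "is_res n r" and s: "is_res m s" and l: "is_lift r s a b"
    and z: "Fm (a 0) = Zero T (Fo (rx r 0)) (Fo (rx s 0))"
  shows "Nm r s b \<in> null_homotopic CC"
proof -
  note [simp] = is_resD[OF r] is_resD[OF s] is_liftD(1-6)[OF l]
  obtain t where t [simp]: "\<And>k. t k \<in> Arr E" "\<And>k. Dom E (t k) = rm r k" "\<And>k. Cod E (t k) = rm s (Suc k)" and
    b0: "Fm (b 0) = Fm (ri s 0 \<star> (rp s (Suc 0) \<star> t 0))" and
    bS: "\<And>k. Fm (b (Suc k)) = Fm (ri s (Suc k) \<star> (rp s (Suc (Suc k)) \<star> t (Suc k))) \<oplus>\<^bsub>T\<^esub> Fm (t k \<star> (ri r k \<star> rp r (Suc k)))"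
    using lift_null_sequence[OF r s l z] by metis
  let ?s = "\<lambda>k. T.Inv (rt s (Suc k)) \<bullet> (Fm (t k) \<bullet> rt r k)"
  show ?thesis unfolding Nm_def Cx_def
    by (rule km.nmap_null[OF res_complex[OF r] res_complex[OF s], where s = ?s])
      (use Nm_arr[OF r s l] in \<open>simp_all add: Nm_def Cx_def cmp_def rd_def b0 bS\<close>)
qed

section \<open>Functoriality of lifts up to homotopy\<close>

lemma is_lift_add:
  assumes r: "is_res n r" and s: "is_res m s" and l: "is_lift r s a b" and l': "is_lift r s a' b'"
  shows "is_lift r s (\<lambda>k. a k \<oplus>\<^bsub>E\<^esub> a' k) (\<lambda>k. b k \<oplus>\<^bsub>E\<^esub> b' k)"
  using is_liftD[OF l] is_liftD[OF l'] is_resD[OF r] is_resD[OF s] unfolding is_lift_def by simp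

lemma is_lift_neg:
  assumes r: "is_res n r" and s: "is_res m s" and l: "is_lift r s a b"
  shows "is_lift r s (\<lambda>k. Neg E (a k)) (\<lambda>k. Neg E (b k))"
  using is_liftD[OF l] is_resD[OF r] is_resD[OF s] unfolding is_lift_def by simp

lemma is_lift_comp:
  assumes r: "is_res n r" and s: "is_res m s" and t: "is_res j t" and l: "is_lift r s a b" and l': "is_lift s t a' b'"
  shows "is_lift r t (\<lambda>k. a' k \<star> a k) (\<lambda>k. b' k \<star> b k)"
proof -
  note [simp] = is_liftD[OF l] is_liftD(1-6)[OF l'] is_resD[OF r] is_resD[OF s] is_resD[OF t]
  show ?thesis unfolding is_lift_def
    by (simp add: E.comp_reduce[OF is_liftD(7)[OF l']] E.comp_reduce[OF is_liftD(8)[OF l']])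
qed

lemma is_lift_id: "is_res n r \<Longrightarrow> is_lift r r (\<lambda>k. Id E (rx r k)) (\<lambda>k. Id E (rm r k))"
  using is_resD[of n r] unfolding is_lift_def by simp

lemma Nm_add:
  assumes r: "is_res n r" and s: "is_res m s" and l: "is_lift r s a b" and l': "is_lift r s a' b'"
  shows "Nm r s (\<lambda>k. b k \<oplus>\<^bsub>E\<^esub> b' k) = Nm r s b \<oplus>\<^bsub>Chb CC\<^esub> Nm r s b'"
proof -
  note [simp] = is_liftD(4-6)[OF l] is_liftD(4-6)[OF l'] is_resD[OF r] is_resD[OF s]
  have "cmp r s (\<lambda>k. b k \<oplus>\<^bsub>E\<^esub> b' k) k = cmp r s b k \<oplus>\<^bsub>CC\<^esub> cmp r s b' k" for k
    unfolding cmp_def by simp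
  hence "cmp r s (\<lambda>k. b k \<oplus>\<^bsub>E\<^esub> b' k) = (\<lambda>k. cmp r s b k \<oplus>\<^bsub>CC\<^esub> cmp r s b' k)" by blast
  thus ?thesis unfolding Nm_def km.nmap_add by simp
qed

lemma Nm_comp:
  assumes r: "is_res n r" and s: "is_res m s" and t: "is_res j t" and l: "is_lift r s a b" and l': "is_lift s t a' b'"
  shows "Nm r t (\<lambda>k. b' k \<star> b k) = Nm s t b' \<cdot>\<^bsub>Chb CC\<^esub> Nm r s b"
proof -
  note [simp] = is_liftD(4-6)[OF l] is_liftD(4-6)[OF l'] is_resD[OF r] is_resD[OF s] is_resD[OF t]
  have "cmp r t (\<lambda>k. b' k \<star> b k) k = cmp s t b' k \<cdot>\<^bsub>CC\<^esub> cmp r s b k" for k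
    unfolding cmp_def by simp
  hence "cmp r t (\<lambda>k. b' k \<star> b k) = (\<lambda>k. cmp s t b' k \<cdot>\<^bsub>CC\<^esub> cmp r s b k)" by blast
  thus ?thesis unfolding Nm_def
    using cmp_simps[OF r s l] cmp_simps[OF s t l'] by (subst km.nmap_comp) simp_all
qed

text \<open>A morphism of T has many representatives in E, and each has many lifts; the choice
  ranges over all of them at once, which is harmless by \<open>Lam_unique\<close>.\<close>

definition Lam :: "('a, 'b, 'o, 'm) resolution \<Rightarrow> ('a, 'b, 'o, 'm) resolution \<Rightarrow> 'm \<Rightarrow> ('o, 'm) cmap set" where
  "Lam r s g = H (Nm r s (SOME b. \<exists>a. is_lift r s a b \<and> Fm (a 0) = g))"

text \<open>The difference of two lifts is a lift of a morphism that is zero in T, hence null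
  homotopic.\<close>

lemma Lam_unique:
  assumes r: "is_res n r" and s: "is_res m s" and l: "is_lift r s a b" and l': "is_lift r s a' b'" and e: "Fm (a 0) = Fm (a' 0)"
  shows "H (Nm r s b) = H (Nm r s b')"
proof -
  note [simp] = is_liftD[OF l] is_liftD[OF l'] is_resD[OF r] is_resD[OF s]
  note d = is_lift_add[OF r s l is_lift_neg[OF r s l']]
  have "Nm r s (\<lambda>k. b k \<oplus>\<^bsub>E\<^esub> Neg E (b' k)) \<in> null_homotopic CC"
    by (rule Nm_null[OF r s d]) (simp add: e)
  hence "H (Nm r s (\<lambda>k. b k \<oplus>\<^bsub>E\<^esub> Neg E (b' k)) \<oplus>\<^bsub>Chb CC\<^esub> Nm r s b') = H (Nm r s b')"
    using Nm_arr[OF r s l'] by (rule km.ch.cls_add_null) simp_all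
  moreover have "Nm r s (\<lambda>k. b k \<oplus>\<^bsub>E\<^esub> Neg E (b' k)) \<oplus>\<^bsub>Chb CC\<^esub> Nm r s b' = Nm r s (\<lambda>k. (b k \<oplus>\<^bsub>E\<^esub> Neg E (b' k)) \<oplus>\<^bsub>E\<^esub> b' k)"
    by (rule Nm_add[OF r s d l', symmetric])
  ultimately show ?thesis by simp
qed

lemma Lam_eq:
  assumes r: "is_res n r" and s: "is_res m s" and l: "is_lift r s a b" and g: "Fm (a 0) = g"
  shows "Lam r s g = H (Nm r s b)"
proof -
  define c where "c = (SOME b. \<exists>a. is_lift r s a b \<and> Fm (a 0) = g)"
  have "\<exists>a. is_lift r s a b \<and> Fm (a 0) = g" using l g by blast
  hence "\<exists>a. is_lift r s a c \<and> Fm (a 0) = g"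
    unfolding c_def by (rule someI[of "\<lambda>b. \<exists>a. is_lift r s a b \<and> Fm (a 0) = g"])
  then obtain a' where l': "is_lift r s a' c" and g': "Fm (a' 0) = g" by blast
  have "H (Nm r s c) = H (Nm r s b)" by (rule Lam_unique[OF r s l' l]) (simp add: g g')
  thus ?thesis unfolding Lam_def c_def .
qed

lemma Lam_obtain:
  assumes r: "is_res n r" and s: "is_res m s" and g: "g \<in> Arr T" "Dom T g = Fo (rx r 0)" "Cod T g = Fo (rx s 0)"
  obtains a b where "is_lift r s a b" "Fm (a 0) = g" "Lam r s g = H (Nm r s b)"
proof -
  obtain x where x: "x \<in> Arr E" "Dom E x = rx r 0" "Cod E x = rx s 0" "Fm x = g"
    using Phi_full[of "rx r 0" "rx s 0" g] g is_resD(8)[OF r] is_resD(8)[OF s] by blast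
  obtain a b where l: "is_lift r s a b" "a 0 = x" by (rule lift_ex[OF r s x(1-3)])
  show thesis using that[OF l(1)] Lam_eq[OF r s l(1)] l(2) x(4) by simp
qed

lemma Lam_simps:
  assumes "is_res n r" "is_res m s" "g \<in> Arr T" "Dom T g = Fo (rx r 0)" "Cod T g = Fo (rx s 0)"
  shows "Lam r s g \<in> Arr km.ch.Q" "Dom km.ch.Q (Lam r s g) = Cx r" "Cod km.ch.Q (Lam r s g) = Cx s"
proof -
  obtain a b where l: "is_lift r s a b" "Lam r s g = H (Nm r s b)" using Lam_obtain[OF assms] .
  thus "Lam r s g \<in> Arr km.ch.Q" "Dom km.ch.Q (Lam r s g) = Cx r" "Cod km.ch.Q (Lam r s g) = Cx s"
    using Nm_arr[OF assms(1,2) l(1)] by simp_all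
qed

lemma Lam_comp:
  assumes r: "is_res n r" and s: "is_res m s" and t: "is_res j t"
    and g: "g \<in> Arr T" "Dom T g = Fo (rx r 0)" "Cod T g = Fo (rx s 0)"
    and h: "h \<in> Arr T" "Dom T h = Fo (rx s 0)" "Cod T h = Fo (rx t 0)"
  shows "Lam r t (h \<bullet> g) = Lam s t h \<odot> Lam r s g"
proof -
  obtain a b where l: "is_lift r s a b" "Fm (a 0) = g" "Lam r s g = H (Nm r s b)" using Lam_obtain[OF r s g] .
  obtain a' b' where l': "is_lift s t a' b'" "Fm (a' 0) = h" "Lam s t h = H (Nm s t b')" using Lam_obtain[OF s t h] .
  note [simp] = is_liftD[OF l(1)] is_liftD[OF l'(1)]
  have "Lam r t (h \<bullet> g) = H (Nm r t (\<lambda>k. b' k \<star> b k))"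
    by (rule Lam_eq[OF r t is_lift_comp[OF r s t l(1) l'(1)]]) (simp add: l(2) l'(2))
  also have "\<dots> = H (Nm s t b') \<odot> H (Nm r s b)"
    unfolding Nm_comp[OF r s t l(1) l'(1)]
    using Nm_arr[OF r s l(1)] Nm_arr[OF s t l'(1)] by simp
  finally show ?thesis using l l' by simp
qed

lemma Lam_add:
  assumes r: "is_res n r" and s: "is_res m s"
    and g: "g \<in> Arr T" "Dom T g = Fo (rx r 0)" "Cod T g = Fo (rx s 0)"
    and h: "h \<in> Arr T" "Dom T h = Fo (rx r 0)" "Cod T h = Fo (rx s 0)"
  shows "Lam r s (g \<oplus>\<^bsub>T\<^esub> h) = Lam r s g \<oplus>\<^bsub>km.ch.Q\<^esub> Lam r s h"
proof -
  obtain a b where l: "is_lift r s a b" "Fm (a 0) = g" "Lam r s g = H (Nm r s b)" using Lam_obtain[OF r s g] .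
  obtain a' b' where l': "is_lift r s a' b'" "Fm (a' 0) = h" "Lam r s h = H (Nm r s b')" using Lam_obtain[OF r s h] .
  note [simp] = is_liftD[OF l(1)] is_liftD[OF l'(1)]
  have "Lam r s (g \<oplus>\<^bsub>T\<^esub> h) = H (Nm r s (\<lambda>k. b k \<oplus>\<^bsub>E\<^esub> b' k))"
    by (rule Lam_eq[OF r s is_lift_add[OF r s l(1) l'(1)]]) (simp add: l(2) l'(2))
  also have "\<dots> = H (Nm r s b) \<oplus>\<^bsub>km.ch.Q\<^esub> H (Nm r s b')"
    unfolding Nm_add[OF r s l(1) l'(1)]
    using Nm_arr[OF r s l(1)] Nm_arr[OF r s l'(1)] by simp
  finally show ?thesis using l l' by simp
qed

lemma Lam_id:
  assumes r: "is_res n r"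
  shows "Lam r r (Id T (Fo (rx r 0))) = H (Id (Chb CC) (Cx r))"
proof -
  note [simp] = is_resD[OF r]
  have "Lam r r (Id T (Fo (rx r 0))) = H (Nm r r (\<lambda>k. Id E (rm r k)))"
    by (rule Lam_eq[OF r r is_lift_id[OF r]]) simp
  moreover have "cmp r r (\<lambda>k. Id E (rm r k)) = (\<lambda>k. Id CC (ro r k))"
    by (rule ext) (simp add: cmp_def)
  ultimately show ?thesis unfolding Nm_def Cx_def km.nmap_id by simp
qed

end

section \<open>The connecting transformation\<close>

lemma (in additive_category) Inv_Id [simp]: "X \<in> Obj C \<Longrightarrow> Inv (Id C X) = Id C X"
  using Inv_simps(4)[of "Id C X"] by simp

context model_subcategory
begin

text \<open>The sign of the inflations turns the complex of \<open>tail r\<close> into the brutal truncation of the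
  complex of \<open>r\<close>, shifted by one without a sign change in the suspension.\<close>

definition tail :: "('a, 'b, 'o, 'm) resolution \<Rightarrow> ('a, 'b, 'o, 'm) resolution" where
  "tail r = \<lparr>rx = (\<lambda>k. rx r (Suc k)), ri = (\<lambda>k. Neg E (ri r (Suc k))), rp = (\<lambda>k. rp r (Suc k)),
     ro = (\<lambda>k. ro r (Suc k)), rt = (\<lambda>k. rt r (Suc k))\<rparr>"

lemma tail_sel [simp]:
  "rx (tail r) k = rx r (Suc k)" "ri (tail r) k = Neg E (ri r (Suc k))" "rp (tail r) k = rp r (Suc k)"
  "ro (tail r) k = ro r (Suc k)" "rt (tail r) k = rt r (Suc k)"
  by (simp_all add: tail_def)

lemma tail_rm [simp]: "is_res n r \<Longrightarrow> rm (tail r) k = rm r (Suc k)"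
  using is_resD(4,5)[of n r] by (simp add: rm_def)

lemma tail_res: "is_res n r \<Longrightarrow> is_res n (tail r)"
proof -
  assume r: "is_res n r"
  note [simp] = is_resD[OF r] is_resD(1-4)[OF r] tail_rm[OF r]
  show ?thesis unfolding is_res_def
    using E.conf_neg[OF is_resD(1)[OF r]] is_res_zero[OF r] is_res_approx[OF r] by simp metis
qed

lemma tail_rd: "is_res n r \<Longrightarrow> rd (tail r) k = Neg T (rd r (Suc k))"
  using is_resD[of n r] by (simp add: rd_def)

lemma tail_lift:
  assumes r: "is_res n r" and s: "is_res m s" and l: "is_lift r s a b"
  shows "is_lift (tail r) (tail s) (\<lambda>k. a (Suc k)) (\<lambda>k. b (Suc k))"
  using is_liftD[OF l] is_resD[OF r] is_resD[OF s] tail_rm[OF r] tail_rm[OF s] unfolding is_lift_def by simp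

text \<open>The projection of the complex of \<open>r\<close> onto its part in negative degrees,
  which is the suspension of the complex of \<open>tail r\<close>.\<close>

definition pi :: "('a, 'b, 'o, 'm) resolution \<Rightarrow> ('o, 'm) cmap" where
  "pi r = km.omap (Cx r) (Cx (tail r)) (\<lambda>k. Id T (ro r (Suc k)))"

lemma pi_arr:
  assumes r: "is_res n r"
  shows "pi r \<in> Arr (Chb CC)" "csrc (pi r) = Cx r" "ctgt (pi r) = shift_cplx CC (Cx (tail r))"
proof -
  note [simp] = is_resD[OF r] 
  have d [simp]: "rd r k \<in> Arr T" "Dom T (rd r k) = ro r (Suc k)" "Cod T (rd r k) = ro r k" for k
    by (simp_all add: rd_def)
  show "pi r \<in> Arr (Chb CC)" unfolding pi_def Cx_def
    by (rule km.omap_arr[OF res_complex[OF r] res_complex[OF tail_res[OF r]]]) (simp_all add: tail_rd[OF r])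
qed (simp_all add: pi_def)

lemma pi_natural:
  assumes r: "is_res n r" and s: "is_res m s" and l: "is_lift r s a b"
  shows "pi s \<cdot>\<^bsub>Chb CC\<^esub> Nm r s b = shift_cmap CC (Nm (tail r) (tail s) (\<lambda>k. b (Suc k))) \<cdot>\<^bsub>Chb CC\<^esub> pi r"
proof -
  note [simp] = is_resD[OF r] is_resD[OF s] cmp_simps[OF r s l]
  have c: "cmp (tail r) (tail s) (\<lambda>k. b (Suc k)) k = cmp r s b (Suc k)" for k by (simp add: cmp_def)
  show ?thesis unfolding pi_def Nm_def Cx_def
    by (subst km.omap_nmap[OF res_complex[OF r] res_complex[OF s]], simp, simp, simp,
      subst km.shift_nmap_omap[OF res_complex[OF r]]) (simp add: c)
qed

text \<open>A morphism \<open>g\<close> from the first syzygy of \<open>r\<close> to the object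
  resolved by \<open>s\<close> induces a map from the complex of \<open>tail r\<close>; it is
  suspended and composed with the truncation.\<close>

definition Om :: "('a, 'b, 'o, 'm) resolution \<Rightarrow> ('a, 'b, 'o, 'm) resolution \<Rightarrow> 'm \<Rightarrow> ('o, 'm) cmap set" where
  "Om r s g = fmor (Kb_shift CC) (Lam (tail r) s g) \<odot> H (pi r)"

lemma Om_rep:
  assumes r: "is_res n r" and s: "is_res m s" and l: "is_lift (tail r) s a b" and g: "Fm (a 0) = g"
  shows "Om r s g = H (km.omap (Cx r) (Cx s) (cmp (tail r) s b))"
    "km.omap (Cx r) (Cx s) (cmp (tail r) s b) \<in> Arr (Chb CC)"
proof -
  note t = tail_res[OF r]
  note [simp] = is_resD[OF r] is_resD[OF s] cmp_simps[OF t s l]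
  have e: "shift_cmap CC (Nm (tail r) s b) \<cdot>\<^bsub>Chb CC\<^esub> pi r = km.omap (Cx r) (Cx s) (cmp (tail r) s b)"
    unfolding pi_def Nm_def Cx_def by (subst km.shift_nmap_omap[OF res_complex[OF r]]) simp
  show "km.omap (Cx r) (Cx s) (cmp (tail r) s b) \<in> Arr (Chb CC)"
    unfolding e[symmetric] using Nm_arr[OF t s l] pi_arr[OF r] by simp
  show "Om r s g = H (km.omap (Cx r) (Cx s) (cmp (tail r) s b))"
    unfolding Om_def Lam_eq[OF t s l g] e[symmetric] using Nm_arr[OF t s l] pi_arr[OF r] by simp
qed

context
  fixes n m r s
  assumes r: "is_res n r" and s: "is_res m s"
begin

lemma Om_simps:
  assumes g: "g \<in> Arr T" "Dom T g = Fo (rx r (Suc 0))" "Cod T g = Fo (rx s 0)"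
  shows "Om r s g \<in> Arr km.ch.Q" "Dom km.ch.Q (Om r s g) = Cx r" "Cod km.ch.Q (Om r s g) = shift_cplx CC (Cx s)"
  using Lam_simps[OF tail_res[OF r] s, of g] g pi_arr[OF r] unfolding Om_def by simp_all

lemma Om_add:
  assumes g: "g \<in> Arr T" "Dom T g = Fo (rx r (Suc 0))" "Cod T g = Fo (rx s 0)"
    and h: "h \<in> Arr T" "Dom T h = Fo (rx r (Suc 0))" "Cod T h = Fo (rx s 0)"
  shows "Om r s (g \<oplus>\<^bsub>T\<^esub> h) = Om r s g \<oplus>\<^bsub>km.ch.Q\<^esub> Om r s h"
  using Lam_simps[OF tail_res[OF r] s, of g] Lam_simps[OF tail_res[OF r] s, of h] g h pi_arr[OF r]
  unfolding Om_def by (subst Lam_add[OF tail_res[OF r] s]) simp_all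

lemma Om_right:
  assumes s': "is_res m' s'" and g: "g \<in> Arr T" "Dom T g = Fo (rx r (Suc 0))" "Cod T g = Fo (rx s 0)"
    and h: "h \<in> Arr T" "Dom T h = Fo (rx s 0)" "Cod T h = Fo (rx s' 0)"
  shows "Om r s' (h \<bullet> g) = fmor (Kb_shift CC) (Lam s s' h) \<odot> Om r s g"
  using Lam_simps[OF tail_res[OF r] s, of g] Lam_simps[OF s s', of h] g h pi_arr[OF r]
  unfolding Om_def by (subst Lam_comp[OF tail_res[OF r] s s']) simp_all

lemma Om_left:
  assumes r': "is_res n' r'" and l: "is_lift r' r a b" and g: "g \<in> Arr T" "Dom T g = Fo (rx r (Suc 0))" "Cod T g = Fo (rx s 0)"
  shows "Om r' s (g \<bullet> Fm (a (Suc 0))) = Om r s g \<odot> Lam r' r (Fm (a 0))"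
proof -
  note t = tail_res[OF r] and t' = tail_res[OF r'] and tl = tail_lift[OF r' r l]
  note [simp] = pi_arr[OF r] pi_arr[OF r'] Nm_arr[OF r' r l] Nm_arr[OF t' t tl] Lam_simps[OF t s, of g, simplified, OF g] g
    is_liftD(1-3)[OF l]
  have "Om r' s (g \<bullet> Fm (a (Suc 0))) = fmor (Kb_shift CC) (Lam (tail r) s g) \<odot>
      (fmor (Kb_shift CC) (Lam (tail r') (tail r) (Fm (a (Suc 0)))) \<odot> H (pi r'))"
    unfolding Om_def using Lam_simps[OF t' t, of "Fm (a (Suc 0))"]
    by (subst Lam_comp[OF t' t s]) simp_all
  also have "fmor (Kb_shift CC) (Lam (tail r') (tail r) (Fm (a (Suc 0)))) \<odot> H (pi r') =
      H (shift_cmap CC (Nm (tail r') (tail r) (\<lambda>k. b (Suc k))) \<cdot>\<^bsub>Chb CC\<^esub> pi r')"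
    by (subst Lam_eq[OF t' t tl refl]) simp
  also have "\<dots> = H (pi r) \<odot> H (Nm r' r b)"
    unfolding pi_natural[OF r' r l, symmetric] by simp
  also have "H (Nm r' r b) = Lam r' r (Fm (a 0))" by (rule Lam_eq[OF r' r l refl, symmetric])
  finally show ?thesis unfolding Om_def Lam_eq[OF r' r l refl] by simp
qed

text \<open>A morphism that extends along the inflation to the middle term, which lies in M, lifts
  there to some \<open>h\<close>. So the lift of the composite can be taken zero beyond degree 0,
  and \<open>h\<close> is the null homotopy. This is what makes the class independent of the choice
  of \<open>g\<close>.\<close>

lemma Om_zero:
  assumes t: "t \<in> Arr T" "Dom T t = Fo (rm r 0)" "Cod T t = Fo (rx s 0)"
  shows "Om r s (t \<bullet> Fm (ri r 0)) = H (Zero (Chb CC) (Cx r) (shift_cplx CC (Cx s)))"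
proof -
  note [simp] = is_resD[OF r] is_resD[OF s] t tail_rm[OF r]
  obtain t' where t': "t' \<in> Arr T" "Dom T t' = Fo (rm r 0)" "Cod T t' = Fo (rm s 0)" "Fm (rp s 0) \<bullet> t' = t"
    using is_res_approx[OF s, of t 0] by auto
  obtain h where h [simp]: "h \<in> Arr E" "Dom E h = rm r 0" "Cod E h = rm s 0" and Fh: "Fm h = t'"
    using Phi_full[of "rm r 0" "rm s 0" t'] t' by auto
  let ?a = "\<lambda>k. if k = 0 then rp s 0 \<star> (h \<star> ri r 0) else Zero E (rx r (Suc k)) (rx s k)"
  let ?b = "\<lambda>k. if k = 0 then h \<star> (ri r 0 \<star> rp r (Suc 0)) else Zero E (rm r (Suc k)) (rm s k)"
  have l: "is_lift (tail r) s ?a ?b" unfolding is_lift_def by auto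
  have g: "Fm (?a 0) = t \<bullet> Fm (ri r 0)" using Fh T.comp_reduce[OF t'(4), of "Fm (ri r 0)"] t' by simp
  note o = Om_rep[OF r s l g]
  have "km.omap (Cx r) (Cx s) (cmp (tail r) s ?b) \<in> null_homotopic CC"
    using o(2) unfolding Cx_def
    by (rule_tac km.omap_null[OF res_complex[OF r] res_complex[OF s], where s = "T.Inv (rt s 0) \<bullet> (Fm h \<bullet> rt r 0)"])
      (simp_all add: cmp_def rd_def)
  hence "H (km.omap (Cx r) (Cx s) (cmp (tail r) s ?b) \<oplus>\<^bsub>Chb CC\<^esub> Zero (Chb CC) (Cx r) (shift_cplx CC (Cx s))) =
    H (Zero (Chb CC) (Cx r) (shift_cplx CC (Cx s)))"
    using Cx_bounded[OF r] Cx_bounded[OF s] by (rule_tac km.ch.cls_add_null) simp_all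
  thus ?thesis using o Cx_bounded[OF r] Cx_bounded[OF s] by simp
qed

end

section \<open>The transformation on extensions\<close>

definition "dl r = \<delta> (ri r 0) (rp r 0)"

lemma dl_simps:
  assumes r: "is_res n r"
  shows "dl r \<in> Arr T" "Dom T (dl r) = Fo (rx r 0)" "Cod T (dl r) = So (Fo (rx r (Suc 0)))"
  using delta_simps[OF is_resD(1)[OF r, of 0]] is_resD[OF r] unfolding dl_def by simp_all

text \<open>Membership in E_M(X, Y) for the resolved objects, in the form of vanishing on M.\<close>

definition kills :: "('a, 'b, 'o, 'm) resolution \<Rightarrow> ('a, 'b, 'o, 'm) resolution \<Rightarrow> 'm \<Rightarrow> bool" where
  "kills r s w \<longleftrightarrow> w \<in> Arr T \<and> Dom T w = Fo (rx r 0) \<and> Cod T w = So (Fo (rx s 0)) \<and>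
     (\<forall>a. a \<in> Arr T \<longrightarrow> Dom T a \<in> M \<longrightarrow> Cod T a = Fo (rx r 0) \<longrightarrow> w \<bullet> a = Zero T (Dom T a) (So (Fo (rx s 0))))"

definition connects :: "('a, 'b, 'o, 'm) resolution \<Rightarrow> ('a, 'b, 'o, 'm) resolution \<Rightarrow> 'm \<Rightarrow> 'm \<Rightarrow> bool" where
  "connects r s w g \<longleftrightarrow> g \<in> Arr T \<and> Dom T g = Fo (rx r (Suc 0)) \<and> Cod T g = Fo (rx s 0) \<and> Sm g \<bullet> dl r = w"

definition Omega :: "('a, 'b, 'o, 'm) resolution \<Rightarrow> ('a, 'b, 'o, 'm) resolution \<Rightarrow> 'm \<Rightarrow> ('o, 'm) cmap set" where
  "Omega r s w = Om r s (SOME g. connects r s w g)"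

text \<open>The middle term of the first conflation lies in M, so \<open>w\<close> vanishes on it
  and factors through the connecting morphism; the factor is a morphism of suspensions and
  desuspends.\<close>

lemma connects_ex:
  assumes r: "is_res n r" and s: "is_res m s" and w: "kills r s w"
  obtains g where "connects r s w g"
proof -
  note [simp] = is_resD[OF r] is_resD[OF s] dl_simps[OF r]
  have w' [simp]: "w \<in> Arr T" "Dom T w = Fo (rx r 0)" "Cod T w = So (Fo (rx s 0))" using w unfolding kills_def by auto
  have "w \<bullet> Fm (rp r 0) = Zero T (Fo (rm r 0)) (So (Fo (rx s 0)))" using w unfolding kills_def by simp
  then obtain h where h: "h \<in> Arr T" "Dom T h = So (Fo (rx r (Suc 0)))" "Cod T h = So (Fo (rx s 0))" "h \<bullet> dl r = w"
    using T.tri_coexact_Z[OF delta_tri[OF is_resD(1)[OF r, of 0]], of w] unfolding dl_def by auto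
  obtain g where "g \<in> Arr T" "Dom T g = Fo (rx r (Suc 0))" "Cod T g = Fo (rx s 0)" "Sm g = h"
    using T.S.full[of "Fo (rx r (Suc 0))" "Fo (rx s 0)" h] h by auto
  thus thesis using that[of g] h(4) unfolding connects_def by simp
qed

text \<open>The suspended difference of two choices of \<open>g\<close> vanishes on the connecting
  morphism, so the difference extends along the inflation and contributes nothing.\<close>

lemma Omega_eq:
  assumes r: "is_res n r" and s: "is_res m s" and g: "connects r s w g"
  shows "Omega r s w = Om r s g"
proof -
  define h where "h = (SOME g. connects r s w g)"
  have h: "connects r s w h" unfolding h_def using g by (rule someI)
  note [simp] = is_resD[OF r] is_resD[OF s] dl_simps[OF r]
  have gh [simp]: "g \<in> Arr T" "Dom T g = Fo (rx r (Suc 0))" "Cod T g = Fo (rx s 0)"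
    "h \<in> Arr T" "Dom T h = Fo (rx r (Suc 0))" "Cod T h = Fo (rx s 0)" and e: "Sm g \<bullet> dl r = w" "Sm h \<bullet> dl r = w"
    using g h unfolding connects_def by auto
  have wt: "w \<in> Arr T" "Dom T w = Fo (rx r 0)" "Cod T w = So (Fo (rx s 0))" unfolding e(1)[symmetric] by simp_all
  have "Sm (h \<oplus>\<^bsub>T\<^esub> Neg T g) \<bullet> dl r = Zero T (Fo (rx r 0)) (So (Fo (rx s 0)))" using e wt by simp
  then obtain y where y: "y \<in> Arr T" "Dom T y = So (Fo (rm r 0))" "Cod T y = So (Fo (rx s 0))" "y \<bullet> Sm (Fm (ri r 0)) = Sm (h \<oplus>\<^bsub>T\<^esub> Neg T g)"
    using T.tri_coexact_SX[OF delta_tri[OF is_resD(1)[OF r, of 0]], of "Sm (h \<oplus>\<^bsub>T\<^esub> Neg T g)"] unfolding dl_def by auto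
  obtain t where t [simp]: "t \<in> Arr T" "Dom T t = Fo (rm r 0)" "Cod T t = Fo (rx s 0)" and St: "Sm t = y"
    using T.S.full[of "Fo (rm r 0)" "Fo (rx s 0)" y] y by auto
  have "Sm (t \<bullet> Fm (ri r 0)) = Sm (h \<oplus>\<^bsub>T\<^esub> Neg T g)" using y(4) St by simp
  hence tg: "t \<bullet> Fm (ri r 0) = h \<oplus>\<^bsub>T\<^esub> Neg T g" by (rule_tac T.S.faithful) simp_all
  have "h = (h \<oplus>\<^bsub>T\<^esub> Neg T g) \<oplus>\<^bsub>T\<^esub> g" by simp
  hence "Om r s h = Om r s (t \<bullet> Fm (ri r 0)) \<oplus>\<^bsub>km.ch.Q\<^esub> Om r s g"
    unfolding tg[symmetric] using Om_add[OF r s, of "t \<bullet> Fm (ri r 0)" g] by simp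
  also have "\<dots> = Om r s g"
    using km.kq.add_zero(1)[of "Om r s g" "Cx r" "shift_cplx CC (Cx s)"] Om_simps[OF r s, of g]
    by (simp add: Om_zero[OF r s])
  finally show ?thesis unfolding Omega_def h_def .
qed

lemma Omega_simps:
  assumes r: "is_res n r" and s: "is_res m s" and w: "kills r s w"
  shows "Omega r s w \<in> Arr km.ch.Q" "Dom km.ch.Q (Omega r s w) = Cx r" "Cod km.ch.Q (Omega r s w) = shift_cplx CC (Cx s)"
proof -
  obtain g where g: "connects r s w g" using connects_ex[OF r s w] .
  thus "Omega r s w \<in> Arr km.ch.Q" "Dom km.ch.Q (Omega r s w) = Cx r" "Cod km.ch.Q (Omega r s w) = shift_cplx CC (Cx s)"
    unfolding Omega_eq[OF r s g] using Om_simps[OF r s, of g] unfolding connects_def by simp_all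
qed

lemma Omega_add:
  assumes r: "is_res n r" and s: "is_res m s" and w: "kills r s w" and w': "kills r s w'"
  shows "Omega r s (w \<oplus>\<^bsub>T\<^esub> w') = Omega r s w \<oplus>\<^bsub>km.ch.Q\<^esub> Omega r s w'"
proof -
  obtain g where g: "connects r s w g" using connects_ex[OF r s w] .
  obtain g' where g': "connects r s w' g'" using connects_ex[OF r s w'] .
  have "connects r s (w \<oplus>\<^bsub>T\<^esub> w') (g \<oplus>\<^bsub>T\<^esub> g')" using g g' dl_simps[OF r] unfolding connects_def by auto
  from Omega_eq[OF r s this] show ?thesis
    unfolding Omega_eq[OF r s g] Omega_eq[OF r s g'] using Om_add[OF r s, of g g'] g g' unfolding connects_def by simp
qed

lemma Omega_right:
  assumes r: "is_res n r" and s: "is_res m s" and s': "is_res m' s'" and w: "kills r s w"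
    and h: "h \<in> Arr T" "Dom T h = Fo (rx s 0)" "Cod T h = Fo (rx s' 0)"
  shows "Omega r s' (Sm h \<bullet> w) = fmor (Kb_shift CC) (Lam s s' h) \<odot> Omega r s w"
proof -
  obtain g where g: "connects r s w g" using connects_ex[OF r s w] .
  have "connects r s' (Sm h \<bullet> w) (h \<bullet> g)" using g h dl_simps[OF r] unfolding connects_def by auto
  from Omega_eq[OF r s' this] show ?thesis
    unfolding Omega_eq[OF r s g] using Om_right[OF r s s', of g h] g h unfolding connects_def by simp
qed

lemma Omega_left:
  assumes r: "is_res n r" and s: "is_res m s" and r': "is_res n' r'" and w: "kills r s w"
    and f: "f \<in> Arr T" "Dom T f = Fo (rx r' 0)" "Cod T f = Fo (rx r 0)"
  shows "Omega r' s (w \<bullet> f) = Omega r s w \<odot> Lam r' r f"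
proof -
  obtain g where g: "connects r s w g" using connects_ex[OF r s w] .
  obtain a b where l: "is_lift r' r a b" "Fm (a 0) = f" using Lam_obtain[OF r' r f] .
  note [simp] = is_resD[OF r] is_resD[OF r'] is_liftD(1-6)[OF l(1)] dl_simps[OF r] dl_simps[OF r']
  have gT [simp]: "g \<in> Arr T" "Dom T g = Fo (rx r (Suc 0))" "Cod T g = Fo (rx s 0)" and gw: "Sm g \<bullet> dl r = w"
    using g unfolding connects_def by auto
  \<comment> \<open>Naturality of \<delta> for the first conflations turns precomposition of
    \<open>w\<close> with \<open>f\<close> into precomposition of \<open>g\<close> with the induced
    morphism of first syzygies.\<close>
  have n: "Sm (Fm (a (Suc 0))) \<bullet> dl r' = dl r \<bullet> Fm (a 0)"
    unfolding dl_def using is_liftD(7,8)[OF l(1), of 0]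
    by (intro delta_natural[OF is_resD(1)[OF r'] is_resD(1)[OF r], of _ _ _ "b 0"]) simp_all
  have "Sm (g \<bullet> Fm (a (Suc 0))) \<bullet> dl r' = Sm g \<bullet> (dl r \<bullet> Fm (a 0))" using n by simp
  also have "\<dots> = w \<bullet> f" using T.comp_reduce[OF gw, of f] f l(2) by simp
  finally have "connects r' s (w \<bullet> f) (g \<bullet> Fm (a (Suc 0)))" unfolding connects_def by simp
  from Omega_eq[OF r' s this] show ?thesis
    unfolding Omega_eq[OF r s g] using Om_left[OF r s r' l(1), of g] l(2) by simp
qed

end

subsection \<open>The horseshoe lemma\<close>

context exact_category
begin

text \<open>A pushout of an inflation keeps the cokernel: \<open>p\<close> and zero induce
  \<open>be\<close>, which is then shown to be isomorphic to a cokernel \<open>q\<close> of the new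
  inflation.\<close>

lemma pushout_conf:
  assumes c: "(i, p) \<in> Conf E" and g: "g \<in> Arr E" "Dom E g = Dom E i"
  obtains al be lam where "(al, be) \<in> Conf E" "Dom E al = Cod E g" "Cod E be = Cod E p" "lam \<in> Arr E"
    "Dom E lam = Cod E i" "Cod E lam = Cod E al" "be \<cdot> lam = p" "lam \<cdot> i = al \<cdot> g"
proof -
  note [simp] = conf_simps[OF c] g
  have "inflation E i" using c unfolding inflation_def by blast
  then obtain al lam where inf: "inflation E al" and la: "lam \<in> Arr E" "al \<in> Arr E" "Dom E lam = Cod E i"
    "Dom E al = Cod E g" "Cod E lam = Cod E al" "lam \<cdot> i = al \<cdot> g" and
    U: "\<And>a b. \<lbrakk>a \<in> Arr E; b \<in> Arr E; Dom E a = Cod E i; Dom E b = Cod E g; Cod E a = Cod E b; a \<cdot> i = b \<cdot> g\<rbrakk> \<Longrightarrow>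
      \<exists>h. h \<in> Arr E \<and> Dom E h = Cod E al \<and> Cod E h = Cod E b \<and> h \<cdot> lam = a \<and> h \<cdot> al = b" and
    Mo: "\<And>h k. \<lbrakk>h \<in> Arr E; k \<in> Arr E; Dom E h = Cod E al; Dom E k = Cod E al; Cod E h = Cod E k; h \<cdot> lam = k \<cdot> lam; h \<cdot> al = k \<cdot> al\<rbrakk> \<Longrightarrow> h = k"
    by (rule pushout_ex[OF _ g conf_simps(1)[OF c]]) (rule that, assumption+)
  note [simp] = la(1-5)
  obtain be where be [simp]: "be \<in> Arr E" "Dom E be = Cod E al" "Cod E be = Cod E p" and
    bl: "be \<cdot> lam = p" "be \<cdot> al = Zero E (Cod E g) (Cod E p)"
    using U[of p "Zero E (Cod E g) (Cod E p)"] by auto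
  obtain q where q: "(al, q) \<in> Conf E" using inf unfolding inflation_def by blast
  note Q = conf_simps[OF q] and [simp] = conf_simps(2,3)[OF q]
  have qa: "q \<cdot> al = Zero E (Cod E g) (Cod E q)" using Q(4) by simp
  have "(q \<cdot> lam) \<cdot> i = Zero E (Dom E i) (Cod E (q \<cdot> lam))"
    using la(6) comp_reduce[OF qa, of g] by simp
  then obtain h where h [simp]: "h \<in> Arr E" "Dom E h = Cod E p" "Cod E h = Cod E q" and hp: "h \<cdot> p = q \<cdot> lam"
    using conf_colift[OF c, of "q \<cdot> lam"] by auto
  obtain k where k [simp]: "k \<in> Arr E" "Dom E k = Cod E q" "Cod E k = Cod E p" and kq: "k \<cdot> q = be"
    using conf_colift[OF q, of be] bl(2) by auto
  have hb: "h \<cdot> be = q" by (rule Mo) (simp_all add: bl qa hp)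
  have "(k \<cdot> h) \<cdot> p = Id E (Cod E p) \<cdot> p" using hp comp_reduce[OF kq, of lam] bl(1) by simp
  hence kh: "k \<cdot> h = Id E (Cod E p)" by (rule_tac conf_epi[OF c]) simp_all
  have "(h \<cdot> k) \<cdot> q = Id E (Cod E q) \<cdot> q" using kq hb by simp
  hence hk: "h \<cdot> k = Id E (Cod E q)" by (rule_tac conf_epi[OF q]) simp_all
  have "is_iso E k" using kh hk by (intro is_isoI[of k h]) simp_all
  hence "(al, be) \<in> Conf E"
    by (intro conf_iso[OF q, of al be "Id E (Cod E g)" "Id E (Cod E al)" k]) (simp_all add: kq)
  thus thesis by (rule that) (use la bl in simp_all)
qed

text \<open>The deflation \<open>(al p', lam) : n \<oplus> m \<rightarrow> z\<close> is the composite of the pullback \<open>n \<oplus> m \<rightarrow> y \<oplus> m\<close> of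
  \<open>p'\<close> and the pullback \<open>y \<oplus> m \<rightarrow> z\<close> of \<open>p\<close> along \<open>be\<close>; its kernel is the pullback of \<open>p'\<close> along \<open>-g\<close>.\<close>

lemma horseshoe_step:
  assumes c: "(i, p) \<in> Conf E" and c': "(i', p') \<in> Conf E" and ab: "(al, be) \<in> Conf E"
    and t: "Dom E al = Cod E p'" "Cod E be = Cod E p"
    and lam: "lam \<in> Arr E" "Dom E lam = Cod E i" "Cod E lam = Cod E al" "be \<cdot> lam = p" "lam \<cdot> i = al \<cdot> g"
    and g: "g \<in> Arr E" "Dom E g = Dom E i" "Cod E g = Cod E p'"
    and sq: "pullback_square p' (Neg E g) gh be'"
    and B: "is_biproduct E (Cod E i') (Cod E i) S i1 j1 p1 q1"
  shows "(i1 \<cdot> gh \<oplus> j1 \<cdot> (i \<cdot> be'), al \<cdot> (p' \<cdot> p1) \<oplus> lam \<cdot> q1) \<in> Conf E" (is "(?k, ?q) \<in> _")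
proof -
  note [simp] = conf_simps[OF c] conf_simps[OF c'] lam(1-3) g biproduct_simps[OF B]
  have [simp]: "al \<in> Arr E" "be \<in> Arr E" "Dom E be = Cod E al" "Dom E al = Cod E p'" "Cod E be = Cod E p" and
    ba: "be \<cdot> al = Zero E (Cod E p') (Cod E p)" using conf_simps[OF ab] t by simp_all
  note SQ = pullback_squareD[OF sq]
  have [simp]: "gh \<in> Arr E" "be' \<in> Arr E" "Dom E gh = Dom E be'" "Cod E gh = Cod E i'" "Cod E be' = Dom E i"
    using SQ by simp_all
  have sq9: "p' \<cdot> gh = Neg E (g \<cdot> be')" using SQ(9) by simp
  obtain D i2 j2 p2 q2 where B2: "is_biproduct E (Cod E p') (Cod E i) D i2 j2 p2 q2"
    using ex_biproduct[of "Cod E p'" "Cod E i"] by auto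
  note [simp] = biproduct_simps[OF B2]
  let ?u = "al \<cdot> p2 \<oplus> lam \<cdot> q2" and ?e = "i2 \<cdot> (p' \<cdot> p1) \<oplus> j2 \<cdot> q1"
  have bl: "be \<cdot> (lam \<cdot> f) = p \<cdot> f" if "f \<in> Arr E" "Cod E f = Cod E i" for f
    using comp_reduce[OF lam(4), of f] that by simp
  have baf: "be \<cdot> (al \<cdot> f) = Zero E (Dom E f) (Cod E p)" if "f \<in> Arr E" "Cod E f = Cod E p'" for f
    using comp_reduce[OF ba, of f] that by simp
  have "pullback_square p be q2 ?u" unfolding pullback_square_def
  proof (intro conjI allI impI)
    fix a b assume a [simp]: "a \<in> Arr E" "b \<in> Arr E" "Dom E a = Dom E b" "Cod E a = Dom E p" "Cod E b = Dom E be"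
      and e: "p \<cdot> a = be \<cdot> b"
    have "be \<cdot> (b \<oplus> Neg E (lam \<cdot> a)) = Zero E (Dom E (b \<oplus> Neg E (lam \<cdot> a))) (Cod E be)"
      using e by (simp add: bl)
    then obtain y where y [simp]: "y \<in> Arr E" "Dom E y = Dom E b" "Cod E y = Cod E p'" and ay: "al \<cdot> y = b \<oplus> Neg E (lam \<cdot> a)"
      using conf_lift[OF ab, of "b \<oplus> Neg E (lam \<cdot> a)"] by auto
    show "\<exists>h. h \<in> Arr E \<and> Dom E h = Dom E a \<and> Cod E h = Dom E q2 \<and> q2 \<cdot> h = a \<and> ?u \<cdot> h = b"
      by (rule exI[of _ "i2 \<cdot> y \<oplus> j2 \<cdot> a"]) (simp add: ay)
  next
    fix h k assume h [simp]: "h \<in> Arr E" "k \<in> Arr E" "Dom E h = Dom E k" "Cod E h = Dom E q2" "Cod E k = Dom E q2"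
      and e: "q2 \<cdot> h = q2 \<cdot> k" "?u \<cdot> h = ?u \<cdot> k"
    have "lam \<cdot> (q2 \<cdot> k) \<oplus> al \<cdot> (p2 \<cdot> h) = lam \<cdot> (q2 \<cdot> k) \<oplus> al \<cdot> (p2 \<cdot> k)"
      using e add_commute[of "lam \<cdot> (q2 \<cdot> k)"] by simp
    hence "al \<cdot> (p2 \<cdot> h) = al \<cdot> (p2 \<cdot> k)" by (rule add_left_cancel) simp_all
    hence "p2 \<cdot> h = p2 \<cdot> k" by (rule_tac conf_mono[OF ab]) simp_all
    thus "h = k" using e(1) by (rule_tac biproduct_eq_in[OF B2]) simp_all
  qed (simp_all add: bl baf)
  hence du: "deflation E ?u" by (rule deflation_of_pullback[OF c])
  have "pullback_square p' p2 p1 ?e" unfolding pullback_square_def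
  proof (intro conjI allI impI)
    fix a b assume a [simp]: "a \<in> Arr E" "b \<in> Arr E" "Dom E a = Dom E b" "Cod E a = Dom E p'" "Cod E b = Dom E p2"
      and e: "p' \<cdot> a = p2 \<cdot> b"
    show "\<exists>h. h \<in> Arr E \<and> Dom E h = Dom E a \<and> Cod E h = Dom E p1 \<and> p1 \<cdot> h = a \<and> ?e \<cdot> h = b"
      using e biproduct_sum(2)[OF B2, of b] by (intro exI[of _ "i1 \<cdot> a \<oplus> j1 \<cdot> (q2 \<cdot> b)"]) simp
  next
    fix h k assume h [simp]: "h \<in> Arr E" "k \<in> Arr E" "Dom E h = Dom E k" "Cod E h = Dom E p1" "Cod E k = Dom E p1"
      and e: "p1 \<cdot> h = p1 \<cdot> k" "?e \<cdot> h = ?e \<cdot> k"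
    have "q2 \<cdot> (?e \<cdot> h) = q2 \<cdot> (?e \<cdot> k)" using e(2) by simp
    hence "q1 \<cdot> h = q1 \<cdot> k" by simp
    thus "h = k" using e(1) by (rule_tac biproduct_eq_in[OF B]) simp_all
  qed simp_all
  hence de: "deflation E ?e" by (rule deflation_of_pullback[OF c'])
  have "deflation E (?u \<cdot> ?e)" by (rule deflation_comp[OF de du]) simp
  then obtain k' where k': "(k', ?q) \<in> Conf E" unfolding deflation_def by auto
  have [simp]: "k' \<in> Arr E" "Cod E k' = S" using conf_simps[OF k'] by simp_all
  have qk: "al \<cdot> (p' \<cdot> (p1 \<cdot> k')) \<oplus> lam \<cdot> (q1 \<cdot> k') = Zero E (Dom E k') (Cod E al)" using conf_simps(4)[OF k'] by simp
  show ?thesis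
  proof (rule conf_of_kernel[OF k'])
    have "al \<cdot> (p' \<cdot> gh) \<oplus> lam \<cdot> (i \<cdot> be') = Zero E (Dom E be') (Cod E al)"
      using sq9 comp_reduce[OF lam(5), of be'] by simp
    thus "?q \<cdot> ?k = Zero E (Dom E ?k) (Cod E ?q)" by simp
    have "be \<cdot> (al \<cdot> (p' \<cdot> (p1 \<cdot> k')) \<oplus> lam \<cdot> (q1 \<cdot> k')) = p \<cdot> (q1 \<cdot> k')" by (simp add: bl baf)
    hence "p \<cdot> (q1 \<cdot> k') = Zero E (Dom E (q1 \<cdot> k')) (Cod E p)" unfolding qk by simp
    then obtain x where x [simp]: "x \<in> Arr E" "Dom E x = Dom E k'" "Cod E x = Dom E i" and ix: "i \<cdot> x = q1 \<cdot> k'"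
      using conf_lift[OF c, of "q1 \<cdot> k'"] by auto
    have "al \<cdot> (p' \<cdot> (p1 \<cdot> k')) \<oplus> al \<cdot> (g \<cdot> x) = Zero E (Dom E k') (Cod E al)"
      using qk comp_reduce[OF lam(5), of x] ix by simp
    hence "al \<cdot> (p' \<cdot> (p1 \<cdot> k')) = Neg E (al \<cdot> (g \<cdot> x))" by (rule add_eq_zero(1)) simp_all
    hence "al \<cdot> (p' \<cdot> (p1 \<cdot> k')) = al \<cdot> (Neg E g \<cdot> x)" by simp
    hence "p' \<cdot> (p1 \<cdot> k') = Neg E g \<cdot> x" by (rule_tac conf_mono[OF ab]) simp_all
    then obtain h where h [simp]: "h \<in> Arr E" "Dom E h = Dom E k'" "Cod E h = Dom E be'" and he: "gh \<cdot> h = p1 \<cdot> k'" "be' \<cdot> h = x"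
      using pullback_lift[OF sq, of "p1 \<cdot> k'" x] by auto
    have "?k \<cdot> h = k'" using biproduct_sum(2)[OF B, of k'] he ix by simp
    thus "\<exists>h. h \<in> Arr E \<and> Dom E h = Dom E k' \<and> Cod E h = Dom E ?k \<and> ?k \<cdot> h = k'"
      by (intro exI[of _ h]) simp
  next
    fix f h assume f [simp]: "f \<in> Arr E" "h \<in> Arr E" "Dom E f = Dom E h" "Cod E f = Dom E ?k" "Cod E h = Dom E ?k"
      and e: "?k \<cdot> f = ?k \<cdot> h"
    have f' [simp]: "Cod E f = Dom E be'" "Cod E h = Dom E be'" using f(4,5) by simp_all
    have "p1 \<cdot> (?k \<cdot> f) = p1 \<cdot> (?k \<cdot> h)" "q1 \<cdot> (?k \<cdot> f) = q1 \<cdot> (?k \<cdot> h)" using e by simp_all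
    hence e1: "gh \<cdot> f = gh \<cdot> h" and e2: "i \<cdot> (be' \<cdot> f) = i \<cdot> (be' \<cdot> h)" by simp_all
    have "be' \<cdot> f = be' \<cdot> h" using e2 by (rule_tac conf_mono[OF c]) simp_all
    thus "f = h" using e1 by (rule_tac pullback_mono[OF sq]) simp_all
  qed simp_all
qed

end

section \<open>The resolution of the middle term of an extension\<close>

context model_subcategory
begin

context
  fixes n r s A B al be lam gh S i1 j1 p1 q1
  assumes r: "is_res n r" and s: "is_res n s" and AB: "is_lift (tail r) s A B"
    and ab: "\<And>k. (al k, be k) \<in> Conf E" "\<And>k. Dom E (al k) = rx s k" "\<And>k. Cod E (be k) = rx r k"
    and lam: "\<And>k. lam k \<in> Arr E" "\<And>k. Dom E (lam k) = rm r k" "\<And>k. Cod E (lam k) = Cod E (al k)"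
      "\<And>k. be k \<star> lam k = rp r k" "\<And>k. lam k \<star> ri r k = al k \<star> A k"
    and gh: "\<And>k. E.pullback_square (rp s k) (Neg E (A k)) (gh k) (be (Suc k))"
      "\<And>k. gh k \<star> al (Suc k) = ri s k" "\<And>k. gh k \<star> lam (Suc k) = Neg E (B k)"
    and bi: "\<And>k. is_biproduct E (rm s k) (rm r k) (S k) (i1 k) (j1 k) (p1 k) (q1 k)"
begin

text \<open>Level k has a conflation x_s(k) -> z(k) -> x_r(k). The object z(k) is covered by the
  biproduct of the middle terms of \<open>s\<close> and \<open>r\<close>, and the kernel of this
  cover is z(k+1), with \<open>gh k\<close> and the composite of \<open>ri r k\<close> and
  \<open>be (Suc k)\<close> as the two components of its inclusion.\<close>

definition "horseshoe = \<lparr>rx = (\<lambda>k. Cod E (al k)), ri = (\<lambda>k. i1 k \<star> gh k \<oplus>\<^bsub>E\<^esub> j1 k \<star> (ri r k \<star> be (Suc k))),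
  rp = (\<lambda>k. al k \<star> (rp s k \<star> p1 k) \<oplus>\<^bsub>E\<^esub> lam k \<star> q1 k), ro = (\<lambda>k. Fo (S k)), rt = (\<lambda>k. Id T (Fo (S k)))\<rparr>"

lemma horseshoe_sel:
  "rx horseshoe k = Cod E (al k)" "ri horseshoe k = i1 k \<star> gh k \<oplus>\<^bsub>E\<^esub> j1 k \<star> (ri r k \<star> be (Suc k))"
  "rp horseshoe k = al k \<star> (rp s k \<star> p1 k) \<oplus>\<^bsub>E\<^esub> lam k \<star> q1 k" "ro horseshoe k = Fo (S k)"
  "rt horseshoe k = Id T (Fo (S k))"
  by (simp_all add: horseshoe_def)

lemma horseshoe_data:
  "al k \<in> Arr E" "be k \<in> Arr E" "Dom E (be k) = Cod E (al k)" "be k \<star> al k = Zero E (rx s k) (rx r k)"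
  "A k \<in> Arr E" "Dom E (A k) = rx r (Suc k)" "Cod E (A k) = rx s k"
  "B k \<in> Arr E" "Dom E (B k) = rm r (Suc k)" "Cod E (B k) = rm s k"
  "gh k \<in> Arr E" "Dom E (gh k) = Cod E (al (Suc k))" "Cod E (gh k) = rm s k"
  using E.conf_simps[OF ab(1)[of k]] E.conf_simps[OF ab(1)[of "Suc k"]] ab(2,3) is_liftD(1-6)[OF AB] tail_rm[OF r]
    E.pullback_squareD[OF gh(1)] is_resD[OF s] by simp_all

lemma horseshoe_reduce:
  assumes "f \<in> Arr E"
  shows "Cod E f = rx s k \<Longrightarrow> be k \<star> (al k \<star> f) = Zero E (Dom E f) (rx r k)"
    "Cod E f = rm r k \<Longrightarrow> be k \<star> (lam k \<star> f) = rp r k \<star> f"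
    "Cod E f = rx s (Suc k) \<Longrightarrow> gh k \<star> (al (Suc k) \<star> f) = ri s k \<star> f"
    "Cod E f = rm r (Suc k) \<Longrightarrow> gh k \<star> (lam (Suc k) \<star> f) = Neg E (B k \<star> f)"
  using assms horseshoe_data lam(1-3) ab(2,3) is_resD[OF r] is_resD[OF s] E.comp_reduce[OF horseshoe_data(4)[of k], of f]
    E.comp_reduce[OF lam(4)[of k], of f] E.comp_reduce[OF gh(2)[of k], of f] E.comp_reduce[OF gh(3)[of k], of f]
  by simp_all

lemma horseshoe_rm: "rm horseshoe k = S k"
  using horseshoe_data ab(3) by (simp add: rm_def[of horseshoe] horseshoe_sel is_resD[OF r] E.biproduct_simps[OF bi])

lemma horseshoe_res: "is_res n horseshoe"
  unfolding is_res_def horseshoe_rm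
proof (intro allI conjI impI)
  fix k
  note [simp] = is_resD[OF r] is_resD[OF s] horseshoe_data horseshoe_sel lam(1-3) ab E.biproduct_simps[OF bi]
  show "(ri horseshoe k, rp horseshoe k) \<in> Conf E" unfolding horseshoe_sel
    by (rule E.horseshoe_step[OF is_resD(1)[OF r] is_resD(1)[OF s] ab(1) _ _ lam(1) _ _ _ lam(5) _ _ _ gh(1)])
      (use lam(4) bi in simp_all)
  show "Cod E (rp horseshoe k) = rx horseshoe k" "Dom E (ri horseshoe k) = rx horseshoe (Suc k)"
    "is_iso T (rt horseshoe k)" "Dom T (rt horseshoe k) = ro horseshoe k" "Cod T (rt horseshoe k) = Fo (S k)" by simp_all
  have "Fo (S k) \<in> M" using M_sub Phi.F_biproduct[OF bi[of k]] is_resD(17)[OF r] is_resD(17)[OF s]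
    unfolding additive_subcategory_def by blast
  thus "ro horseshoe k \<in> M" by simp
next
  fix k assume k: "n < k"
  note [simp] = is_resD[OF r] is_resD[OF s] horseshoe_data horseshoe_sel ab
  have "is_zero T (Cod T (Fm (al k)))"
    by (rule T.tri_zero_middle[OF delta_tri[OF ab(1)]]) (use is_res_zero[OF r k] is_res_zero[OF s k] in simp_all)
  thus "is_zero T (Fo (rx horseshoe k))" by simp
next
  fix k f assume f [simp]: "f \<in> Arr T" and fM: "Dom T f \<in> M" and fc: "Cod T f = Fo (rx horseshoe k)"
  note [simp] = is_resD[OF r] is_resD[OF s] horseshoe_data horseshoe_sel lam(1-3) ab E.biproduct_simps[OF bi]
  have [simp]: "Cod T f = Fo (Cod E (al k))" using fc by simp
  \<comment> \<open>To lift \<open>f\<close> from M, first lift its image under \<open>be k\<close>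
    in \<open>r\<close>. What remains of \<open>f\<close> after subtracting \<open>lam k\<close> of
    that lift comes from the object resolved by \<open>s\<close> and is lifted there.\<close>
  obtain g where g: "g \<in> Arr T" "Dom T g = Dom T (Fm (be k) \<bullet> f)" "Cod T g = Fo (rm r k)" "Fm (rp r k) \<bullet> g = Fm (be k) \<bullet> f"
    by (rule is_res_approx[OF r, of "Fm (be k) \<bullet> f" k]) (use fM in simp_all)
  have [simp]: "g \<in> Arr T" "Dom T g = Dom T f" "Cod T g = Fo (rm r k)" using g by simp_all
  have bl: "Fm (be k) \<bullet> Fm (lam k) = Fm (rp r k)" by (subst Phi.F_comp[symmetric]) (simp_all add: lam(4))
  have "Fm (be k) \<bullet> (f \<oplus>\<^bsub>T\<^esub> Neg T (Fm (lam k) \<bullet> g)) = Zero T (Dom T (f \<oplus>\<^bsub>T\<^esub> Neg T (Fm (lam k) \<bullet> g))) (Cod T (Fm (be k)))"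
    using g(4) T.comp_reduce[OF bl, of g] by simp
  then obtain h where h [simp]: "h \<in> Arr T" "Dom T h = Dom T f" "Cod T h = Fo (rx s k)" and ah: "Fm (al k) \<bullet> h = f \<oplus>\<^bsub>T\<^esub> Neg T (Fm (lam k) \<bullet> g)"
    using T.tri_exact_Y[OF delta_tri[OF ab(1)[of k]], of "f \<oplus>\<^bsub>T\<^esub> Neg T (Fm (lam k) \<bullet> g)"] by auto
  obtain h' where h': "h' \<in> Arr T" "Dom T h' = Dom T h" "Cod T h' = Fo (rm s k)" "Fm (rp s k) \<bullet> h' = h"
    by (rule is_res_approx[OF s, of h k]) (use fM in simp_all)
  have [simp]: "h' \<in> Arr T" "Dom T h' = Dom T f" "Cod T h' = Fo (rm s k)" using h' by simp_all
  note F = T.biproduct_simps[OF Phi.F_biproduct[OF bi[of k]]]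
  have "Fm (rp horseshoe k) \<bullet> (Fm (i1 k) \<bullet> h' \<oplus>\<^bsub>T\<^esub> Fm (j1 k) \<bullet> g) = f"
    using ah F(20-23)[of h'] F(20-23)[of g] h'(4) by simp
  thus "\<exists>g. g \<in> Arr T \<and> Dom T g = Dom T f \<and> Cod T g = Fo (S k) \<and> Fm (rp horseshoe k) \<bullet> g = f"
    by (intro exI[of _ "Fm (i1 k) \<bullet> h' \<oplus>\<^bsub>T\<^esub> Fm (j1 k) \<bullet> g"]) simp
qed

lemma horseshoe_lift: "is_lift s horseshoe al i1" "is_lift horseshoe r be q1"
proof -
  note [simp] = is_resD[OF r] is_resD[OF s] horseshoe_data horseshoe_sel lam(1-3) ab E.biproduct_simps[OF bi]
    horseshoe_rm horseshoe_reduce gh(2)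
  show "is_lift s horseshoe al i1" "is_lift horseshoe r be q1" unfolding is_lift_def by simp_all
qed

text \<open>The off-diagonal entry stems from the composite of \<open>gh\<close> and
  \<open>lam\<close>, which is -B. Its sign matches the convention for split extensions, so their
  connecting map is the one induced by \<open>B\<close>.\<close>

lemma horseshoe_rd: "rd horseshoe k = Fm (i1 k) \<bullet> (Fm (ri s k) \<bullet> (Fm (rp s (Suc k)) \<bullet> Fm (p1 (Suc k)))) \<oplus>\<^bsub>T\<^esub>
  (Neg T (Fm (i1 k) \<bullet> (Fm (B k) \<bullet> Fm (q1 (Suc k)))) \<oplus>\<^bsub>T\<^esub> Fm (j1 k) \<bullet> (Fm (ri r k) \<bullet> (Fm (rp r (Suc k)) \<bullet> Fm (q1 (Suc k)))))"
proof -
  note [simp] = is_resD[OF r] is_resD[OF s] horseshoe_data lam(1-3) ab E.biproduct_simps[OF bi]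
    horseshoe_rm horseshoe_reduce gh(2)
  have "ri horseshoe k \<star> rp horseshoe (Suc k) = i1 k \<star> (ri s k \<star> (rp s (Suc k) \<star> p1 (Suc k))) \<oplus>\<^bsub>E\<^esub>
    (Neg E (i1 k \<star> (B k \<star> q1 (Suc k))) \<oplus>\<^bsub>E\<^esub> j1 k \<star> (ri r k \<star> (rp r (Suc k) \<star> q1 (Suc k))))"
    unfolding horseshoe_sel by (simp add: E.add_ac)
  thus ?thesis unfolding rd_def horseshoe_sel(4,5) by simp
qed

lemma horseshoe_tri:
  assumes g: "connects r s w (Fm (A 0))"
  shows "(Lam s horseshoe (Fm (al 0)), Lam horseshoe r (Fm (be 0)), Omega r s w) \<in> Tri (Kb CC)"
proof -
  note t = horseshoe_res and tr = tail_res[OF r]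
  note [simp] = is_resD[OF r] is_resD[OF s] horseshoe_data(5-10) E.biproduct_simps[OF bi] 
  let ?c = "cmp (tail r) s B" and ?a = "cmp s horseshoe i1" and ?b = "cmp horseshoe r q1"
  have c [simp]: "?c k \<in> Arr T" "Dom T (?c k) = ro r (Suc k)" "Cod T (?c k) = ro s k" for k
    using cmp_simps[OF tr s AB] by simp_all
  have tM: "Fo (S k) \<in> M" for k using is_resD(12)[OF t] by (simp add: horseshoe_sel)
  have a: "?a k = Fm (i1 k) \<bullet> rt s k" "?b k = T.Inv (rt r k) \<bullet> Fm (q1 k)" for k
    by (simp_all add: cmp_def horseshoe_sel)
  have "is_biproduct CC (ro s k) (ro r k) (Fo (S k)) (Fm (i1 k) \<bullet> rt s k) (Fm (j1 k) \<bullet> rt r k)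
     (T.Inv (rt s k) \<bullet> Fm (p1 k)) (T.Inv (rt r k) \<bullet> Fm (q1 k))" for k
    unfolding full_subcat_biproduct is_biproduct_def
    using T.biproduct_simps[OF Phi.F_biproduct[OF bi[of k]]] T.biproduct_sum[OF Phi.F_biproduct[OF bi[of k]]] tM[of k] by simp
  moreover have "rd horseshoe k = (Fm (i1 k) \<bullet> rt s k) \<cdot>\<^bsub>CC\<^esub> (rd s k \<cdot>\<^bsub>CC\<^esub> (T.Inv (rt s (Suc k)) \<bullet> Fm (p1 (Suc k)))) \<oplus>\<^bsub>CC\<^esub>
      (Neg CC ((Fm (i1 k) \<bullet> rt s k) \<cdot>\<^bsub>CC\<^esub> (?c k \<cdot>\<^bsub>CC\<^esub> (T.Inv (rt r (Suc k)) \<bullet> Fm (q1 (Suc k))))) \<oplus>\<^bsub>CC\<^esub>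
       (Fm (j1 k) \<bullet> rt r k) \<cdot>\<^bsub>CC\<^esub> (rd r k \<cdot>\<^bsub>CC\<^esub> (T.Inv (rt r (Suc k)) \<bullet> Fm (q1 (Suc k)))))" for k
    unfolding horseshoe_rd using tM[of k] tM[of "Suc k"] by (simp add: rd_def cmp_def)
  ultimately have "(hcls CC (km.nmap (km.ncx (ro s) (rd s)) (km.ncx (\<lambda>k. Fo (S k)) (rd horseshoe)) (\<lambda>k. Fm (i1 k) \<bullet> rt s k)),
      hcls CC (km.nmap (km.ncx (\<lambda>k. Fo (S k)) (rd horseshoe)) (km.ncx (ro r) (rd r)) (\<lambda>k. T.Inv (rt r k) \<bullet> Fm (q1 k))),
      hcls CC (km.omap (km.ncx (ro r) (rd r)) (km.ncx (ro s) (rd s)) ?c)) \<in> Tri (Kb CC)"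
    using Om_rep(2)[OF r s AB refl, unfolded Cx_def]
    by (intro km.ncx_split_ext[OF res_complex[OF s] res_complex[OF r]]) simp_all
  moreover have "Cx horseshoe = km.ncx (\<lambda>k. Fo (S k)) (rd horseshoe)"
    unfolding Cx_def by (intro arg_cong2[of _ _ _ _ km.ncx] ext) (simp_all add: horseshoe_sel)
  moreover have "?a = (\<lambda>k. Fm (i1 k) \<bullet> rt s k)" "?b = (\<lambda>k. T.Inv (rt r k) \<bullet> Fm (q1 k))" using a by auto
  ultimately show ?thesis
    unfolding Omega_eq[OF r s g] Om_rep(1)[OF r s AB refl] Lam_eq[OF s t horseshoe_lift(1) refl]
      Lam_eq[OF t r horseshoe_lift(2) refl] Nm_def by (simp add: Cx_def)
qed

end

lemma horseshoe_data_ex: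
  assumes r: "is_res n r" and s: "is_res n s" and AB: "is_lift (tail r) s A B"
  shows "\<exists>al be lam gh. (al, be) \<in> Conf E \<and> Dom E al = rx s k \<and> Cod E be = rx r k \<and> lam \<in> Arr E \<and> Dom E lam = rm r k \<and>
    Cod E lam = Cod E al \<and> be \<star> lam = rp r k \<and> lam \<star> ri r k = al \<star> A k \<and>
    (\<forall>j. k = Suc j \<longrightarrow> E.pullback_square (rp s j) (Neg E (A j)) gh be \<and> gh \<star> al = ri s j \<and> gh \<star> lam = Neg E (B j))"
proof -
  note [simp] = is_resD[OF r] is_resD[OF s]
  have AB' [simp]: "A k \<in> Arr E" "Dom E (A k) = rx r (Suc k)" "Cod E (A k) = rx s k"
    "B k \<in> Arr E" "Dom E (B k) = rm r (Suc k)" "Cod E (B k) = rm s k" for k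
    using is_liftD(1-6)[OF AB] tail_rm[OF r] by simp_all
  show ?thesis
  proof (cases k)
    case 0
    obtain al be lam where "(al, be) \<in> Conf E" "Dom E al = Cod E (A 0)" "Cod E be = Cod E (rp r 0)" "lam \<in> Arr E"
      "Dom E lam = Cod E (ri r 0)" "Cod E lam = Cod E al" "be \<star> lam = rp r 0" "lam \<star> ri r 0 = al \<star> A 0"
      by (rule E.pushout_conf[OF is_resD(1)[OF r, of 0], of "A 0"]) simp_all
    thus ?thesis unfolding 0 by (intro exI[of _ al] exI[of _ be] exI[of _ lam]) simp
  next
    case (Suc j)
    obtain al be gh where c: "(al, be) \<in> Conf E" and sq: "E.pullback_square (rp s j) (Neg E (A j)) gh be" and
      d: "Dom E al = Dom E (ri s j)" "Cod E al = Dom E be" "gh \<star> al = ri s j"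
      by (rule E.pullback_ex[OF is_resD(1)[OF s, of j], of "Neg E (A j)"]) simp_all
    note SQ = E.pullback_squareD[OF sq]
    have [simp]: "al \<in> Arr E" "be \<in> Arr E" "Dom E al = rx s (Suc j)" "Cod E be = rx r (Suc j)" "Cod E al = Dom E be"
      "gh \<in> Arr E" "Dom E gh = Dom E be" "Cod E gh = rm s j" and ba: "be \<star> al = Zero E (rx s (Suc j)) (rx r (Suc j))"
      using E.conf_simps[OF c] d SQ by simp_all
    have "rp s j \<star> Neg E (B j) = Neg E (A j) \<star> rp r (Suc j)" using is_liftD(7)[OF AB, of j] by simp
    then obtain lam where lam [simp]: "lam \<in> Arr E" "Dom E lam = rm r (Suc j)" "Cod E lam = Dom E be"
      and gl: "gh \<star> lam = Neg E (B j)" "be \<star> lam = rp r (Suc j)"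
      using E.pullback_lift[OF sq, of "Neg E (B j)" "rp r (Suc j)"] by auto
    have "lam \<star> ri r (Suc j) = al \<star> A (Suc j)"
    proof (rule E.pullback_mono[OF sq])
      have "Neg E (B j \<star> ri r (Suc j)) = ri s j \<star> A (Suc j)" using is_liftD(8)[OF AB, of j] by simp
      thus "gh \<star> (lam \<star> ri r (Suc j)) = gh \<star> (al \<star> A (Suc j))"
        using E.comp_reduce[OF gl(1), of "ri r (Suc j)"] E.comp_reduce[OF d(3), of "A (Suc j)"] by simp
      show "be \<star> (lam \<star> ri r (Suc j)) = be \<star> (al \<star> A (Suc j))"
        using E.comp_reduce[OF gl(2), of "ri r (Suc j)"] E.comp_reduce[OF ba, of "A (Suc j)"] by simp
    qed simp_all
    thus ?thesis unfolding Suc using c sq d(3) gl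
      by (intro exI[of _ al] exI[of _ be] exI[of _ lam] exI[of _ gh]) simp
  qed
qed

theorem horseshoe_ex:
  assumes r: "is_res n r" and s: "is_res n s" and w: "kills r s w"
  obtains t al be where "is_res n t" "(al, be) \<in> Conf E" "Dom E al = rx s 0" "Cod E be = rx r 0" "Cod E al = rx t 0"
    "\<delta> al be = w" "(Lam s t (Fm al), Lam t r (Fm be), Omega r s w) \<in> Tri (Kb CC)"
proof -
  note [simp] = is_resD[OF r] is_resD[OF s]
  obtain g where g: "connects r s w g" by (rule connects_ex[OF r s w])
  have g' [simp]: "g \<in> Arr T" "Dom T g = Fo (rx r (Suc 0))" "Cod T g = Fo (rx s 0)" and gw: "Sm g \<bullet> dl r = w"
    using g unfolding connects_def by auto
  obtain A B where AB: "is_lift (tail r) s A B" and A0: "Fm (A 0) = g"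
    and "Lam (tail r) s g = H (Nm (tail r) s B)"
    by (rule Lam_obtain[OF tail_res[OF r] s, of g]) simp_all
  have A' [simp]: "A k \<in> Arr E" "Dom E (A k) = rx r (Suc k)" "Cod E (A k) = rx s k" for k
    using is_liftD(1-3)[OF AB] by simp_all
  obtain al be lam gh where d: "\<And>k. (al k, be k) \<in> Conf E \<and> Dom E (al k) = rx s k \<and> Cod E (be k) = rx r k \<and>
    lam k \<in> Arr E \<and> Dom E (lam k) = rm r k \<and> Cod E (lam k) = Cod E (al k) \<and> be k \<star> lam k = rp r k \<and> lam k \<star> ri r k = al k \<star> A k \<and>
    (\<forall>j. k = Suc j \<longrightarrow> E.pullback_square (rp s j) (Neg E (A j)) (gh k) (be k) \<and> gh k \<star> al k = ri s j \<and> gh k \<star> lam k = Neg E (B j))"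
    using horseshoe_data_ex[OF r s AB] by metis
  have "\<forall>k. \<exists>S i1 j1 p1 q1. is_biproduct E (rm s k) (rm r k) S i1 j1 p1 q1" by (auto intro!: E.ex_biproduct)
  then obtain S i1 j1 p1 q1 where bi: "\<And>k. is_biproduct E (rm s k) (rm r k) (S k) (i1 k) (j1 k) (p1 k) (q1 k)" by metis
  have D: "\<And>k. (al k, be k) \<in> Conf E" "\<And>k. Dom E (al k) = rx s k" "\<And>k. Cod E (be k) = rx r k"
      "\<And>k. lam k \<in> Arr E" "\<And>k. Dom E (lam k) = rm r k" "\<And>k. Cod E (lam k) = Cod E (al k)"
      "\<And>k. be k \<star> lam k = rp r k" "\<And>k. lam k \<star> ri r k = al k \<star> A k"
      "\<And>k. E.pullback_square (rp s k) (Neg E (A k)) (gh (Suc k)) (be (Suc k))"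
      "\<And>k. gh (Suc k) \<star> al (Suc k) = ri s k" "\<And>k. gh (Suc k) \<star> lam (Suc k) = Neg E (B k)"
    using d by blast+
  \<comment> \<open>The map \<open>gh\<close> obtained at level k + 1 goes to the middle term of
    \<open>s\<close> at level k, hence the shift of its index.\<close>
  let ?t = "horseshoe r s al be lam (\<lambda>k. gh (Suc k)) S i1 j1 p1 q1"
  note ctx = r s AB D bi
  \<comment> \<open>The map \<open>lam 0\<close> is a morphism from the first conflation of
    \<open>r\<close> to the pushout conflation; naturality of \<delta> identifies the connecting
    morphism of the latter with \<open>w\<close>.\<close>
  have "Sm (Fm (A 0)) \<bullet> \<delta> (ri r 0) (rp r 0) = \<delta> (al 0) (be 0) \<bullet> Fm (Id E (rx r 0))"
    by (rule delta_natural[OF is_resD(1)[OF r] D(1), of _ _ _ "lam 0"])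
      (use D(2-8)[of 0] E.conf_simps[OF D(1)[of 0]] in simp_all)
  hence "\<delta> (al 0) (be 0) = w" using gw A0 delta_simps[OF D(1)[of 0]] D(3) by (simp add: dl_def)
  moreover have "connects r s w (Fm (A 0))" using g A0 by simp
  ultimately show thesis
    by (intro that[OF horseshoe_res[OF ctx] D(1) D(2) D(3)])
      (use horseshoe_tri[OF ctx] horseshoe_sel(1)[OF ctx, of 0] in simp_all)
qed

end

section \<open>The categories pr\<close>

context triangulated_category
begin

lemma starI: "(u, v, w) \<in> Tri T \<Longrightarrow> Dom T u \<in> A \<Longrightarrow> Cod T v \<in> B \<Longrightarrow> Cod T u \<in> star T A B"
  unfolding star_def using obj_simps(2)[OF tri_simps(1)] by blast

lemma starE:
  assumes "Z \<in> star T A B"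
  obtains u v w where "(u, v, w) \<in> Tri T" "Dom T u \<in> A" "Cod T u = Z" "Cod T v \<in> B"
  using assms unfolding star_def by blast

lemma shift_subcat_1: "Y \<in> shift_subcat T 1 A \<longleftrightarrow> Y \<in> Obj T \<and> (\<exists>X \<in> A. isomorphic T Y (So X))"
  unfolding shift_subcat_def by simp

lemma shift_subcat_Suc: "Y \<in> shift_subcat T (Suc k) A \<longleftrightarrow> Y \<in> Obj T \<and> (\<exists>X \<in> A. isomorphic T Y (So ((So ^^ k) X)))"
  unfolding shift_subcat_def by simp

lemma funpow_shift_obj [simp]: "X \<in> Obj T \<Longrightarrow> (So ^^ k) X \<in> Obj T"
  by (induction k) simp_all

lemma funpow_shift_mem: "X \<in> A \<Longrightarrow> X \<in> Obj T \<Longrightarrow> (So ^^ k) X \<in> shift_subcat T k A"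
  unfolding shift_subcat_def using isomorphic_refl[of "(So ^^ k) X"] by (intro CollectI conjI bexI[of _ X]) simp_all

lemma tri_zero_iso_snd:
  assumes t: "(u, v, w) \<in> Tri T" and z: "is_zero T (Dom T u)"
  shows "is_iso T v"
proof -
  note [simp] = tri_simps[OF t]
  have "w \<cdot> Id T (Cod T v) = Zero T (Dom T (Id T (Cod T v))) (So (Dom T u))"
    using to_zero[OF S.F_is_zero[OF z], of w "Cod T v"] by simp
  then obtain g where g [simp]: "g \<in> Arr T" "Dom T g = Cod T v" "Cod T g = Cod T u" and vg: "v \<cdot> g = Id T (Cod T v)"
    using tri_exact_Z[OF t, of "Id T (Cod T v)"] by auto
  have "v \<cdot> (g \<cdot> v \<oplus> Neg T (Id T (Cod T u))) = Zero T (Dom T (g \<cdot> v \<oplus> Neg T (Id T (Cod T u)))) (Cod T v)"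
    using comp_reduce[OF vg, of v] by simp
  then obtain h where h: "h \<in> Arr T" "Dom T h = Cod T u" "Cod T h = Dom T u" "u \<cdot> h = g \<cdot> v \<oplus> Neg T (Id T (Cod T u))"
    using tri_exact_Y[OF t, of "g \<cdot> v \<oplus> Neg T (Id T (Cod T u))"] by auto
  have "h = Zero T (Cod T u) (Dom T u)" using to_zero[OF z, of h] h by simp
  hence "g \<cdot> v = Id T (Cod T u)" using h(4) z by (rule_tac diff_zero) simp_all
  thus ?thesis using vg by (rule_tac is_isoI[of v g]) simp_all
qed

lemma tri_iso_end:
  assumes t: "(u, v, w) \<in> Tri T" and e: "is_iso T e" "Dom T e = Cod T v"
  shows "(u, e \<cdot> v, w \<cdot> Inv e) \<in> Tri T"
  by (rule tri_isoI[OF t, of "Id T (Dom T u)" "Id T (Cod T u)" e]) (use tri_simps[OF t] e in simp_all)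

lemma tri_iso_middle:
  assumes t: "(u, v, w) \<in> Tri T" and e: "is_iso T e" "Dom T e = Cod T u"
  shows "(e \<cdot> u, v \<cdot> Inv e, w) \<in> Tri T"
  by (rule tri_isoI[OF t, of "Id T (Dom T u)" e "Id T (Cod T v)"]) (use tri_simps[OF t] e in simp_all)

lemma star_iso:
  assumes Z: "Z \<in> star T A B" and i: "isomorphic T Z Z'"
  shows "Z' \<in> star T A B"
proof -
  obtain u v w where t: "(u, v, w) \<in> Tri T" and uv: "Dom T u \<in> A" "Cod T u = Z" "Cod T v \<in> B" by (rule starE[OF Z])
  obtain e where e: "is_iso T e" "Dom T e = Z" "Cod T e = Z'" by (rule isomorphicE[OF i])
  have "Cod T (e \<cdot> u) \<in> star T A B"
    by (rule starI[OF tri_iso_middle[OF t e(1)]]) (use e uv tri_simps[OF t] in simp_all)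
  thus ?thesis using e uv tri_simps[OF t] by simp
qed

text \<open>Objects and morphisms of the triangle are desuspended one by one. The third morphism is
  negated to match the sign that suspending a triangle introduces.\<close>

lemma star_shift:
  assumes K: "K \<in> star T (shift_subcat T 1 A) (shift_subcat T 1 B)" and AB: "A \<subseteq> Obj T" "B \<subseteq> Obj T"
  shows "K \<in> shift_subcat T 1 (star T A B)"
proof -
  obtain u v w where t: "(u, v, w) \<in> Tri T" and uv: "Dom T u \<in> shift_subcat T 1 A" "Cod T u = K" "Cod T v \<in> shift_subcat T 1 B"
    by (rule starE[OF K])
  obtain X where X: "X \<in> A" "isomorphic T (Dom T u) (So X)" using uv(1) unfolding shift_subcat_1 by blast
  obtain Y where Y: "Y \<in> B" "isomorphic T (Cod T v) (So Y)" using uv(3) unfolding shift_subcat_1 by blast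
  note [simp] = tri_simps[OF t]
  have K' [simp]: "K \<in> Obj T" using obj_simps(2)[OF tri_simps(1)[OF t]] uv(2) by simp
  obtain Z where Z: "Z \<in> Obj T" "isomorphic T (So Z) K" using S.ess_surj[OF K'] by blast
  have XY [simp]: "X \<in> Obj T" "Y \<in> Obj T" "Z \<in> Obj T" using X Y Z AB by auto
  obtain a where a [simp]: "is_iso T a" "Dom T a = Dom T u" "Cod T a = So X" by (rule isomorphicE[OF X(2)])
  obtain c where c [simp]: "is_iso T c" "Dom T c = Cod T v" "Cod T c = So Y" by (rule isomorphicE[OF Y(2)])
  obtain b where b [simp]: "is_iso T b" "Dom T b = K" "Cod T b = So Z" by (rule isomorphicE[OF isomorphic_sym[OF Z(2)]])
  note [simp] = uv(2)
  obtain u' where u' [simp]: "u' \<in> Arr T" "Dom T u' = X" "Cod T u' = Z" and Su: "Sm u' = b \<cdot> (u \<cdot> Inv a)"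
    using S.full[of X Z "b \<cdot> (u \<cdot> Inv a)"] by auto
  obtain v' where v' [simp]: "v' \<in> Arr T" "Dom T v' = Z" "Cod T v' = Y" and Sv: "Sm v' = c \<cdot> (v \<cdot> Inv b)"
    using S.full[of Z Y "c \<cdot> (v \<cdot> Inv b)"] by auto
  obtain w' where w' [simp]: "w' \<in> Arr T" "Dom T w' = Y" "Cod T w' = So X" and Sw: "Sm w' = Neg T (Sm a \<cdot> (w \<cdot> Inv c))"
    using S.full[of Y "So X" "Neg T (Sm a \<cdot> (w \<cdot> Inv c))"] by auto
  have "(Sm u', Sm v', Neg T (Sm w')) \<in> Tri T"
    by (rule tri_isoI[OF t a(1) b(1) c(1)]) (simp_all add: Su Sv Sw)
  hence "(u', v', w') \<in> Tri T" by (rule tri_unshift) simp_all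
  from starI[OF this, of A B] have "Z \<in> star T A B" using X Y by simp
  thus ?thesis unfolding shift_subcat_1 using isomorphic_sym[OF Z(2)] \<open>K \<in> Obj T\<close> by (intro conjI bexI)
qed

end

context model_subcategory
begin

lemma pr_obj: "pr T M k \<subseteq> Obj T"
proof (cases k)
  case (Suc j)
  thus ?thesis by (cases j) (auto simp: star_def)
qed auto

lemma pr_iso: "X \<in> pr T M k \<Longrightarrow> isomorphic T X Y \<Longrightarrow> Y \<in> pr T M k"
proof (cases k)
  case (Suc j)
  thus "X \<in> pr T M k \<Longrightarrow> isomorphic T X Y \<Longrightarrow> Y \<in> pr T M k"
    by (cases j) (auto intro: T.star_iso T.additive_subcategory_iso[OF M_sub])
qed (use T.isomorphic_zero in auto)

text \<open>The definition of \<open>pr\<close> splits off the top suspension, whereas resolutions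
  split off the bottom copy of M. The octahedral axiom re-brackets: the cone of M -> Z is an
  extension of the top suspension by \<Sigma> of the shorter product.\<close>

lemma pr_star: "pr T M (Suc (Suc j)) \<subseteq> star T M (shift_subcat T 1 (pr T M (Suc j)))"
proof (induction j)
  case 0
  show ?case by simp
next
  case (Suc j)
  show ?case
  proof
    fix Z assume "Z \<in> pr T M (Suc (Suc (Suc j)))"
    hence "Z \<in> star T (pr T M (Suc (Suc j))) (shift_subcat T (Suc (Suc j)) M)" by simp
    then obtain v k k' where v: "(v, k, k') \<in> Tri T" and d: "Dom T v \<in> pr T M (Suc (Suc j))" "Cod T v = Z"
      "Cod T k \<in> shift_subcat T (Suc (Suc j)) M" by (rule T.starE)
    have "Dom T v \<in> star T M (shift_subcat T 1 (pr T M (Suc j)))" using d(1) Suc.IH by blast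
    then obtain u i i' where u: "(u, i, i') \<in> Tri T" and e: "Dom T u \<in> M" "Cod T u = Dom T v"
      "Cod T i \<in> shift_subcat T 1 (pr T M (Suc j))" by (rule T.starE)
    note [simp] = T.tri_simps[OF u] T.tri_simps[OF v]
    obtain q q' where vu: "(v \<bullet> u, q, q') \<in> Tri T" using T.TR1_ex[of "v \<bullet> u"] e(2) by auto
    obtain f g where f: "(f, g, Sm i \<bullet> k') \<in> Tri T" "Dom T f = Cod T i" "Cod T f = Cod T q" "Cod T g = Cod T k"
      using T.octahedral[OF u v e(2) vu] by metis
    have kM: "Cod T k \<in> shift_subcat T 1 (shift_subcat T (Suc j) M)"
      using d(3) T.funpow_shift_mem[OF _ M_obj, of _ M "Suc j"] unfolding T.shift_subcat_1 T.shift_subcat_Suc[of _ "Suc j"]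
      by auto
    have "Cod T f \<in> star T (shift_subcat T 1 (pr T M (Suc j))) (shift_subcat T 1 (shift_subcat T (Suc j) M))"
      by (rule T.starI[OF f(1)]) (use f e kM in simp_all)
    hence "Cod T q \<in> shift_subcat T 1 (star T (pr T M (Suc j)) (shift_subcat T (Suc j) M))"
      unfolding f(3) by (rule T.star_shift) (use pr_obj in \<open>auto simp: shift_subcat_def\<close>)
    hence q: "Cod T q \<in> shift_subcat T 1 (pr T M (Suc (Suc j)))" by simp
    have "Cod T (v \<bullet> u) \<in> star T M (shift_subcat T 1 (pr T M (Suc (Suc j))))"
      by (rule T.starI[OF vu]) (use e q in simp_all)
    thus "Z \<in> star T M (shift_subcat T 1 (pr T M (Suc (Suc j))))" using e d by simp
  qed
qed

text \<open>The opposite re-bracketing, by the dual form of the octahedral axiom.\<close>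

lemma star_pr: "star T M (shift_subcat T 1 (pr T M (Suc j))) \<subseteq> pr T M (Suc (Suc j))"
proof (induction j)
  case 0
  show ?case by simp
next
  case (Suc j)
  show ?case
  proof
    fix Z assume "Z \<in> star T M (shift_subcat T 1 (pr T M (Suc (Suc j))))"
    then obtain u v w where t: "(u, v, w) \<in> Tri T" and d: "Dom T u \<in> M" "Cod T u = Z"
      "Cod T v \<in> shift_subcat T 1 (pr T M (Suc (Suc j)))" by (rule T.starE)
    then obtain W where W: "W \<in> star T (pr T M (Suc j)) (shift_subcat T (Suc j) M)" and i: "isomorphic T (Cod T v) (So W)"
      unfolding T.shift_subcat_1 by auto
    obtain e where e: "is_iso T e" "Dom T e = Cod T v" "Cod T e = So W" by (rule T.isomorphicE[OF i])
    obtain a b c where a: "(a, b, c) \<in> Tri T" and ab: "Dom T a \<in> pr T M (Suc j)" "Cod T a = W"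
      "Cod T b \<in> shift_subcat T (Suc j) M" by (rule T.starE[OF W])
    note t' = T.tri_iso_end[OF t e(1,2)] and a' = T.tri_shift[OF a]
    note [simp] = T.tri_simps[OF t] T.tri_simps[OF a] e
    obtain h' d' e' w'' where o: "(h', Sm b \<bullet> (e \<bullet> v), w'') \<in> Tri T" "Dom T d' = Dom T u" "Cod T d' = Dom T h'"
      "Cod T e' = Dom T (Sm a)" "(d', e', (w \<bullet> T.Inv e) \<bullet> Sm a) \<in> Tri T"
      by (rule T.octahedral_op[OF t' a']) (use ab in simp_all)
    have aS: "Dom T (Sm a) \<in> shift_subcat T 1 (pr T M (Suc j))" unfolding T.shift_subcat_1
      using ab(1) T.isomorphic_refl[of "So (Dom T a)"] by auto
    have "Cod T d' \<in> star T M (shift_subcat T 1 (pr T M (Suc j)))"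
      by (rule T.starI[OF o(5)]) (use o(2,4) d aS in simp_all)
    hence h: "Dom T h' \<in> pr T M (Suc (Suc j))" using Suc.IH o(3) by auto
    have "Cod T (Sm b) \<in> shift_subcat T (Suc (Suc j)) M"
      using ab(3) T.S.F_isomorphic[of "Cod T b"] unfolding T.shift_subcat_Suc by auto
    hence "Cod T h' \<in> star T (pr T M (Suc (Suc j))) (shift_subcat T (Suc (Suc j)) M)"
      by (rule_tac T.starI[OF o(1)]) (use h ab in simp_all)
    moreover have "Cod T h' = Z" using T.tri_simps(4)[OF o(1)] ab d by simp
    ultimately show "Z \<in> pr T M (Suc (Suc (Suc j)))" by simp
  qed
qed

text \<open>Downward from k = n: there the deflation is invertible in T because the next syzygy
  vanishes, so x(n) lies in M. Each further conflation, rotated, adds one factor M on the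
  left.\<close>

lemma res_pr:
  assumes r: "is_res n r" and k: "k \<le> n"
  shows "Fo (rx r k) \<in> pr T M (Suc (n - k))"
  using k
proof (induction "n - k" arbitrary: k)
  case 0
  hence [simp]: "k = n" by simp
  note [simp] = is_resD[OF r]
  have "is_iso T (Fm (rp r n))"
    using is_res_zero[OF r, of "Suc n"] by (rule_tac T.tri_zero_iso_snd[OF delta_tri[OF is_resD(1)[OF r]]]) simp
  from M_iso[OF this] show ?case by simp
next
  case (Suc j)
  note [simp] = is_resD[OF r] delta_simps[OF is_resD(1)[OF r]]
  have j: "j = n - Suc k" "Suc k \<le> n" "n - k = Suc (n - Suc k)" using Suc(2) by auto
  have s: "So (Fo (rx r (Suc k))) \<in> shift_subcat T 1 (pr T M (Suc (n - Suc k)))"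
    using T.funpow_shift_mem[OF Suc(1)[OF j(1,2)], of 1] by simp
  have "Cod T (Fm (rp r k)) \<in> star T M (shift_subcat T 1 (pr T M (Suc (n - Suc k))))"
    by (rule T.starI[OF T.TR2_rotate[OF delta_tri[OF is_resD(1)[OF r, of k]]]]) (use s in simp_all)
  thus ?case using star_pr unfolding j(3) by auto
qed

end

section \<open>Vanishing and approximations from rigidity\<close>

locale rigid_model = model_subcategory E T \<Phi> \<delta> M
  for E :: "('a, 'b, 'y) excat_scheme" and T :: "('o, 'm, 'z) tricat_scheme" and \<Phi> :: "('a, 'b, 'o, 'm) catfun"
    and \<delta> :: "'b \<Rightarrow> 'b \<Rightarrow> 'm" and M :: "'o set" +
  fixes n :: nat
  assumes n_pos: "n \<ge> 1" and M_rigid: "rigid T n M"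
begin

lemma shift_power_vanish:
  assumes f: "f \<in> Arr T" "Dom T f \<in> M" and X: "X \<in> M" "isomorphic T (Cod T f) ((So ^^ k) X)" and k: "1 \<le> k" "k \<le> n"
  shows "f = Zero T (Dom T f) (Cod T f)"
proof -
  obtain e where e [simp]: "is_iso T e" "Dom T e = Cod T f" "Cod T e = (So ^^ k) X" by (rule T.isomorphicE[OF X(2)])
  have "e \<bullet> f \<in> Hom T (Dom T f) ((So ^^ k) X)" using f by simp
  hence "e \<bullet> f = Zero T (Dom T f) ((So ^^ k) X)" using M_rigid k f(2) X(1) unfolding rigid_def by blast
  hence "e \<bullet> f = e \<bullet> Zero T (Dom T f) (Cod T f)" using f by simp
  thus ?thesis using f by (rule_tac T.iso_left_cancel[of e]) simp_all
qed

text \<open>The top factor of \<open>pr T M j\<close> is \<Sigma> to the power j - 1 of M and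
  contributes morphisms from M to the j-th suspension of M. So the bound j \<le> n is exactly what
  n-rigidity covers.\<close>

lemma vanish_pr:
  assumes "f \<in> Arr T" "Dom T f \<in> M" "Cod T f = So W" "W \<in> pr T M j" "j \<le> n"
  shows "f = Zero T (Dom T f) (Cod T f)"
  using assms
proof (induction j arbitrary: f W)
  case 0
  thus ?case by (intro T.to_zero) auto
next
  case (Suc j)
  show ?case
  proof (cases j)
    case 0
    thus ?thesis using Suc.prems shift_power_vanish[of f W 1] T.isomorphic_refl[of "So W"] by simp
  next
    case (Suc l)
    have "W \<in> star T (pr T M (Suc l)) (shift_subcat T (Suc l) M)" using Suc.prems(4) Suc by simp
    then obtain u v w where t: "(u, v, w) \<in> Tri T" and d: "Dom T u \<in> pr T M (Suc l)" "Cod T u = W"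
      "Cod T v \<in> shift_subcat T (Suc l) M" by (rule T.starE)
    note [simp] = T.tri_simps[OF t] Suc.prems(1,3)
    obtain X where X: "X \<in> M" "isomorphic T (Cod T v) ((So ^^ Suc l) X)" using d(3) unfolding shift_subcat_def by blast
    have "isomorphic T (Cod T (Sm v \<bullet> f)) ((So ^^ Suc (Suc l)) X)" using T.S.F_isomorphic[OF X(2)] d(2) by simp
    hence "Sm v \<bullet> f = Zero T (Dom T (Sm v \<bullet> f)) (Cod T (Sm v \<bullet> f))"
      using X(1) Suc.prems Suc d(2) by (rule_tac shift_power_vanish[of _ X "Suc (Suc l)"]) simp_all
    hence "Sm v \<bullet> f = Zero T (Dom T f) (Cod T (Sm v))" using d(2) by simp
    then obtain g where g: "g \<in> Arr T" "Dom T g = Dom T f" "Cod T g = So (Dom T u)" "Sm u \<bullet> g = f"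
      using T.tri_exact_Y[OF T.tri_shift[OF t], of f] d(2) by auto
    have "g = Zero T (Dom T g) (Cod T g)"
      by (rule Suc.IH[of g "Dom T u"]) (use g d Suc Suc.prems in simp_all)
    hence "g = Zero T (Dom T f) (So (Dom T u))" unfolding g(2,3) .
    hence "Sm u \<bullet> Zero T (Dom T f) (So (Dom T u)) = f" using g(4) by simp
    thus ?thesis using d(2) by simp
  qed
qed

text \<open>The object is an extension of some \<Sigma>\<Phi>a by an object of M, and the morphism
  to \<Sigma>\<Phi>a is realized by a conflation in E. Its deflation is an approximation because the
  obstruction to lifting a morphism from M lies in \<Sigma>\<Phi>a, where it vanishes by
  rigidity.\<close>

lemma pr_step:
  assumes x: "x \<in> Obj E" and p: "Fo x \<in> pr T M j" and j: "j \<le> Suc n"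
  obtains i p where "(i, p) \<in> Conf E" "Cod E p = x" "Fo (Cod E i) \<in> M" "Fo (Dom E i) \<in> pr T M (j - 1)"
    "\<forall>f. f \<in> Arr T \<longrightarrow> Dom T f \<in> M \<longrightarrow> Cod T f = Fo x \<longrightarrow>
       (\<exists>g. g \<in> Arr T \<and> Dom T g = Dom T f \<and> Cod T g = Fo (Cod E i) \<and> Fm p \<bullet> g = f)"
proof (cases "j \<le> 1")
  case True
  \<comment> \<open>Here the object is its own approximation with zero kernel. For j = 0 it lies in
    M as a zero object, and truncated subtraction gives j - 1 = 0 in both cases.\<close>
  obtain z where z: "is_zero E z" using E.ex_zero by blast
  have "j = 0 \<or> j = Suc 0" using True by auto
  hence "Fo x \<in> M" using p T.additive_subcategory_zero[OF M_sub] by auto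
  moreover have "is_zero T (Fo z)" using z by simp
  hence "Fo z \<in> pr T M (j - 1)" using True by simp
  ultimately show thesis
    by (intro that[OF E.conf_id[OF x z]]) (use x z in auto)
next
  case False
  then obtain l where l: "j = Suc (Suc l)" by (metis One_nat_def Suc_le_mono le0 not0_implies_Suc)
  have "Fo x \<in> star T M (shift_subcat T 1 (pr T M (Suc l)))" using p pr_star unfolding l by blast
  then obtain u v w where t: "(u, v, w) \<in> Tri T" and d: "Dom T u \<in> M" "Cod T u = Fo x"
    "Cod T v \<in> shift_subcat T 1 (pr T M (Suc l))" by (rule T.starE)
  obtain W where W: "W \<in> pr T M (Suc l)" "isomorphic T (Cod T v) (So W)" using d(3) unfolding T.shift_subcat_1 by blast
  have "W \<in> Obj T" using W(1) pr_obj by blast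
  then obtain a where a: "a \<in> Obj E" "isomorphic T (Fo a) W" using Phi_ess_surj by blast
  have aW: "Fo a \<in> pr T M (Suc l)" by (rule pr_iso[OF W(1) T.isomorphic_sym[OF a(2)]])
  have "isomorphic T (Cod T v) (So (Fo a))"
    by (rule T.isomorphic_trans[OF W(2) T.S.F_isomorphic[OF T.isomorphic_sym[OF a(2)]]])
  then obtain e where e: "is_iso T e" "Dom T e = Cod T v" "Cod T e = So (Fo a)" by (rule T.isomorphicE)
  note [simp] = T.tri_simps[OF t] e a(1) x d(2)
  note t' = T.tri_iso_end[OF t e(1,2)]
  obtain i p where c: "(i, p) \<in> Conf E" "Dom E i = a" "Cod E p = x" "\<delta> i p = e \<bullet> v"
    by (rule realize[of a x "e \<bullet> v"]) simp_all
  note [simp] = E.conf_simps[OF c(1)] c(2,3)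
  note D = T.TR2_rotate[OF delta_tri[OF c(1)]]
  have Fd: "(Fm p, e \<bullet> v, Neg T (Sm (Fm i))) \<in> Tri T" using D c(4) by simp
  \<comment> \<open>The given triangle and that of the conflation agree in their second and third
    objects and the morphism between them, so the middle term of the conflation is isomorphic to the
    object of M.\<close>
  obtain h where h: "h \<in> Arr T" "Dom T h = Dom T u" "Cod T h = Dom T (Fm p)" "Id T (Fo x) \<bullet> u = Fm p \<bullet> h"
    "Sm h \<bullet> (w \<bullet> T.Inv e) = Neg T (Sm (Fm i)) \<bullet> Id T (So (Fo a))"
    by (rule T.tri_morphism_fst[OF t' Fd, of "Id T (Fo x)" "Id T (So (Fo a))"]) simp_all
  have "is_iso T h"
    by (rule T.five_lemma_fst[OF t' Fd h(1-3) _ _ _ _ _ _ h(4) _ h(5)]) simp_all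
  from M_iso[OF this] have M: "Fo (Cod E i) \<in> M" using h(2,3) d(1) by simp
  show thesis
  proof (rule that[OF c(1,3) M])
    show "Fo (Dom E i) \<in> pr T M (j - 1)" using aW l by simp
    show "\<forall>f. f \<in> Arr T \<longrightarrow> Dom T f \<in> M \<longrightarrow> Cod T f = Fo x \<longrightarrow>
       (\<exists>g. g \<in> Arr T \<and> Dom T g = Dom T f \<and> Cod T g = Fo (Cod E i) \<and> Fm p \<bullet> g = f)"
    proof (intro allI impI)
      fix f assume f: "f \<in> Arr T" "Dom T f \<in> M" "Cod T f = Fo x"
      have "\<delta> i p \<bullet> f = Zero T (Dom T (\<delta> i p \<bullet> f)) (Cod T (\<delta> i p \<bullet> f))"
        by (rule vanish_pr[of _ "Fo a" "Suc l"]) (use f aW l j c(4) in simp_all)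
      hence z: "\<delta> i p \<bullet> f = Zero T (Dom T f) (So (Dom T (Fm i)))" using f c(4) by simp
      show "\<exists>g. g \<in> Arr T \<and> Dom T g = Dom T f \<and> Cod T g = Fo (Cod E i) \<and> Fm p \<bullet> g = f"
        using T.tri_exact_Z[OF delta_tri[OF c(1)] f(1) _ z] f by auto
    qed
  qed
qed

lemma pr_res:
  assumes x: "x \<in> Obj E" and p: "Fo x \<in> pr T M (Suc n)"
  obtains r where "is_res n r" "rx r 0 = x"
proof -
  define C where "C i p \<longleftrightarrow> (i, p) \<in> Conf E \<and> Fo (Cod E i) \<in> M \<and> (\<forall>f. f \<in> Arr T \<longrightarrow> Dom T f \<in> M \<longrightarrow> Cod T f = Fo (Cod E p) \<longrightarrow>
       (\<exists>g. g \<in> Arr T \<and> Dom T g = Dom T f \<and> Cod T g = Fo (Cod E i) \<and> Fm p \<bullet> g = f))" for i p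
  \<comment> \<open>The subtraction is truncated: from k = n + 1 on, the condition says that the
    syzygy is zero in T, as a resolution of length n demands.\<close>
  define P where "P k y \<longleftrightarrow> y \<in> Obj E \<and> Fo y \<in> pr T M (Suc n - k) \<and> (k = 0 \<longrightarrow> y = x)" for k y
  define Q where "Q k y y' \<longleftrightarrow> (\<exists>i p. C i p \<and> Cod E p = y \<and> Dom E i = y')" for k :: nat and y y'
  have "\<exists>y'. P (Suc k) y' \<and> Q k y y'" if y: "P k y" for k y
  proof -
    have y': "y \<in> Obj E" "Fo y \<in> pr T M (Suc n - k)" using y unfolding P_def by auto
    obtain i p where c: "(i, p) \<in> Conf E" "Cod E p = y" "Fo (Cod E i) \<in> M" and d: "Fo (Dom E i) \<in> pr T M (Suc n - k - 1)" and
     f: "\<forall>f. f \<in> Arr T \<longrightarrow> Dom T f \<in> M \<longrightarrow> Cod T f = Fo y \<longrightarrow>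
       (\<exists>g. g \<in> Arr T \<and> Dom T g = Dom T f \<and> Cod T g = Fo (Cod E i) \<and> Fm p \<bullet> g = f)"
      by (rule pr_step[OF y']) simp_all
    have "P (Suc k) (Dom E i)" unfolding P_def using d E.conf_simps[OF c(1)] by simp
    moreover have "Q k y (Dom E i)" unfolding Q_def C_def using c f by blast
    ultimately show ?thesis by blast
  qed
  moreover have "P 0 x" unfolding P_def using x p by simp
  ultimately obtain X where X: "\<And>k. P k (X k)" "\<And>k. Q k (X k) (X (Suc k))"
    using dependent_nat_choice[of P Q] by blast
  have "\<forall>k. \<exists>i p. C i p \<and> Cod E p = X k \<and> Dom E i = X (Suc k)" using X(2) unfolding Q_def by blast
  then obtain i p where ip: "\<And>k. C (i k) (p k)" "\<And>k. Cod E (p k) = X k" "\<And>k. Dom E (i k) = X (Suc k)" by metis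
  let ?r = "\<lparr>rx = X, ri = i, rp = p, ro = (\<lambda>k. Fo (Cod E (i k))), rt = (\<lambda>k. Id T (Fo (Cod E (i k))))\<rparr>"
  have "is_zero T (Fo (X k))" if "n < k" for k using X(1)[of k] that unfolding P_def by simp
  moreover have "Fo (Cod E (i k)) \<in> M" for k using ip(1) unfolding C_def by blast
  ultimately have "is_res n ?r" unfolding is_res_def rm_def using ip unfolding C_def by simp
  moreover have "X 0 = x" using X(1)[of 0] unfolding P_def by simp
  ultimately show thesis using that[of ?r] by simp
qed

text \<open>A composite M -> X -> \<Sigma> pr(n) vanishes by rigidity. Conversely X is the middle of
  a triangle with first object in M and third object in \<Sigma> pr(n), and a morphism that vanishes
  on the former factors through the latter.\<close>

lemma factor_pr:
  assumes X: "X \<in> pr T M (Suc n)" and Y: "Y \<in> Obj T"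
  shows "factor_through T (shift_subcat T 1 (pr T M n)) X (So Y) =
    {w \<in> Hom T X (So Y). \<forall>A \<in> M. \<forall>a \<in> Hom T A X. w \<bullet> a = Zero T A (So Y)}" (is "?L = ?R")
proof
  show "?L \<subseteq> ?R"
  proof
    fix w assume "w \<in> ?L"
    then obtain W g h where w: "w \<in> Hom T X (So Y)" and W: "W \<in> shift_subcat T 1 (pr T M n)" and g: "g \<in> Hom T X W" "h \<in> Hom T W (So Y)" "w = h \<bullet> g"
      unfolding factor_through_def by blast
    obtain V where V: "V \<in> pr T M n" "isomorphic T W (So V)" using W unfolding T.shift_subcat_1 by blast
    obtain e where e: "is_iso T e" "Dom T e = W" "Cod T e = So V" by (rule T.isomorphicE[OF V(2)])
    have "w \<bullet> a = Zero T A (So Y)" if a: "A \<in> M" "a \<in> Hom T A X" for A a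
    proof -
      have "e \<bullet> (g \<bullet> a) = Zero T (Dom T (e \<bullet> (g \<bullet> a))) (Cod T (e \<bullet> (g \<bullet> a)))"
        by (rule vanish_pr[OF _ _ _ V(1)]) (use a e g in auto)
      hence "e \<bullet> (g \<bullet> a) = e \<bullet> Zero T A W" using a e g by auto
      hence "g \<bullet> a = Zero T A W" by (rule T.iso_left_cancel) (use a e g in auto)
      thus ?thesis using a g Y by auto
    qed
    thus "w \<in> ?R" using w by blast
  qed
  show "?R \<subseteq> ?L"
  proof
    fix w assume w: "w \<in> ?R"
    obtain m where m: "n = Suc m" using n_pos by (cases n) auto
    have "X \<in> star T M (shift_subcat T 1 (pr T M n))" using X pr_star[of m] unfolding m by blast
    then obtain u v z where t: "(u, v, z) \<in> Tri T" and d: "Dom T u \<in> M" "Cod T u = X" "Cod T v \<in> shift_subcat T 1 (pr T M n)"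
      by (rule T.starE)
    note [simp] = T.tri_simps[OF t]
    have "w \<bullet> u = Zero T (Dom T u) (Cod T w)" using w d by auto
    then obtain g where "g \<in> Arr T" "Dom T g = Cod T v" "Cod T g = Cod T w" "g \<bullet> v = w"
      using T.tri_coexact_Y[OF t, of w] w d by auto
    thus "w \<in> ?L" unfolding factor_through_def using w d
      by (intro CollectI conjI bexI[of _ "Cod T v"] bexI[of _ v] bexI[of _ g]) auto
  qed
qed

end

section \<open>The extriangulated functor\<close>

context rigid_model
begin

section \<open>Trivial resolutions of the objects of M\<close>

definition "zE = (SOME z. is_zero E z)"

lemma zE_zero: "is_zero E zE"
  unfolding zE_def using E.ex_zero by (rule someI_ex)

lemma zero_obj_model:
  "zero_obj CC \<in> M" "zE \<in> Obj E" "Id T (zero_obj CC) = Zero T (zero_obj CC) (zero_obj CC)"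
  "Id T (Fo zE) = Zero T (Fo zE) (Fo zE)" "Id E zE = Zero E zE zE" "is_zero T (Fo zE)"
  using km.zero_obj_simps zE_zero Phi.F_is_zero[OF zE_zero] by (simp_all add: T.is_zero_iff E.is_zero_iff)

lemma zero_obj_iso: "is_iso T (Zero T (zero_obj CC) (Fo zE))"
  using zero_obj_model by (intro T.is_isoI[of _ "Zero T (Fo zE) (zero_obj CC)"]) simp_all

text \<open>The model in E has \<open>x\<close> and \<open>zE\<close>, while \<open>ro\<close>
  prescribes \<open>X\<close> and the fixed zero object of the stalk complex. Thus the resulting
  complex equals the stalk and is not merely isomorphic to it.\<close>

definition stalk_res :: "'o \<Rightarrow> 'a \<Rightarrow> 'm \<Rightarrow> ('a, 'b, 'o, 'm) resolution" where
  "stalk_res X x f = \<lparr>rx = (\<lambda>k. if k = 0 then x else zE), ri = (\<lambda>k. Zero E zE (if k = 0 then x else zE)),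
     rp = (\<lambda>k. Id E (if k = 0 then x else zE)), ro = (\<lambda>k. if k = 0 then X else zero_obj CC),
     rt = (\<lambda>k. if k = 0 then f else Zero T (zero_obj CC) (Fo zE))\<rparr>"

lemma stalk_res_sel [simp]:
  "rx (stalk_res X x f) k = (if k = 0 then x else zE)" "ri (stalk_res X x f) k = Zero E zE (if k = 0 then x else zE)"
  "rp (stalk_res X x f) k = Id E (if k = 0 then x else zE)" "ro (stalk_res X x f) k = (if k = 0 then X else zero_obj CC)"
  "rt (stalk_res X x f) k = (if k = 0 then f else Zero T (zero_obj CC) (Fo zE))"
  by (simp_all add: stalk_res_def)

definition "stalk_data X x f \<longleftrightarrow> X \<in> M \<and> x \<in> Obj E \<and> is_iso T f \<and> Dom T f = X \<and> Cod T f = Fo x"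

lemma stalk_rm:
  assumes "stalk_data X x f"
  shows "rm (stalk_res X x f) k = (if k = 0 then x else zE)"
  using assms zero_obj_model by (simp add: rm_def stalk_data_def)

lemma stalk_is_res:
  assumes d: "stalk_data X x f"
  shows "is_res n (stalk_res X x f)"
proof -
  have [simp]: "X \<in> M" "x \<in> Obj E" "is_iso T f" "Dom T f = X" "Cod T f = Fo x" using d unfolding stalk_data_def by auto
  note [simp] = zero_obj_model zero_obj_iso stalk_rm[OF d]
  have "\<exists>g. g \<in> Arr T \<and> Dom T g = Dom T h \<and> Cod T g = Fo (if k = 0 then x else zE) \<and> Fm (Id E (if k = 0 then x else zE)) \<bullet> g = h"
    if "h \<in> Arr T" "Cod T h = Fo (if k = 0 then x else zE)" for h and k :: nat
    using that by (intro exI[of _ h]) (auto split: if_splits)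
  moreover have "(Zero E zE (if k = 0 then x else zE), Id E (if k = 0 then x else zE)) \<in> Conf E" for k :: nat
    by (rule E.conf_id[OF _ zE_zero]) simp
  ultimately show ?thesis unfolding is_res_def stalk_rm[OF d] stalk_res_sel by (simp del: zero_obj_model(5))
qed

lemma stalk_Cx:
  assumes d: "stalk_data X x f"
  shows "Cx (stalk_res X x f) = stalk CC X"
proof -
  have [simp]: "X \<in> M" "x \<in> Obj E" "is_iso T f" "Dom T f = X" "Cod T f = Fo x" using d unfolding stalk_data_def by auto
  note [simp] = zero_obj_model zero_obj_iso
  have "rd (stalk_res X x f) = (\<lambda>k. Zero T (zero_obj CC) (if k = 0 then X else zero_obj CC))"
    by (rule ext) (simp add: rd_def del: zero_obj_model(5))
  moreover have "ro (stalk_res X x f) = (\<lambda>k. if k = 0 then X else zero_obj CC)" by auto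
  ultimately have "Cx (stalk_res X x f) = km.ncx (\<lambda>k. if k = 0 then X else zero_obj CC)
    (\<lambda>k. Zero T (zero_obj CC) (if k = 0 then X else zero_obj CC))" unfolding Cx_def by simp
  thus ?thesis unfolding km.ncx_def stalk_def Let_def by (auto simp: fun_eq_iff)
qed

text \<open>The conjugation by \<open>f\<close> and \<open>f'\<close> is undone by the
  identifications \<open>rt\<close> in the components of the chain map, so \<open>h\<close> itself
  appears in degree 0.\<close>

lemma stalk_Lam:
  assumes d: "stalk_data X x f" and d': "stalk_data X' x' f'" and h: "h \<in> Arr T" "Dom T h = X" "Cod T h = X'"
  shows "Lam (stalk_res X x f) (stalk_res X' x' f') (f' \<bullet> (h \<bullet> T.Inv f)) = H (stalk_map CC h)"
proof -
  have [simp]: "X \<in> M" "x \<in> Obj E" "is_iso T f" "Dom T f = X" "Cod T f = Fo x"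
    "X' \<in> M" "x' \<in> Obj E" "is_iso T f'" "Dom T f' = X'" "Cod T f' = Fo x'" using d d' unfolding stalk_data_def by auto
  note [simp] = zero_obj_model zero_obj_iso stalk_rm[OF d] stalk_rm[OF d'] h
  obtain g where g [simp]: "g \<in> Arr E" "Dom E g = x" "Cod E g = x'" and Fg: "Fm g = f' \<bullet> (h \<bullet> T.Inv f)"
    using Phi_full[of x x' "f' \<bullet> (h \<bullet> T.Inv f)"] by auto
  let ?r = "stalk_res X x f" and ?s = "stalk_res X' x' f'" and ?b = "\<lambda>k :: nat. if k = 0 then g else Zero E zE zE"
  have l: "is_lift ?r ?s ?b ?b" unfolding is_lift_def stalk_res_sel stalk_rm[OF d] stalk_rm[OF d']
    by (simp del: zero_obj_model(5))
  have "cmp ?r ?s ?b k = (if k = 0 then h else Zero T (zero_obj CC) (zero_obj CC))" for k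
    unfolding cmp_def by (simp add: Fg)
  hence "cmp ?r ?s ?b = (\<lambda>k. if k = 0 then h else Zero T (zero_obj CC) (zero_obj CC))" by blast
  hence "Nm ?r ?s ?b = stalk_map CC h"
    unfolding Nm_def stalk_Cx[OF d] stalk_Cx[OF d'] km.nmap_def stalk_map_def by (auto simp: fun_eq_iff)
  thus ?thesis using Lam_eq[OF stalk_is_res[OF d] stalk_is_res[OF d'] l, of "f' \<bullet> (h \<bullet> T.Inv f)"] Fg by simp
qed

section \<open>Extriangles of pr and their resolved models\<close>

abbreviation "PR \<equiv> pr T M (Suc n)"
abbreviation "PG X Y \<equiv> factor_through T (shift_subcat T 1 (pr T M n)) X (So Y)"

lemma PG_D:
  assumes "w \<in> PG X Y" "X \<in> PR" "Y \<in> PR"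
  shows "w \<in> Arr T" "Dom T w = X" "Cod T w = So Y" "X \<in> Obj T" "Y \<in> Obj T"
    "a \<in> Arr T \<Longrightarrow> Dom T a \<in> M \<Longrightarrow> Cod T a = X \<Longrightarrow> w \<bullet> a = Zero T (Dom T a) (So Y)"
proof -
  show o: "X \<in> Obj T" "Y \<in> Obj T" using assms pr_obj by blast+
  show "w \<in> Arr T" "Dom T w = X" "Cod T w = So Y"
    "a \<in> Arr T \<Longrightarrow> Dom T a \<in> M \<Longrightarrow> Cod T a = X \<Longrightarrow> w \<bullet> a = Zero T (Dom T a) (So Y)"
    using assms(1) unfolding factor_pr[OF assms(2) o(2)] by auto
qed

lemma PG_kills:
  assumes w: "w \<in> PG X Y" and XY: "X \<in> PR" "Y \<in> PR" and f: "is_iso T f" "Dom T f = X" "Cod T f = Fo (rx r 0)"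
    and g: "g \<in> Arr T" "Dom T g = Y" "Cod T g = Fo (rx s 0)"
  shows "kills r s (Sm g \<bullet> (w \<bullet> T.Inv f))"
proof -
  note [simp] = PG_D(1-5)[OF w XY] f g
  have [simp]: "Fo (rx s 0) \<in> Obj T" using T.obj_simps(2)[OF g(1)] by simp
  have "(Sm g \<bullet> (w \<bullet> T.Inv f)) \<bullet> a = Zero T (Dom T a) (So (Fo (rx s 0)))"
    if a: "a \<in> Arr T" "Dom T a \<in> M" "Cod T a = Fo (rx r 0)" for a
    using PG_D(6)[OF w XY, of "T.Inv f \<bullet> a"] a by simp
  thus ?thesis unfolding kills_def by simp
qed

text \<open>The horseshoe conflation for the transported class has that class as its third morphism,
  so its middle term is isomorphic to that of the given triangle. The isomorphism \<open>e\<close>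
  carries the resolved triangle back.\<close>

lemma triangle_model:
  assumes t: "(u, v, w) \<in> Tri T" and XY: "Cod T v \<in> PR" "Dom T u \<in> PR" and w: "w \<in> PG (Cod T v) (Dom T u)"
    and r: "is_res n r" and f: "is_iso T f" "Dom T f = Cod T v" "Cod T f = Fo (rx r 0)"
    and s: "is_res n s" and g: "is_iso T g" "Dom T g = Dom T u" "Cod T g = Fo (rx s 0)"
  obtains q e where "is_res n q" "is_iso T e" "Dom T e = Cod T u" "Cod T e = Fo (rx q 0)"
    "(Lam s q (e \<bullet> (u \<bullet> T.Inv g)), Lam q r (f \<bullet> (v \<bullet> T.Inv e)), Omega r s (Sm g \<bullet> (w \<bullet> T.Inv f))) \<in> Tri (Kb CC)"
proof -
  note [simp] = T.tri_simps[OF t] f g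
  have k: "kills r s (Sm g \<bullet> (w \<bullet> T.Inv f))" by (rule PG_kills[OF w XY]) simp_all
  obtain q al be where q: "is_res n q" and c: "(al, be) \<in> Conf E" "Dom E al = rx s 0" "Cod E be = rx r 0" "Cod E al = rx q 0"
    "\<delta> al be = Sm g \<bullet> (w \<bullet> T.Inv f)" and K: "(Lam s q (Fm al), Lam q r (Fm be), Omega r s (Sm g \<bullet> (w \<bullet> T.Inv f))) \<in> Tri (Kb CC)"
    by (rule horseshoe_ex[OF r s k])
  have t': "(Fm al, Fm be, Sm g \<bullet> (w \<bullet> T.Inv f)) \<in> Tri T" using delta_tri[OF c(1)] c(5) by simp
  note [simp] = E.conf_simps(1-3)[OF c(1)] c(2-4)
  obtain e where e: "e \<in> Arr T" "Dom T e = Cod T u" "Cod T e = Cod T (Fm al)" "e \<bullet> u = Fm al \<bullet> g" "f \<bullet> v = Fm be \<bullet> e"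
    by (rule T.tri_morphism_snd[OF t t', of g f]) simp_all
  have i: "is_iso T e"
    by (rule T.five_lemma_snd[OF t t' _ _ _ e(1-3) _ _ _ e(4,5)]) simp_all
  note [simp] = i e(2) e(3)[simplified]
  have "e \<bullet> (u \<bullet> T.Inv g) = Fm al" using T.comp_reduce[OF e(4), of "T.Inv g"] by simp
  moreover have "f \<bullet> (v \<bullet> T.Inv e) = Fm be" using T.comp_reduce[OF e(5), of "T.Inv e"] by simp
  ultimately show thesis using that[OF q i] K by simp
qed

lemma pr_resolution:
  assumes X: "X \<in> PR"
  obtains r f where "is_res n r" "is_iso T f" "Dom T f = X" "Cod T f = Fo (rx r 0)"
proof -
  have "X \<in> Obj T" using X pr_obj by blast
  then obtain x where x: "x \<in> Obj E" "isomorphic T (Fo x) X" using Phi_ess_surj by blast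
  obtain f where f: "is_iso T f" "Dom T f = X" "Cod T f = Fo x" by (rule T.isomorphicE[OF T.isomorphic_sym[OF x(2)]])
  obtain r where r: "is_res n r" "rx r 0 = x" by (rule pr_res[OF x(1) pr_iso[OF X T.isomorphic_sym[OF x(2)]]])
  show thesis by (rule that[OF r(1) f(1,2)]) (simp add: f r)
qed

lemma res_PR: "is_res n r \<Longrightarrow> isomorphic T (Fo (rx r 0)) X \<Longrightarrow> X \<in> PR"
  using pr_iso[OF res_pr[of n r 0]] by simp

text \<open>The horseshoe gives the middle term a resolution of length n, and objects with such a
  resolution lie in pr.\<close>

lemma pr_extension:
  assumes t: "(u, v, w) \<in> Tri T" and XY: "Dom T u \<in> PR" "Cod T v \<in> PR" and w: "w \<in> PG (Cod T v) (Dom T u)"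
  shows "Cod T u \<in> PR"
proof -
  obtain r f where r: "is_res n r" "is_iso T f" "Dom T f = Cod T v" "Cod T f = Fo (rx r 0)" by (rule pr_resolution[OF XY(2)])
  obtain s g where s: "is_res n s" "is_iso T g" "Dom T g = Dom T u" "Cod T g = Fo (rx s 0)" by (rule pr_resolution[OF XY(1)])
  obtain q e where q: "is_res n q" "is_iso T e" "Dom T e = Cod T u" "Cod T e = Fo (rx q 0)"
    by (rule triangle_model[OF t XY(2,1) w r s])
  show ?thesis by (rule res_PR[OF q(1) T.isomorphic_sym[OF T.isomorphicI[OF q(2-4)]]])
qed

lemma stalk_data_ex:
  assumes X: "X \<in> M"
  obtains x f where "stalk_data X x f"
proof -
  obtain x where x: "x \<in> Obj E" "isomorphic T (Fo x) X" using Phi_ess_surj X M_obj by blast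
  obtain f where "is_iso T f" "Dom T f = X" "Cod T f = Fo x" by (rule T.isomorphicE[OF T.isomorphic_sym[OF x(2)]])
  thus thesis using that[of x f] X x unfolding stalk_data_def by blast
qed

lemma M_PR: "X \<in> M \<Longrightarrow> X \<in> PR"
proof -
  assume "X \<in> M"
  then obtain x f where d: "stalk_data X x f" by (rule stalk_data_ex)
  have f: "is_iso T f" "Dom T f = X" "Cod T f = Fo x" using d unfolding stalk_data_def by auto
  show "X \<in> PR" by (rule res_PR[OF stalk_is_res[OF d]]) (use T.isomorphic_sym[OF T.isomorphicI[OF f]] in simp)
qed

lemma pr_relative: "relative_structure T PR M PG"
proof (unfold_locales)
  show "additive_subcategory T PR" unfolding additive_subcategory_def
  proof (intro conjI ballI allI impI)
    show "PR \<subseteq> Obj T" by (rule pr_obj)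
    show "Y \<in> PR" if "X \<in> PR" "isomorphic T X Y" for X Y using pr_iso that .
    obtain z where z: "is_zero T z" using T.ex_zero by blast
    thus "\<exists>Z\<in>PR. is_zero T Z" using M_PR[OF T.additive_subcategory_zero[OF M_sub z]] by blast
    fix A B D i j p q assume A: "A \<in> PR" "B \<in> PR" and b: "is_biproduct T A B D i j p q"
    note [simp] = T.biproduct_simps[OF b]
    \<comment> \<open>A biproduct is the middle term of the extension with class zero, so additivity
      is a case of closure under extensions.\<close>
    have "Zero T B (So A) \<in> PG B A" unfolding factor_pr[OF A(2) T.biproduct_simps(17)[OF b]] by auto
    thus "D \<in> PR" using pr_extension[OF T.tri_split[OF b]] A by simp
  qed
  show "M \<subseteq> Obj T" by auto
  show "PG X Y = {w \<in> Hom T X (So Y). \<forall>A\<in>M. \<forall>a\<in>Hom T A X. w \<bullet> a = Zero T A (So Y)}" if "X \<in> PR" "Y \<in> PR" for X Y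
    using factor_pr[OF that(1)] that(2) pr_obj by blast
  show "Cod T u \<in> PR" if "(u, v, w) \<in> Tri T" "Dom T u \<in> PR" "Cod T v \<in> PR" "w \<in> PG (Cod T v) (Dom T u)" for u v w
    using pr_extension that .
qed

end

sublocale rigid_model \<subseteq> src: relative_structure T "pr T M (Suc n)" M
  "\<lambda>X Y. factor_through T (shift_subcat T 1 (pr T M n)) X (fobj (Sh T) Y)"
  by (rule pr_relative)

sublocale rigid_model \<subseteq> tgt: relative_structure "Kb (full_subcat T M)" "K_interval (full_subcat T M) n" "{}"
  "\<lambda>X Y. Hom (Kb (full_subcat T M)) X (fobj (Sh (Kb (full_subcat T M))) Y)"
  by (rule km.K_extricat_relative)

context rigid_model
begin

section \<open>The functor for a fixed choice of resolutions\<close>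

context
  fixes rs :: "'o \<Rightarrow> ('a, 'b, 'o, 'm) resolution" and ph :: "'o \<Rightarrow> 'm"
  assumes rs: "\<And>X. X \<in> PR \<Longrightarrow> is_res n (rs X)"
    and ph: "\<And>X. X \<in> PR \<Longrightarrow> is_iso T (ph X)" "\<And>X. X \<in> PR \<Longrightarrow> Dom T (ph X) = X" "\<And>X. X \<in> PR \<Longrightarrow> Cod T (ph X) = Fo (rx (rs X) 0)"
begin

definition "lf f = ph (Cod T f) \<bullet> (f \<bullet> T.Inv (ph (Dom T f)))"
definition "Pf = \<lparr>fobj = (\<lambda>X. Cx (rs X)), fmor = (\<lambda>f. Lam (rs (Dom T f)) (rs (Cod T f)) (lf f))\<rparr>"
definition "Of X Y w = Omega (rs X) (rs Y) (Sm (ph Y) \<bullet> (w \<bullet> T.Inv (ph X)))"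

lemma Pf_sel: "fobj Pf X = Cx (rs X)" "fmor Pf f = Lam (rs (Dom T f)) (rs (Cod T f)) (ph (Cod T f) \<bullet> (f \<bullet> T.Inv (ph (Dom T f))))"
  by (simp_all add: Pf_def lf_def)

lemma lf_simps:
  assumes "f \<in> Arr T" "Dom T f \<in> PR" "Cod T f \<in> PR"
  shows "lf f \<in> Arr T" "Dom T (lf f) = Fo (rx (rs (Dom T f)) 0)" "Cod T (lf f) = Fo (rx (rs (Cod T f)) 0)"
  using assms ph unfolding lf_def by simp_all

lemma lf_comp:
  assumes "f \<in> Arr T" "g \<in> Arr T" "Dom T g = Cod T f" "Dom T f \<in> PR" "Cod T f \<in> PR" "Cod T g \<in> PR"
  shows "lf (g \<bullet> f) = lf g \<bullet> lf f"
  using assms ph unfolding lf_def by simp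

lemma Pf_simps:
  assumes "f \<in> Arr T" "Dom T f \<in> PR" "Cod T f \<in> PR"
  shows "fmor Pf f \<in> Arr km.ch.Q" "Dom km.ch.Q (fmor Pf f) = fobj Pf (Dom T f)" "Cod km.ch.Q (fmor Pf f) = fobj Pf (Cod T f)"
  using Lam_simps[OF rs rs lf_simps] assms unfolding Pf_def by simp_all

lemma Pf_obj: "X \<in> PR \<Longrightarrow> fobj Pf X \<in> K_interval CC n"
  unfolding Pf_def using Cx_interval[OF rs] by simp

lemma Pf_comp:
  assumes "f \<in> Arr T" "g \<in> Arr T" "Cod T f = Dom T g" "Dom T f \<in> PR" "Dom T g \<in> PR" "Cod T g \<in> PR"
  shows "fmor Pf (g \<bullet> f) = fmor Pf g \<odot> fmor Pf f"
  using assms Lam_comp[OF rs rs rs, of "Dom T f" "Cod T f" "Cod T g" "lf f" "lf g"] lf_simps[of f] lf_simps[of g] lf_comp[of f g]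
  unfolding Pf_def by simp

lemma Pf_add:
  assumes "f \<in> Arr T" "g \<in> Arr T" "Dom T g = Dom T f" "Cod T g = Cod T f" "Dom T f \<in> PR" "Cod T f \<in> PR"
  shows "fmor Pf (f \<oplus>\<^bsub>T\<^esub> g) = fmor Pf f \<oplus>\<^bsub>km.ch.Q\<^esub> fmor Pf g"
proof -
  have "lf (f \<oplus>\<^bsub>T\<^esub> g) = lf f \<oplus>\<^bsub>T\<^esub> lf g" using assms ph unfolding lf_def by simp
  thus ?thesis
    using assms Lam_add[OF rs rs, of "Dom T f" "Cod T f" "lf f" "lf g"] lf_simps[of f] lf_simps[of g]
    unfolding Pf_def by simp
qed

lemma Pf_id:
  assumes X: "X \<in> PR"
  shows "fmor Pf (Id T X) = H (Id (Chb CC) (fobj Pf X))"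
proof -
  have [simp]: "X \<in> Obj T" using X pr_obj by blast
  have "lf (Id T X) = Id T (Fo (rx (rs X) 0))" unfolding lf_def using ph[OF X] by simp
  thus ?thesis unfolding Pf_def using Lam_id[OF rs[OF X]] by simp
qed

lemma Of_kills:
  assumes "w \<in> PG X Y" "X \<in> PR" "Y \<in> PR"
  shows "kills (rs X) (rs Y) (Sm (ph Y) \<bullet> (w \<bullet> T.Inv (ph X)))"
  by (rule PG_kills[OF assms]) (use ph assms in simp_all)

lemma Of_simps:
  assumes "w \<in> PG X Y" "X \<in> PR" "Y \<in> PR"
  shows "Of X Y w \<in> Arr km.ch.Q" "Dom km.ch.Q (Of X Y w) = fobj Pf X" "Cod km.ch.Q (Of X Y w) = shift_cplx CC (fobj Pf Y)"
  using Omega_simps[OF rs rs Of_kills[OF assms]] assms unfolding Of_def Pf_def by simp_all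

lemma Of_add:
  assumes w: "w \<in> PG X Y" and w': "w' \<in> PG X Y" and XY: "X \<in> PR" "Y \<in> PR"
  shows "Of X Y (w \<oplus>\<^bsub>T\<^esub> w') = Of X Y w \<oplus>\<^bsub>km.ch.Q\<^esub> Of X Y w'"
  using Omega_add[OF rs[OF XY(1)] rs[OF XY(2)] Of_kills[OF w XY] Of_kills[OF w' XY]] PG_D(1-5)[OF w XY] PG_D(1-5)[OF w' XY] ph XY
  unfolding Of_def by simp

lemma Of_natural:
  assumes w: "w \<in> PG X Y" and XY: "X \<in> PR" "Y \<in> PR" and f: "f \<in> Arr T" "Dom T f \<in> PR" "Cod T f = X"
    and g: "g \<in> Arr T" "Dom T g = Y" "Cod T g \<in> PR"
  shows "Of (Dom T f) (Cod T g) (Sm g \<bullet> (w \<bullet> f)) = fmor (Kb_shift CC) (fmor Pf g) \<odot> (Of X Y w \<odot> fmor Pf f)"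
proof -
  note [simp] = PG_D(1-5)[OF w XY] f g XY ph
  let ?w = "Sm (ph Y) \<bullet> (w \<bullet> T.Inv (ph X))"
  have lf: "lf f \<in> Arr T" "Dom T (lf f) = Fo (rx (rs (Dom T f)) 0)" "Cod T (lf f) = Fo (rx (rs X) 0)"
    using lf_simps[of f] by simp_all
  have lg: "lf g \<in> Arr T" "Dom T (lf g) = Fo (rx (rs Y) 0)" "Cod T (lf g) = Fo (rx (rs (Cod T g)) 0)"
    using lf_simps[of g] by simp_all
  note k = Of_kills[OF w XY]
  have z: "?w \<bullet> (lf f \<bullet> a) = Zero T (Dom T (lf f \<bullet> a)) (So (Fo (rx (rs Y) 0)))"
    if "a \<in> Arr T" "Dom T a \<in> M" "Cod T a = Fo (rx (rs (Dom T f)) 0)" for a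
    using k that lf unfolding kills_def by simp
  have k': "kills (rs (Dom T f)) (rs Y) (?w \<bullet> lf f)" unfolding kills_def using z lf by simp
  have "Sm (ph (Cod T g)) \<bullet> ((Sm g \<bullet> (w \<bullet> f)) \<bullet> T.Inv (ph (Dom T f))) = Sm (lf g) \<bullet> (?w \<bullet> lf f)"
    unfolding lf_def by simp
  hence "Of (Dom T f) (Cod T g) (Sm g \<bullet> (w \<bullet> f)) = Omega (rs (Dom T f)) (rs (Cod T g)) (Sm (lf g) \<bullet> (?w \<bullet> lf f))"
    unfolding Of_def by simp
  also have "\<dots> = fmor (Kb_shift CC) (Lam (rs Y) (rs (Cod T g)) (lf g)) \<odot> Omega (rs (Dom T f)) (rs Y) (?w \<bullet> lf f)"
    by (rule Omega_right[OF rs rs rs k' lg]) simp_all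
  also have "Omega (rs (Dom T f)) (rs Y) (?w \<bullet> lf f) = Omega (rs X) (rs Y) ?w \<odot> Lam (rs (Dom T f)) (rs X) (lf f)"
    by (rule Omega_left[OF rs rs rs k lf]) simp_all
  finally show ?thesis unfolding Of_def Pf_def by simp
qed

text \<open>The horseshoe resolves the middle term by some \<open>q\<close> and not by the chosen
  resolution. Comparing the two resolutions gives an isomorphism of complexes, because
  \<open>Lam\<close> respects composites and identities, and this isomorphism replaces one by the
  other in the triangle.\<close>

lemma Of_tri:
  assumes t: "(u, v, w) \<in> Tri T" and PR: "Dom T u \<in> PR" "Cod T u \<in> PR" "Cod T v \<in> PR" and w: "w \<in> PG (Cod T v) (Dom T u)"
  shows "(fmor Pf u, fmor Pf v, Of (Cod T v) (Dom T u) w) \<in> Tri (Kb CC)"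
proof -
  note [simp] = T.tri_simps[OF t] PR ph
  obtain q e where q: "is_res n q" and e [simp]: "is_iso T e" "Dom T e = Cod T u" "Cod T e = Fo (rx q 0)" and
    K: "(Lam (rs (Dom T u)) q (e \<bullet> (u \<bullet> T.Inv (ph (Dom T u)))), Lam q (rs (Cod T v)) (ph (Cod T v) \<bullet> (v \<bullet> T.Inv e)),
      Of (Cod T v) (Dom T u) w) \<in> Tri (Kb CC)"
    unfolding Of_def by (rule triangle_model[OF t PR(3,1) w rs[OF PR(3)] ph(1-3)[OF PR(3)] rs[OF PR(1)] ph(1-3)[OF PR(1)]])
  let ?Z = "Cod T u" let ?i = "ph ?Z \<bullet> T.Inv e" and ?j = "e \<bullet> T.Inv (ph ?Z)"
  let ?a = "e \<bullet> (u \<bullet> T.Inv (ph (Dom T u)))" and ?b = "ph (Cod T v) \<bullet> (v \<bullet> T.Inv e)"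
  note r = rs[OF PR(1)] rs[OF PR(2)] rs[OF PR(3)]
  have 1: "Lam q (rs ?Z) ?i \<odot> Lam (rs ?Z) q ?j = H (Id (Chb CC) (Cx (rs ?Z)))"
    by (subst Lam_comp[OF r(2) q r(2), symmetric]) (simp_all add: Lam_id[OF r(2)])
  have 2: "Lam (rs ?Z) q ?j \<odot> Lam q (rs ?Z) ?i = H (Id (Chb CC) (Cx q))"
    by (subst Lam_comp[OF q r(2) q, symmetric]) (simp_all add: Lam_id[OF q])
  have Li: "Lam q (rs ?Z) ?i \<in> Arr km.ch.Q" "Dom km.ch.Q (Lam q (rs ?Z) ?i) = Cx q" "Cod km.ch.Q (Lam q (rs ?Z) ?i) = Cx (rs ?Z)"
    by (rule Lam_simps[OF q r(2)]; simp)+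
  have Lj: "Lam (rs ?Z) q ?j \<in> Arr km.ch.Q" "Dom km.ch.Q (Lam (rs ?Z) q ?j) = Cx (rs ?Z)" "Cod km.ch.Q (Lam (rs ?Z) q ?j) = Cx q"
    by (rule Lam_simps[OF r(2) q]; simp)+
  have La: "Lam (rs (Dom T u)) q ?a \<in> Arr km.ch.Q" "Dom km.ch.Q (Lam (rs (Dom T u)) q ?a) = fobj Pf (Dom T u)" "Cod km.ch.Q (Lam (rs (Dom T u)) q ?a) = Cx q"
    using Lam_simps[OF r(1) q, of ?a] by (simp_all add: Pf_def)
  have Lb: "Lam q (rs (Cod T v)) ?b \<in> Arr km.ch.Q" "Dom km.ch.Q (Lam q (rs (Cod T v)) ?b) = Cx q" "Cod km.ch.Q (Lam q (rs (Cod T v)) ?b) = fobj Pf (Cod T v)"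
    using Lam_simps[OF q r(3), of ?b] by (simp_all add: Pf_def)
  note O = Of_simps[OF w PR(3,1)] and Pu = Pf_simps[of u] and Pv = Pf_simps[of v]
  have iso: "is_iso km.ch.Q (Lam q (rs ?Z) ?i)"
    by (rule km.kq.is_isoI[OF Li(1) Lj(1)]) (simp_all add: 1 2 Li Lj)
  have "Lam q (rs ?Z) ?i \<odot> Lam (rs (Dom T u)) q ?a = Lam (rs (Dom T u)) (rs ?Z) (lf u)"
    unfolding lf_def by (subst Lam_comp[OF r(1) q r(2), symmetric]) simp_all
  hence eu: "Lam q (rs ?Z) ?i \<odot> Lam (rs (Dom T u)) q ?a = fmor Pf u" by (simp add: Pf_def)
  have "Lam (rs ?Z) (rs (Cod T v)) (lf v) \<odot> Lam q (rs ?Z) ?i = Lam q (rs (Cod T v)) ?b"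
    using lf_simps[of v] by (subst Lam_comp[OF q r(2) r(3), symmetric]) (simp_all add: lf_def)
  hence ev: "fmor Pf v \<odot> Lam q (rs ?Z) ?i = Lam q (rs (Cod T v)) ?b" by (simp add: Pf_def)
  have b: "fobj Pf (Dom T u) \<in> bounded_complexes CC" "fobj Pf (Cod T v) \<in> bounded_complexes CC"
    unfolding Pf_def using Cx_bounded[OF r(1)] Cx_bounded[OF r(3)] by simp_all
  have sid: "H (shift_cmap CC (Id (Chb CC) (Cx (rs (Dom T u))))) = H (Id (Chb CC) (shift_cplx CC (Cx (rs (Dom T u)))))"
    using km.kb.S.F_id[of "Cx (rs (Dom T u))"] Cx_bounded[OF r(1)] by simp
  show ?thesis
    by (rule km.kb.tri_isoI[OF K, of "H (Id (Chb CC) (fobj Pf (Dom T u)))" "Lam q (rs ?Z) ?i" "H (Id (Chb CC) (fobj Pf (Cod T v)))"])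
      (use b iso in \<open>simp_all add: La Lb Li O Pu Pv eu ev sid Pf_def[THEN arg_cong[of _ _ fobj]]\<close>)
qed

lemma Pf_extriangulated: "extriangulated_functor src.R tgt.R Pf Of"
proof -
  define C where "C = src.R"
  define D where "D = tgt.R"
  note [simp] = src.R_sel[folded C_def] tgt.R_sel[folded D_def]
  interpret s: extriangulated_category C unfolding C_def by (rule src.relative_extriangulated)
  interpret t: extriangulated_category D unfolding D_def by (rule tgt.relative_extriangulated)
  have "extriangulated_functor C D Pf Of"
  proof (unfold_locales)
    show "fobj Pf X \<in> Obj D" if "X \<in> Obj C" for X using that Pf_obj by simp
    show "fmor Pf \<in> hom (HomGrp C X Y) (HomGrp D (fobj Pf X) (fobj Pf Y))" if "X \<in> Obj C" "Y \<in> Obj C" for X Y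
      unfolding hom_def HomGrp_def using that Pf_simps Pf_obj Pf_add by auto
    show "fmor Pf (Id C X) = Id D (fobj Pf X)" if "X \<in> Obj C" for X using that Pf_id by simp
    show "fmor Pf (g \<cdot>\<^bsub>C\<^esub> f) = fmor Pf g \<cdot>\<^bsub>D\<^esub> fmor Pf f" if "f \<in> Hom C X Y" "g \<in> Hom C Y Z" for f g X Y Z
      using that Pf_comp[of f g] by auto
    show "Of X Y \<in> hom (Ext C X Y) (Ext D (fobj Pf X) (fobj Pf Y))" if "X \<in> Obj C" "Y \<in> Obj C" for X Y
      unfolding hom_def using that Of_simps[of _ X Y] Of_add[of _ X Y] by simp
    show "Of X' Y' (Act C f g w) = Act D (fmor Pf f) (fmor Pf g) (Of X Y w)"
      if "f \<in> Hom C X' X" "g \<in> Hom C Y Y'" "w \<in> carrier (Ext C X Y)" for f g w X X' Y Y'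
    proof -
      have f: "f \<in> Arr T" "Dom T f = X'" "Cod T f = X" "X' \<in> PR" "X \<in> PR" and g: "g \<in> Arr T" "Dom T g = Y" "Cod T g = Y'" "Y' \<in> PR" "Y \<in> PR"
        and w: "w \<in> PG X Y" using that by auto
      have g': "g \<in> Arr T" "Dom T g \<in> PR" "Cod T g \<in> PR" and f': "f \<in> Arr T" "Dom T f \<in> PR" "Cod T f \<in> PR" using f g by auto
      have "fmor (Kb_shift CC) (fmor Pf g) \<in> Arr km.ch.Q" "Dom km.ch.Q (fmor (Kb_shift CC) (fmor Pf g)) = shift_cplx CC (fobj Pf Y)"
        using km.kb.S.F_simps[of "fmor Pf g"] Pf_simps[OF g'] g by simp_all
      thus ?thesis
        using Of_natural[OF w, of f g] Of_simps[OF w] Pf_simps[OF f'] PG_D(1-5)[OF w f(5) g(5)] f g by simp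
    qed
    show "(fmor Pf u, fmor Pf v, Of (Cod C v) (Dom C u) w) \<in> Real D" if "(u, v, w) \<in> Real C" for u v w
    proof -
      note d = src.R_realD[folded C_def, OF that]
      show ?thesis unfolding tgt.R_real[folded D_def]
        using Of_tri[OF d(1-5)] Pf_simps[of u] Pf_simps[of v] Of_simps[OF d(5)] Pf_obj d by simp
    qed
  qed
  thus ?thesis unfolding C_def D_def .
qed

end

theorem extriangulated_functor_ex:
  obtains P \<Omega> where "extriangulated_functor (pr_extricat T M n) (K_extricat CC n) P \<Omega>"
    "\<And>X. X \<in> M \<Longrightarrow> fobj P X = stalk CC X" "\<And>f. f \<in> Arr CC \<Longrightarrow> fmor P f = H (stalk_map CC f)"
proof -
  \<comment> \<open>The trivial resolution on M is part of what is chosen, with the same isomorphism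
    in the resolution and in the comparison map, so a single choice function settles both values on
    M.\<close>
  have "\<exists>r f. X \<in> PR \<longrightarrow> is_res n r \<and> is_iso T f \<and> Dom T f = X \<and> Cod T f = Fo (rx r 0) \<and>
    (X \<in> M \<longrightarrow> (\<exists>x. stalk_data X x f \<and> r = stalk_res X x f))" for X
  proof (cases "X \<in> M")
    case True
    then obtain x f where d: "stalk_data X x f" by (rule stalk_data_ex)
    thus ?thesis using stalk_is_res[OF d]
      by (intro exI[of _ "stalk_res X x f"] exI[of _ f]) (auto simp: stalk_data_def)
  next
    case False
    thus ?thesis using pr_resolution[of X] by metis
  qed
  then obtain rs ph where c: "\<And>X. X \<in> PR \<Longrightarrow> is_res n (rs X) \<and> is_iso T (ph X) \<and> Dom T (ph X) = X \<and> Cod T (ph X) = Fo (rx (rs X) 0) \<and>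
    (X \<in> M \<longrightarrow> (\<exists>x. stalk_data X x (ph X) \<and> rs X = stalk_res X x (ph X)))" by metis
  have c': "\<And>X. X \<in> PR \<Longrightarrow> is_res n (rs X)" "\<And>X. X \<in> PR \<Longrightarrow> is_iso T (ph X)" "\<And>X. X \<in> PR \<Longrightarrow> Dom T (ph X) = X"
    "\<And>X. X \<in> PR \<Longrightarrow> Cod T (ph X) = Fo (rx (rs X) 0)" using c by blast+
  have s: "\<exists>x. stalk_data X x (ph X) \<and> rs X = stalk_res X x (ph X)" if "X \<in> M" for X using c M_PR that by blast
  show thesis
  proof (rule that)
    show "extriangulated_functor (pr_extricat T M n) (K_extricat CC n) (Pf rs ph) (Of rs ph)"
      using Pf_extriangulated[OF c'] unfolding pr_extricat_def K_extricat_def by simp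
    show "fobj (Pf rs ph) X = stalk CC X" if "X \<in> M" for X
      using s[OF that] stalk_Cx Pf_sel(1)[OF c', of X] by auto
    show "fmor (Pf rs ph) f = H (stalk_map CC f)" if "f \<in> Arr CC" for f
    proof -
      have f: "f \<in> Arr T" "Dom T f \<in> M" "Cod T f \<in> M" using that by auto
      obtain x where x: "stalk_data (Dom T f) x (ph (Dom T f))" "rs (Dom T f) = stalk_res (Dom T f) x (ph (Dom T f))" using s[OF f(2)] by blast
      obtain y where y: "stalk_data (Cod T f) y (ph (Cod T f))" "rs (Cod T f) = stalk_res (Cod T f) y (ph (Cod T f))" using s[OF f(3)] by blast
      show ?thesis using stalk_Lam[OF x(1) y(1) f(1) refl refl] x(2) y(2) Pf_sel(2)[OF c', of f] by simp
    qed
  qed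
qed

end

theorem theorem1p1:
  fixes T :: "('o, 'm) tricat" and M :: "'o set" and n :: nat
  assumes "n \<ge> 1"
    and "algebraic_triangulated TYPE('a) TYPE('b) T"
    and "additive_subcategory T M"
    and "closed_under_summands T M"
    and "rigid T n M"
  shows "\<exists>P \<Omega>. extriangulated_functor (pr_extricat T M n) (K_extricat (full_subcat T M) n) P \<Omega> \<and>
    (\<forall>X \<in> M. fobj P X = fobj (stalk_functor (full_subcat T M)) X) \<and>
    (\<forall>f \<in> Arr (full_subcat T M). fmor P f = fmor (stalk_functor (full_subcat T M)) f)"
proof -
  obtain E :: "('a, 'b) excat" and \<Phi> \<delta> where "frobenius_model E T \<Phi> \<delta>"
    by (rule algebraic_frobenius_model[OF assms(2)])
  then interpret rigid_model E T \<Phi> \<delta> M n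
    using assms(1,3,5) by (simp add: rigid_model_def rigid_model_axioms_def model_subcategory_def model_subcategory_axioms_def)
  obtain P \<Omega> where "extriangulated_functor (pr_extricat T M n) (K_extricat (full_subcat T M) n) P \<Omega>"
    and "\<And>X. X \<in> M \<Longrightarrow> fobj P X = stalk (full_subcat T M) X"
    and "\<And>f. f \<in> Arr (full_subcat T M) \<Longrightarrow> fmor P f = hcls (full_subcat T M) (stalk_map (full_subcat T M) f)"
    by (rule extriangulated_functor_ex) (rule that, assumption+)
  thus ?thesis unfolding stalk_functor_def by (intro exI[of _ P] exI[of _ \<Omega>]) (simp del: full_subcat_sel)
qed


end
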